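(* Let $S$ be an affine difference scheme, $G$ a flat affine difference group scheme over $S$, and $\mathcal{F}$ a difference $\mathcal{A}(G)$-comodule. For every $n>0$ there is an exact sequence $$0\to\mathrm{H}^{n-1}(G,\mathcal{F})_\sigma\to\mathcal{H}^n(G,\mathcal{F})\to\mathrm{H}^n(G,\mathcal{F})^\sigma\to0,$$ where $\mathcal{H}^n(G,\mathcal{F})=\mathrm{Ext}^n_{\mathcal{A}(G)\text{-Comod}}(\mathcal{A}(S),\mathcal{F})$ is computed in the ordinary category of difference comodules.
   Context: A difference ring $k$ is a commutative ring with identity $\lfloor k\rfloor$ with an endomorphism $\sigma_k$; a difference $k$-module is a $\lfloor k\rfloor$-module $M$ with additive $\sigma_M$ such that $\sigma_M(rm)=\sigma_k(r)\sigma_M(m)$; morphisms commute with $\sigma$; tensor products carry $\sigma\otimes\sigma$. An affine difference scheme $S$ corresponds to a difference ring $\mathcal{A}(S)$; an affine difference $S$-group $G$ corresponds to a commutative difference Hopf algebra $\mathcal{A}(G)$ over $\mathcal{A}(S)$ (a Hopf algebra with an endomorphism compatible with $\sigma_{\mathcal{A}(S)}$, all structure maps commuting with $\sigma$), with comultiplication $\Delta$. $G$ is flat if $\lfloor\mathcal{A}(G)\rfloor$ is flat over $\lfloor\mathcal{A}(S)\rfloor$. A difference $\mathcal{A}(G)$-comodule is a difference $\mathcal{A}(S)$-module $\mathcal{F}$ with a coassociative counital coaction $\mu_{\mathcal{F}}:\mathcal{F}\to\mathcal{F}\otimes_{\mathcal{A}(S)}\mathcal{A}(G)$ which is a morphism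 of difference modules; $\mathcal{A}(G)\text{-Comod}$ is the (abelian) category of these with comodule maps commuting with $\sigma$. $\mathcal{A}(S)$ is a comodule via $1\mapsto1\otimes1$. $\mathrm{H}^n(G,\mathcal{F})$ is the $n$-th cohomology, a difference abelian group, of the complex $\mathrm{C}^n(G,\mathcal{F})=\mathcal{F}\otimes\mathcal{A}(G)^{\otimes n}$ with differential $\partial(f\otimes a_1\otimes\cdots\otimes a_n)=\mu_{\mathcal{F}}(f)\otimes a_1\otimes\cdots\otimes a_n+\sum_{i=1}^n(-1)^if\otimes a_1\otimes\cdots\otimes\Delta a_i\otimes\cdots\otimes a_n+(-1)^{n+1}f\otimes a_1\otimes\cdots\otimes a_n\otimes1.$ $\mathrm{Ext}^n_{\mathcal{A}(G)\text{-Comod}}(\mathcal{A}(S),-)$ is the $n$-th right derived functor of $\mathrm{Hom}_{\mathcal{A}(G)\text{-Comod}}(\mathcal{A}(S),-)$. For a difference abelian group $M$, $M^\sigma=\mathrm{Ker}(\sigma-\mathrm{id})$ and $M_\sigma=\mathrm{Coker}(\sigma-\mathrm{id})$. *)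

theory Defs
  imports "HOL-Algebra.RingHom" "HOL-Algebra.Module" "HOL-Algebra.Free_Abelian_Groups"
begin

section \<open>Difference rings and difference modules\<close>

record 'k difference_ring = "'k ring" +
  rendo :: "'k \<Rightarrow> 'k"

record ('k, 'm) difference_module = "('k, 'm) module" +
  mendo :: "'m \<Rightarrow> 'm"

locale difference_ring = cring k
  for k :: "'k difference_ring" +
  assumes rendo_hom: "rendo k \<in> ring_hom k k"

locale difference_module = difference_ring k + module k M
  for k :: "'k difference_ring" and M :: "('k, 'm, 'z) difference_module_scheme" +
  assumes mendo_hom: "mendo M \<in> hom (add_monoid M) (add_monoid M)"
    and mendo_smult: "\<lbrakk>r \<in> carrier k; m \<in> carrier M\<rbrakk> \<Longrightarrow>
          mendo M (r \<odot>\<^bsub>M\<^esub> m) = rendo k r \<odot>\<^bsub>M\<^esub> mendo M m"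

definition linear_maps ::
  "('k, 'y) ring_scheme \<Rightarrow> ('k, 'm, 'z) module_scheme \<Rightarrow> ('k, 'n, 'w) module_scheme \<Rightarrow> ('m \<Rightarrow> 'n) set"
  where "linear_maps k M N =
    {f \<in> hom (add_monoid M) (add_monoid N).
       \<forall>r \<in> carrier k. \<forall>m \<in> carrier M. f (r \<odot>\<^bsub>M\<^esub> m) = r \<odot>\<^bsub>N\<^esub> f m}"

definition regular_module :: "'k difference_ring \<Rightarrow> ('k, 'k) difference_module"
  where "regular_module k =
    \<lparr>carrier = carrier k, mult = mult k, one = one k, ring.zero = ring.zero k, add = add k,
     smult = mult k, mendo = rendo k\<rparr>"


section \<open>The tensor products of a module with the tensor powers of another\<close>

text \<open>
  \<open>M \<otimes> A \<otimes> \<dots> \<otimes> A\<close> (with \<open>n\<close> factors \<open>A\<close>, all tensor products over \<open>k\<close>) is the free abelian group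
  on the pairs \<open>(m, as)\<close> with \<open>m\<close> in \<open>M\<close> and \<open>as\<close> a list of \<open>n\<close> elements of \<open>A\<close>, modulo the
  relations that make \<open>m \<otimes> a\<^sub>1 \<otimes> \<dots> \<otimes> a\<^sub>n\<close> additive in every slot and balanced over \<open>k\<close>. Lists are
  used so that all \<open>n\<close> give carriers in one HOL type. In particular \<open>M \<otimes> A\<close> is the case
  \<open>n = 1\<close>, and \<open>A \<otimes> A\<close> is the case \<open>M = A\<close>, \<open>n = 1\<close>.
\<close>

type_synonym ('m, 'a) tensors = "('m \<times> 'a list \<Rightarrow>\<^sub>0 int) set"

definition tensor_free ::
  "('k, 'm, 'z) module_scheme \<Rightarrow> ('k, 'a, 'w) module_scheme \<Rightarrow> nat \<Rightarrow> ('m \<times> 'a list \<Rightarrow>\<^sub>0 int) monoid"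
  where "tensor_free M A n =
    free_Abelian_group (carrier M \<times> {as. length as = n \<and> set as \<subseteq> carrier A})"

definition tensor_relators ::
  "('k, 'y) ring_scheme \<Rightarrow> ('k, 'm, 'z) module_scheme \<Rightarrow> ('k, 'a, 'w) module_scheme \<Rightarrow> nat
    \<Rightarrow> ('m \<times> 'a list \<Rightarrow>\<^sub>0 int) set"
  where "tensor_relators k M A n =
     {frag_of (m \<oplus>\<^bsub>M\<^esub> m', as) - frag_of (m, as) - frag_of (m', as) | m m' as.
        m \<in> carrier M \<and> m' \<in> carrier M \<and> set as \<subseteq> carrier A \<and> length as = n}
   \<union> {frag_of (m, us @ (a \<oplus>\<^bsub>A\<^esub> a') # vs) - frag_of (m, us @ a # vs) - frag_of (m, us @ a' # vs)
        | m us a a' vs.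
        m \<in> carrier M \<and> a \<in> carrier A \<and> a' \<in> carrier A \<and> set us \<subseteq> carrier A \<and> set vs \<subseteq> carrier A
        \<and> length us + 1 + length vs = n}
   \<union> {frag_of (r \<odot>\<^bsub>M\<^esub> m, us @ a # vs) - frag_of (m, us @ (r \<odot>\<^bsub>A\<^esub> a) # vs) | r m us a vs.
        r \<in> carrier k \<and> m \<in> carrier M \<and> a \<in> carrier A \<and> set us \<subseteq> carrier A \<and> set vs \<subseteq> carrier A
        \<and> length us + 1 + length vs = n}"

definition tensor_null ::
  "('k, 'y) ring_scheme \<Rightarrow> ('k, 'm, 'z) module_scheme \<Rightarrow> ('k, 'a, 'w) module_scheme \<Rightarrow> nat
    \<Rightarrow> ('m, 'a) tensors"
  where "tensor_null k M A n = generate (tensor_free M A n) (tensor_relators k M A n)"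

definition pure_tensor ::
  "('k, 'y) ring_scheme \<Rightarrow> ('k, 'm, 'z) module_scheme \<Rightarrow> ('k, 'a, 'w) module_scheme
    \<Rightarrow> 'm \<Rightarrow> 'a list \<Rightarrow> ('m, 'a) tensors"
  where "pure_tensor k M A m as =
    tensor_null k M A (length as) #>\<^bsub>tensor_free M A (length as)\<^esub> frag_of (m, as)"

definition linear_extension :: "('b, 'z) ring_scheme \<Rightarrow> ('p \<Rightarrow> 'b) \<Rightarrow> ('p \<Rightarrow>\<^sub>0 int) \<Rightarrow> 'b"
  where "linear_extension B g c =
    (\<Oplus>\<^bsub>B\<^esub>p\<in>Poly_Mapping.keys c. [Poly_Mapping.lookup c p] \<cdot>\<^bsub>B\<^esub> g p)"

text \<open>
  If \<open>g\<close> is additive in every slot and balanced, its additive extension takes a single value on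
  each class of the quotient, and \<open>tensor_lift B g\<close> is the additive map with
  \<open>m \<otimes> a\<^sub>1 \<otimes> \<dots> \<otimes> a\<^sub>n \<mapsto> g m [a\<^sub>1, \<dots>, a\<^sub>n]\<close>. It is only applied to such \<open>g\<close>.
\<close>

definition tensor_lift ::
  "('b, 'z) ring_scheme \<Rightarrow> ('m \<Rightarrow> 'a list \<Rightarrow> 'b) \<Rightarrow> ('m, 'a) tensors \<Rightarrow> 'b"
  where "tensor_lift B g X = the_elem (linear_extension B (\<lambda>(m, as). g m as) ` X)"

definition tensor_additive ::
  "('k, 'y) ring_scheme \<Rightarrow> ('k, 'm, 'z) module_scheme \<Rightarrow> ('k, 'a, 'w) module_scheme \<Rightarrow> nat
    \<Rightarrow> ('m, 'a) tensors ring"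
  where "tensor_additive k M A n = (let Q = tensor_free M A n Mod tensor_null k M A n in
    \<lparr>carrier = carrier Q, mult = undefined, one = undefined,
     ring.zero = one Q, add = mult Q\<rparr>)"

text \<open>Only the module structure is meant: the ring fields \<open>mult\<close> and \<open>one\<close> carry no information.\<close>

definition tensor ::
  "('k, 'y) ring_scheme \<Rightarrow> ('k, 'm, 'z) module_scheme \<Rightarrow> ('k, 'a, 'w) module_scheme \<Rightarrow> nat
    \<Rightarrow> ('k, ('m, 'a) tensors) module"
  where "tensor k M A n = ring.extend (tensor_additive k M A n)
    (module.fields
      (\<lambda>r. tensor_lift (tensor_additive k M A n) (\<lambda>m as. pure_tensor k M A (r \<odot>\<^bsub>M\<^esub> m) as)))"

text \<open>\<open>f \<otimes> id \<otimes> \<dots> \<otimes> id\<close>\<close>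

definition tensor_map ::
  "('k, 'y) ring_scheme \<Rightarrow> ('k, 'n, 'z) module_scheme \<Rightarrow> ('k, 'a, 'w) module_scheme \<Rightarrow> nat
    \<Rightarrow> ('m \<Rightarrow> 'n) \<Rightarrow> ('m, 'a) tensors \<Rightarrow> ('n, 'a) tensors"
  where "tensor_map k N A n f = tensor_lift (tensor k N A n) (\<lambda>m as. pure_tensor k N A (f m) as)"

text \<open>\<open>\<sigma> \<otimes> \<sigma> \<otimes> \<dots> \<otimes> \<sigma>\<close>\<close>

definition tensor_endo ::
  "('k, 'y) ring_scheme \<Rightarrow> ('k, 'm, 'z) difference_module_scheme
    \<Rightarrow> ('k, 'a, 'w) difference_module_scheme \<Rightarrow> nat \<Rightarrow> ('m, 'a) tensors \<Rightarrow> ('m, 'a) tensors"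
  where "tensor_endo k M A n = tensor_lift (tensor k M A n)
    (\<lambda>m as. pure_tensor k M A (mendo M m) (map (mendo A) as))"

text \<open>For \<open>X\<close> in \<open>M \<otimes> A\<close>, the element \<open>X \<otimes> a\<^sub>1 \<otimes> \<dots> \<otimes> a\<^sub>n\<close>.\<close>

definition tensor_append ::
  "('k, 'y) ring_scheme \<Rightarrow> ('k, 'm, 'z) module_scheme \<Rightarrow> ('k, 'a, 'w) module_scheme
    \<Rightarrow> ('m, 'a) tensors \<Rightarrow> 'a list \<Rightarrow> ('m, 'a) tensors"
  where "tensor_append k M A X as =
    tensor_lift (tensor k M A (1 + length as)) (\<lambda>m bs. pure_tensor k M A m (bs @ as)) X"

text \<open>For \<open>D\<close> in \<open>A \<otimes> A\<close>, the element \<open>m \<otimes> u\<^sub>1 \<otimes> \<dots> \<otimes> D \<otimes> v\<^sub>1 \<otimes> \<dots>\<close>.\<close>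

definition tensor_insert ::
  "('k, 'y) ring_scheme \<Rightarrow> ('k, 'm, 'z) module_scheme \<Rightarrow> ('k, 'a, 'w) module_scheme
    \<Rightarrow> 'm \<Rightarrow> 'a list \<Rightarrow> ('a, 'a) tensors \<Rightarrow> 'a list \<Rightarrow> ('m, 'a) tensors"
  where "tensor_insert k M A m us D vs =
    tensor_lift (tensor k M A (length us + 2 + length vs))
      (\<lambda>b cs. pure_tensor k M A m (us @ (b # cs) @ vs)) D"

text \<open>\<open>(a \<otimes> a')(b \<otimes> b') = ab \<otimes> a'b'\<close> in \<open>A \<otimes> A\<close>\<close>

definition tensor_mult ::
  "('k, 'y) ring_scheme \<Rightarrow> ('k, 'a, 'w) module_scheme
    \<Rightarrow> ('a, 'a) tensors \<Rightarrow> ('a, 'a) tensors \<Rightarrow> ('a, 'a) tensors"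
  where "tensor_mult k A X Y =
    tensor_lift (tensor k A A 1) (\<lambda>a as.
      tensor_lift (tensor k A A 1) (\<lambda>b bs.
        pure_tensor k A A (a \<otimes>\<^bsub>A\<^esub> b) [hd as \<otimes>\<^bsub>A\<^esub> hd bs]) Y) X"


section \<open>Difference Hopf algebras and difference comodules\<close>

record ('k, 'a) difference_hopf_algebra = "('k, 'a) difference_module" +
  comult :: "'a \<Rightarrow> ('a, 'a) tensors"
  counit :: "'a \<Rightarrow> 'k"
  antipode :: "'a \<Rightarrow> 'a"

record ('k, 'a, 'm) difference_comodule = "('k, 'm) difference_module" +
  coaction :: "'m \<Rightarrow> ('m, 'a) tensors"

text \<open>\<open>(\<mu> \<otimes> id) \<circ> \<mu> = (id \<otimes> \<Delta>) \<circ> \<mu>\<close> and \<open>(id \<otimes> \<epsilon>) \<circ> \<mu> = id\<close>\<close>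

definition coassociative_counital ::
  "('k, 'y) ring_scheme \<Rightarrow> ('k, 'a) difference_hopf_algebra \<Rightarrow> ('k, 'm, 'z) module_scheme
    \<Rightarrow> ('m \<Rightarrow> ('m, 'a) tensors) \<Rightarrow> bool"
  where "coassociative_counital k A M \<mu> \<longleftrightarrow>
    (\<forall>m \<in> carrier M.
       tensor_lift (tensor k M A 2) (\<lambda>m' as. tensor_append k M A (\<mu> m') as) (\<mu> m)
         = tensor_lift (tensor k M A 2) (\<lambda>m' as. tensor_insert k M A m' [] (comult A (hd as)) []) (\<mu> m)
     \<and> tensor_lift M (\<lambda>m' as. counit A (hd as) \<odot>\<^bsub>M\<^esub> m') (\<mu> m) = m)"

text \<open>
  The algebra of functions on an affine difference group scheme over the spectrum of \<open>k\<close>.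
  \<open>coassociative_counital k A A (comult A)\<close> is coassociativity of \<open>\<Delta>\<close> and the right counit law.
\<close>

locale difference_hopf_algebra = difference_module k A + algebra k A
  for k :: "'k difference_ring" and A :: "('k, 'a) difference_hopf_algebra" +
  assumes mendo_ring_hom: "mendo A \<in> ring_hom A A"
    and comult_linear: "comult A \<in> linear_maps k A (tensor k A A 1)"
    and comult_one: "comult A \<one>\<^bsub>A\<^esub> = pure_tensor k A A \<one>\<^bsub>A\<^esub> [\<one>\<^bsub>A\<^esub>]"
    and comult_mult: "\<lbrakk>x \<in> carrier A; y \<in> carrier A\<rbrakk> \<Longrightarrow>
          comult A (x \<otimes>\<^bsub>A\<^esub> y) = tensor_mult k A (comult A x) (comult A y)"
    and counit_ring_hom: "counit A \<in> ring_hom A k"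
    and counit_linear: "counit A \<in> linear_maps k A (regular_module k)"
    and antipode_linear: "antipode A \<in> linear_maps k A A"
    and coassoc_counit_right: "coassociative_counital k A A (comult A)"
    and counit_left: "x \<in> carrier A \<Longrightarrow>
          tensor_lift A (\<lambda>a as. counit A a \<odot>\<^bsub>A\<^esub> hd as) (comult A x) = x"
    and antipode_left: "x \<in> carrier A \<Longrightarrow>
          tensor_lift A (\<lambda>a as. antipode A a \<otimes>\<^bsub>A\<^esub> hd as) (comult A x) = counit A x \<odot>\<^bsub>A\<^esub> \<one>\<^bsub>A\<^esub>"
    and antipode_right: "x \<in> carrier A \<Longrightarrow>
          tensor_lift A (\<lambda>a as. a \<otimes>\<^bsub>A\<^esub> antipode A (hd as)) (comult A x) = counit A x \<odot>\<^bsub>A\<^esub> \<one>\<^bsub>A\<^esub>"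
    and comult_mendo: "x \<in> carrier A \<Longrightarrow> comult A (mendo A x) = tensor_endo k A A 1 (comult A x)"
    and counit_mendo: "x \<in> carrier A \<Longrightarrow> counit A (mendo A x) = rendo k (counit A x)"
    and antipode_mendo: "x \<in> carrier A \<Longrightarrow> antipode A (mendo A x) = mendo A (antipode A x)"

locale difference_comodule = difference_module k M
  for k :: "'k difference_ring" and A :: "('k, 'a) difference_hopf_algebra"
    and M :: "('k, 'a, 'm) difference_comodule" +
  assumes coaction_linear: "coaction M \<in> linear_maps k M (tensor k M A 1)"
    and coaction_mendo: "m \<in> carrier M \<Longrightarrow>
          coaction M (mendo M m) = tensor_endo k M A 1 (coaction M m)"
    and coassoc_counit: "coassociative_counital k A M (coaction M)"

definition unit_comodule ::
  "'k difference_ring \<Rightarrow> ('k, 'a) difference_hopf_algebra \<Rightarrow> ('k, 'a, 'k) difference_comodule"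
  where "unit_comodule k A = difference_module.extend (regular_module k)
    (difference_comodule.fields (\<lambda>r. pure_tensor k (regular_module k) A r [\<one>\<^bsub>A\<^esub>]))"

definition comodule_maps ::
  "'k difference_ring \<Rightarrow> ('k, 'a) difference_hopf_algebra \<Rightarrow> ('k, 'a, 'm) difference_comodule
    \<Rightarrow> ('k, 'a, 'n) difference_comodule \<Rightarrow> ('m \<Rightarrow> 'n) set"
  where "comodule_maps k A M N =
    {f \<in> linear_maps k M N. \<forall>m \<in> carrier M.
       f (mendo M m) = mendo N (f m) \<and>
       coaction N (f m) = tensor_map k N A 1 f (coaction M m)}"

text \<open>Homomorphisms are represented by functions that are \<open>undefined\<close> off the carrier, so that
  equality in this group is equality of homomorphisms.\<close>

definition comodule_hom_group ::
  "'k difference_ring \<Rightarrow> ('k, 'a) difference_hopf_algebra \<Rightarrow> ('k, 'a, 'm) difference_comodule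
    \<Rightarrow> ('k, 'a, 'n) difference_comodule \<Rightarrow> ('m \<Rightarrow> 'n) monoid"
  where "comodule_hom_group k A M N =
    \<lparr>carrier = comodule_maps k A M N \<inter> extensional (carrier M),
     mult = (\<lambda>f g. \<lambda>m\<in>carrier M. f m \<oplus>\<^bsub>N\<^esub> g m),
     one = (\<lambda>m\<in>carrier M. \<zero>\<^bsub>N\<^esub>)\<rparr>"


section \<open>Flatness and injectivity\<close>

text \<open>
  Both notions quantify over all modules (comodules), which HOL can only express one element type
  at a time; the type \<open>'t\<close> of the test objects is therefore a parameter. Restricting the test
  objects weakens a property, so a flat module or injective comodule in the unrestricted sense has
  these properties for every \<open>'t\<close>, and a theorem that assumes them for one \<open>'t\<close> covers it.
\<close>

definition flat_module ::
  "'t itself \<Rightarrow> ('k, 'y) ring_scheme \<Rightarrow> ('k, 'a, 'w) module_scheme \<Rightarrow> bool"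
  where "flat_module TYPE('t) k A \<longleftrightarrow>
    (\<forall>(M :: ('k, 't) module) (N :: ('k, 't) module). \<forall>f \<in> linear_maps k M N.
       module k M \<and> module k N \<and> inj_on f (carrier M) \<longrightarrow>
       inj_on (tensor_map k N A 1 f) (carrier (tensor k M A 1)))"

text \<open>Over a flat \<open>A\<close>, the monomorphisms of comodules are the injective comodule maps, and exactness
  of a sequence of comodules is exactness of the underlying abelian groups.\<close>

definition injective_comodule ::
  "'t itself \<Rightarrow> 'k difference_ring \<Rightarrow> ('k, 'a) difference_hopf_algebra
    \<Rightarrow> ('k, 'a, 'm) difference_comodule \<Rightarrow> bool"
  where "injective_comodule TYPE('t) k A J \<longleftrightarrow>
    difference_comodule k A J \<and>
    (\<forall>(X :: ('k, 'a, 't) difference_comodule) (Y :: ('k, 'a, 't) difference_comodule).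
      \<forall>i \<in> comodule_maps k A X Y. \<forall>f \<in> comodule_maps k A X J.
        difference_comodule k A X \<and> difference_comodule k A Y \<and> inj_on i (carrier X) \<longrightarrow>
        (\<exists>g \<in> comodule_maps k A Y J. \<forall>x \<in> carrier X. g (i x) = f x))"

definition injective_resolution ::
  "'t itself \<Rightarrow> 'k difference_ring \<Rightarrow> ('k, 'a) difference_hopf_algebra
    \<Rightarrow> ('k, 'a, 'f) difference_comodule
    \<Rightarrow> (nat \<Rightarrow> ('k, 'a, 'm) difference_comodule) \<Rightarrow> (nat \<Rightarrow> 'm \<Rightarrow> 'm) \<Rightarrow> ('f \<Rightarrow> 'm) \<Rightarrow> bool"
  where "injective_resolution TYPE('t) k A F J d e \<longleftrightarrow>
    (\<forall>n. injective_comodule TYPE('t) k A (J n)) \<and>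
    (\<forall>n. d n \<in> comodule_maps k A (J n) (J (Suc n))) \<and>
    e \<in> comodule_maps k A F (J 0) \<and>
    inj_on e (carrier F) \<and>
    e ` carrier F = kernel (add_monoid (J 0)) (add_monoid (J 1)) (d 0) \<and>
    (\<forall>n. d n ` carrier (J n)
       = kernel (add_monoid (J (Suc n))) (add_monoid (J (Suc (Suc n)))) (d (Suc n)))"

text \<open>
  A test type into which \<open>'k\<close>, \<open>'a\<close>, \<open>'m\<close>, and the finite lists and the sequences over itself inject.
  For flatness, testing on it is no restriction, since ideals of \<open>k\<close> suffice as test objects.
\<close>

type_synonym ('k, 'a, 'm) test = "nat \<Rightarrow> 'k + 'a + 'm"


section \<open>Cohomology\<close>

definition coboundaries :: "(nat \<Rightarrow> ('x, 'z) monoid_scheme) \<Rightarrow> (nat \<Rightarrow> 'x \<Rightarrow> 'x) \<Rightarrow> nat \<Rightarrow> 'x set"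
  where "coboundaries C d n = (case n of 0 \<Rightarrow> {\<one>\<^bsub>C 0\<^esub>} | Suc m \<Rightarrow> d m ` carrier (C m))"

definition cohomology ::
  "(nat \<Rightarrow> ('x, 'z) monoid_scheme) \<Rightarrow> (nat \<Rightarrow> 'x \<Rightarrow> 'x) \<Rightarrow> nat \<Rightarrow> 'x set monoid"
  where "cohomology C d n =
    (C n)\<lparr>carrier := kernel (C n) (C (Suc n)) (d n)\<rparr> Mod coboundaries C d n"

text \<open>The right derived functors of \<open>Hom(k, -)\<close> at the comodule resolved by \<open>J\<close>.\<close>

definition ext_from_unit ::
  "'k difference_ring \<Rightarrow> ('k, 'a) difference_hopf_algebra
    \<Rightarrow> (nat \<Rightarrow> ('k, 'a, 'm) difference_comodule) \<Rightarrow> (nat \<Rightarrow> 'm \<Rightarrow> 'm) \<Rightarrow> nat \<Rightarrow> ('k \<Rightarrow> 'm) set monoid"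
  where "ext_from_unit k A J d =
    cohomology (\<lambda>n. comodule_hom_group k A (unit_comodule k A) (J n))
               (\<lambda>n. compose (carrier k) (d n))"

definition hochschild_diff ::
  "'k difference_ring \<Rightarrow> ('k, 'a) difference_hopf_algebra \<Rightarrow> ('k, 'a, 'f) difference_comodule
    \<Rightarrow> nat \<Rightarrow> ('f, 'a) tensors \<Rightarrow> ('f, 'a) tensors"
  where "hochschild_diff k A F n = (let T = tensor k F A (Suc n) in
    tensor_lift T (\<lambda>f as.
      tensor_append k F A (coaction F f) as
      \<oplus>\<^bsub>T\<^esub> (\<Oplus>\<^bsub>T\<^esub>i\<in>{1..n}. [((- 1 :: int) ^ i)] \<cdot>\<^bsub>T\<^esub>
            tensor_insert k F A f (take (i - 1) as) (comult A (as ! (i - 1))) (drop i as))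
      \<oplus>\<^bsub>T\<^esub> [((- 1 :: int) ^ (n + 1))] \<cdot>\<^bsub>T\<^esub> pure_tensor k F A f (as @ [\<one>\<^bsub>A\<^esub>])))"

definition hochschild_complex ::
  "'k difference_ring \<Rightarrow> ('k, 'a) difference_hopf_algebra \<Rightarrow> ('k, 'a, 'f) difference_comodule
    \<Rightarrow> nat \<Rightarrow> ('f, 'a) tensors monoid"
  where "hochschild_complex k A F n = add_monoid (tensor_additive k F A n)"

definition group_cohomology ::
  "'k difference_ring \<Rightarrow> ('k, 'a) difference_hopf_algebra \<Rightarrow> ('k, 'a, 'f) difference_comodule
    \<Rightarrow> nat \<Rightarrow> ('f, 'a) tensors set monoid"
  where "group_cohomology k A F = cohomology (hochschild_complex k A F) (hochschild_diff k A F)"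

text \<open>The class of \<open>x\<close> is sent to the class of \<open>\<sigma> x\<close>.\<close>

definition group_cohomology_endo ::
  "'k difference_ring \<Rightarrow> ('k, 'a) difference_hopf_algebra \<Rightarrow> ('k, 'a, 'f) difference_comodule
    \<Rightarrow> nat \<Rightarrow> ('f, 'a) tensors set \<Rightarrow> ('f, 'a) tensors set"
  where "group_cohomology_endo k A F n X =
    coboundaries (hochschild_complex k A F) (hochschild_diff k A F) n
      <#>\<^bsub>hochschild_complex k A F n\<^esub> (tensor_endo k F A n ` X)"

definition invariants :: "('x, 'z) monoid_scheme \<Rightarrow> ('x \<Rightarrow> 'x) \<Rightarrow> ('x, 'z) monoid_scheme"
  where "invariants H s = H\<lparr>carrier := {x \<in> carrier H. s x = x}\<rparr>"

definition coinvariants :: "('x, 'z) monoid_scheme \<Rightarrow> ('x \<Rightarrow> 'x) \<Rightarrow> 'x set monoid"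
  where "coinvariants H s = H Mod ((\<lambda>x. s x \<otimes>\<^bsub>H\<^esub> inv\<^bsub>H\<^esub> x) ` carrier H)"

definition short_exact ::
  "('x, 'p) monoid_scheme \<Rightarrow> ('x \<Rightarrow> 'y) \<Rightarrow> ('y, 'q) monoid_scheme \<Rightarrow> ('y \<Rightarrow> 'z) \<Rightarrow> ('z, 'r) monoid_scheme
    \<Rightarrow> bool"
  where "short_exact G \<alpha> H \<beta> K \<longleftrightarrow>
    group G \<and> group H \<and> group K \<and> \<alpha> \<in> mon G H \<and> \<beta> \<in> epi H K \<and> \<alpha> ` carrier G = kernel H K \<beta>"

end

theory Submission
  imports Defs "HOL-Library.Nat_Bijection"
begin

text \<open>
  Write \<open>X\<^sup>p\<^sup>,\<^sup>q = J\<^sup>p \<otimes> A\<^bsup>\<otimes>q\<^esup>\<close> for the double complex of Hochschild cochains with values in the injective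
  resolution \<open>F \<rightarrow> J\<^sup>\<bullet>\<close>. By flatness its rows are exact with kernel \<open>F \<otimes> A\<^bsup>\<otimes>q\<^esup>\<close> at the start. An injective
  comodule \<open>J\<close> is a retract of the cofree comodule \<open>J \<otimes> A\<close>, so the columns are exact with kernel the
  invariants \<open>I\<^sup>p\<close> of \<open>J\<^sup>p\<close>; therefore \<open>I\<^sup>\<bullet>\<close> computes \<open>H\<^sup>n(G, F)\<close>, compatibly with \<open>\<sigma>\<close>. A homomorphism
  from the unit comodule to \<open>J\<^sup>p\<close> is an element of \<open>I\<^sup>p\<close> fixed by \<open>\<sigma>\<close>, and \<open>\<sigma> - 1\<close> maps \<open>I\<^sup>p\<close> onto itself
  because \<open>J\<^sup>p\<close> is injective. The claim is then read off the long exact sequence of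
  \<open>0 \<rightarrow> Hom(k, J\<^sup>\<bullet>) \<rightarrow> I\<^sup>\<bullet> \<rightarrow> I\<^sup>\<bullet> \<rightarrow> 0\<close>. The isomorphism with \<open>H\<^sup>n(G, F)\<close> and the maps of the sequence are
  handled as additive relations on cocycles.
\<close>

section \<open>Additive maps\<close>

text \<open>In derived terms, \<open>Hom(k, -)\<close> is the functor of invariants followed by that
  of \<sigma>-fixed elements, whose derived functors are the kernel and cokernel of \<sigma> - 1 and
  vanish above degree 1; the sequence is the resulting two-column spectral sequence. The obstacle is
  that the terms of the resolution are injective among difference comodules, which says nothing
  evident about the comodules left when \<sigma> is forgotten. Both acyclicity statements must come
  from test objects that carry \<sigma> themselves: for Hochschild cohomology J \<otimes> A with
  \<sigma> \<otimes> \<sigma>, for \<sigma> - 1 an extension whose endomorphism is twisted by an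
  invariant. The staircase through the double complex involves a choice at every step; as a relation
  it is compatible with \<sigma> step by step, whereas a chosen map on cocycles need not be. The
  cofaces and their homotopy recurse on the last factor, so that the coefficients, where the
  coaction acts, stay in the base case.\<close>

abbreviation (input) additive_maps :: "('x, 'p) ring_scheme \<Rightarrow> ('y, 'q) ring_scheme \<Rightarrow> ('x \<Rightarrow> 'y) set"
  where "additive_maps X Y \<equiv> hom (add_monoid X) (add_monoid Y)"

lemma additive_mapsI:
  assumes "\<And>x. x \<in> carrier X \<Longrightarrow> f x \<in> carrier Y"
    and "\<And>x y. \<lbrakk>x \<in> carrier X; y \<in> carrier X\<rbrakk> \<Longrightarrow> f (x \<oplus>\<^bsub>X\<^esub> y) = f x \<oplus>\<^bsub>Y\<^esub> f y"
  shows "f \<in> additive_maps X Y"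
  using assms by (auto simp: hom_def)

lemma additive_closed: "\<lbrakk>f \<in> additive_maps X Y; x \<in> carrier X\<rbrakk> \<Longrightarrow> f x \<in> carrier Y"
  by (auto simp: hom_def)

lemma additive_add:
  "\<lbrakk>f \<in> additive_maps X Y; x \<in> carrier X; y \<in> carrier X\<rbrakk> \<Longrightarrow> f (x \<oplus>\<^bsub>X\<^esub> y) = f x \<oplus>\<^bsub>Y\<^esub> f y"
  by (auto simp: hom_def)

lemma additive_id: "(\<lambda>x. x) \<in> additive_maps X X"
  by (simp add: hom_def)

lemma additive_hom:
  "\<lbrakk>f \<in> additive_maps X Y; abelian_group X; abelian_group Y\<rbrakk> \<Longrightarrow> abelian_group_hom X Y f"
  by (intro abelian_group_homI group_hom.intro group_hom_axioms.intro abelian_group.a_group)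

lemma additive_zero:
  "\<lbrakk>f \<in> additive_maps X Y; abelian_group X; abelian_group Y\<rbrakk> \<Longrightarrow> f \<zero>\<^bsub>X\<^esub> = \<zero>\<^bsub>Y\<^esub>"
  by (rule abelian_group_hom.hom_zero[OF additive_hom])

lemma additive_minus:
  "\<lbrakk>f \<in> additive_maps X Y; abelian_group X; abelian_group Y; x \<in> carrier X\<rbrakk>
    \<Longrightarrow> f (\<ominus>\<^bsub>X\<^esub> x) = \<ominus>\<^bsub>Y\<^esub> f x"
  by (rule abelian_group_hom.hom_a_inv[OF additive_hom])

lemma additive_diff:
  "\<lbrakk>f \<in> additive_maps X Y; abelian_group X; abelian_group Y; x \<in> carrier X; y \<in> carrier X\<rbrakk>
    \<Longrightarrow> f (x \<ominus>\<^bsub>X\<^esub> y) = f x \<ominus>\<^bsub>Y\<^esub> f y"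
  by (simp add: a_minus_def additive_add additive_minus abelian_group.a_inv_closed)

lemma additive_compose:
  "\<lbrakk>f \<in> additive_maps X Y; g \<in> additive_maps Y Z\<rbrakk> \<Longrightarrow> (\<lambda>x. g (f x)) \<in> additive_maps X Z"
  by (intro additive_mapsI) (simp_all add: additive_closed additive_add)

lemma additive_finsum:
  assumes f: "f \<in> additive_maps X Y" and X: "abelian_group X" and Y: "abelian_group Y"
    and "finite S" and "g \<in> S \<rightarrow> carrier X"
  shows "f (finsum X g S) = finsum Y (\<lambda>i. f (g i)) S"
proof -
  interpret X: abelian_group X by (fact X)
  interpret Y: abelian_group Y by (fact Y)
  show ?thesis using assms(4,5)
  proof (induction S rule: finite_induct)
    case empty
    then show ?case using additive_zero[OF f X Y] by simp
  next
    case (insert i S)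
    have "(\<lambda>i. f (g i)) \<in> S \<rightarrow> carrier Y" "f (g i) \<in> carrier Y"
      using additive_closed[OF f] insert.prems by auto
    with insert show ?case
      using additive_add[OF f, of "g i" "finsum X g S"]
      by (simp add: X.finsum_insert Y.finsum_insert X.finsum_closed Pi_iff)
  qed
qed

lemma additive_add_pow:
  assumes f: "f \<in> additive_maps X Y" and X: "abelian_group X" and Y: "abelian_group Y"
    and "x \<in> carrier X"
  shows "f ([(i::int)] \<cdot>\<^bsub>X\<^esub> x) = [i] \<cdot>\<^bsub>Y\<^esub> f x"
proof -
  interpret group_hom "add_monoid X" "add_monoid Y" f
    by (intro group_hom.intro group_hom_axioms.intro abelian_group.a_group f X Y)
  show ?thesis
    unfolding add_pow_def using hom_int_pow[of x i] assms(4) by simp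
qed

lemma add_pow_closed:
  assumes "abelian_group X" and "x \<in> carrier X"
  shows "[(i::int)] \<cdot>\<^bsub>X\<^esub> x \<in> carrier X"
  using group.int_pow_closed[OF abelian_group.a_group[OF assms(1)], of x i] assms(2)
  by (simp add: add_pow_def)

lemma add_pow_additive:
  assumes "abelian_group X"
  shows "(\<lambda>x. [(i::int)] \<cdot>\<^bsub>X\<^esub> x) \<in> additive_maps X X"
proof (rule additive_mapsI)
  interpret comm_group "add_monoid X" by (rule abelian_group.a_comm_group[OF assms])
  fix x y assume "x \<in> carrier X" "y \<in> carrier X"
  then show "[i] \<cdot>\<^bsub>X\<^esub> (x \<oplus>\<^bsub>X\<^esub> y) = [i] \<cdot>\<^bsub>X\<^esub> x \<oplus>\<^bsub>X\<^esub> [i] \<cdot>\<^bsub>X\<^esub> y"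
    using int_pow_mult_distrib[of x y i] m_comm[of x y] by (simp add: add_pow_def)
qed (rule add_pow_closed[OF assms])

lemma additive_add_map:
  assumes "abelian_group Y" and f: "f \<in> additive_maps X Y" and g: "g \<in> additive_maps X Y"
  shows "(\<lambda>x. f x \<oplus>\<^bsub>Y\<^esub> g x) \<in> additive_maps X Y"
proof (rule additive_mapsI)
  interpret Y: abelian_group Y by fact
  fix x y assume "x \<in> carrier X" "y \<in> carrier X"
  then show "f (x \<oplus>\<^bsub>X\<^esub> y) \<oplus>\<^bsub>Y\<^esub> g (x \<oplus>\<^bsub>X\<^esub> y) = f x \<oplus>\<^bsub>Y\<^esub> g x \<oplus>\<^bsub>Y\<^esub> (f y \<oplus>\<^bsub>Y\<^esub> g y)"
    using additive_closed[OF f] additive_closed[OF g]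
    by (simp add: additive_add[OF f] additive_add[OF g] Y.a_ac)
next
  fix x assume "x \<in> carrier X"
  then show "f x \<oplus>\<^bsub>Y\<^esub> g x \<in> carrier Y"
    using additive_closed[OF f] additive_closed[OF g] assms(1)
    by (simp add: abelian_groupE(1))
qed

lemma additive_finsum_map:
  assumes Y: "abelian_group Y" and f: "\<And>i. i \<in> S \<Longrightarrow> f i \<in> additive_maps X Y"
  shows "(\<lambda>x. \<Oplus>\<^bsub>Y\<^esub>i\<in>S. f i x) \<in> additive_maps X Y"
proof (rule additive_mapsI)
  interpret Y: abelian_group Y by fact
  fix x assume x: "x \<in> carrier X"
  then show "(\<Oplus>\<^bsub>Y\<^esub>i\<in>S. f i x) \<in> carrier Y"
    using additive_closed[OF f] by (auto intro: Y.finsum_closed)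
  fix y assume y: "y \<in> carrier X"
  have "(\<Oplus>\<^bsub>Y\<^esub>i\<in>S. f i (x \<oplus>\<^bsub>X\<^esub> y)) = (\<Oplus>\<^bsub>Y\<^esub>i\<in>S. f i x \<oplus>\<^bsub>Y\<^esub> f i y)"
    using additive_closed[OF f] x y by (intro Y.finsum_cong') (auto simp: additive_add[OF f])
  also have "\<dots> = (\<Oplus>\<^bsub>Y\<^esub>i\<in>S. f i x) \<oplus>\<^bsub>Y\<^esub> (\<Oplus>\<^bsub>Y\<^esub>i\<in>S. f i y)"
    using additive_closed[OF f] x y by (intro Y.finsum_addf) auto
  finally show "(\<Oplus>\<^bsub>Y\<^esub>i\<in>S. f i (x \<oplus>\<^bsub>X\<^esub> y)) = (\<Oplus>\<^bsub>Y\<^esub>i\<in>S. f i x) \<oplus>\<^bsub>Y\<^esub> (\<Oplus>\<^bsub>Y\<^esub>i\<in>S. f i y)" .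
qed

lemma linear_mapsI:
  assumes "f \<in> additive_maps M N"
    and "\<And>r m. \<lbrakk>r \<in> carrier k; m \<in> carrier M\<rbrakk> \<Longrightarrow> f (r \<odot>\<^bsub>M\<^esub> m) = r \<odot>\<^bsub>N\<^esub> f m"
  shows "f \<in> linear_maps k M N"
  using assms by (auto simp: linear_maps_def)

lemma linear_additive: "f \<in> linear_maps k M N \<Longrightarrow> f \<in> additive_maps M N"
  by (auto simp: linear_maps_def)

lemma linear_smult:
  "\<lbrakk>f \<in> linear_maps k M N; r \<in> carrier k; m \<in> carrier M\<rbrakk> \<Longrightarrow> f (r \<odot>\<^bsub>M\<^esub> m) = r \<odot>\<^bsub>N\<^esub> f m"
  by (auto simp: linear_maps_def)

lemma linear_closed: "\<lbrakk>f \<in> linear_maps k M N; m \<in> carrier M\<rbrakk> \<Longrightarrow> f m \<in> carrier N"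
  by (auto simp: linear_maps_def hom_def)

lemma linear_add:
  "\<lbrakk>f \<in> linear_maps k M N; x \<in> carrier M; y \<in> carrier M\<rbrakk> \<Longrightarrow> f (x \<oplus>\<^bsub>M\<^esub> y) = f x \<oplus>\<^bsub>N\<^esub> f y"
  by (auto simp: linear_maps_def hom_def)

lemma linear_compose:
  "\<lbrakk>f \<in> linear_maps k L M; g \<in> linear_maps k M N\<rbrakk> \<Longrightarrow> (\<lambda>x. g (f x)) \<in> linear_maps k L N"
  by (intro linear_mapsI additive_compose[of f L M g N])
    (simp_all add: linear_additive linear_smult linear_closed)

section \<open>The universal property of the tensor products\<close>

text \<open>The clauses mirror the three families of \<open>tensor_relators\<close>. Scalars pass
  between \<open>M\<close> and each slot; passing them from one slot to another is a consequence, by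
  way of \<open>M\<close>.\<close>

definition balanced_map ::
  "('k, 'y) ring_scheme \<Rightarrow> ('k, 'm, 'z) module_scheme \<Rightarrow> ('k, 'a, 'w) module_scheme \<Rightarrow> nat
    \<Rightarrow> ('b, 'v) ring_scheme \<Rightarrow> ('m \<Rightarrow> 'a list \<Rightarrow> 'b) \<Rightarrow> bool"
  where "balanced_map k M A n B g \<longleftrightarrow>
    (\<forall>m as. m \<in> carrier M \<and> length as = n \<and> set as \<subseteq> carrier A \<longrightarrow> g m as \<in> carrier B) \<and>
    (\<forall>m m' as. m \<in> carrier M \<and> m' \<in> carrier M \<and> length as = n \<and> set as \<subseteq> carrier A \<longrightarrow>
       g (m \<oplus>\<^bsub>M\<^esub> m') as = g m as \<oplus>\<^bsub>B\<^esub> g m' as) \<and>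
    (\<forall>m us a a' vs. m \<in> carrier M \<and> a \<in> carrier A \<and> a' \<in> carrier A \<and> set us \<subseteq> carrier A \<and>
       set vs \<subseteq> carrier A \<and> length us + 1 + length vs = n \<longrightarrow>
       g m (us @ (a \<oplus>\<^bsub>A\<^esub> a') # vs) = g m (us @ a # vs) \<oplus>\<^bsub>B\<^esub> g m (us @ a' # vs)) \<and>
    (\<forall>r m us a vs. r \<in> carrier k \<and> m \<in> carrier M \<and> a \<in> carrier A \<and> set us \<subseteq> carrier A \<and>
       set vs \<subseteq> carrier A \<and> length us + 1 + length vs = n \<longrightarrow>
       g (r \<odot>\<^bsub>M\<^esub> m) (us @ a # vs) = g m (us @ (r \<odot>\<^bsub>A\<^esub> a) # vs))"

lemma balanced_mapI:
  assumes "\<And>m as. \<lbrakk>m \<in> carrier M; length as = n; set as \<subseteq> carrier A\<rbrakk> \<Longrightarrow> g m as \<in> carrier B"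
    and "\<And>m m' as. \<lbrakk>m \<in> carrier M; m' \<in> carrier M; length as = n; set as \<subseteq> carrier A\<rbrakk> \<Longrightarrow>
       g (m \<oplus>\<^bsub>M\<^esub> m') as = g m as \<oplus>\<^bsub>B\<^esub> g m' as"
    and "\<And>m us a a' vs. \<lbrakk>m \<in> carrier M; a \<in> carrier A; a' \<in> carrier A; set us \<subseteq> carrier A;
       set vs \<subseteq> carrier A; n = length us + 1 + length vs\<rbrakk> \<Longrightarrow>
       g m (us @ (a \<oplus>\<^bsub>A\<^esub> a') # vs) = g m (us @ a # vs) \<oplus>\<^bsub>B\<^esub> g m (us @ a' # vs)"
    and "\<And>r m us a vs. \<lbrakk>r \<in> carrier k; m \<in> carrier M; a \<in> carrier A; set us \<subseteq> carrier A;
       set vs \<subseteq> carrier A; n = length us + 1 + length vs\<rbrakk> \<Longrightarrow>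
       g (r \<odot>\<^bsub>M\<^esub> m) (us @ a # vs) = g m (us @ (r \<odot>\<^bsub>A\<^esub> a) # vs)"
  shows "balanced_map k M A n B g"
  unfolding balanced_map_def
  apply (intro conjI allI impI; elim conjE)
  subgoal by (rule assms(1))
  subgoal by (rule assms(2))
  subgoal by (rule assms(3)) auto
  subgoal by (rule assms(4)) auto
  done

lemma balanced_mapD:
  assumes "balanced_map k M A n B g"
  shows "\<lbrakk>m \<in> carrier M; length as = n; set as \<subseteq> carrier A\<rbrakk> \<Longrightarrow> g m as \<in> carrier B"
    and "\<lbrakk>m \<in> carrier M; m' \<in> carrier M; length as = n; set as \<subseteq> carrier A\<rbrakk> \<Longrightarrow>
       g (m \<oplus>\<^bsub>M\<^esub> m') as = g m as \<oplus>\<^bsub>B\<^esub> g m' as"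
    and "\<lbrakk>m \<in> carrier M; a \<in> carrier A; a' \<in> carrier A; set us \<subseteq> carrier A;
       set vs \<subseteq> carrier A; n = length us + 1 + length vs\<rbrakk> \<Longrightarrow>
       g m (us @ (a \<oplus>\<^bsub>A\<^esub> a') # vs) = g m (us @ a # vs) \<oplus>\<^bsub>B\<^esub> g m (us @ a' # vs)"
  using assms by (simp_all add: balanced_map_def)

text \<open>The support of a sum may be smaller than the union of the supports because of
  cancellation. Extending the sums by zero terms to a common finite set is what makes additivity a
  termwise statement.\<close>

lemma linear_extension_superset:
  assumes B: "abelian_group B" and "finite S" "Poly_Mapping.keys c \<subseteq> S" "g \<in> S \<rightarrow> carrier B"
  shows "linear_extension B g c = (\<Oplus>\<^bsub>B\<^esub>p\<in>S. [Poly_Mapping.lookup c p] \<cdot>\<^bsub>B\<^esub> g p)"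
proof -
  interpret B: abelian_group B by (fact B)
  have z: "[Poly_Mapping.lookup c p] \<cdot>\<^bsub>B\<^esub> g p = \<zero>\<^bsub>B\<^esub>" if "p \<notin> Poly_Mapping.keys c" for p
    using that by (simp add: not_in_keys_iff_lookup_eq_zero add_pow_def)
  have "(\<Oplus>\<^bsub>B\<^esub>p\<in>Poly_Mapping.keys c. [Poly_Mapping.lookup c p] \<cdot>\<^bsub>B\<^esub> g p)
      = (\<Oplus>\<^bsub>B\<^esub>p\<in>S. [Poly_Mapping.lookup c p] \<cdot>\<^bsub>B\<^esub> g p)"
    using assms z by (intro B.add.finprod_mono_neutral_cong_left)
      (auto intro!: add_pow_closed[OF B])
  then show ?thesis by (simp add: linear_extension_def)
qed

lemma linear_extension_hom:
  assumes B: "abelian_group B" and g: "g \<in> S \<rightarrow> carrier B"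
  shows "linear_extension B g \<in> hom (free_Abelian_group S) (add_monoid B)"
proof (rule homI)
  interpret B: abelian_group B by (fact B)
  fix c assume c: "c \<in> carrier (free_Abelian_group S)"
  then show "linear_extension B g c \<in> carrier (add_monoid B)"
    using g by (auto simp: linear_extension_def intro!: B.finsum_closed add_pow_closed[OF B])
  fix c' assume c': "c' \<in> carrier (free_Abelian_group S)"
  let ?S = "Poly_Mapping.keys c \<union> Poly_Mapping.keys c'"
  have S: "finite ?S" "?S \<subseteq> S" using c c' by auto
  have gS: "g \<in> ?S \<rightarrow> carrier B" using S(2) g by blast
  have cl: "(\<lambda>p. [Poly_Mapping.lookup d p] \<cdot>\<^bsub>B\<^esub> g p) \<in> ?S \<rightarrow> carrier B" for d :: "_ \<Rightarrow>\<^sub>0 int"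
    using gS unfolding Pi_iff by (blast intro: add_pow_closed[OF B])
  have "[Poly_Mapping.lookup (c + c') p] \<cdot>\<^bsub>B\<^esub> g p =
      [Poly_Mapping.lookup c p] \<cdot>\<^bsub>B\<^esub> g p \<oplus>\<^bsub>B\<^esub> [Poly_Mapping.lookup c' p] \<cdot>\<^bsub>B\<^esub> g p" if "p \<in> ?S" for p
    using group.int_pow_mult[OF B.a_group, of "g p"] gS that
    by (auto simp: lookup_add add_pow_def)
  then have "(\<Oplus>\<^bsub>B\<^esub>p\<in>?S. [Poly_Mapping.lookup (c + c') p] \<cdot>\<^bsub>B\<^esub> g p)
     = (\<Oplus>\<^bsub>B\<^esub>p\<in>?S. [Poly_Mapping.lookup c p] \<cdot>\<^bsub>B\<^esub> g p \<oplus>\<^bsub>B\<^esub> [Poly_Mapping.lookup c' p] \<cdot>\<^bsub>B\<^esub> g p)"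
    using cl[of c] cl[of c'] by (intro B.finsum_cong') auto
  also have "\<dots> = (\<Oplus>\<^bsub>B\<^esub>p\<in>?S. [Poly_Mapping.lookup c p] \<cdot>\<^bsub>B\<^esub> g p) \<oplus>\<^bsub>B\<^esub>
      (\<Oplus>\<^bsub>B\<^esub>p\<in>?S. [Poly_Mapping.lookup c' p] \<cdot>\<^bsub>B\<^esub> g p)"
    using cl by (intro B.finsum_addf)
  finally show "linear_extension B g (c \<otimes>\<^bsub>free_Abelian_group S\<^esub> c')
      = linear_extension B g c \<otimes>\<^bsub>add_monoid B\<^esub> linear_extension B g c'"
    using linear_extension_superset[OF B S(1) keys_add[of c c'] gS]
      linear_extension_superset[OF B S(1) _ gS, of c] linear_extension_superset[OF B S(1) _ gS, of c']
    by simp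
qed

lemma linear_extension_frag_of:
  assumes B: "abelian_group B" and "g p \<in> carrier B"
  shows "linear_extension B g (frag_of p) = g p"
proof -
  interpret B: abelian_group B by (fact B)
  have "[(1::int)] \<cdot>\<^bsub>B\<^esub> g p = g p"
    using group.int_pow_1[OF B.a_group, of "g p"] assms(2) by (simp add: add_pow_def)
  then show ?thesis
    using assms(2) B.finsum_singleton[of p "{p}" g] linear_extension_superset[OF B, of "{p}" "frag_of p" g]
    by (simp add: B.finsum_insert)
qed

section \<open>The quotient by the balancing relations\<close>

lemma tensor_group: "comm_group (tensor_free M A n)"
  by (simp add: tensor_free_def abelian_free_Abelian_group)

text \<open>The coefficient module is a parameter of the lemmas and not of the locale, because it is
  instantiated at different types: comodules, tensor products over them, and \<open>A\<close>
  itself.\<close>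

locale tensor_factor =
  fixes k :: "('k, 'y) ring_scheme" and A :: "('k, 'a, 'w) module_scheme"
  assumes A_module: "module k A"
begin

lemma A_closed [simp]:
  "\<lbrakk>a \<in> carrier A; a' \<in> carrier A\<rbrakk> \<Longrightarrow> a \<oplus>\<^bsub>A\<^esub> a' \<in> carrier A"
  "\<lbrakk>r \<in> carrier k; a \<in> carrier A\<rbrakk> \<Longrightarrow> r \<odot>\<^bsub>A\<^esub> a \<in> carrier A"
proof -
  interpret module k A by (fact A_module)
  show "\<lbrakk>a \<in> carrier A; a' \<in> carrier A\<rbrakk> \<Longrightarrow> a \<oplus>\<^bsub>A\<^esub> a' \<in> carrier A"
    "\<lbrakk>r \<in> carrier k; a \<in> carrier A\<rbrakk> \<Longrightarrow> r \<odot>\<^bsub>A\<^esub> a \<in> carrier A" by auto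
qed

lemma module_abelian_group [simp]: "module k M \<Longrightarrow> abelian_group M"
  by (rule module.axioms)

lemma module_closed [simp]:
  assumes "module k M"
  shows "\<lbrakk>m \<in> carrier M; m' \<in> carrier M\<rbrakk> \<Longrightarrow> m \<oplus>\<^bsub>M\<^esub> m' \<in> carrier M"
    and "\<lbrakk>r \<in> carrier k; m \<in> carrier M\<rbrakk> \<Longrightarrow> r \<odot>\<^bsub>M\<^esub> m \<in> carrier M"
    and "m \<in> carrier M \<Longrightarrow> \<ominus>\<^bsub>M\<^esub> m \<in> carrier M"
    and "\<lbrakk>m \<in> carrier M; m' \<in> carrier M\<rbrakk> \<Longrightarrow> m \<ominus>\<^bsub>M\<^esub> m' \<in> carrier M"
    and "\<zero>\<^bsub>M\<^esub> \<in> carrier M"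
proof -
  interpret module k M by (fact assms)
  show "\<lbrakk>m \<in> carrier M; m' \<in> carrier M\<rbrakk> \<Longrightarrow> m \<oplus>\<^bsub>M\<^esub> m' \<in> carrier M"
    "\<lbrakk>r \<in> carrier k; m \<in> carrier M\<rbrakk> \<Longrightarrow> r \<odot>\<^bsub>M\<^esub> m \<in> carrier M"
    "m \<in> carrier M \<Longrightarrow> \<ominus>\<^bsub>M\<^esub> m \<in> carrier M"
    "\<lbrakk>m \<in> carrier M; m' \<in> carrier M\<rbrakk> \<Longrightarrow> m \<ominus>\<^bsub>M\<^esub> m' \<in> carrier M" "\<zero>\<^bsub>M\<^esub> \<in> carrier M" by auto
qed

lemma tensor_relators_subset:
  assumes "module k M"
  shows "tensor_relators k M A n \<subseteq> carrier (tensor_free M A n)"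
proof -
  let ?S = "carrier M \<times> {as. length as = n \<and> set as \<subseteq> carrier A}"
  have c: "x - y \<in> carrier (free_Abelian_group ?S)"
    if "x \<in> carrier (free_Abelian_group ?S)" "y \<in> carrier (free_Abelian_group ?S)" for x y
    using that keys_diff[of x y] unfolding carrier_free_Abelian_group_iff by (meson Un_least order.trans)
  have d: "frag_of p - frag_of q \<in> carrier (free_Abelian_group ?S)" if "p \<in> ?S" "q \<in> ?S" for p q
    by (intro c) (use that in simp_all)
  have d3: "frag_of p - frag_of q - frag_of r \<in> carrier (free_Abelian_group ?S)"
    if "p \<in> ?S" "q \<in> ?S" "r \<in> ?S" for p q r
    by (intro c) (use that in simp_all)
  show ?thesis
    unfolding tensor_relators_def tensor_free_def
    apply (rule Un_least)+
    subgoal by (rule subsetI, elim CollectE exE conjE, erule ssubst, rule d3) (simp_all add: assms)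
    subgoal by (rule subsetI, elim CollectE exE conjE, erule ssubst, rule d3) (simp_all add: assms)
    subgoal by (rule subsetI, elim CollectE exE conjE, erule ssubst, rule d) (simp_all add: assms)
    done
qed

lemma tensor_null_subgroup:
  assumes "module k M"
  shows "subgroup (tensor_null k M A n) (tensor_free M A n)"
  unfolding tensor_null_def
  by (intro group.generate_is_subgroup tensor_relators_subset[OF assms] comm_group.axioms(2)[OF tensor_group])

lemma tensor_null_normal:
  assumes "module k M"
  shows "tensor_null k M A n \<lhd> tensor_free M A n"
  by (intro comm_group.subgroup_imp_normal tensor_group tensor_null_subgroup assms)

lemma tensor_additive_simps:
  "carrier (tensor_additive k M A n) = carrier (tensor_free M A n Mod tensor_null k M A n)"
  "add (tensor_additive k M A n) = mult (tensor_free M A n Mod tensor_null k M A n)"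
  "ring.zero (tensor_additive k M A n) = one (tensor_free M A n Mod tensor_null k M A n)"
  by (simp_all add: tensor_additive_def Let_def)

lemma tensor_simps:
  "carrier (tensor k M A n) = carrier (tensor_free M A n Mod tensor_null k M A n)"
  "add (tensor k M A n) = mult (tensor_free M A n Mod tensor_null k M A n)"
  "ring.zero (tensor k M A n) = one (tensor_free M A n Mod tensor_null k M A n)"
  by (simp_all add: tensor_def tensor_additive_simps ring.defs module.defs)

lemma abelian_group_tensor_additive:
  assumes "module k M"
  shows "abelian_group (tensor_additive k M A n)"
proof (rule comm_group_abelian_groupI)
  have "add_monoid (tensor_additive k M A n) = tensor_free M A n Mod tensor_null k M A n"
    by (simp add: tensor_additive_simps)
  then show "comm_group (add_monoid (tensor_additive k M A n))"
    by (metis assms comm_group.abelian_FactGroup tensor_group tensor_null_subgroup)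
qed

lemma abelian_group_cong_simps:
  assumes "abelian_group X" "carrier X = carrier Y" "add X = add Y" "ring.zero X = ring.zero Y"
  shows "abelian_group Y"
  using abelian_groupE[OF assms(1)] unfolding assms(2-4) by (intro abelian_groupI) auto

lemma abelian_group_tensor [simp]:
  assumes "module k M"
  shows "abelian_group (tensor k M A n)"
  by (rule abelian_group_cong_simps[OF abelian_group_tensor_additive[OF assms]])
     (simp_all add: tensor_additive_simps tensor_simps)

lemma carrier_tensor_cases:
  assumes "X \<in> carrier (tensor k M A n)"
  obtains c where "c \<in> carrier (tensor_free M A n)" "X = tensor_null k M A n #>\<^bsub>tensor_free M A n\<^esub> c"
  using assms by (auto simp: tensor_simps carrier_FactGroup)

lemma tensor_coset_hom:
  assumes "module k M"
  shows "(\<lambda>c. tensor_null k M A n #>\<^bsub>tensor_free M A n\<^esub> c)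
    \<in> hom (tensor_free M A n) (add_monoid (tensor k M A n))"
  using normal.r_coset_hom_Mod[OF tensor_null_normal[OF assms, of n]] by (simp add: tensor_simps hom_def)

lemma tensor_free_simps:
  "mult (tensor_free M A n) = (+)" "one (tensor_free M A n) = 0"
  "c \<in> carrier (tensor_free M A n) \<longleftrightarrow>
    Poly_Mapping.keys c \<subseteq> carrier M \<times> {as. length as = n \<and> set as \<subseteq> carrier A}"
  by (auto simp: tensor_free_def fun_eq_iff)

lemma tensor_free_add:
  "\<lbrakk>c \<in> carrier (tensor_free M A n); d \<in> carrier (tensor_free M A n)\<rbrakk>
    \<Longrightarrow> c + d \<in> carrier (tensor_free M A n)"
  unfolding tensor_free_simps using keys_add[of c d] by (meson Un_least order.trans)

lemma tensor_free_diff: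
  "\<lbrakk>c \<in> carrier (tensor_free M A n); d \<in> carrier (tensor_free M A n)\<rbrakk>
    \<Longrightarrow> c - d \<in> carrier (tensor_free M A n)"
  unfolding tensor_free_simps using keys_diff[of c d] by (meson Un_least order.trans)

lemma frag_of_tensor_free:
  "\<lbrakk>m \<in> carrier M; length as = n; set as \<subseteq> carrier A\<rbrakk> \<Longrightarrow> frag_of (m, as) \<in> carrier (tensor_free M A n)"
  by (simp add: tensor_free_def)

lemma pure_closed [simp]:
  assumes "module k M" "m \<in> carrier M" "length as = n" "set as \<subseteq> carrier A"
  shows "pure_tensor k M A m as \<in> carrier (tensor k M A n)"
  using assms by (auto simp: pure_tensor_def tensor_simps carrier_FactGroup frag_of_tensor_free)

lemma tensor_null_coset:
  assumes M: "module k M" and "x \<in> tensor_relators k M A n"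
  shows "tensor_null k M A n #>\<^bsub>tensor_free M A n\<^esub> x = \<zero>\<^bsub>tensor k M A n\<^esub>"
proof -
  have "x \<in> tensor_null k M A n"
    unfolding tensor_null_def by (rule generate.incl[OF assms(2)])
  then show ?thesis
    using group.coset_join2[OF comm_group.axioms(2)[OF tensor_group] _ tensor_null_subgroup[OF M]]
      subgroup.mem_carrier[OF tensor_null_subgroup[OF M]]
    by (simp add: tensor_simps)
qed

lemma tensor_relator_eq:
  assumes M: "module k M" and "x - y \<in> tensor_relators k M A n"
    and x: "x \<in> carrier (tensor_free M A n)" and y: "y \<in> carrier (tensor_free M A n)"
  shows "tensor_null k M A n #>\<^bsub>tensor_free M A n\<^esub> x = tensor_null k M A n #>\<^bsub>tensor_free M A n\<^esub> y"
proof -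
  interpret T: abelian_group "tensor k M A n" using M by simp
  have "x - y \<in> carrier (tensor_free M A n)"
    using assms(2) tensor_relators_subset[OF M] by blast
  moreover have "x = (x - y) \<otimes>\<^bsub>tensor_free M A n\<^esub> y"
    by (simp add: tensor_free_simps)
  ultimately show ?thesis
    using hom_mult[OF tensor_coset_hom[OF M, of n], of "x - y" y] y
      hom_in_carrier[OF tensor_coset_hom[OF M, of n] y] tensor_null_coset[OF M assms(2)] by simp
qed

lemma pure_add_left:
  assumes M: "module k M" and m: "m \<in> carrier M" "m' \<in> carrier M" and as: "length as = n" "set as \<subseteq> carrier A"
  shows "pure_tensor k M A (m \<oplus>\<^bsub>M\<^esub> m') as
     = pure_tensor k M A m as \<oplus>\<^bsub>tensor k M A n\<^esub> pure_tensor k M A m' as"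
proof -
  let ?F = "tensor_free M A n"
  have f: "frag_of (m \<oplus>\<^bsub>M\<^esub> m', as) \<in> carrier ?F" "frag_of (m, as) \<in> carrier ?F" "frag_of (m', as) \<in> carrier ?F"
    using assms by (auto intro: frag_of_tensor_free)
  then have s: "frag_of (m, as) + frag_of (m', as) \<in> carrier ?F"
    by (blast intro: tensor_free_add)
  have "frag_of (m \<oplus>\<^bsub>M\<^esub> m', as) - (frag_of (m, as) + frag_of (m', as)) \<in> tensor_relators k M A n"
    unfolding tensor_relators_def diff_diff_add[symmetric] using assms by (intro UnI1) blast
  from tensor_relator_eq[OF M this f(1) s] show ?thesis
    using hom_mult[OF tensor_coset_hom[OF M, of n] f(2,3)] as(1) by (simp add: pure_tensor_def tensor_free_simps)
qed

lemma pure_zero: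
  assumes M: "module k M" and as: "length as = n" "set as \<subseteq> carrier A"
  shows "pure_tensor k M A \<zero>\<^bsub>M\<^esub> as = \<zero>\<^bsub>tensor k M A n\<^esub>"
proof -
  have "(\<lambda>m. pure_tensor k M A m as) \<in> additive_maps M (tensor k M A n)"
    by (rule additive_mapsI) (simp_all add: M as pure_add_left)
  from additive_zero[OF this] show ?thesis using M by simp
qed


lemma pure_add_slot:
  assumes M: "module k M" and "m \<in> carrier M" and a: "a \<in> carrier A" "a' \<in> carrier A"
    and "set us \<subseteq> carrier A" "set vs \<subseteq> carrier A" and n: "length us + 1 + length vs = n"
  shows "pure_tensor k M A m (us @ (a \<oplus>\<^bsub>A\<^esub> a') # vs)
     = pure_tensor k M A m (us @ a # vs) \<oplus>\<^bsub>tensor k M A n\<^esub> pure_tensor k M A m (us @ a' # vs)"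
proof -
  let ?F = "tensor_free M A n"
  have f: "frag_of (m, us @ (a \<oplus>\<^bsub>A\<^esub> a') # vs) \<in> carrier ?F" "frag_of (m, us @ a # vs) \<in> carrier ?F"
    "frag_of (m, us @ a' # vs) \<in> carrier ?F"
    using assms by (auto intro!: frag_of_tensor_free)
  then have s: "frag_of (m, us @ a # vs) + frag_of (m, us @ a' # vs) \<in> carrier ?F"
    by (blast intro: tensor_free_add)
  have "frag_of (m, us @ (a \<oplus>\<^bsub>A\<^esub> a') # vs) - (frag_of (m, us @ a # vs) + frag_of (m, us @ a' # vs))
      \<in> tensor_relators k M A n"
    unfolding tensor_relators_def diff_diff_add[symmetric] using assms by (intro UnI1[OF UnI2]) blast
  from tensor_relator_eq[OF M this f(1) s] show ?thesis
    using hom_mult[OF tensor_coset_hom[OF M, of n] f(2,3)] n by (simp add: pure_tensor_def tensor_free_simps)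
qed

lemma pure_smult_slot:
  assumes M: "module k M" and "r \<in> carrier k" "m \<in> carrier M" and a: "a \<in> carrier A"
    and "set us \<subseteq> carrier A" "set vs \<subseteq> carrier A"
  shows "pure_tensor k M A (r \<odot>\<^bsub>M\<^esub> m) (us @ a # vs) = pure_tensor k M A m (us @ (r \<odot>\<^bsub>A\<^esub> a) # vs)"
proof -
  let ?n = "length us + 1 + length vs"
  let ?F = "tensor_free M A ?n"
  have f: "frag_of (r \<odot>\<^bsub>M\<^esub> m, us @ a # vs) \<in> carrier ?F"
    "frag_of (m, us @ (r \<odot>\<^bsub>A\<^esub> a) # vs) \<in> carrier ?F"
    using assms by (auto intro!: frag_of_tensor_free)
  have "frag_of (r \<odot>\<^bsub>M\<^esub> m, us @ a # vs) - frag_of (m, us @ (r \<odot>\<^bsub>A\<^esub> a) # vs) \<in> tensor_relators k M A ?n"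
    unfolding tensor_relators_def using assms by (intro UnI2) blast
  from tensor_relator_eq[OF M this f] show ?thesis
    by (simp add: pure_tensor_def)
qed

lemma pure_balanced:
  assumes M: "module k M"
  shows "balanced_map k M A n (tensor k M A n) (pure_tensor k M A)"
  by (rule balanced_mapI) (simp_all add: M pure_add_left pure_add_slot pure_smult_slot)

lemma balanced_compose:
  assumes "balanced_map k M A n B g" and "h \<in> additive_maps B C"
  shows "balanced_map k M A n C (\<lambda>m as. h (g m as))"
  using assms(1) additive_closed[OF assms(2)] unfolding balanced_map_def
  by (auto simp: additive_add[OF assms(2)])

text \<open>Closure under differences stands for sums, negatives and zero together, and additive
  maps respect it through one lemma, \<open>additive_diff\<close>.\<close>

lemma tensor_induct [consumes 2, case_names pure diff]:
  assumes M: "module k M" and X: "X \<in> carrier (tensor k M A n)"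
    and pure: "\<And>m as. \<lbrakk>m \<in> carrier M; length as = n; set as \<subseteq> carrier A\<rbrakk> \<Longrightarrow> P (pure_tensor k M A m as)"
    and diff: "\<And>x y. \<lbrakk>x \<in> carrier (tensor k M A n); y \<in> carrier (tensor k M A n); P x; P y\<rbrakk>
      \<Longrightarrow> P (x \<ominus>\<^bsub>tensor k M A n\<^esub> y)"
  shows "P X"
proof -
  let ?F = "tensor_free M A n" and ?T = "tensor k M A n"
  let ?q = "\<lambda>c. tensor_null k M A n #>\<^bsub>?F\<^esub> c"
  interpret T: abelian_group ?T using M by simp
  interpret q: group_hom ?F "add_monoid ?T" ?q
    by (intro group_hom.intro group_hom_axioms.intro tensor_coset_hom M T.a_group comm_group.axioms(2)[OF tensor_group])
  obtain c where c: "c \<in> carrier ?F" "X = ?q c"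
    using X by (rule carrier_tensor_cases)
  \<comment> \<open>Zero is obtained as a pure tensor minus itself; filling the n slots of that
    tensor takes some element of \<open>carrier A\<close>.\<close>
  have z: "P \<zero>\<^bsub>?T\<^esub>"
  proof -
    interpret M: module k M by (fact M)
    obtain a where "a \<in> carrier A" using A_module by (metis abelian_groupE(2) module_abelian_group)
    then have p: "pure_tensor k M A \<zero>\<^bsub>M\<^esub> (replicate n a) \<in> carrier ?T"
      "P (pure_tensor k M A \<zero>\<^bsub>M\<^esub> (replicate n a))"
      by (auto intro!: pure simp: M set_replicate_conv_if split: if_splits)
    from diff[OF p(1) p(1) p(2) p(2)] p(1) show ?thesis
      by (simp add: T.minus_eq T.r_neg)
  qed
  have "P (?q c)"
  proof (rule free_Abelian_group_induct[OF c(1)[unfolded tensor_free_simps]])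
    show "P (?q 0)" using z q.hom_one by (simp add: tensor_free_simps)
  next
    fix x y
    assume h: "Poly_Mapping.keys x \<subseteq> carrier M \<times> {as. length as = n \<and> set as \<subseteq> carrier A}"
      "Poly_Mapping.keys y \<subseteq> carrier M \<times> {as. length as = n \<and> set as \<subseteq> carrier A}"
      "P (?q x)" "P (?q y)"
    then have xy: "x \<in> carrier ?F" "y \<in> carrier ?F" by (simp_all add: tensor_free_simps)
    have "x - y = x \<otimes>\<^bsub>?F\<^esub> inv\<^bsub>?F\<^esub> y"
      using h by (simp add: tensor_free_def)
    then have "?q (x - y) = ?q x \<ominus>\<^bsub>?T\<^esub> ?q y"
      using xy q.hom_mult[of x "inv\<^bsub>?F\<^esub> y"] q.hom_inv[of y]
      by (simp add: T.minus_eq a_inv_def)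
    moreover have "?q x \<in> carrier ?T" "?q y \<in> carrier ?T"
      using q.hom_closed xy by auto
    ultimately show "P (?q (x - y))" using diff h by simp
  next
    fix p assume "p \<in> carrier M \<times> {as. length as = n \<and> set as \<subseteq> carrier A}"
    then show "P (?q (frag_of p))" using pure[of "fst p" "snd p"] by (auto simp: pure_tensor_def)
  qed
  then show ?thesis using c by simp
qed

text \<open>Pure tensors generate, so equality has to be checked on them only. Nearly every identity
  between maps on tensors below is reduced to this; the two additivity proofs passed to the rule
  encode which composites are compared.\<close>

lemma additive_eqI:
  assumes M: "module k M" and B: "abelian_group B"
    and f: "f \<in> additive_maps (tensor k M A n) B" and g: "g \<in> additive_maps (tensor k M A n) B"
    and eq: "\<And>m as. \<lbrakk>m \<in> carrier M; length as = n; set as \<subseteq> carrier A\<rbrakk>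
      \<Longrightarrow> f (pure_tensor k M A m as) = g (pure_tensor k M A m as)"
    and X: "X \<in> carrier (tensor k M A n)"
  shows "f X = g X"
  using M X
proof (induction rule: tensor_induct)
  case (pure m as)
  then show ?case by (rule eq)
next
  case (diff x y)
  then show ?case using additive_diff[OF f _ B] additive_diff[OF g _ B] M by simp
qed

text \<open>Vanishing on the relators puts the subgroup they generate into the kernel of the
  additive extension, which is therefore constant on cosets. This is what gives
  \<open>the_elem\<close> in \<open>tensor_lift\<close> its meaning.\<close>

lemma tensor_lift_pure_additive:
  assumes M: "module k M" and B: "abelian_group B" and g: "balanced_map k M A n B g"
  shows "tensor_lift B g \<in> additive_maps (tensor k M A n) B"
    and "\<lbrakk>m \<in> carrier M; length as = n; set as \<subseteq> carrier A\<rbrakk>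
      \<Longrightarrow> tensor_lift B g (pure_tensor k M A m as) = g m as"
proof -
  let ?F = "tensor_free M A n" and ?T = "tensor k M A n" and ?N = "tensor_null k M A n"
  let ?q = "\<lambda>c. ?N #>\<^bsub>?F\<^esub> c" and ?L = "linear_extension B (\<lambda>(m, as). g m as)"
  let ?S = "carrier M \<times> {as. length as = n \<and> set as \<subseteq> carrier A}"
  interpret B: abelian_group B by (fact B)
  have gS: "(\<lambda>(m, as). g m as) \<in> ?S \<rightarrow> carrier B"
    using g by (auto simp: balanced_map_def)
  interpret L: group_hom ?F "add_monoid B" ?L
    using linear_extension_hom[OF B gS]
    by (intro group_hom.intro group_hom_axioms.intro B.a_group comm_group.axioms(2)[OF tensor_group])
      (simp add: tensor_free_def)
  have Lf: "?L (frag_of (m, as)) = g m as" if "m \<in> carrier M" "length as = n" "set as \<subseteq> carrier A" for m as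
    using linear_extension_frag_of[OF B, of "\<lambda>(m, as). g m as" "(m, as)"] funcset_mem[OF gS, of "(m, as)"] that by simp
  have Ldiff: "?L (x - y) = ?L x \<ominus>\<^bsub>B\<^esub> ?L y" if "x \<in> carrier ?F" "y \<in> carrier ?F" for x y
  proof -
    have "x - y = x \<otimes>\<^bsub>?F\<^esub> inv\<^bsub>?F\<^esub> y"
      using that by (simp add: tensor_free_def)
    then show ?thesis
      using that L.hom_mult[of x "inv\<^bsub>?F\<^esub> y"] L.hom_inv[of y] by (simp add: B.minus_eq a_inv_def)
  qed
  have rel: "?L x = \<zero>\<^bsub>B\<^esub>" if "x \<in> tensor_relators k M A n" for x
    using that[unfolded tensor_relators_def]
  proof (elim UnE CollectE exE conjE)
    fix m m' as
    assume x: "x = frag_of (m \<oplus>\<^bsub>M\<^esub> m', as) - frag_of (m, as) - frag_of (m', as)"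
      and m: "m \<in> carrier M" "m' \<in> carrier M" and as: "set as \<subseteq> carrier A" "length as = n"
    have f: "frag_of (m \<oplus>\<^bsub>M\<^esub> m', as) \<in> carrier ?F" "frag_of (m, as) \<in> carrier ?F" "frag_of (m', as) \<in> carrier ?F"
      using m as M by (auto intro: frag_of_tensor_free)
    have c: "g m as \<in> carrier B" "g m' as \<in> carrier B" "g (m \<oplus>\<^bsub>M\<^esub> m') as = g m as \<oplus>\<^bsub>B\<^esub> g m' as"
      using g m as by (auto simp: balanced_map_def)
    then show ?thesis
      unfolding x using m as M f c
      by (simp add: Ldiff tensor_free_diff Lf B.minus_eq B.a_ac B.r_neg B.minus_add B.r_neg1 B.r_neg2)
  next
    fix m us a a' vs
    assume x: "x = frag_of (m, us @ (a \<oplus>\<^bsub>A\<^esub> a') # vs) - frag_of (m, us @ a # vs) - frag_of (m, us @ a' # vs)"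
      and m: "m \<in> carrier M" "a \<in> carrier A" "a' \<in> carrier A" "set us \<subseteq> carrier A" "set vs \<subseteq> carrier A"
        "length us + 1 + length vs = n"
    have f: "frag_of (m, us @ (a \<oplus>\<^bsub>A\<^esub> a') # vs) \<in> carrier ?F" "frag_of (m, us @ a # vs) \<in> carrier ?F"
      "frag_of (m, us @ a' # vs) \<in> carrier ?F"
      using m M by (auto intro!: frag_of_tensor_free)
    have "g m (us @ (a \<oplus>\<^bsub>A\<^esub> a') # vs) = g m (us @ a # vs) \<oplus>\<^bsub>B\<^esub> g m (us @ a' # vs)"
      using g m unfolding balanced_map_def by blast
    moreover have "g m (us @ a # vs) \<in> carrier B" "g m (us @ a' # vs) \<in> carrier B"
      using g m by (auto simp: balanced_map_def)
    ultimately show ?thesis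
      unfolding x using m M f
      by (simp add: Ldiff tensor_free_diff Lf B.minus_eq B.a_ac B.r_neg B.minus_add B.r_neg1 B.r_neg2)
  next
    fix r m us a vs
    assume x: "x = frag_of (r \<odot>\<^bsub>M\<^esub> m, us @ a # vs) - frag_of (m, us @ (r \<odot>\<^bsub>A\<^esub> a) # vs)"
      and m: "r \<in> carrier k" "m \<in> carrier M" "a \<in> carrier A" "set us \<subseteq> carrier A" "set vs \<subseteq> carrier A"
        "length us + 1 + length vs = n"
    have f: "frag_of (r \<odot>\<^bsub>M\<^esub> m, us @ a # vs) \<in> carrier ?F" "frag_of (m, us @ (r \<odot>\<^bsub>A\<^esub> a) # vs) \<in> carrier ?F"
      using m M by (auto intro!: frag_of_tensor_free)
    have "g (r \<odot>\<^bsub>M\<^esub> m) (us @ a # vs) = g m (us @ (r \<odot>\<^bsub>A\<^esub> a) # vs)"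
      using g m unfolding balanced_map_def by blast
    moreover have "g m (us @ (r \<odot>\<^bsub>A\<^esub> a) # vs) \<in> carrier B"
      using g m by (auto simp: balanced_map_def)
    ultimately show ?thesis
      unfolding x using m M f by (simp add: Ldiff Lf B.minus_eq B.r_neg)
  qed
  have "tensor_relators k M A n \<subseteq> kernel ?F (add_monoid B) ?L"
    using rel tensor_relators_subset[OF M, of n] by (auto simp: kernel_def)
  then have null: "?N \<subseteq> kernel ?F (add_monoid B) ?L"
    unfolding tensor_null_def
    by (rule group.generate_subgroup_incl[OF L.G.is_group _ L.subgroup_kernel])
  have lift: "tensor_lift B g (?q c) = ?L c" if c: "c \<in> carrier ?F" for c
  proof -
    have "?L x = ?L c" if "x \<in> ?q c" for x
    proof -
      obtain z where z: "z \<in> ?N" "x = z \<otimes>\<^bsub>?F\<^esub> c" using \<open>x \<in> ?q c\<close> by (auto simp: r_coset_def)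
      then have "z \<in> carrier ?F" "?L z = \<zero>\<^bsub>B\<^esub>" using null by (auto simp: kernel_def)
      then show ?thesis using z c L.hom_mult[of z c] L.hom_closed[of c] by simp
    qed
    moreover have "c \<in> ?q c" by (rule group.rcos_self[OF L.G.is_group c tensor_null_subgroup[OF M]])
    ultimately have "?L ` ?q c = {?L c}" by blast
    then show ?thesis by (simp add: tensor_lift_def)
  qed
  show "tensor_lift B g \<in> additive_maps ?T B"
  proof (rule additive_mapsI)
    fix X assume "X \<in> carrier ?T"
    then obtain c where c: "c \<in> carrier ?F" "X = ?q c" by (rule carrier_tensor_cases)
    then show "tensor_lift B g X \<in> carrier B" using lift L.hom_closed[of c] by simp
    fix Y assume "Y \<in> carrier ?T"
    then obtain d where d: "d \<in> carrier ?F" "Y = ?q d" by (rule carrier_tensor_cases)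
    have "X \<oplus>\<^bsub>?T\<^esub> Y = ?q (c \<otimes>\<^bsub>?F\<^esub> d)"
      using hom_mult[OF tensor_coset_hom[OF M] c(1) d(1)] c d by simp
    then show "tensor_lift B g (X \<oplus>\<^bsub>?T\<^esub> Y) = tensor_lift B g X \<oplus>\<^bsub>B\<^esub> tensor_lift B g Y"
      using c d lift L.hom_mult[of c d] by simp
  qed
  show "tensor_lift B g (pure_tensor k M A m as) = g m as"
    if "m \<in> carrier M" "length as = n" "set as \<subseteq> carrier A"
    using that lift[OF frag_of_tensor_free[OF that]] Lf by (simp add: pure_tensor_def)
qed

lemmas tensor_lift_additive = tensor_lift_pure_additive(1)
lemmas tensor_lift_pure = tensor_lift_pure_additive(2)

text \<open>Here g is balanced because it is the restriction of an additive map to pure tensors. A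
  lift given by an unfamiliar formula can thus be identified with a known map without another
  verification of the relations.\<close>

lemma tensor_lift_eq:
  assumes M: "module k M" and B: "abelian_group B" and h: "h \<in> additive_maps (tensor k M A n) B"
    and eq: "\<And>m as. \<lbrakk>m \<in> carrier M; length as = n; set as \<subseteq> carrier A\<rbrakk>
      \<Longrightarrow> g m as = h (pure_tensor k M A m as)"
    and X: "X \<in> carrier (tensor k M A n)"
  shows "tensor_lift B g X = h X"
proof -
  have b: "balanced_map k M A n B g"
    using balanced_compose[OF pure_balanced[OF M, of n] h] unfolding balanced_map_def
    by (auto simp: eq M)
  show ?thesis
    using additive_eqI[OF M B tensor_lift_additive[OF M B b] h _ X] tensor_lift_pure[OF M B b] eq by simp
qed

end

context tensor_factor
begin

section \<open>Module structure\<close>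

text \<open>The scalar multiplication of \<open>tensor\<close> is itself a lift, with target
  \<open>tensor_additive\<close>. The two records have the same additive group but are different
  terms, so one has to be exchanged for the other.\<close>

lemma additive_maps_tensor_additive:
  "additive_maps X (tensor_additive k M A n) = additive_maps X (tensor k M A n)"
  by (simp add: hom_def tensor_simps tensor_additive_simps)

lemma balanced_map_tensor_additive:
  "balanced_map k M A n (tensor_additive k N A l) g = balanced_map k M A n (tensor k N A l) g"
  by (simp add: balanced_map_def tensor_simps tensor_additive_simps)

lemma smult_linear:
  assumes "module k M" "r \<in> carrier k"
  shows "smult M r \<in> linear_maps k M M"
proof -
  interpret module k M by fact
  have "r \<odot>\<^bsub>M\<^esub> (r' \<odot>\<^bsub>M\<^esub> m) = r' \<odot>\<^bsub>M\<^esub> (r \<odot>\<^bsub>M\<^esub> m)" if "r' \<in> carrier k" "m \<in> carrier M" for r' m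
    using that assms(2) by (metis R.m_comm smult_assoc1)
  then show ?thesis
    using assms(2) by (intro linear_mapsI additive_mapsI) (auto simp: smult_r_distr)
qed

lemma map_pure_balanced:
  assumes M: "module k M" and N: "module k N" and f: "f \<in> linear_maps k M N"
  shows "balanced_map k M A n (tensor k N A n) (\<lambda>m as. pure_tensor k N A (f m) as)"
  by (rule balanced_mapI)
    (simp_all add: M N linear_closed[OF f] linear_add[OF f] linear_smult[OF f] pure_add_left pure_add_slot
      pure_smult_slot)

lemma smult_tensor:
  "smult (tensor k M A n) r = tensor_lift (tensor_additive k M A n) (\<lambda>m as. pure_tensor k M A (r \<odot>\<^bsub>M\<^esub> m) as)"
  by (simp add: tensor_def ring.defs module.defs)

lemma
  assumes M: "module k M" and r: "r \<in> carrier k"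
  shows smult_tensor_additive: "smult (tensor k M A n) r \<in> additive_maps (tensor k M A n) (tensor k M A n)"
    and smult_pure: "\<lbrakk>m \<in> carrier M; length as = n; set as \<subseteq> carrier A\<rbrakk> \<Longrightarrow>
      r \<odot>\<^bsub>tensor k M A n\<^esub> pure_tensor k M A m as = pure_tensor k M A (r \<odot>\<^bsub>M\<^esub> m) as"
proof -
  have b: "balanced_map k M A n (tensor_additive k M A n) (\<lambda>m as. pure_tensor k M A (r \<odot>\<^bsub>M\<^esub> m) as)"
    unfolding balanced_map_tensor_additive by (intro map_pure_balanced M smult_linear r)
  note lift = tensor_lift_pure_additive[OF M abelian_group_tensor_additive[OF M] b]
  show "smult (tensor k M A n) r \<in> additive_maps (tensor k M A n) (tensor k M A n)"
    unfolding smult_tensor using lift(1) unfolding additive_maps_tensor_additive .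
  show "r \<odot>\<^bsub>tensor k M A n\<^esub> pure_tensor k M A m as = pure_tensor k M A (r \<odot>\<^bsub>M\<^esub> m) as"
    if "m \<in> carrier M" "length as = n" "set as \<subseteq> carrier A"
    using lift(2) that by (simp add: smult_tensor)
qed

lemma k_cring: "cring k"
  using A_module by (rule module.axioms)

lemma module_tensor [simp]:
  assumes M: "module k M"
  shows "module k (tensor k M A n)"
proof (rule moduleI)
  let ?T = "tensor k M A n"
  interpret M: module k M by (fact M)
  show "cring k" by (rule k_cring)
  show T: "abelian_group ?T" using M by simp
  interpret T: abelian_group ?T by (fact T)
  note s = smult_tensor_additive[OF M, of _ n]
  show c: "r \<odot>\<^bsub>?T\<^esub> x \<in> carrier ?T" if "r \<in> carrier k" "x \<in> carrier ?T" for r x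
    using additive_closed[OF s] that by blast
  show "r \<odot>\<^bsub>?T\<^esub> (x \<oplus>\<^bsub>?T\<^esub> y) = r \<odot>\<^bsub>?T\<^esub> x \<oplus>\<^bsub>?T\<^esub> r \<odot>\<^bsub>?T\<^esub> y"
    if "r \<in> carrier k" "x \<in> carrier ?T" "y \<in> carrier ?T" for r x y
    using additive_add[OF s] that by blast
  show "(r \<oplus>\<^bsub>k\<^esub> r') \<odot>\<^bsub>?T\<^esub> x = r \<odot>\<^bsub>?T\<^esub> x \<oplus>\<^bsub>?T\<^esub> r' \<odot>\<^bsub>?T\<^esub> x"
    if "r \<in> carrier k" "r' \<in> carrier k" "x \<in> carrier ?T" for r r' x
    by (rule additive_eqI[OF M T s additive_add_map[OF T s s] _ that(3)])
      (use that in \<open>simp_all add: smult_pure M M.smult_l_distr pure_add_left\<close>)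
  show "(r \<otimes>\<^bsub>k\<^esub> r') \<odot>\<^bsub>?T\<^esub> x = r \<odot>\<^bsub>?T\<^esub> (r' \<odot>\<^bsub>?T\<^esub> x)"
    if "r \<in> carrier k" "r' \<in> carrier k" "x \<in> carrier ?T" for r r' x
    by (rule additive_eqI[OF M T s additive_compose[OF s s] _ that(3)])
      (use that in \<open>simp_all add: smult_pure M M.smult_assoc1\<close>)
  show "\<one>\<^bsub>k\<^esub> \<odot>\<^bsub>?T\<^esub> x = x" if "x \<in> carrier ?T" for x
    by (rule additive_eqI[OF M T s _ _ that, of "\<one>\<^bsub>k\<^esub>" "\<lambda>x. x"]) (simp_all add: additive_mapsI smult_pure M)
qed

lemma smult_pure_slot:
  assumes M: "module k M" and "r \<in> carrier k" "m \<in> carrier M" "a \<in> carrier A"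
    and "set us \<subseteq> carrier A" "set vs \<subseteq> carrier A" "length us + 1 + length vs = n"
  shows "pure_tensor k M A m (us @ (r \<odot>\<^bsub>A\<^esub> a) # vs) = r \<odot>\<^bsub>tensor k M A n\<^esub> pure_tensor k M A m (us @ a # vs)"
  using assms by (simp add: smult_pure pure_smult_slot)

lemma additive_linearI:
  assumes M: "module k M" and N: "module k N"
    and f: "f \<in> additive_maps (tensor k M A n) N"
    and p: "\<And>r m as. \<lbrakk>r \<in> carrier k; m \<in> carrier M; length as = n; set as \<subseteq> carrier A\<rbrakk>
      \<Longrightarrow> f (pure_tensor k M A (r \<odot>\<^bsub>M\<^esub> m) as) = r \<odot>\<^bsub>N\<^esub> f (pure_tensor k M A m as)"
  shows "f \<in> linear_maps k (tensor k M A n) N"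
proof (rule linear_mapsI[OF f])
  fix r x assume r: "r \<in> carrier k" and x: "x \<in> carrier (tensor k M A n)"
  have "(\<lambda>x. f (r \<odot>\<^bsub>tensor k M A n\<^esub> x)) \<in> additive_maps (tensor k M A n) N"
    by (rule additive_compose[OF smult_tensor_additive[OF M r] f])
  moreover have "(\<lambda>x. r \<odot>\<^bsub>N\<^esub> f x) \<in> additive_maps (tensor k M A n) N"
    by (rule additive_compose[OF f linear_additive[OF smult_linear[OF N r]]])
  ultimately show "f (r \<odot>\<^bsub>tensor k M A n\<^esub> x) = r \<odot>\<^bsub>N\<^esub> f x"
    by (rule additive_eqI[OF M module_abelian_group[OF N]]) (simp_all add: x r M smult_pure p)
qed

section \<open>Appending factors\<close>

text \<open>The operation of \<open>tensor_append\<close>, with n factors already present instead of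
  one.\<close>

definition tail :: "('k, 'm, 'z) module_scheme \<Rightarrow> nat \<Rightarrow> ('m, 'a) tensors \<Rightarrow> 'a list \<Rightarrow> ('m, 'a) tensors"
  where "tail M n x as = tensor_lift (tensor k M A (n + length as)) (\<lambda>m bs. pure_tensor k M A m (bs @ as)) x"

text \<open>The constructor for inductions on the number of factors. Growing at the right end leaves
  \<open>M\<close>, where a coaction acts, as the base case.\<close>

definition snoc :: "('k, 'm, 'z) module_scheme \<Rightarrow> nat \<Rightarrow> ('m, 'a) tensors \<Rightarrow> 'a \<Rightarrow> ('m, 'a) tensors"
  where "snoc M n x a = tail M n x [a]"

lemma tensor_append_tail: "tensor_append k M A X as = tail M 1 X as"
  by (simp add: tensor_append_def tail_def)

lemma
  assumes M: "module k M" and as: "set as \<subseteq> carrier A"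
  shows tail_additive: "(\<lambda>x. tail M n x as) \<in> additive_maps (tensor k M A n) (tensor k M A (n + length as))"
    and tail_pure: "\<lbrakk>m \<in> carrier M; length bs = n; set bs \<subseteq> carrier A\<rbrakk>
      \<Longrightarrow> tail M n (pure_tensor k M A m bs) as = pure_tensor k M A m (bs @ as)"
proof -
  have b: "balanced_map k M A n (tensor k M A (n + length as)) (\<lambda>m bs. pure_tensor k M A m (bs @ as))"
    using as by (intro balanced_mapI) (simp_all add: M pure_add_left pure_add_slot pure_smult_slot add.assoc)
  note lift = tensor_lift_pure_additive[OF M abelian_group_tensor[OF M] b]
  show "(\<lambda>x. tail M n x as) \<in> additive_maps (tensor k M A n) (tensor k M A (n + length as))"
    using lift(1) by (simp add: tail_def)
  show "tail M n (pure_tensor k M A m bs) as = pure_tensor k M A m (bs @ as)"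
    if "m \<in> carrier M" "length bs = n" "set bs \<subseteq> carrier A"
    using lift(2)[OF that] by (simp add: tail_def)
qed

lemma snoc_additive:
  assumes "module k M" "a \<in> carrier A"
  shows "(\<lambda>x. snoc M n x a) \<in> additive_maps (tensor k M A n) (tensor k M A (Suc n))"
  using tail_additive[OF assms(1), of "[a]" n] assms(2) by (simp add: snoc_def)

lemma snoc_closed [simp]:
  assumes "module k M" "x \<in> carrier (tensor k M A n)" "a \<in> carrier A"
  shows "snoc M n x a \<in> carrier (tensor k M A (Suc n))"
  using additive_closed[OF snoc_additive] assms by blast

lemma snoc_pure:
  "\<lbrakk>module k M; a \<in> carrier A; m \<in> carrier M; length as = n; set as \<subseteq> carrier A\<rbrakk>
    \<Longrightarrow> snoc M n (pure_tensor k M A m as) a = pure_tensor k M A m (as @ [a])"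
  using tail_pure[of M "[a]"] by (simp add: snoc_def)

lemma snoc_add:
  assumes M: "module k M" and a: "a \<in> carrier A" "b \<in> carrier A" and x: "x \<in> carrier (tensor k M A n)"
  shows "snoc M n x (a \<oplus>\<^bsub>A\<^esub> b) = snoc M n x a \<oplus>\<^bsub>tensor k M A (Suc n)\<^esub> snoc M n x b"
proof (rule additive_eqI[OF M _ snoc_additive[OF M] additive_add_map[OF _ snoc_additive[OF M a(1)] snoc_additive[OF M a(2)]] _ x])
  fix m as assume "m \<in> carrier M" "length as = n" "set as \<subseteq> carrier A"
  then show "snoc M n (pure_tensor k M A m as) (a \<oplus>\<^bsub>A\<^esub> b) = snoc M n (pure_tensor k M A m as) a
    \<oplus>\<^bsub>tensor k M A (Suc n)\<^esub> snoc M n (pure_tensor k M A m as) b"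
    using a M pure_add_slot[OF M, of m a b as "[]" "Suc n"] by (simp add: snoc_pure)
qed (use M a in simp_all)

lemma snoc_linear:
  assumes M: "module k M" and a: "a \<in> carrier A"
  shows "(\<lambda>x. snoc M n x a) \<in> linear_maps k (tensor k M A n) (tensor k M A (Suc n))"
  using M a by (intro additive_linearI snoc_additive) (simp_all add: snoc_pure smult_pure)

lemma snoc_smult:
  assumes M: "module k M" and "a \<in> carrier A" "r \<in> carrier k" "x \<in> carrier (tensor k M A n)"
  shows "snoc M n (r \<odot>\<^bsub>tensor k M A n\<^esub> x) a = r \<odot>\<^bsub>tensor k M A (Suc n)\<^esub> snoc M n x a"
  using linear_smult[OF snoc_linear] assms by blast

lemma snoc_smult_right:
  assumes M: "module k M" and a: "a \<in> carrier A" and r: "r \<in> carrier k" and x: "x \<in> carrier (tensor k M A n)"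
  shows "snoc M n x (r \<odot>\<^bsub>A\<^esub> a) = r \<odot>\<^bsub>tensor k M A (Suc n)\<^esub> snoc M n x a"
proof (rule additive_eqI[OF M _ snoc_additive[OF M] additive_compose[OF snoc_additive[OF M a] smult_tensor_additive[OF M r]] _ x])
  fix m as assume "m \<in> carrier M" "length as = n" "set as \<subseteq> carrier A"
  then show "snoc M n (pure_tensor k M A m as) (r \<odot>\<^bsub>A\<^esub> a)
    = r \<odot>\<^bsub>tensor k M A (Suc n)\<^esub> snoc M n (pure_tensor k M A m as) a"
    using a r M smult_pure_slot[OF M r, of m a as "[]" "Suc n"] by (simp add: snoc_pure)
qed (use M a r in simp_all)

section \<open>Induction and lifting along the last factor\<close>

lemma snoc_induct [consumes 2, case_names snoc diff]:
  assumes M: "module k M" and X: "X \<in> carrier (tensor k M A (Suc n))"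
    and snoc: "\<And>x a. \<lbrakk>x \<in> carrier (tensor k M A n); a \<in> carrier A\<rbrakk> \<Longrightarrow> P (snoc M n x a)"
    and diff: "\<And>x y. \<lbrakk>x \<in> carrier (tensor k M A (Suc n)); y \<in> carrier (tensor k M A (Suc n)); P x; P y\<rbrakk>
      \<Longrightarrow> P (x \<ominus>\<^bsub>tensor k M A (Suc n)\<^esub> y)"
  shows "P X"
  using M X
proof (induction rule: tensor_induct)
  case (pure m as)
  then obtain bs a where as: "as = bs @ [a]" by (metis length_Suc_conv_rev)
  then show ?case
    using snoc[of "pure_tensor k M A m bs" a] pure by (simp add: snoc_pure M)
qed (rule diff)

lemma snoc_eqI:
  assumes M: "module k M" and B: "abelian_group B"
    and f: "f \<in> additive_maps (tensor k M A (Suc n)) B" and g: "g \<in> additive_maps (tensor k M A (Suc n)) B"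
    and eq: "\<And>x a. \<lbrakk>x \<in> carrier (tensor k M A n); a \<in> carrier A\<rbrakk> \<Longrightarrow> f (snoc M n x a) = g (snoc M n x a)"
    and X: "X \<in> carrier (tensor k M A (Suc n))"
  shows "f X = g X"
  using M X
proof (induction rule: snoc_induct)
  case (diff x y)
  then show ?case using additive_diff[OF f _ B] additive_diff[OF g _ B] M by simp
qed (rule eq)

text \<open>The target is only an abelian group, hence the last clause passes scalars across instead
  of taking them out.\<close>

definition bilinear_map :: "('k, 'x, 'z) module_scheme \<Rightarrow> ('b, 'v) ring_scheme \<Rightarrow> ('x \<Rightarrow> 'a \<Rightarrow> 'b) \<Rightarrow> bool"
  where "bilinear_map X B \<phi> \<longleftrightarrow>
    (\<forall>a \<in> carrier A. (\<lambda>x. \<phi> x a) \<in> additive_maps X B) \<and>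
    (\<forall>x \<in> carrier X. \<forall>a \<in> carrier A. \<forall>b \<in> carrier A. \<phi> x (a \<oplus>\<^bsub>A\<^esub> b) = \<phi> x a \<oplus>\<^bsub>B\<^esub> \<phi> x b) \<and>
    (\<forall>r \<in> carrier k. \<forall>x \<in> carrier X. \<forall>a \<in> carrier A. \<phi> (r \<odot>\<^bsub>X\<^esub> x) a = \<phi> x (r \<odot>\<^bsub>A\<^esub> a))"

lemma bilinear_mapI:
  assumes "\<And>a. a \<in> carrier A \<Longrightarrow> (\<lambda>x. \<phi> x a) \<in> additive_maps X B"
    and "\<And>x a b. \<lbrakk>x \<in> carrier X; a \<in> carrier A; b \<in> carrier A\<rbrakk> \<Longrightarrow> \<phi> x (a \<oplus>\<^bsub>A\<^esub> b) = \<phi> x a \<oplus>\<^bsub>B\<^esub> \<phi> x b"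
    and "\<And>r x a. \<lbrakk>r \<in> carrier k; x \<in> carrier X; a \<in> carrier A\<rbrakk> \<Longrightarrow> \<phi> (r \<odot>\<^bsub>X\<^esub> x) a = \<phi> x (r \<odot>\<^bsub>A\<^esub> a)"
  shows "bilinear_map X B \<phi>"
  using assms unfolding bilinear_map_def by blast

lemma snoc_bilinear: "module k M \<Longrightarrow> bilinear_map (tensor k M A n) (tensor k M A (Suc n)) (snoc M n)"
  by (intro bilinear_mapI) (simp_all add: snoc_additive snoc_add snoc_smult snoc_smult_right)

lemma bilinear_compose_left:
  assumes \<phi>: "bilinear_map X B \<phi>" and h: "h \<in> linear_maps k Y X"
  shows "bilinear_map Y B (\<lambda>y a. \<phi> (h y) a)"
proof (rule bilinear_mapI)
  fix a assume a: "a \<in> carrier A"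
  then show "(\<lambda>y. \<phi> (h y) a) \<in> additive_maps Y B"
    using \<phi> additive_compose[OF linear_additive[OF h], of "\<lambda>x. \<phi> x a" B] by (auto simp: bilinear_map_def)
qed (use \<phi> linear_closed[OF h] linear_smult[OF h] in \<open>auto simp: bilinear_map_def\<close>)

text \<open>The universal property of the product of M \<otimes> A \<otimes> ... \<otimes> A with
  one more factor \<open>A\<close>. Splitting each list into \<open>butlast\<close> and
  \<open>last\<close> avoids tensors of tensors, which would live in another type.\<close>

definition snoc_lift ::
  "('k, 'm, 'z) module_scheme \<Rightarrow> ('b, 'v) ring_scheme \<Rightarrow> (('m, 'a) tensors \<Rightarrow> 'a \<Rightarrow> 'b) \<Rightarrow> ('m, 'a) tensors \<Rightarrow> 'b"
  where "snoc_lift M B \<phi> = tensor_lift B (\<lambda>m as. \<phi> (pure_tensor k M A m (butlast as)) (last as))"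

lemma
  assumes M: "module k M" and B: "abelian_group B" and \<phi>: "bilinear_map (tensor k M A n) B \<phi>"
  shows snoc_lift_additive: "snoc_lift M B \<phi> \<in> additive_maps (tensor k M A (Suc n)) B"
    and snoc_lift_snoc: "\<lbrakk>x \<in> carrier (tensor k M A n); a \<in> carrier A\<rbrakk>
      \<Longrightarrow> snoc_lift M B \<phi> (snoc M n x a) = \<phi> x a"
proof -
  let ?T = "tensor k M A n"
  have \<phi>1: "(\<lambda>x. \<phi> x a) \<in> additive_maps ?T B" if "a \<in> carrier A" for a
    using \<phi> that by (simp add: bilinear_map_def)
  have \<phi>2: "\<phi> x (a \<oplus>\<^bsub>A\<^esub> b) = \<phi> x a \<oplus>\<^bsub>B\<^esub> \<phi> x b" if "x \<in> carrier ?T" "a \<in> carrier A" "b \<in> carrier A" for x a b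
    using \<phi> that by (simp add: bilinear_map_def)
  have \<phi>3: "\<phi> (r \<odot>\<^bsub>?T\<^esub> x) a = \<phi> x (r \<odot>\<^bsub>A\<^esub> a)" if "r \<in> carrier k" "x \<in> carrier ?T" "a \<in> carrier A" for r x a
    using \<phi> that by (simp add: bilinear_map_def)
  have last: "last as \<in> carrier A" "set (butlast as) \<subseteq> carrier A"
    if "length as = Suc n" "set as \<subseteq> carrier A" for as
    using that by (auto dest: in_set_butlastD intro: subsetD[OF that(2) last_in_set])
  have b: "balanced_map k M A (Suc n) B (\<lambda>m as. \<phi> (pure_tensor k M A m (butlast as)) (last as))"
  proof (rule balanced_mapI)
    fix m as assume m: "m \<in> carrier M" "length as = Suc n" "set as \<subseteq> carrier A"
    then show "\<phi> (pure_tensor k M A m (butlast as)) (last as) \<in> carrier B"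
      using additive_closed[OF \<phi>1[OF last(1)]] last by (simp add: M)
    fix m' assume "m' \<in> carrier M"
    then show "\<phi> (pure_tensor k M A (m \<oplus>\<^bsub>M\<^esub> m') (butlast as)) (last as)
        = \<phi> (pure_tensor k M A m (butlast as)) (last as) \<oplus>\<^bsub>B\<^esub> \<phi> (pure_tensor k M A m' (butlast as)) (last as)"
      using additive_add[OF \<phi>1[OF last(1)]] last m by (simp add: M pure_add_left)
  next
    fix m us a a' vs
    assume m: "m \<in> carrier M" "a \<in> carrier A" "a' \<in> carrier A" "set us \<subseteq> carrier A" "set vs \<subseteq> carrier A"
      and n: "Suc n = length us + 1 + length vs"
    let ?as = "\<lambda>a. us @ a # vs"
    show "\<phi> (pure_tensor k M A m (butlast (us @ (a \<oplus>\<^bsub>A\<^esub> a') # vs))) (last (us @ (a \<oplus>\<^bsub>A\<^esub> a') # vs))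
       = \<phi> (pure_tensor k M A m (butlast (us @ a # vs))) (last (us @ a # vs))
         \<oplus>\<^bsub>B\<^esub> \<phi> (pure_tensor k M A m (butlast (us @ a' # vs))) (last (us @ a' # vs))"
    \<comment> \<open>The changed slot is either the last one, seen by the second argument of
      \<phi>, or part of the prefix, seen by the pure tensor in the first argument.\<close>
    proof (cases vs rule: rev_cases)
      case Nil
      then show ?thesis using m n \<phi>2 by (simp add: butlast_append M)
    next
      case (snoc ws b)
      then show ?thesis
        using m n additive_add[OF \<phi>1, of b] by (simp add: butlast_append M pure_add_slot[where n=n])
    qed
  next
    fix r m us a vs
    assume m: "r \<in> carrier k" "m \<in> carrier M" "a \<in> carrier A" "set us \<subseteq> carrier A" "set vs \<subseteq> carrier A"
      and n: "Suc n = length us + 1 + length vs"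
    show "\<phi> (pure_tensor k M A (r \<odot>\<^bsub>M\<^esub> m) (butlast (us @ a # vs))) (last (us @ a # vs))
       = \<phi> (pure_tensor k M A m (butlast (us @ (r \<odot>\<^bsub>A\<^esub> a) # vs))) (last (us @ (r \<odot>\<^bsub>A\<^esub> a) # vs))"
    proof (cases vs rule: rev_cases)
      case Nil
      then show ?thesis
        using m n \<phi>3[of r "pure_tensor k M A m us" a] by (simp add: butlast_append M smult_pure)
    next
      case (snoc ws b)
      then show ?thesis
        using m n by (simp add: butlast_append M pure_smult_slot)
    qed
  qed
  note lift = tensor_lift_pure_additive[OF M B b]
  show a: "snoc_lift M B \<phi> \<in> additive_maps (tensor k M A (Suc n)) B"
    using lift(1) by (simp add: snoc_lift_def)
  show "snoc_lift M B \<phi> (snoc M n x a) = \<phi> x a" if x: "x \<in> carrier ?T" and "a \<in> carrier A" for x a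
    by (rule additive_eqI[OF M B additive_compose[OF snoc_additive a] \<phi>1 _ x])
      (use that M in \<open>simp_all add: snoc_pure snoc_lift_def lift(2)\<close>)
qed

section \<open>Tensors without factors of \<open>A\<close>\<close>

lemma pure0_additive: "module k M \<Longrightarrow> (\<lambda>m. pure_tensor k M A m []) \<in> additive_maps M (tensor k M A 0)"
  by (intro additive_mapsI) (simp_all add: pure_add_left)

lemma tensor0_cases:
  assumes M: "module k M" and X: "X \<in> carrier (tensor k M A 0)"
  obtains m where "m \<in> carrier M" "X = pure_tensor k M A m []"
proof -
  have "\<exists>m \<in> carrier M. X = pure_tensor k M A m []"
    using M X
  proof (induction rule: tensor_induct)
    case (pure m as)
    then show ?case by auto
  next
    case (diff x y)
    then obtain m m' where m: "m \<in> carrier M" "x = pure_tensor k M A m []"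
      "m' \<in> carrier M" "y = pure_tensor k M A m' []" by blast
    have "pure_tensor k M A (m \<ominus>\<^bsub>M\<^esub> m') [] = x \<ominus>\<^bsub>tensor k M A 0\<^esub> y"
      using additive_diff[OF pure0_additive[OF M] module_abelian_group[OF M] abelian_group_tensor[OF M] m(1,3)] m
      by simp
    moreover have "m \<ominus>\<^bsub>M\<^esub> m' \<in> carrier M"
      using m M by simp
    ultimately show ?case by metis
  qed
  then show ?thesis using that by blast
qed

lemma
  assumes M: "module k M" and B: "abelian_group B" and \<phi>: "\<phi> \<in> additive_maps M B"
  shows lift0_additive: "tensor_lift B (\<lambda>m as. \<phi> m) \<in> additive_maps (tensor k M A 0) B"
    and lift0_pure: "m \<in> carrier M \<Longrightarrow> tensor_lift B (\<lambda>m as. \<phi> m) (pure_tensor k M A m []) = \<phi> m"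
proof -
  have b: "balanced_map k M A 0 B (\<lambda>m as. \<phi> m)"
    by (rule balanced_mapI) (simp_all add: additive_closed[OF \<phi>] additive_add[OF \<phi>])
  note lift = tensor_lift_pure_additive[OF M B b]
  show "tensor_lift B (\<lambda>m as. \<phi> m) \<in> additive_maps (tensor k M A 0) B" by (rule lift(1))
  show "tensor_lift B (\<lambda>m as. \<phi> m) (pure_tensor k M A m []) = \<phi> m" if "m \<in> carrier M"
    using lift(2)[of m "[]"] that by simp
qed

text \<open>The lift of the identity of \<open>M\<close> is a left inverse.\<close>

lemma pure0_inject:
  assumes M: "module k M" and m: "m \<in> carrier M" "m' \<in> carrier M"
    and eq: "pure_tensor k M A m [] = pure_tensor k M A m' []"
  shows "m = m'"
  using lift0_pure[OF M module_abelian_group[OF M] additive_id m(1)]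
    lift0_pure[OF M module_abelian_group[OF M] additive_id m(2)] unfolding eq by (rule trans[OF sym])

section \<open>Functoriality\<close>

lemma
  assumes M: "module k M" and N: "module k N" and f: "f \<in> linear_maps k M N"
  shows map_additive: "tensor_map k N A n f \<in> additive_maps (tensor k M A n) (tensor k N A n)"
    and map_pure: "\<lbrakk>m \<in> carrier M; length as = n; set as \<subseteq> carrier A\<rbrakk> \<Longrightarrow>
      tensor_map k N A n f (pure_tensor k M A m as) = pure_tensor k N A (f m) as"
  using tensor_lift_pure_additive[OF M _ map_pure_balanced[OF M N f, of n]] N
  by (simp_all add: tensor_map_def)

lemma map_linear:
  assumes M: "module k M" and N: "module k N" and f: "f \<in> linear_maps k M N"
  shows "tensor_map k N A n f \<in> linear_maps k (tensor k M A n) (tensor k N A n)"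
  by (intro additive_linearI map_additive)
    (simp_all add: assms linear_closed[OF f] linear_smult[OF f] map_pure smult_pure)

lemma map_snoc:
  assumes M: "module k M" and N: "module k N" and f: "f \<in> linear_maps k M N"
    and x: "x \<in> carrier (tensor k M A n)" and a: "a \<in> carrier A"
  shows "tensor_map k N A (Suc n) f (snoc M n x a) = snoc N n (tensor_map k N A n f x) a"
  by (rule additive_eqI[OF M _ additive_compose[OF snoc_additive[OF M a] map_additive[OF M N f]]
        additive_compose[OF map_additive[OF M N f] snoc_additive[OF N a]] _ x])
    (use a in \<open>simp_all add: M N f snoc_pure map_pure linear_closed[OF f]\<close>)

lemma map_compose:
  assumes L: "module k L" and M: "module k M" and N: "module k N"
    and f: "f \<in> linear_maps k L M" and g: "g \<in> linear_maps k M N"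
    and h: "h \<in> linear_maps k L N" and eq: "\<And>l. l \<in> carrier L \<Longrightarrow> h l = g (f l)"
    and x: "x \<in> carrier (tensor k L A n)"
  shows "tensor_map k N A n g (tensor_map k M A n f x) = tensor_map k N A n h x"
  by (rule additive_eqI[OF L _ additive_compose[OF map_additive[OF L M f] map_additive[OF M N g]]
        map_additive[OF L N h] _ x])
    (simp_all add: L M N f g h map_pure linear_closed[OF f] eq)

lemma map_id:
  assumes L: "module k L" and h: "h \<in> linear_maps k L L" and eq: "\<And>l. l \<in> carrier L \<Longrightarrow> h l = l"
    and x: "x \<in> carrier (tensor k L A n)"
  shows "tensor_map k L A n h x = x"
  by (rule additive_eqI[OF L _ map_additive[OF L L h] additive_mapsI _ x]) (simp_all add: L h map_pure eq)

section \<open>Inserting an element of \<open>A \<otimes> A\<close>\<close>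

lemma tensor1_eqI:
  assumes M: "module k M" and B: "abelian_group B"
    and f: "f \<in> additive_maps (tensor k M A (Suc 0)) B" and g: "g \<in> additive_maps (tensor k M A (Suc 0)) B"
    and eq: "\<And>m a. \<lbrakk>m \<in> carrier M; a \<in> carrier A\<rbrakk>
      \<Longrightarrow> f (pure_tensor k M A m [a]) = g (pure_tensor k M A m [a])"
    and X: "X \<in> carrier (tensor k M A (Suc 0))"
  shows "f X = g X"
proof (rule additive_eqI[OF M B f g _ X])
  fix m as assume "m \<in> carrier M" "length as = Suc 0" "set as \<subseteq> carrier A"
  then show "f (pure_tensor k M A m as) = g (pure_tensor k M A m as)"
    using eq by (cases as) auto
qed

lemma pure_linear:
  "\<lbrakk>module k M; m \<in> carrier M\<rbrakk> \<Longrightarrow> (\<lambda>a. pure_tensor k M A m [a]) \<in> linear_maps k A (tensor k M A (Suc 0))"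
  using pure_add_slot[of M m _ _ "[]" "[]" "Suc 0"] smult_pure_slot[of M _ m _ "[]" "[]" "Suc 0"]
  by (intro linear_mapsI additive_mapsI) simp_all

lemma pure_linear_left: "\<lbrakk>module k M; a \<in> carrier A\<rbrakk> \<Longrightarrow> (\<lambda>m. pure_tensor k M A m [a]) \<in> linear_maps k M (tensor k M A (Suc 0))"
  by (intro linear_mapsI additive_mapsI) (simp_all add: pure_add_left smult_pure)

lemma tail_Nil:
  assumes M: "module k M" and x: "x \<in> carrier (tensor k M A n)"
  shows "tail M n x [] = x"
proof (rule additive_eqI[OF M abelian_group_tensor[OF M] _ additive_id _ x])
  show "(\<lambda>x. tail M n x []) \<in> additive_maps (tensor k M A n) (tensor k M A n)"
    using tail_additive[OF M, of "[]" n] by simp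
qed (simp add: tail_pure M)

lemma tail_snoc:
  assumes M: "module k M" and x: "x \<in> carrier (tensor k M A n)" and as: "set as \<subseteq> carrier A" "a \<in> carrier A"
  shows "tail M n x (as @ [a]) = snoc M (n + length as) (tail M n x as) a"
proof (rule additive_eqI[OF M _ _ additive_compose[OF tail_additive[OF M as(1)] snoc_additive[OF M as(2)]] _ x])
  show "(\<lambda>x. tail M n x (as @ [a])) \<in> additive_maps (tensor k M A n) (tensor k M A (Suc (n + length as)))"
    using tail_additive[OF M, of "as @ [a]" n] as by simp
qed (use as in \<open>simp_all add: M tail_pure snoc_pure\<close>)

text \<open>\<open>x \<otimes> D\<close> for \<open>D\<close> in \<open>A \<otimes> A\<close>\<close>

definition double :: "('k, 'm, 'z) module_scheme \<Rightarrow> nat \<Rightarrow> ('m, 'a) tensors \<Rightarrow> ('a, 'a) tensors \<Rightarrow> ('m, 'a) tensors"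
  where "double M n x D = tensor_lift (tensor k M A (Suc (Suc n))) (\<lambda>b cs. snoc M (Suc n) (snoc M n x b) (hd cs)) D"

lemma
  assumes M: "module k M" and x: "x \<in> carrier (tensor k M A n)"
  shows double_additive: "double M n x \<in> additive_maps (tensor k A A (Suc 0)) (tensor k M A (Suc (Suc n)))"
    and double_pure: "\<lbrakk>b \<in> carrier A; c \<in> carrier A\<rbrakk> \<Longrightarrow>
      double M n x (pure_tensor k A A b [c]) = snoc M (Suc n) (snoc M n x b) c"
proof -
  have hd: "hd cs \<in> carrier A" if "length cs = Suc 0" "set cs \<subseteq> carrier A" for cs
    using that by (cases cs) auto
  have b: "balanced_map k A A (Suc 0) (tensor k M A (Suc (Suc n))) (\<lambda>b cs. snoc M (Suc n) (snoc M n x b) (hd cs))"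
    by (rule balanced_mapI)
      (simp_all add: M x hd snoc_add snoc_smult_right snoc_smult additive_add[OF snoc_additive])
  note lift = tensor_lift_pure_additive[OF A_module abelian_group_tensor[OF M] b]
  show "double M n x \<in> additive_maps (tensor k A A (Suc 0)) (tensor k M A (Suc (Suc n)))"
    using lift(1) unfolding double_def[abs_def] .
  show "double M n x (pure_tensor k A A b [c]) = snoc M (Suc n) (snoc M n x b) c"
    if "b \<in> carrier A" "c \<in> carrier A"
    using lift(2)[of b "[c]"] that by (simp add: double_def)
qed

lemma double_additive_left:
  assumes M: "module k M" and D: "D \<in> carrier (tensor k A A (Suc 0))"
  shows "(\<lambda>x. double M n x D) \<in> additive_maps (tensor k M A n) (tensor k M A (Suc (Suc n)))"
proof (rule additive_mapsI)
  fix x assume x: "x \<in> carrier (tensor k M A n)"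
  then show "double M n x D \<in> carrier (tensor k M A (Suc (Suc n)))"
    using additive_closed[OF double_additive[OF M x] D] by simp
  fix y assume y: "y \<in> carrier (tensor k M A n)"
  have xy: "x \<oplus>\<^bsub>tensor k M A n\<^esub> y \<in> carrier (tensor k M A n)"
    using x y M by simp
  show "double M n (x \<oplus>\<^bsub>tensor k M A n\<^esub> y) D
      = double M n x D \<oplus>\<^bsub>tensor k M A (Suc (Suc n))\<^esub> double M n y D"
    by (rule tensor1_eqI[OF A_module _ double_additive[OF M xy]
          additive_add_map[OF _ double_additive[OF M x] double_additive[OF M y]] _ D])
      (simp_all add: M x y xy double_pure additive_add[OF snoc_additive])
qed

lemma double_smult:
  assumes M: "module k M" and D: "D \<in> carrier (tensor k A A (Suc 0))" and r: "r \<in> carrier k"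
    and x: "x \<in> carrier (tensor k M A n)"
  shows "double M n (r \<odot>\<^bsub>tensor k M A n\<^esub> x) D = double M n x (r \<odot>\<^bsub>tensor k A A (Suc 0)\<^esub> D)"
proof -
  have rx: "r \<odot>\<^bsub>tensor k M A n\<^esub> x \<in> carrier (tensor k M A n)"
    using x r M by simp
  show ?thesis
    by (rule tensor1_eqI[OF A_module _ double_additive[OF M rx]
          additive_compose[OF smult_tensor_additive[OF A_module r] double_additive[OF M x]] _ D])
      (simp_all add: M x r A_module double_pure smult_pure snoc_smult snoc_smult_right)
qed

lemma double_bilinear:
  assumes M: "module k M" and \<delta>: "\<delta> \<in> linear_maps k A (tensor k A A (Suc 0))"
  shows "bilinear_map (tensor k M A n) (tensor k M A (Suc (Suc n))) (\<lambda>x a. double M n x (\<delta> a))"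
  by (rule bilinear_mapI)
    (simp_all add: M double_additive_left linear_closed[OF \<delta>] linear_add[OF \<delta>] linear_smult[OF \<delta>]
      double_smult additive_add[OF double_additive])

lemma map_double:
  assumes M: "module k M" and N: "module k N" and f: "f \<in> linear_maps k M N"
    and x: "x \<in> carrier (tensor k M A n)" and D: "D \<in> carrier (tensor k A A (Suc 0))"
  shows "tensor_map k N A (Suc (Suc n)) f (double M n x D) = double N n (tensor_map k N A n f x) D"
proof -
  have fx: "tensor_map k N A n f x \<in> carrier (tensor k N A n)"
    by (rule additive_closed[OF map_additive[OF M N f] x])
  show ?thesis
    by (rule tensor1_eqI[OF A_module _ additive_compose[OF double_additive[OF M x] map_additive[OF M N f]]
          double_additive[OF N fx] _ D])
      (simp_all add: M N x f fx map_snoc double_pure)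
qed

text \<open>Splits the single lift behind \<open>tensor_insert\<close> into two operations whose
  behaviour under one more factor is known, so that it can be met by the recursion on the last
  factor.\<close>

lemma insert_tail:
  assumes M: "module k M" and m: "m \<in> carrier M" and us: "set us \<subseteq> carrier A" and vs: "set vs \<subseteq> carrier A"
    and D: "D \<in> carrier (tensor k A A (Suc 0))"
  shows "tensor_insert k M A m us D vs
    = tail M (Suc (Suc (length us))) (double M (length us) (pure_tensor k M A m us) D) vs"
proof -
  have p: "pure_tensor k M A m us \<in> carrier (tensor k M A (length us))"
    using M m us by simp
  show ?thesis
    unfolding tensor_insert_def
  proof (rule tensor_lift_eq[OF A_module _ _ _ D])
    show "(\<lambda>D. tail M (Suc (Suc (length us))) (double M (length us) (pure_tensor k M A m us) D) vs)
      \<in> additive_maps (tensor k A A (Suc 0)) (tensor k M A (length us + 2 + length vs))"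
      using additive_compose[OF double_additive[OF M p] tail_additive[OF M vs]] by simp
    fix b cs assume b: "b \<in> carrier A" and cs: "length cs = Suc 0" "set cs \<subseteq> carrier A"
    obtain c where c: "cs = [c]" using cs(1) by (cases cs) auto
    show "pure_tensor k M A m (us @ (b # cs) @ vs)
      = tail M (Suc (Suc (length us))) (double M (length us) (pure_tensor k M A m us) (pure_tensor k A A b cs)) vs"
      using M m us vs p b cs(2) unfolding c by (simp add: double_pure snoc_pure tail_pure)
  qed (simp add: M)
qed

end

section \<open>Signed sums\<close>

lemma sign_pow:
  assumes "abelian_group X" "x \<in> carrier X"
  shows "[((- 1 :: int) ^ i)] \<cdot>\<^bsub>X\<^esub> x = (if even i then x else \<ominus>\<^bsub>X\<^esub> x)"
proof -
  interpret X: abelian_group X by fact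
  show ?thesis
    using assms(2) group.int_pow_1[OF X.a_group, of x] group.int_pow_neg[OF X.a_group, of x 1]
    by (auto simp: add_pow_def a_inv_def)
qed

definition alternating_sum :: "('b, 'v) ring_scheme \<Rightarrow> (nat \<Rightarrow> 'b) \<Rightarrow> nat \<Rightarrow> 'b"
  where "alternating_sum B a n = (\<Oplus>\<^bsub>B\<^esub>i\<in>{..n}. [((- 1 :: int) ^ i)] \<cdot>\<^bsub>B\<^esub> a i)"

context abelian_group
begin

lemma diff_zero_imp_eq:
  assumes "x \<ominus> y = \<zero>" "x \<in> carrier G" "y \<in> carrier G"
  shows "x = y"
  using assms minus_equality[of x "\<ominus> y"] by (simp add: a_minus_def)

lemma alternating_sum_closed:
  "(\<And>i. i \<le> n \<Longrightarrow> a i \<in> carrier G) \<Longrightarrow> alternating_sum G a n \<in> carrier G"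
  unfolding alternating_sum_def by (intro finsum_closed) (auto intro!: add_pow_closed abelian_group_axioms)

lemma alternating_sum_0: "a 0 \<in> carrier G \<Longrightarrow> alternating_sum G a 0 = a 0"
  using sign_pow[OF abelian_group_axioms, of "a 0" 0] by (simp add: alternating_sum_def)

lemma alternating_sum_Suc:
  assumes "\<And>i. i \<le> Suc n \<Longrightarrow> a i \<in> carrier G"
  shows "alternating_sum G a (Suc n) = [((- 1 :: int) ^ Suc n)] \<cdot> a (Suc n) \<oplus> alternating_sum G a n"
  unfolding alternating_sum_def
  by (rule finsum_Suc) (use assms in \<open>auto intro!: add_pow_closed abelian_group_axioms\<close>)

text \<open>Detaches the zeroth term, which is the exceptional one both in the contracting homotopy
  and in the differential of degree 0.\<close>

lemma alternating_sum_shift: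
  assumes "\<And>i. i \<le> Suc n \<Longrightarrow> a i \<in> carrier G"
  shows "alternating_sum G a (Suc n) = a 0 \<ominus> alternating_sum G (\<lambda>i. a (Suc i)) n"
  using assms
proof (induction n)
  case 0
  have "a 0 \<in> carrier G" "a 1 \<in> carrier G" using 0 by auto
  then show ?case
    using sign_pow[OF abelian_group_axioms, of "a 1" 1]
    by (simp add: alternating_sum_Suc[of 0 a] 0 alternating_sum_0 a_minus_def a_comm)
next
  case (Suc n)
  let ?x = "[((- 1 :: int) ^ Suc n)] \<cdot> a (Suc (Suc n))"
  let ?y = "alternating_sum G (\<lambda>i. a (Suc i)) n"
  have c: "a 0 \<in> carrier G" "a (Suc (Suc n)) \<in> carrier G" "?x \<in> carrier G" "?y \<in> carrier G"
    using Suc.prems by (auto intro!: add_pow_closed abelian_group_axioms alternating_sum_closed)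
  have "[((- 1 :: int) ^ Suc (Suc n))] \<cdot> a (Suc (Suc n)) = \<ominus> ?x"
    using c by (simp add: sign_pow[OF abelian_group_axioms] del: power_Suc)
  then have "alternating_sum G a (Suc (Suc n)) = \<ominus> ?x \<oplus> (a 0 \<ominus> ?y)"
    using alternating_sum_Suc[of "Suc n" a] Suc by simp
  moreover have "alternating_sum G (\<lambda>i. a (Suc i)) (Suc n) = ?x \<oplus> ?y"
    using alternating_sum_Suc[of n "\<lambda>i. a (Suc i)"] Suc.prems by simp
  ultimately show ?case
    using c by (simp add: a_minus_def minus_add a_ac)
qed

lemma alternating_sum_add:
  assumes "\<And>i. i \<le> n \<Longrightarrow> a i \<in> carrier G" "\<And>i. i \<le> n \<Longrightarrow> b i \<in> carrier G"
  shows "alternating_sum G (\<lambda>i. a i \<oplus> b i) n = alternating_sum G a n \<oplus> alternating_sum G b n"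
proof -
  have "alternating_sum G (\<lambda>i. a i \<oplus> b i) n
      = (\<Oplus>i\<in>{..n}. [((- 1 :: int) ^ i)] \<cdot> a i \<oplus> [((- 1 :: int) ^ i)] \<cdot> b i)"
    unfolding alternating_sum_def
    by (rule finsum_cong')
      (use assms in \<open>auto intro!: add_pow_closed abelian_group_axioms
        additive_add[OF add_pow_additive[OF abelian_group_axioms]]\<close>)
  also have "\<dots> = alternating_sum G a n \<oplus> alternating_sum G b n"
    unfolding alternating_sum_def
    by (rule finsum_addf) (use assms in \<open>auto intro!: add_pow_closed abelian_group_axioms\<close>)
  finally show ?thesis .
qed

lemma alternating_sum_cong:
  assumes "\<And>i. i \<le> n \<Longrightarrow> b i \<in> carrier G" "\<And>i. i \<le> n \<Longrightarrow> a i = b i"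
  shows "alternating_sum G a n = alternating_sum G b n"
  unfolding alternating_sum_def
  by (rule finsum_cong') (use assms in \<open>auto intro!: add_pow_closed abelian_group_axioms\<close>)

lemma alternating_sum_sign:
  assumes "\<And>i. i \<le> n \<Longrightarrow> a i \<in> carrier G"
  shows "[((- 1 :: int) ^ l)] \<cdot> alternating_sum G a n = alternating_sum G (\<lambda>i. [((- 1 :: int) ^ l)] \<cdot> a i) n"
proof -
  have "[((- 1 :: int) ^ l)] \<cdot> alternating_sum G a n
      = (\<Oplus>i\<in>{..n}. [((- 1 :: int) ^ l)] \<cdot> ([((- 1 :: int) ^ i)] \<cdot> a i))"
    unfolding alternating_sum_def
    by (rule additive_finsum[OF add_pow_additive])
      (use assms in \<open>auto intro!: add_pow_closed abelian_group_axioms\<close>)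
  also have "\<dots> = alternating_sum G (\<lambda>i. [((- 1 :: int) ^ l)] \<cdot> a i) n"
    unfolding alternating_sum_def
    by (rule finsum_cong') (use assms in \<open>auto simp: sign_pow[OF abelian_group_axioms]\<close>)
  finally show ?thesis .
qed

text \<open>The cancellation behind \<open>\<partial>\<partial> = 0\<close>: the terms with \<open>i < j\<close> cancel those with \<open>i \<ge> j\<close>.\<close>

lemma alternating_double_sum:
  assumes "\<And>i j. \<lbrakk>i \<le> n; j \<le> Suc n\<rbrakk> \<Longrightarrow> a j i \<in> carrier G"
    and "\<And>i j. \<lbrakk>i \<le> j; j \<le> n\<rbrakk> \<Longrightarrow> a (Suc j) i = a i j"
  shows "alternating_sum G (\<lambda>j. alternating_sum G (\<lambda>i. a j i) n) (Suc n) = \<zero>"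
  using assms
proof (induction n)
  case 0
  have a: "a 0 0 \<in> carrier G" "a (Suc 0) 0 = a 0 0" using 0 by auto
  have "alternating_sum G (\<lambda>i. a j i) 0 = a 0 0" if "j \<le> Suc 0" for j
    using that a by (auto simp: alternating_sum_0 le_Suc_eq)
  then have "alternating_sum G (\<lambda>j. alternating_sum G (\<lambda>i. a j i) 0) (Suc 0) = alternating_sum G (\<lambda>j. a 0 0) (Suc 0)"
    using a by (intro alternating_sum_cong) auto
  also have "\<dots> = \<zero>"
    using alternating_sum_Suc[of 0 "\<lambda>j. a 0 0"] a sign_pow[OF abelian_group_axioms, of "a 0 0" 1]
    by (simp add: alternating_sum_0 l_neg)
  finally show ?case .
next
  case (Suc n)
  note c = Suc.prems(1)
  let ?s = "[((- 1 :: int) ^ Suc n)] \<cdot> alternating_sum G (\<lambda>j. a j (Suc n)) (Suc n)"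
  let ?f = "\<lambda>j. alternating_sum G (\<lambda>i. a j i) (Suc n)"
  have sc: "alternating_sum G (\<lambda>j. a j (Suc n)) (Suc n) \<in> carrier G"
    by (rule alternating_sum_closed) (use c in auto)
  then have sc': "?s \<in> carrier G"
    by (rule add_pow_closed[OF abelian_group_axioms])
  have fc: "?f j \<in> carrier G" if "j \<le> Suc (Suc n)" for j
    using that by (auto intro!: alternating_sum_closed c)
  have fc': "alternating_sum G (\<lambda>i. a j i) n \<in> carrier G" if "j \<le> Suc n" for j
    using that by (auto intro!: alternating_sum_closed c)
  have fSuc: "?f j = [((- 1 :: int) ^ Suc n)] \<cdot> a j (Suc n) \<oplus> alternating_sum G (\<lambda>i. a j i) n"
    if "j \<le> Suc n" for j
    by (rule alternating_sum_Suc) (use c that in auto)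
  have "alternating_sum G ?f (Suc n)
      = alternating_sum G (\<lambda>j. [((- 1 :: int) ^ Suc n)] \<cdot> a j (Suc n) \<oplus> alternating_sum G (\<lambda>i. a j i) n) (Suc n)"
    by (rule alternating_sum_cong[OF _ fSuc])
      (use c fc' in \<open>auto intro!: add_pow_closed abelian_group_axioms\<close>)
  also have "\<dots> = alternating_sum G (\<lambda>j. [((- 1 :: int) ^ Suc n)] \<cdot> a j (Suc n)) (Suc n)
      \<oplus> alternating_sum G (\<lambda>j. alternating_sum G (\<lambda>i. a j i) n) (Suc n)"
    by (rule alternating_sum_add) (use c fc' in \<open>auto intro!: add_pow_closed abelian_group_axioms\<close>)
  also have "alternating_sum G (\<lambda>j. [((- 1 :: int) ^ Suc n)] \<cdot> a j (Suc n)) (Suc n) = ?s"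
    by (rule alternating_sum_sign[symmetric]) (use c in auto)
  also have "alternating_sum G (\<lambda>j. alternating_sum G (\<lambda>i. a j i) n) (Suc n) = \<zero>"
    by (rule Suc.IH) (use Suc.prems in auto)
  finally have 1: "alternating_sum G ?f (Suc n) = ?s"
    using sc' by simp
  \<comment> \<open>The symmetry with j = \<open>Suc n\<close> turns the row of index
    \<open>Suc (Suc n)\<close> into the column of index \<open>Suc n\<close>. These two are all that
    the induction hypothesis leaves over, and they come with opposite signs.\<close>
  have 2: "?f (Suc (Suc n)) = alternating_sum G (\<lambda>j. a j (Suc n)) (Suc n)"
    by (rule alternating_sum_cong) (use Suc.prems in auto)
  have "alternating_sum G ?f (Suc (Suc n)) = [((- 1 :: int) ^ Suc (Suc n))] \<cdot> ?f (Suc (Suc n)) \<oplus> ?s"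
    using alternating_sum_Suc[of "Suc n" ?f] fc 1 by simp
  then show ?case
    unfolding 2 using sc by (simp add: sign_pow[OF abelian_group_axioms] l_neg r_neg del: power_Suc)
qed

end

lemma additive_alternating_sum:
  assumes f: "f \<in> additive_maps X Y" and X: "abelian_group X" and Y: "abelian_group Y"
    and a: "\<And>i. i \<le> n \<Longrightarrow> a i \<in> carrier X"
  shows "f (alternating_sum X a n) = alternating_sum Y (\<lambda>i. f (a i)) n"
proof -
  interpret Y: abelian_group Y by fact
  have "f (alternating_sum X a n) = (\<Oplus>\<^bsub>Y\<^esub>i\<in>{..n}. f ([((- 1 :: int) ^ i)] \<cdot>\<^bsub>X\<^esub> a i))"
    unfolding alternating_sum_def
    by (rule additive_finsum[OF f X Y]) (use a in \<open>auto intro!: add_pow_closed X\<close>)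
  also have "\<dots> = alternating_sum Y (\<lambda>i. f (a i)) n"
    unfolding alternating_sum_def
    by (rule Y.finsum_cong')
      (use a additive_closed[OF f] in \<open>auto intro!: add_pow_closed Y additive_add_pow[OF f X Y]\<close>)
  finally show ?thesis .
qed

section \<open>The endomorphism of a tensor product\<close>

locale hopf_factor = tensor_factor k A
  for k :: "'k difference_ring" and A :: "('k, 'a) difference_hopf_algebra" +
  assumes hopf: "difference_hopf_algebra k A"
begin

lemma A_difference_module [simp]: "difference_module k A"
  using hopf by (rule difference_hopf_algebra.axioms)

lemma difference_ring: "difference_ring k"
  using A_difference_module by (rule difference_module.axioms)

lemma difference_module_module [simp]: "difference_module k M \<Longrightarrow> module k M"
  by (rule difference_module.axioms)

lemma mendo_additive: "difference_module k M \<Longrightarrow> mendo M \<in> additive_maps M M"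
  by (rule difference_module.mendo_hom)

lemma mendo_closed [simp]: "\<lbrakk>difference_module k M; m \<in> carrier M\<rbrakk> \<Longrightarrow> mendo M m \<in> carrier M"
  by (rule additive_closed[OF mendo_additive])

lemma mendo_add [simp]:
  "\<lbrakk>difference_module k M; m \<in> carrier M; m' \<in> carrier M\<rbrakk> \<Longrightarrow>
    mendo M (m \<oplus>\<^bsub>M\<^esub> m') = mendo M m \<oplus>\<^bsub>M\<^esub> mendo M m'"
  by (rule additive_add[OF mendo_additive])

lemma mendo_smult [simp]:
  "\<lbrakk>difference_module k M; r \<in> carrier k; m \<in> carrier M\<rbrakk> \<Longrightarrow>
    mendo M (r \<odot>\<^bsub>M\<^esub> m) = rendo k r \<odot>\<^bsub>M\<^esub> mendo M m"
  by (rule difference_module.mendo_smult)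

lemma rendo_closed [simp]: "r \<in> carrier k \<Longrightarrow> rendo k r \<in> carrier k"
  using difference_ring.rendo_hom[OF difference_ring] by (auto simp: ring_hom_def)

lemma set_map_mendo [simp]: "set as \<subseteq> carrier A \<Longrightarrow> mendo A ` set as \<subseteq> carrier A"
  by auto

lemma
  assumes M: "difference_module k M"
  shows endo_additive: "tensor_endo k M A n \<in> additive_maps (tensor k M A n) (tensor k M A n)"
    and endo_pure: "\<lbrakk>m \<in> carrier M; length as = n; set as \<subseteq> carrier A\<rbrakk> \<Longrightarrow>
      tensor_endo k M A n (pure_tensor k M A m as) = pure_tensor k M A (mendo M m) (map (mendo A) as)"
proof -
  have b: "balanced_map k M A n (tensor k M A n) (\<lambda>m as. pure_tensor k M A (mendo M m) (map (mendo A) as))"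
    by (rule balanced_mapI) (simp_all add: M pure_add_left pure_add_slot pure_smult_slot)
  note lift = tensor_lift_pure_additive[OF difference_module_module[OF M] _ b]
  show "tensor_endo k M A n \<in> additive_maps (tensor k M A n) (tensor k M A n)"
    using lift(1) M by (simp add: tensor_endo_def)
  show "tensor_endo k M A n (pure_tensor k M A m as) = pure_tensor k M A (mendo M m) (map (mendo A) as)"
    if "m \<in> carrier M" "length as = n" "set as \<subseteq> carrier A"
    using lift(2)[OF _ that] M by (simp add: tensor_endo_def)
qed

lemma endo_closed [simp]:
  "\<lbrakk>difference_module k M; x \<in> carrier (tensor k M A n)\<rbrakk> \<Longrightarrow> tensor_endo k M A n x \<in> carrier (tensor k M A n)"
  by (rule additive_closed[OF endo_additive])

lemma endo_smult:
  assumes M: "difference_module k M" and r: "r \<in> carrier k" and x: "x \<in> carrier (tensor k M A n)"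
  shows "tensor_endo k M A n (r \<odot>\<^bsub>tensor k M A n\<^esub> x) = rendo k r \<odot>\<^bsub>tensor k M A n\<^esub> tensor_endo k M A n x"
  by (rule additive_eqI[OF _ _ additive_compose[OF smult_tensor_additive endo_additive]
        additive_compose[OF endo_additive smult_tensor_additive] _ x])
    (simp_all add: M r endo_pure smult_pure)

lemma endo_snoc:
  assumes M: "difference_module k M" and x: "x \<in> carrier (tensor k M A n)" and a: "a \<in> carrier A"
  shows "tensor_endo k M A (Suc n) (snoc M n x a) = snoc M n (tensor_endo k M A n x) (mendo A a)"
  by (rule additive_eqI[OF _ _ additive_compose[OF snoc_additive endo_additive]
        additive_compose[OF endo_additive snoc_additive] _ x])
    (simp_all add: M a snoc_pure endo_pure)

lemma endo_double:
  assumes M: "difference_module k M" and x: "x \<in> carrier (tensor k M A n)" and D: "D \<in> carrier (tensor k A A (Suc 0))"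
  shows "tensor_endo k M A (Suc (Suc n)) (double M n x D)
    = double M n (tensor_endo k M A n x) (tensor_endo k A A (Suc 0) D)"
proof -
  have ex: "tensor_endo k M A n x \<in> carrier (tensor k M A n)" using M x by simp
  show ?thesis
    by (rule tensor1_eqI[OF A_module _ additive_compose[OF double_additive[OF _ x] endo_additive[OF M]]
          additive_compose[OF endo_additive[OF A_difference_module] double_additive[OF _ ex]] _ D])
      (simp_all add: M x ex endo_pure[OF A_difference_module] double_pure endo_snoc)
qed

lemma map_endo:
  assumes M: "difference_module k M" and N: "difference_module k N" and f: "f \<in> linear_maps k M N"
    and fs: "\<And>m. m \<in> carrier M \<Longrightarrow> f (mendo M m) = mendo N (f m)"
    and x: "x \<in> carrier (tensor k M A n)"
  shows "tensor_map k N A n f (tensor_endo k M A n x) = tensor_endo k N A n (tensor_map k N A n f x)"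
  by (rule additive_eqI[OF _ _ additive_compose[OF endo_additive[OF M] map_additive[OF _ _ f]]
        additive_compose[OF map_additive[OF _ _ f] endo_additive[OF N]] _ x])
    (simp_all add: M N f fs endo_pure map_pure linear_closed[OF f])

section \<open>The cosimplicial structure\<close>

lemma comult_linear: "comult A \<in> linear_maps k A (tensor k A A (Suc 0))"
  using difference_hopf_algebra.comult_linear[OF hopf] by simp

lemma comult_closed [simp]: "a \<in> carrier A \<Longrightarrow> comult A a \<in> carrier (tensor k A A (Suc 0))"
  by (rule linear_closed[OF comult_linear])

lemma one_closed [simp]: "\<one>\<^bsub>A\<^esub> \<in> carrier A"
proof -
  interpret difference_hopf_algebra k A by (fact hopf)
  show ?thesis by simp
qed

lemma comult_one: "comult A \<one>\<^bsub>A\<^esub> = pure_tensor k A A \<one>\<^bsub>A\<^esub> [\<one>\<^bsub>A\<^esub>]"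
  by (rule difference_hopf_algebra.comult_one[OF hopf])

lemma mendo_one [simp]: "mendo A \<one>\<^bsub>A\<^esub> = \<one>\<^bsub>A\<^esub>"
  by (rule ring_hom_one[OF difference_hopf_algebra.mendo_ring_hom[OF hopf]])

lemma comult_mendo: "a \<in> carrier A \<Longrightarrow> comult A (mendo A a) = tensor_endo k A A (Suc 0) (comult A a)"
  using difference_hopf_algebra.comult_mendo[OF hopf] by simp

text \<open>The cofaces of the cobar construction: index 0 applies \<mu>, the indices 1 to n
  comultiply a factor, index n + 1 appends a unit. All but the last two leave the last factor alone,
  which gives the recursion.\<close>

primrec coface ::
  "('k, 'm, 'z) module_scheme \<Rightarrow> ('m \<Rightarrow> ('m, 'a) tensors) \<Rightarrow> nat \<Rightarrow> nat \<Rightarrow> ('m, 'a) tensors \<Rightarrow> ('m, 'a) tensors"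
  where
    "coface M \<mu> 0 i = (if i = 0 then tensor_lift (tensor k M A (Suc 0)) (\<lambda>m as. \<mu> m) else (\<lambda>x. snoc M 0 x \<one>\<^bsub>A\<^esub>))"
  | "coface M \<mu> (Suc n) i =
      (if i \<le> n then snoc_lift M (tensor k M A (Suc (Suc n))) (\<lambda>x a. snoc M (Suc n) (coface M \<mu> n i x) a)
       else if i = Suc n then snoc_lift M (tensor k M A (Suc (Suc n))) (\<lambda>x a. double M n x (comult A a))
       else (\<lambda>x. snoc M (Suc n) x \<one>\<^bsub>A\<^esub>))"

lemma snoc_lift_linear:
  assumes M: "module k M" and B: "module k B" and \<phi>: "bilinear_map (tensor k M A n) B \<phi>"
    and s: "\<And>r x a. \<lbrakk>r \<in> carrier k; x \<in> carrier (tensor k M A n); a \<in> carrier A\<rbrakk>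
      \<Longrightarrow> \<phi> (r \<odot>\<^bsub>tensor k M A n\<^esub> x) a = r \<odot>\<^bsub>B\<^esub> \<phi> x a"
  shows "snoc_lift M B \<phi> \<in> linear_maps k (tensor k M A (Suc n)) B"
proof (rule linear_mapsI[OF snoc_lift_additive[OF M module_abelian_group[OF B] \<phi>]])
  fix r x assume r: "r \<in> carrier k" and x: "x \<in> carrier (tensor k M A (Suc n))"
  note add = snoc_lift_additive[OF M module_abelian_group[OF B] \<phi>]
  show "snoc_lift M B \<phi> (r \<odot>\<^bsub>tensor k M A (Suc n)\<^esub> x) = r \<odot>\<^bsub>B\<^esub> snoc_lift M B \<phi> x"
  proof (rule snoc_eqI[OF M module_abelian_group[OF B] additive_compose[OF smult_tensor_additive[OF M r] add]
          additive_compose[OF add linear_additive[OF smult_linear[OF B r]]] _ x])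
    fix y a assume y: "y \<in> carrier (tensor k M A n)" and a: "a \<in> carrier A"
    then have "snoc_lift M B \<phi> (r \<odot>\<^bsub>tensor k M A (Suc n)\<^esub> snoc M n y a)
      = snoc_lift M B \<phi> (snoc M n (r \<odot>\<^bsub>tensor k M A n\<^esub> y) a)"
      by (simp add: snoc_smult M r)
    also have "\<dots> = r \<odot>\<^bsub>B\<^esub> snoc_lift M B \<phi> (snoc M n y a)"
      using y a r M by (simp add: snoc_lift_snoc[OF M module_abelian_group[OF B] \<phi>] s)
    finally show "snoc_lift M B \<phi> (r \<odot>\<^bsub>tensor k M A (Suc n)\<^esub> snoc M n y a)
      = r \<odot>\<^bsub>B\<^esub> snoc_lift M B \<phi> (snoc M n y a)" .
  qed
qed

lemma double_smult_left:
  assumes M: "module k M" and D: "D \<in> carrier (tensor k A A (Suc 0))" and r: "r \<in> carrier k"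
    and x: "x \<in> carrier (tensor k M A n)"
  shows "double M n (r \<odot>\<^bsub>tensor k M A n\<^esub> x) D = r \<odot>\<^bsub>tensor k M A (Suc (Suc n))\<^esub> double M n x D"
proof -
  have rx: "r \<odot>\<^bsub>tensor k M A n\<^esub> x \<in> carrier (tensor k M A n)"
    using x r M by simp
  show ?thesis
    by (rule tensor1_eqI[OF A_module _ double_additive[OF M rx]
          additive_compose[OF double_additive[OF M x] smult_tensor_additive[OF M r]] _ D])
      (simp_all add: M x r rx double_pure snoc_smult)
qed

end

text \<open>Cofaces are formed for any linear map \<mu>, before coassociativity is available: a
  candidate for a coaction is later shown to be coassociative by an identity between its own
  cofaces.\<close>

locale coaction_factor = hopf_factor k A
  for k :: "'k difference_ring" and A :: "('k, 'a) difference_hopf_algebra"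
    and M :: "('k, 'm, 'z) module_scheme" and \<mu> +
  assumes M_module [simp]: "module k M"
    and \<mu>_linear: "\<mu> \<in> linear_maps k M (tensor k M A (Suc 0))"
begin

lemma \<mu>_closed [simp]: "m \<in> carrier M \<Longrightarrow> \<mu> m \<in> carrier (tensor k M A (Suc 0))"
  by (rule linear_closed[OF \<mu>_linear])

lemma coface_bilinear:
  assumes f: "f \<in> linear_maps k (tensor k M A n) (tensor k M A (Suc n))"
  shows "bilinear_map (tensor k M A n) (tensor k M A (Suc (Suc n))) (\<lambda>x a. snoc M (Suc n) (f x) a)"
  by (rule bilinear_compose_left[OF snoc_bilinear f]) simp

lemma coface_linear: "coface M \<mu> n i \<in> linear_maps k (tensor k M A n) (tensor k M A (Suc n))"
proof (induction n arbitrary: i)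
  case 0
  show ?case
    using snoc_linear[of M "\<one>\<^bsub>A\<^esub>" 0]
    by (auto intro!: additive_linearI lift0_additive linear_additive[OF \<mu>_linear]
        simp: lift0_pure linear_additive[OF \<mu>_linear] linear_smult[OF \<mu>_linear])
next
  case (Suc n)
  have 1: "snoc_lift M (tensor k M A (Suc (Suc n))) (\<lambda>x a. snoc M (Suc n) (coface M \<mu> n i x) a)
    \<in> linear_maps k (tensor k M A (Suc n)) (tensor k M A (Suc (Suc n)))"
    by (rule snoc_lift_linear[OF _ _ coface_bilinear[OF Suc]])
      (simp_all add: linear_smult[OF Suc] linear_closed[OF Suc] snoc_smult)
  have 2: "snoc_lift M (tensor k M A (Suc (Suc n))) (\<lambda>x a. double M n x (comult A a))
    \<in> linear_maps k (tensor k M A (Suc n)) (tensor k M A (Suc (Suc n)))"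
    by (rule snoc_lift_linear[OF _ _ double_bilinear[OF _ comult_linear]]) (simp_all add: double_smult_left)
  show ?case
    using 1 2 snoc_linear[of M "\<one>\<^bsub>A\<^esub>" "Suc n"] by auto
qed

lemmas coface_additive = linear_additive[OF coface_linear]
lemmas coface_closed [simp] = linear_closed[OF coface_linear]

declare coface.simps [simp del]

lemma coface_0: "m \<in> carrier M \<Longrightarrow> coface M \<mu> 0 0 (pure_tensor k M A m []) = \<mu> m"
  by (simp add: coface.simps lift0_pure linear_additive[OF \<mu>_linear])

lemma coface_last: "coface M \<mu> n (Suc n) x = snoc M n x \<one>\<^bsub>A\<^esub>"
  by (cases n) (simp_all add: coface.simps)

lemma coface_snoc:
  "\<lbrakk>i \<le> n; x \<in> carrier (tensor k M A n); a \<in> carrier A\<rbrakk> \<Longrightarrow>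
    coface M \<mu> (Suc n) i (snoc M n x a) = snoc M (Suc n) (coface M \<mu> n i x) a"
  by (simp add: coface.simps snoc_lift_snoc[OF _ _ coface_bilinear[OF coface_linear]])

lemma coface_comult:
  "\<lbrakk>x \<in> carrier (tensor k M A n); a \<in> carrier A\<rbrakk> \<Longrightarrow>
    coface M \<mu> (Suc n) (Suc n) (snoc M n x a) = double M n x (comult A a)"
  by (simp add: coface.simps snoc_lift_snoc[OF _ _ double_bilinear[OF _ comult_linear]])

lemma coface_double:
  assumes i: "i \<le> n" and x: "x \<in> carrier (tensor k M A n)" and D: "D \<in> carrier (tensor k A A (Suc 0))"
  shows "coface M \<mu> (Suc (Suc n)) i (double M n x D) = double M (Suc n) (coface M \<mu> n i x) D"
proof -
  have cx: "coface M \<mu> n i x \<in> carrier (tensor k M A (Suc n))" using x by simp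
  show ?thesis
    by (rule tensor1_eqI[OF A_module _ additive_compose[OF double_additive[OF _ x] coface_additive]
          double_additive[OF _ cx] _ D])
      (use i x cx in \<open>simp_all add: double_pure coface_snoc\<close>)
qed

lemma coface_pure_first:
  "\<lbrakk>m \<in> carrier M; length as = n; set as \<subseteq> carrier A\<rbrakk> \<Longrightarrow>
    coface M \<mu> n 0 (pure_tensor k M A m as) = tail M (Suc 0) (\<mu> m) as"
proof (induction n arbitrary: as)
  case 0
  then show ?case by (simp add: coface_0 tail_Nil)
next
  case (Suc n)
  then obtain bs a where as: "as = bs @ [a]" by (metis length_Suc_conv_rev)
  then show ?case
    using Suc.prems Suc.IH[of bs] coface_snoc[of 0 n "pure_tensor k M A m bs" a]
    by (simp add: snoc_pure tail_snoc)
qed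

text \<open>Links the recursion to the closed formula in \<open>hochschild_diff\<close>. List
  positions count from 0 and the comultiplying cofaces from 1, hence \<open>Suc i\<close>.\<close>

lemma coface_pure_inner:
  "\<lbrakk>m \<in> carrier M; length as = n; set as \<subseteq> carrier A; i < n\<rbrakk> \<Longrightarrow>
    coface M \<mu> n (Suc i) (pure_tensor k M A m as)
      = tensor_insert k M A m (take i as) (comult A (as ! i)) (drop (Suc i) as)"
proof (induction n arbitrary: as)
  case (Suc n)
  then obtain bs a where as: "as = bs @ [a]" by (metis length_Suc_conv_rev)
  have bs: "length bs = n" "set bs \<subseteq> carrier A" "a \<in> carrier A" using Suc.prems as by auto
  have p: "pure_tensor k M A m bs \<in> carrier (tensor k M A n)" using bs Suc.prems by simp
  have eq: "pure_tensor k M A m as = snoc M n (pure_tensor k M A m bs) a"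
    using Suc.prems bs by (simp add: as snoc_pure)
  have sub: "set (take i bs) \<subseteq> carrier A" "set (drop (Suc i) bs) \<subseteq> carrier A"
    using bs set_take_subset[of i bs] set_drop_subset[of "Suc i" bs] by auto
  show ?case
  proof (cases "i = n")
    case True
    then show ?thesis
      using bs p Suc.prems by (simp add: as insert_tail tail_Nil eq[unfolded as] coface_comult
          additive_closed[OF double_additive] nth_append)
  next
    case False
    then have i: "i < n" using Suc.prems by simp
    then have c: "bs ! i \<in> carrier A" using bs by auto
    have "coface M \<mu> (Suc n) (Suc i) (pure_tensor k M A m as)
       = snoc M (Suc n) (tensor_insert k M A m (take i bs) (comult A (bs ! i)) (drop (Suc i) bs)) a"
      unfolding eq using Suc.IH[OF Suc.prems(1) bs(1,2) i] coface_snoc[of "Suc i" n, OF _ p bs(3)] i by simp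
    also have "\<dots> = tensor_insert k M A m (take i bs) (comult A (bs ! i)) (drop (Suc i) bs @ [a])"
      using sub c bs i Suc.prems(1)
      by (simp add: insert_tail tail_snoc additive_closed[OF double_additive])
    finally show ?thesis
      using i bs by (simp add: as nth_append)
  qed
qed simp


section \<open>The Hochschild complex\<close>

lemma coface_1_eqI:
  assumes h: "h \<in> additive_maps (tensor k M A (Suc 0)) B" and B: "abelian_group B"
    and eq: "\<And>m a. \<lbrakk>m \<in> carrier M; a \<in> carrier A\<rbrakk> \<Longrightarrow> g m [a] = h (pure_tensor k M A m [a])"
    and X: "X \<in> carrier (tensor k M A (Suc 0))"
  shows "tensor_lift B g X = h X"
proof (rule tensor_lift_eq[OF M_module B h _ X])
  fix m as assume "m \<in> carrier M" "length as = Suc 0" "set as \<subseteq> carrier A"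
  then show "g m as = h (pure_tensor k M A m as)"
    using eq by (cases as) auto
qed

definition counit_map :: "('m, 'a) tensors \<Rightarrow> 'm"
  where "counit_map = tensor_lift M (\<lambda>m as. counit A (hd as) \<odot>\<^bsub>M\<^esub> m)"

lemma counit_map_additive: "counit_map \<in> additive_maps (tensor k M A (Suc 0)) M"
  and counit_map_pure: "\<lbrakk>m \<in> carrier M; a \<in> carrier A\<rbrakk> \<Longrightarrow>
    counit_map (pure_tensor k M A m [a]) = counit A a \<odot>\<^bsub>M\<^esub> m"
proof -
  interpret M: module k M by simp
  have hd: "hd cs \<in> carrier A" if "length cs = Suc 0" "set cs \<subseteq> carrier A" for cs
    using that by (cases cs) auto
  note e = difference_hopf_algebra.counit_linear[OF hopf]
  have ec: "counit A a \<in> carrier k" if "a \<in> carrier A" for a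
    using linear_closed[OF e that] by (simp add: regular_module_def)
  have b: "balanced_map k M A (Suc 0) M (\<lambda>m as. counit A (hd as) \<odot>\<^bsub>M\<^esub> m)"
  proof (rule balanced_mapI)
    fix m us a a' vs assume "m \<in> carrier M" "a \<in> carrier A" "a' \<in> carrier A" "Suc 0 = length (us :: 'a list) + 1 + length (vs :: 'a list)"
    then show "counit A (hd (us @ (a \<oplus>\<^bsub>A\<^esub> a') # vs)) \<odot>\<^bsub>M\<^esub> m
      = counit A (hd (us @ a # vs)) \<odot>\<^bsub>M\<^esub> m \<oplus>\<^bsub>M\<^esub> counit A (hd (us @ a' # vs)) \<odot>\<^bsub>M\<^esub> m"
      using linear_add[OF e, of a a'] by (simp add: regular_module_def M.smult_l_distr ec)
  next
    fix r m us a vs assume "r \<in> carrier k" "m \<in> carrier M" "a \<in> carrier A" "Suc 0 = length (us :: 'a list) + 1 + length (vs :: 'a list)"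
    then show "counit A (hd (us @ a # vs)) \<odot>\<^bsub>M\<^esub> (r \<odot>\<^bsub>M\<^esub> m) = counit A (hd (us @ (r \<odot>\<^bsub>A\<^esub> a) # vs)) \<odot>\<^bsub>M\<^esub> m"
      using linear_smult[OF e, of r a] by (simp add: regular_module_def M.smult_assoc1[symmetric] ec M.R.m_comm)
  qed (simp_all add: hd ec M.smult_r_distr)
  note lift = tensor_lift_pure_additive[OF M_module module_abelian_group[OF M_module] b]
  show "counit_map \<in> additive_maps (tensor k M A (Suc 0)) M"
    unfolding counit_map_def by (rule lift(1))
  show "counit_map (pure_tensor k M A m [a]) = counit A a \<odot>\<^bsub>M\<^esub> m" if "m \<in> carrier M" "a \<in> carrier A"
    using lift(2)[of m "[a]"] that by (simp add: counit_map_def)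
qed

text \<open>The maps \<mu> \<otimes> id and id \<otimes> \<Delta> are the cofaces of index 0 and 1
  on M \<otimes> A, so coassociativity is itself a cosimplicial identity, and naturality of cofaces
  applies to it.\<close>

lemma coassociative_iff:
  "coassociative_counital k A M \<mu> \<longleftrightarrow>
    (\<forall>m \<in> carrier M. coface M \<mu> (Suc 0) 0 (\<mu> m) = coface M \<mu> (Suc 0) (Suc 0) (\<mu> m) \<and> counit_map (\<mu> m) = m)"
proof -
  have c: "coface M \<mu> (Suc 0) i \<in> additive_maps (tensor k M A (Suc 0)) (tensor k M A 2)" for i
    using coface_additive[of "Suc 0" i] by (simp add: numeral_2_eq_2)
  have 1: "tensor_lift (tensor k M A 2) (\<lambda>m' as. tensor_append k M A (\<mu> m') as) (\<mu> m)
      = coface M \<mu> (Suc 0) 0 (\<mu> m)" if "m \<in> carrier M" for m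
    by (rule coface_1_eqI[OF c]) (simp_all add: that tensor_append_tail coface_pure_first)
  have 2: "tensor_lift (tensor k M A 2) (\<lambda>m' as. tensor_insert k M A m' [] (comult A (hd as)) []) (\<mu> m)
      = coface M \<mu> (Suc 0) (Suc 0) (\<mu> m)" if "m \<in> carrier M" for m
    by (rule coface_1_eqI[OF c]) (simp_all add: that coface_pure_inner)
  show ?thesis
    unfolding coassociative_counital_def counit_map_def by (intro ball_cong) (simp_all add: 1 2)
qed

text \<open>The map of \<open>hochschild_diff\<close>, regrouped as a sum over cofaces. Vanishing of
  its square, naturality and the contracting homotopy then follow from identities between single
  cofaces.\<close>

definition cobar :: "nat \<Rightarrow> ('m, 'a) tensors \<Rightarrow> ('m, 'a) tensors"
  where "cobar n x = alternating_sum (tensor k M A (Suc n)) (\<lambda>i. coface M \<mu> n i x) (Suc n)"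

lemma cobar_additive: "cobar n \<in> additive_maps (tensor k M A n) (tensor k M A (Suc n))"
  unfolding cobar_def[abs_def] alternating_sum_def
  by (intro additive_finsum_map additive_compose[OF coface_additive add_pow_additive]) simp_all

lemma cobar_closed [simp]: "x \<in> carrier (tensor k M A n) \<Longrightarrow> cobar n x \<in> carrier (tensor k M A (Suc n))"
  by (rule additive_closed[OF cobar_additive])

lemma cobar_pure:
  assumes m: "m \<in> carrier M" and as: "length as = n" "set as \<subseteq> carrier A"
  shows "cobar n (pure_tensor k M A m as) =
      tail M 1 (\<mu> m) as \<oplus>\<^bsub>tensor k M A (Suc n)\<^esub>
      (\<Oplus>\<^bsub>tensor k M A (Suc n)\<^esub>i\<in>{1..n}. [((- 1 :: int) ^ i)] \<cdot>\<^bsub>tensor k M A (Suc n)\<^esub>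
        tensor_insert k M A m (take (i - 1) as) (comult A (as ! (i - 1))) (drop i as))
      \<oplus>\<^bsub>tensor k M A (Suc n)\<^esub> [((- 1 :: int) ^ (n + 1))] \<cdot>\<^bsub>tensor k M A (Suc n)\<^esub> pure_tensor k M A m (as @ [\<one>\<^bsub>A\<^esub>])"
proof -
  let ?T = "tensor k M A (Suc n)" and ?x = "pure_tensor k M A m as"
  interpret T: abelian_group ?T by simp
  let ?t = "\<lambda>i. [((- 1 :: int) ^ i)] \<cdot>\<^bsub>?T\<^esub> coface M \<mu> n i ?x"
  have x: "?x \<in> carrier (tensor k M A n)" using m as by simp
  have t: "?t i \<in> carrier ?T" for i
    using x by (intro add_pow_closed T.abelian_group_axioms coface_closed)
  then have "?t \<in> S \<rightarrow> carrier ?T" for S by blast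
  note tP = this
  \<comment> \<open>The terms of index \<open>Suc n\<close> and 0 are split off, being the appended
    unit and the coaction; the remaining ones comultiply a factor.\<close>
  have "cobar n ?x = ?t (Suc n) \<oplus>\<^bsub>?T\<^esub> (\<Oplus>\<^bsub>?T\<^esub>i\<in>{..n}. ?t i)"
    unfolding cobar_def alternating_sum_def by (rule T.finsum_Suc) (rule tP)
  also have "{..n} = insert 0 {1..n}" by auto
  also have "(\<Oplus>\<^bsub>?T\<^esub>i\<in>insert 0 {1..n}. ?t i) = ?t 0 \<oplus>\<^bsub>?T\<^esub> (\<Oplus>\<^bsub>?T\<^esub>i\<in>{1..n}. ?t i)"
    by (rule T.finsum_insert[OF _ _ tP t]) auto
  also have "(\<Oplus>\<^bsub>?T\<^esub>i\<in>{1..n}. ?t i) = (\<Oplus>\<^bsub>?T\<^esub>i\<in>{1..n}. [((- 1 :: int) ^ i)] \<cdot>\<^bsub>?T\<^esub>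
        tensor_insert k M A m (take (i - 1) as) (comult A (as ! (i - 1))) (drop i as))"
  proof (rule T.finsum_cong'[symmetric])
    fix i assume i: "i \<in> {1..n}"
    then show "[((- 1 :: int) ^ i)] \<cdot>\<^bsub>?T\<^esub>
        tensor_insert k M A m (take (i - 1) as) (comult A (as ! (i - 1))) (drop i as) = ?t i"
      using coface_pure_inner[OF m as, of "i - 1"] by auto
  qed (auto intro: tP t)
  also have "?t 0 = tail M 1 (\<mu> m) as"
    using coface_pure_first[OF m as] sign_pow[OF T.abelian_group_axioms coface_closed[OF x], of 0 0] by simp
  also have "?t (Suc n) = [((- 1 :: int) ^ (n + 1))] \<cdot>\<^bsub>?T\<^esub> pure_tensor k M A m (as @ [\<one>\<^bsub>A\<^esub>])"
    using m as by (simp add: coface_last snoc_pure)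
  finally have eq: "cobar n ?x = [((- 1 :: int) ^ (n + 1))] \<cdot>\<^bsub>?T\<^esub> pure_tensor k M A m (as @ [\<one>\<^bsub>A\<^esub>])
     \<oplus>\<^bsub>?T\<^esub> (tail M 1 (\<mu> m) as \<oplus>\<^bsub>?T\<^esub> (\<Oplus>\<^bsub>?T\<^esub>i\<in>{1..n}. [((- 1 :: int) ^ i)] \<cdot>\<^bsub>?T\<^esub>
        tensor_insert k M A m (take (i - 1) as) (comult A (as ! (i - 1))) (drop i as)))"
    (is "_ = ?l \<oplus>\<^bsub>?T\<^esub> (?f \<oplus>\<^bsub>?T\<^esub> ?s)") .
  have "?l \<in> carrier ?T"
    using m as by (intro add_pow_closed T.abelian_group_axioms pure_closed) auto
  moreover have "?f \<in> carrier ?T"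
    using coface_closed[OF x, of 0] coface_pure_first[OF m as] by simp
  moreover have "?s \<in> carrier ?T"
  proof (rule T.finsum_closed, rule funcsetI)
    fix i assume "i \<in> {1..n}"
    then show "[((- 1 :: int) ^ i)] \<cdot>\<^bsub>?T\<^esub>
        tensor_insert k M A m (take (i - 1) as) (comult A (as ! (i - 1))) (drop i as) \<in> carrier ?T"
      using coface_pure_inner[OF m as, of "i - 1"] t[of i] by auto
  qed
  ultimately show ?thesis
    unfolding eq by (intro T.a_comm T.a_closed)
qed

end

locale coassociative_factor = coaction_factor k A M \<mu>
  for k :: "'k difference_ring" and A :: "('k, 'a) difference_hopf_algebra"
    and M :: "('k, 'm, 'z) module_scheme" and \<mu> +
  assumes coassociative: "coassociative_counital k A M \<mu>"
begin

lemma coface_coassociative: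
  assumes m: "m \<in> carrier M"
  shows "coface M \<mu> (Suc 0) 0 (\<mu> m) = coface M \<mu> (Suc 0) (Suc 0) (\<mu> m)"
  using coassociative m by (simp add: coassociative_iff)

lemma counital:
  assumes m: "m \<in> carrier M"
  shows "counit_map (\<mu> m) = m"
  using coassociative m by (simp add: coassociative_iff)

end

context hopf_factor
begin

text \<open>The Hopf algebra coacts on itself by \<open>comult\<close>. Facts about A \<otimes> A
  and A \<otimes> A \<otimes> A become instances of those for a coefficient module.\<close>

lemma A_coassociative_factor: "coassociative_factor k A A (comult A)"
  by (intro coassociative_factor.intro coassociative_factor_axioms.intro coaction_factor.intro
      coaction_factor_axioms.intro hopf_factor_axioms A_module comult_linear
      difference_hopf_algebra.coassoc_counit_right[OF hopf])

lemma triple_bilinear: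
  assumes M: "module k M" and y: "y \<in> carrier (tensor k M A n)"
  shows "bilinear_map (tensor k A A (Suc 0)) (tensor k M A (Suc (Suc (Suc n))))
    (\<lambda>D a. snoc M (Suc (Suc n)) (double M n y D) a)"
proof (rule bilinear_compose_left[OF snoc_bilinear[OF M]])
  have "double M n y (r \<odot>\<^bsub>tensor k A A (Suc 0)\<^esub> D) = r \<odot>\<^bsub>tensor k M A (Suc (Suc n))\<^esub> double M n y D"
    if "r \<in> carrier k" "D \<in> carrier (tensor k A A (Suc 0))" for r D
    using double_smult[OF M that(2,1) y] double_smult_left[OF M that(2,1) y] by simp
  then show "double M n y \<in> linear_maps k (tensor k A A (Suc 0)) (tensor k M A (Suc (Suc n)))"
    by (intro linear_mapsI double_additive M y)
qed

end

context coaction_factor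
begin

text \<open>Coassociativity of \<Delta> in the last factor. The map \<open>E\<close> tensors with y
  on the left; both cofaces of y \<otimes> D are images under \<open>E\<close> of the cofaces of D,
  taken in the complex with coefficients \<open>A\<close>, where coassociativity is already
  known.\<close>

lemma coface_double_comult:
  assumes y: "y \<in> carrier (tensor k M A n)" and a: "a \<in> carrier A"
  shows "coface M \<mu> (Suc (Suc n)) (Suc (Suc n)) (double M n y (comult A a))
    = coface M \<mu> (Suc (Suc n)) (Suc n) (double M n y (comult A a))"
proof -
  interpret A: coassociative_factor k A A "comult A" by (rule A_coassociative_factor)
  let ?B = "tensor k M A (Suc (Suc (Suc n)))"
  define E where "E = snoc_lift A ?B (\<lambda>D a. snoc M (Suc (Suc n)) (double M n y D) a)"
  note bil = triple_bilinear[OF M_module y]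
  have E: "E \<in> additive_maps (tensor k A A (Suc (Suc 0))) ?B"
    unfolding E_def by (rule snoc_lift_additive[OF A_module _ bil]) simp
  have E_snoc: "E (snoc A (Suc 0) D c) = snoc M (Suc (Suc n)) (double M n y D) c"
    if "D \<in> carrier (tensor k A A (Suc 0))" "c \<in> carrier A" for D c
    unfolding E_def using that by (simp add: snoc_lift_snoc[OF A_module _ bil])
  have dc: "double M n y D \<in> carrier (tensor k M A (Suc (Suc n)))"
    if "D \<in> carrier (tensor k A A (Suc 0))" for D
    using additive_closed[OF double_additive[OF M_module y] that] .
  have E_double: "E (double A 0 (pure_tensor k A A b []) D) = double M (Suc n) (snoc M n y b) D"
    if b: "b \<in> carrier A" and D: "D \<in> carrier (tensor k A A (Suc 0))" for b D
  proof -
    have p: "pure_tensor k A A b [] \<in> carrier (tensor k A A 0)" "snoc M n y b \<in> carrier (tensor k M A (Suc n))"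
      using b y by simp_all
    have s0: "snoc A 0 (pure_tensor k A A b []) c = pure_tensor k A A b [c]" if "c \<in> carrier A" for c
      using snoc_pure[OF A_module that b, of "[]" 0] by simp
    show ?thesis
      by (rule tensor1_eqI[OF A_module _ additive_compose[OF double_additive[OF A_module p(1)] E]
            double_additive[OF M_module p(2)] _ D])
        (use b p y in \<open>simp_all add: double_pure[OF A_module p(1)] double_pure[OF M_module p(2)] s0 E_snoc
          double_pure[OF M_module y]\<close>)
  qed
  have 1: "coface M \<mu> (Suc (Suc n)) (Suc n) (double M n y D) = E (coface A (comult A) (Suc 0) 0 D)"
    if D: "D \<in> carrier (tensor k A A (Suc 0))" for D
  proof (rule tensor1_eqI[OF A_module _ additive_compose[OF double_additive[OF M_module y] coface_additive]
        additive_compose[OF A.coface_additive E] _ D])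
    fix b c assume bc: "b \<in> carrier A" "c \<in> carrier A"
    have "coface A (comult A) (Suc 0) 0 (pure_tensor k A A b [c]) = snoc A (Suc 0) (comult A b) c"
      using bc A.coface_pure_first[of b "[c]" "Suc 0"] by (simp add: snoc_def)
    then show "coface M \<mu> (Suc (Suc n)) (Suc n) (double M n y (pure_tensor k A A b [c]))
        = E (coface A (comult A) (Suc 0) 0 (pure_tensor k A A b [c]))"
      using bc y by (simp add: double_pure coface_snoc coface_comult E_snoc)
  qed simp
  have 2: "coface M \<mu> (Suc (Suc n)) (Suc (Suc n)) (double M n y D) = E (coface A (comult A) (Suc 0) (Suc 0) D)"
    if D: "D \<in> carrier (tensor k A A (Suc 0))" for D
  proof (rule tensor1_eqI[OF A_module _ additive_compose[OF double_additive[OF M_module y] coface_additive]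
        additive_compose[OF A.coface_additive E] _ D])
    fix b c assume bc: "b \<in> carrier A" "c \<in> carrier A"
    have "coface A (comult A) (Suc 0) (Suc 0) (pure_tensor k A A b [c]) = double A 0 (pure_tensor k A A b []) (comult A c)"
      using bc A.coface_comult[of "pure_tensor k A A b []" 0 c] by (simp add: snoc_pure)
    then show "coface M \<mu> (Suc (Suc n)) (Suc (Suc n)) (double M n y (pure_tensor k A A b [c]))
        = E (coface A (comult A) (Suc 0) (Suc 0) (pure_tensor k A A b [c]))"
      using bc y by (simp add: double_pure coface_comult E_double)
  qed simp
  show ?thesis
    using 1 2 A.coface_coassociative[OF a] a by simp
qed

end

context coassociative_factor
begin

text \<open>Peeling off the last factor leaves three sources for the identities: coassociativity of
  \<mu> in degree 0, coassociativity of \<Delta> when both cofaces meet the last factor, and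
  \<Delta>(1) = 1 \<otimes> 1 when a unit is appended. The shift to \<open>Suc j\<close> is the form
  consumed by \<open>alternating_double_sum\<close>.\<close>

lemma coface_coface:
  assumes "i \<le> j" "j \<le> Suc n" "x \<in> carrier (tensor k M A n)"
  shows "coface M \<mu> (Suc n) (Suc j) (coface M \<mu> n i x) = coface M \<mu> (Suc n) i (coface M \<mu> n j x)"
  using assms
proof (induction n arbitrary: i j x)
  case 0
  obtain m where m: "m \<in> carrier M" "x = pure_tensor k M A m []"
    using tensor0_cases[OF M_module 0(3)] by blast
  consider "i = 0" "j = 0" | "i = 0" "j = Suc 0" | "i = Suc 0" "j = Suc 0"
    using 0 by (auto simp: le_Suc_eq)
  then show ?case
  proof cases
    case 1
    then show ?thesis using m by (simp add: coface_0 coface_coassociative)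
  next
    case 2
    then show ?thesis using 0(3) by (simp add: coface_last coface_snoc)
  next
    case 3
    have "double M 0 x (comult A \<one>\<^bsub>A\<^esub>) = snoc M (Suc 0) (snoc M 0 x \<one>\<^bsub>A\<^esub>) \<one>\<^bsub>A\<^esub>"
      using 0(3) by (simp add: comult_one double_pure)
    with 3 show ?thesis using 0(3) by (simp add: coface_last coface_comult)
  qed
next
  case (Suc n)
  show ?case
  proof (cases "j = Suc (Suc n)")
    case True
    show ?thesis
    proof (cases "i = Suc (Suc n)")
      case i: True
      show ?thesis
        unfolding True i coface_last using Suc.prems(3) by (simp add: coface_comult comult_one double_pure)
    next
      case False
      then show ?thesis
        unfolding True coface_last using Suc.prems by (simp add: coface_snoc)
    qed
  next
    case False
    then have j: "j \<le> Suc n" using Suc.prems by simp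
    show ?thesis
    proof (rule snoc_eqI[OF M_module _ additive_compose[OF coface_additive coface_additive]
          additive_compose[OF coface_additive coface_additive] _ Suc.prems(3)])
      fix y a assume y: "y \<in> carrier (tensor k M A n)" and a: "a \<in> carrier A"
      \<comment> \<open>Either both cofaces act on the prefix, or only the one of index i does, or
        both comultiply the last factor.\<close>
      consider "i \<le> n" "j \<le> n" | "i \<le> n" "j = Suc n" | "i = Suc n" "j = Suc n"
        using j Suc.prems by linarith
      then show "coface M \<mu> (Suc (Suc n)) (Suc j) (coface M \<mu> (Suc n) i (snoc M n y a))
          = coface M \<mu> (Suc (Suc n)) i (coface M \<mu> (Suc n) j (snoc M n y a))"
      proof cases
        case 1
        then show ?thesis
          using y a Suc.prems Suc.IH[of i j y] by (simp add: coface_snoc)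
      next
        case 2
        then show ?thesis
          using y a by (simp add: coface_snoc coface_comult coface_double)
      next
        case 3
        then show ?thesis
          using y a by (simp add: coface_comult coface_double_comult)
      qed
    qed simp
  qed
qed

lemma cobar_cobar:
  assumes x: "x \<in> carrier (tensor k M A n)"
  shows "cobar (Suc n) (cobar n x) = \<zero>\<^bsub>tensor k M A (Suc (Suc n))\<^esub>"
proof -
  let ?T = "tensor k M A (Suc (Suc n))"
  interpret T: abelian_group ?T by simp
  have coface_sum: "coface M \<mu> (Suc n) j (alternating_sum (tensor k M A (Suc n)) (\<lambda>i. coface M \<mu> n i x) (Suc n))
      = alternating_sum ?T (\<lambda>i. coface M \<mu> (Suc n) j (coface M \<mu> n i x)) (Suc n)" for j
    by (rule additive_alternating_sum[OF coface_additive]) (use x in simp_all)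
  have "cobar (Suc n) (cobar n x)
      = alternating_sum ?T (\<lambda>j. alternating_sum ?T (\<lambda>i. coface M \<mu> (Suc n) j (coface M \<mu> n i x)) (Suc n)) (Suc (Suc n))"
    unfolding cobar_def coface_sum
    by (rule T.alternating_sum_cong) (use x in \<open>auto intro!: T.alternating_sum_closed\<close>)
  also have "\<dots> = \<zero>\<^bsub>?T\<^esub>"
    by (rule T.alternating_double_sum) (use x coface_coface[OF _ _ x] in auto)
  finally show ?thesis .
qed

end

context hopf_factor
begin

section \<open>Naturality and contractions of the Hochschild complex\<close>

lemma comodule_difference_module [simp]: "difference_comodule k A M \<Longrightarrow> difference_module k M"
  by (rule difference_comodule.axioms)

lemma comodule_module [simp]: "difference_comodule k A M \<Longrightarrow> module k M"
  by simp

lemma comodule_coaction_linear: "difference_comodule k A M \<Longrightarrow> coaction M \<in> linear_maps k M (tensor k M A (Suc 0))"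
  using difference_comodule.coaction_linear by fastforce

lemma comodule_coaction_mendo:
  "\<lbrakk>difference_comodule k A M; m \<in> carrier M\<rbrakk> \<Longrightarrow>
    coaction M (mendo M m) = tensor_endo k M A (Suc 0) (coaction M m)"
  using difference_comodule.coaction_mendo by fastforce

lemma comodule_factor: "difference_comodule k A M \<Longrightarrow> coassociative_factor k A M (coaction M)"
  by (intro coassociative_factor.intro coassociative_factor_axioms.intro coaction_factor.intro
      coaction_factor_axioms.intro hopf_factor_axioms comodule_module comodule_coaction_linear
      difference_comodule.coassoc_counit)

lemma comodule_mapsI:
  assumes "f \<in> linear_maps k M N" and "\<And>m. m \<in> carrier M \<Longrightarrow> f (mendo M m) = mendo N (f m)"
    and "\<And>m. m \<in> carrier M \<Longrightarrow> coaction N (f m) = tensor_map k N A (Suc 0) f (coaction M m)"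
  shows "f \<in> comodule_maps k A M N"
  using assms by (simp add: comodule_maps_def)

lemma
  assumes "f \<in> comodule_maps k A M N"
  shows comodule_map_linear: "f \<in> linear_maps k M N"
    and comodule_map_mendo: "m \<in> carrier M \<Longrightarrow> f (mendo M m) = mendo N (f m)"
    and comodule_map_coaction: "m \<in> carrier M \<Longrightarrow> coaction N (f m) = tensor_map k N A (Suc 0) f (coaction M m)"
  using assms by (simp_all add: comodule_maps_def)

text \<open>Comultiplying a factor and appending a unit do not involve the coefficients, so the
  compatibility of f with the coactions enters in degree 0 and is carried along by the
  recursion.\<close>

lemma coface_map:
  assumes "coaction_factor k A M \<mu>" "coaction_factor k A N \<nu>" and f: "f \<in> linear_maps k M N"
    and eq: "\<And>m. m \<in> carrier M \<Longrightarrow> \<nu> (f m) = tensor_map k N A (Suc 0) f (\<mu> m)"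
    and "i \<le> Suc n" "x \<in> carrier (tensor k M A n)"
  shows "tensor_map k N A (Suc n) f (coface M \<mu> n i x) = coface N \<nu> n i (tensor_map k N A n f x)"
  using assms(5,6)
proof (induction n arbitrary: i x)
  interpret M: coaction_factor k A M \<mu> by fact
  interpret N: coaction_factor k A N \<nu> by fact
  note mc = additive_closed[OF map_additive[OF M.M_module N.M_module f]]
  case 0
  then obtain m where m: "m \<in> carrier M" "x = pure_tensor k M A m []"
    using tensor0_cases[OF M.M_module 0(2)] by blast
  consider "i = 0" | "i = Suc 0" using 0 by linarith
  then show ?case
  proof cases
    case 1
    then show ?thesis using m f by (simp add: M.coface_0 N.coface_0 map_pure eq linear_closed[OF f])
  next
    case 2
    then show ?thesis using 0 f by (simp add: M.coface_last N.coface_last map_snoc)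
  qed
next
  interpret M: coaction_factor k A M \<mu> by fact
  interpret N: coaction_factor k A N \<nu> by fact
  note map = map_additive[OF M.M_module N.M_module f]
  note mc = additive_closed[OF map]
  case (Suc n)
  show ?case
  proof (cases "i = Suc (Suc n)")
    case True
    then show ?thesis using Suc.prems f by (simp add: M.coface_last N.coface_last map_snoc)
  next
    case False
    show ?thesis
    proof (rule snoc_eqI[OF M.M_module _ additive_compose[OF M.coface_additive map]
          additive_compose[OF map N.coface_additive] _ Suc.prems(2)])
      fix y a assume y: "y \<in> carrier (tensor k M A n)" and a: "a \<in> carrier A"
      consider "i \<le> n" | "i = Suc n" using False Suc.prems(1) by linarith
      then show "tensor_map k N A (Suc (Suc n)) f (coface M \<mu> (Suc n) i (snoc M n y a))
          = coface N \<nu> (Suc n) i (tensor_map k N A (Suc n) f (snoc M n y a))"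
      proof cases
        case 1
        then show ?thesis
          using y a f mc[OF y] Suc.IH[OF _ y, of i] by (simp add: M.coface_snoc N.coface_snoc map_snoc)
      next
        case 2
        then show ?thesis
          using y a f mc[OF y] by (simp add: M.coface_comult N.coface_comult map_snoc map_double)
      qed
    qed simp
  qed
qed

text \<open>Every ingredient commutes with \<sigma>: \<mu> at the bottom, \<open>comult\<close> in
  the last factor, and the appended unit because \<sigma> preserves one.\<close>

lemma coface_endo:
  assumes "coaction_factor k A M \<mu>" and M: "difference_module k M"
    and eq: "\<And>m. m \<in> carrier M \<Longrightarrow> \<mu> (mendo M m) = tensor_endo k M A (Suc 0) (\<mu> m)"
    and "i \<le> Suc n" "x \<in> carrier (tensor k M A n)"
  shows "tensor_endo k M A (Suc n) (coface M \<mu> n i x) = coface M \<mu> n i (tensor_endo k M A n x)"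
  using assms(4,5)
proof (induction n arbitrary: i x)
  interpret M: coaction_factor k A M \<mu> by fact
  case 0
  then obtain m where m: "m \<in> carrier M" "x = pure_tensor k M A m []"
    using tensor0_cases[OF M.M_module 0(2)] by blast
  consider "i = 0" | "i = Suc 0" using 0 by linarith
  then show ?case
  proof cases
    case 1
    then show ?thesis using m M by (simp add: M.coface_0 endo_pure eq)
  next
    case 2
    then show ?thesis using 0 M by (simp add: M.coface_last endo_snoc)
  qed
next
  interpret M: coaction_factor k A M \<mu> by fact
  case (Suc n)
  show ?case
  proof (cases "i = Suc (Suc n)")
    case True
    then show ?thesis using Suc.prems M by (simp add: M.coface_last endo_snoc)
  next
    case False
    show ?thesis
    proof (rule snoc_eqI[OF M.M_module _ additive_compose[OF M.coface_additive endo_additive[OF M]]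
          additive_compose[OF endo_additive[OF M] M.coface_additive] _ Suc.prems(2)])
      fix y a assume y: "y \<in> carrier (tensor k M A n)" and a: "a \<in> carrier A"
      consider "i \<le> n" | "i = Suc n" using False Suc.prems(1) by linarith
      then show "tensor_endo k M A (Suc (Suc n)) (coface M \<mu> (Suc n) i (snoc M n y a))
          = coface M \<mu> (Suc n) i (tensor_endo k M A (Suc n) (snoc M n y a))"
      proof cases
        case 1
        then show ?thesis
          using y a M Suc.IH[OF _ y, of i] by (simp add: M.coface_snoc endo_snoc)
      next
        case 2
        then show ?thesis
          using y a M by (simp add: M.coface_comult endo_snoc endo_double comult_mendo)
      qed
    qed simp
  qed
qed

context
  fixes M :: "('k, 'a, 'm) difference_comodule"
  assumes M: "difference_comodule k A M"
begin

interpretation M: coassociative_factor k A M "coaction M"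
  using M by (rule comodule_factor)

lemma hochschild_diff_eq:
  assumes x: "x \<in> carrier (tensor k M A n)"
  shows "hochschild_diff k A M n x = M.cobar n x"
  unfolding hochschild_diff_def Let_def
  by (rule tensor_lift_eq[OF M.M_module _ M.cobar_additive _ x])
    (simp_all add: M.cobar_pure[unfolded One_nat_def] tensor_append_tail)

lemma hochschild_diff_additive:
  "hochschild_diff k A M n \<in> additive_maps (tensor k M A n) (tensor k M A (Suc n))"
  using M.cobar_additive[of n] M.M_module[THEN module_closed(1)[OF module_tensor]]
  by (intro additive_mapsI) (simp_all add: hochschild_diff_eq additive_add)

lemma hochschild_diff_square:
  "x \<in> carrier (tensor k M A n) \<Longrightarrow>
    hochschild_diff k A M (Suc n) (hochschild_diff k A M n x) = \<zero>\<^bsub>tensor k M A (Suc (Suc n))\<^esub>"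
  by (simp add: hochschild_diff_eq M.cobar_cobar)

lemma hochschild_diff_endo:
  assumes x: "x \<in> carrier (tensor k M A n)"
  shows "tensor_endo k M A (Suc n) (hochschild_diff k A M n x) = hochschild_diff k A M n (tensor_endo k M A n x)"
proof -
  interpret T: abelian_group "tensor k M A (Suc n)" by simp
  have dM: "difference_module k M" using M by simp
  have "tensor_endo k M A (Suc n) (M.cobar n x)
    = alternating_sum (tensor k M A (Suc n)) (\<lambda>i. tensor_endo k M A (Suc n) (coface M (coaction M) n i x)) (Suc n)"
    unfolding M.cobar_def by (rule additive_alternating_sum[OF endo_additive[OF dM]]) (use x in simp_all)
  also have "\<dots> = M.cobar n (tensor_endo k M A n x)"
    unfolding M.cobar_def
    by (rule T.alternating_sum_cong)
      (use x M in \<open>simp_all add: coface_endo[OF M.coaction_factor_axioms] comodule_coaction_mendo\<close>)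
  finally show ?thesis using x M by (simp add: hochschild_diff_eq)
qed

lemma hochschild_diff_0:
  assumes m: "m \<in> carrier M"
  shows "hochschild_diff k A M 0 (pure_tensor k M A m [])
    = coaction M m \<ominus>\<^bsub>tensor k M A (Suc 0)\<^esub> pure_tensor k M A m [\<one>\<^bsub>A\<^esub>]"
proof -
  interpret T: abelian_group "tensor k M A (Suc 0)" by simp
  have "coface M (coaction M) 0 (Suc 0) (pure_tensor k M A m []) = pure_tensor k M A m [\<one>\<^bsub>A\<^esub>]"
    using m by (simp add: M.coface_last snoc_pure)
  then show ?thesis
    using m T.alternating_sum_shift[of 0 "\<lambda>i. coface M (coaction M) 0 i (pure_tensor k M A m [])"]
    by (simp add: hochschild_diff_eq M.cobar_def T.alternating_sum_0 M.coface_0)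
qed

end

lemma hochschild_diff_map:
  assumes M: "difference_comodule k A M" and N: "difference_comodule k A N"
    and f: "f \<in> comodule_maps k A M N" and x: "x \<in> carrier (tensor k M A n)"
  shows "tensor_map k N A (Suc n) f (hochschild_diff k A M n x) = hochschild_diff k A N n (tensor_map k N A n f x)"
proof -
  interpret M: coassociative_factor k A M "coaction M" using M by (rule comodule_factor)
  interpret N: coassociative_factor k A N "coaction N" using N by (rule comodule_factor)
  interpret T: abelian_group "tensor k N A (Suc n)" by simp
  note map = map_additive[OF M.M_module N.M_module comodule_map_linear[OF f]]
  have "tensor_map k N A (Suc n) f (M.cobar n x)
    = alternating_sum (tensor k N A (Suc n)) (\<lambda>i. tensor_map k N A (Suc n) f (coface M (coaction M) n i x)) (Suc n)"
    unfolding M.cobar_def by (rule additive_alternating_sum[OF map]) (use x in simp_all)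
  also have "\<dots> = N.cobar n (tensor_map k N A n f x)"
    unfolding N.cobar_def
    by (rule T.alternating_sum_cong)
      (use x additive_closed[OF map x] in \<open>simp_all add: comodule_map_coaction[OF f]
        coface_map[OF M.coaction_factor_axioms N.coaction_factor_axioms comodule_map_linear[OF f]]\<close>)
  finally show ?thesis
    using x M N additive_closed[OF map x] by (simp add: hochschild_diff_eq)
qed

end

text \<open>The last assumption says that \<rho> is a comodule map on M \<otimes> A with the
  coaction id \<otimes> \<Delta>. It is phrased through \<open>comult A a\<close> so that no tensor
  product over M \<otimes> A has to be formed.\<close>

locale contraction = coassociative_factor k A M \<mu>
  for k :: "'k difference_ring" and A :: "('k, 'a) difference_hopf_algebra"
    and M :: "('k, 'm, 'z) module_scheme" and \<mu> +
  fixes \<rho>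
  assumes \<rho>_linear: "\<rho> \<in> linear_maps k (tensor k M A (Suc 0)) M"
    and \<rho>_\<mu>: "m \<in> carrier M \<Longrightarrow> \<rho> (\<mu> m) = m"
    and \<mu>_\<rho>: "\<lbrakk>m \<in> carrier M; a \<in> carrier A\<rbrakk> \<Longrightarrow> \<mu> (\<rho> (pure_tensor k M A m [a]))
      = tensor_map k M A (Suc 0) (\<lambda>b. \<rho> (pure_tensor k M A m [b])) (comult A a)"
begin

text \<open>\<open>\<rho>\<close> applied to the first two factors. Since \<open>\<rho>\<close> is a comodule retraction of \<open>\<mu>\<close>, this shifts every
  coface except the first down by one, hence is a contracting homotopy.\<close>

primrec degen :: "nat \<Rightarrow> ('m, 'a) tensors \<Rightarrow> ('m, 'a) tensors"
  where
    "degen 0 = (\<lambda>x. pure_tensor k M A (\<rho> x) [])"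
  | "degen (Suc n) = snoc_lift M (tensor k M A (Suc n)) (\<lambda>x a. snoc M n (degen n x) a)"

lemma degen_linear: "degen n \<in> linear_maps k (tensor k M A (Suc n)) (tensor k M A n)"
proof (induction n)
  case 0
  have "(\<lambda>x. pure_tensor k M A (\<rho> x) []) \<in> additive_maps (tensor k M A (Suc 0)) (tensor k M A 0)"
    by (rule additive_compose[OF linear_additive[OF \<rho>_linear] pure0_additive[OF M_module]])
  then show ?case
    unfolding degen.simps
    by (rule linear_mapsI) (simp add: linear_smult[OF \<rho>_linear] linear_closed[OF \<rho>_linear] smult_pure)
next
  case (Suc n)
  show ?case
    unfolding degen.simps
    by (rule snoc_lift_linear[OF _ _ bilinear_compose_left[OF snoc_bilinear Suc]])
      (simp_all add: linear_smult[OF Suc] linear_closed[OF Suc] snoc_smult)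
qed

lemmas degen_additive = linear_additive[OF degen_linear]
lemmas degen_closed [simp] = linear_closed[OF degen_linear]

lemma degen_snoc:
  "\<lbrakk>x \<in> carrier (tensor k M A (Suc n)); a \<in> carrier A\<rbrakk> \<Longrightarrow>
    degen (Suc n) (snoc M (Suc n) x a) = snoc M n (degen n x) a"
  by (simp add: snoc_lift_snoc[OF _ _ bilinear_compose_left[OF snoc_bilinear degen_linear]])

lemma degen_0: "degen 0 x = pure_tensor k M A (\<rho> x) []"
  by simp

declare degen.simps [simp del]

lemma degen_double:
  assumes x: "x \<in> carrier (tensor k M A (Suc n))" and D: "D \<in> carrier (tensor k A A (Suc 0))"
  shows "degen (Suc (Suc n)) (double M (Suc n) x D) = double M n (degen n x) D"
proof -
  have dx: "degen n x \<in> carrier (tensor k M A n)" using x by simp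
  show ?thesis
    by (rule tensor1_eqI[OF A_module _ additive_compose[OF double_additive[OF _ x] degen_additive]
          double_additive[OF _ dx] _ D])
      (simp_all add: x dx double_pure degen_snoc)
qed

lemma degen_coface_0: "x \<in> carrier (tensor k M A n) \<Longrightarrow> degen n (coface M \<mu> n 0 x) = x"
proof (induction n arbitrary: x)
  case 0
  then show ?case
    using tensor0_cases[OF M_module 0] by (metis coface_0 degen_0 \<rho>_\<mu>)
next
  case (Suc n)
  show ?case
    by (rule snoc_eqI[OF M_module _ additive_compose[OF coface_additive degen_additive] additive_id _ Suc.prems])
      (simp_all add: coface_snoc degen_snoc Suc.IH)
qed

lemma degen_coface_Suc:
  "\<lbrakk>i \<le> Suc n; x \<in> carrier (tensor k M A (Suc n))\<rbrakk> \<Longrightarrow>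
    degen (Suc n) (coface M \<mu> (Suc n) (Suc i) x) = coface M \<mu> n i (degen n x)"
proof (induction n arbitrary: i x)
  case 0
  consider "i = 0" | "i = Suc 0" using 0 by linarith
  then show ?case
  proof cases
    case 1
    \<comment> \<open>Here \<rho> has to be a comodule map: the coface of index 1 comultiplies the
      very factor that \<rho> absorbs.\<close>
    have "degen (Suc 0) (coface M \<mu> (Suc 0) (Suc 0) x) = coface M \<mu> 0 0 (degen 0 x)"
    proof (rule tensor1_eqI[OF M_module _ additive_compose[OF coface_additive degen_additive]
          additive_compose[OF degen_additive coface_additive] _ 0(2)])
      fix m a assume m: "m \<in> carrier M" and a: "a \<in> carrier A"
      have p: "pure_tensor k M A m [] \<in> carrier (tensor k M A 0)" using m by simp
      have s: "pure_tensor k M A m [b] = snoc M 0 (pure_tensor k M A m []) b" if "b \<in> carrier A" for b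
        using snoc_pure[OF M_module that m, of "[]" 0] by simp
      have r: "(\<lambda>b. \<rho> (pure_tensor k M A m [b])) \<in> linear_maps k A M"
        by (rule linear_compose[OF pure_linear[OF M_module m] \<rho>_linear])
      have "degen (Suc 0) (double M 0 (pure_tensor k M A m []) D)
        = tensor_map k M A (Suc 0) (\<lambda>b. \<rho> (pure_tensor k M A m [b])) D"
        if D: "D \<in> carrier (tensor k A A (Suc 0))" for D
      proof (rule tensor1_eqI[OF A_module _ additive_compose[OF double_additive[OF M_module p] degen_additive]
            map_additive[OF A_module M_module r] _ D])
        fix b c assume bc: "b \<in> carrier A" "c \<in> carrier A"
        have "snoc M 0 (pure_tensor k M A (\<rho> (pure_tensor k M A m [b])) []) c
            = pure_tensor k M A (\<rho> (pure_tensor k M A m [b])) [c]"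
          using snoc_pure[OF M_module bc(2), of "\<rho> (pure_tensor k M A m [b])" "[]" 0] linear_closed[OF r bc(1)] by simp
        then show "degen (Suc 0) (double M 0 (pure_tensor k M A m []) (pure_tensor k A A b [c]))
            = tensor_map k M A (Suc 0) (\<lambda>b. \<rho> (pure_tensor k M A m [b])) (pure_tensor k A A b [c])"
          using bc m p r by (simp add: double_pure degen_snoc map_pure degen_0 s[symmetric])
      qed simp
      then show "degen (Suc 0) (coface M \<mu> (Suc 0) (Suc 0) (pure_tensor k M A m [a]))
          = coface M \<mu> 0 0 (degen 0 (pure_tensor k M A m [a]))"
        using m a p \<mu>_\<rho>[OF m a] linear_closed[OF r a]
        by (simp add: s[OF a] coface_comult degen_0 coface_0)
    qed simp
    then show ?thesis using 1 by simp
  next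
    case 2
    then show ?thesis using 0 by (simp add: coface_last degen_snoc)
  qed
next
  case (Suc n)
  show ?case
  proof (cases "i = Suc (Suc n)")
    case True
    then show ?thesis using Suc.prems by (simp add: coface_last degen_snoc)
  next
    case False
    show ?thesis
    proof (rule snoc_eqI[OF M_module _ additive_compose[OF coface_additive degen_additive]
          additive_compose[OF degen_additive coface_additive] _ Suc.prems(2)])
      fix y a assume y: "y \<in> carrier (tensor k M A (Suc n))" and a: "a \<in> carrier A"
      consider "i \<le> n" | "i = Suc n" using False Suc.prems(1) by linarith
      then show "degen (Suc (Suc n)) (coface M \<mu> (Suc (Suc n)) (Suc i) (snoc M (Suc n) y a))
          = coface M \<mu> (Suc n) i (degen (Suc n) (snoc M (Suc n) y a))"
      proof cases
        case 1
        then show ?thesis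
          using y a Suc.IH[OF _ y, of i] by (simp add: coface_snoc degen_snoc)
      next
        case 2
        then show ?thesis
          using y a by (simp add: coface_comult degen_snoc degen_double)
      qed
    qed simp
  qed
qed

text \<open>The coface of index 0 gives x back, and the others reassemble into the differential one
  degree lower with the opposite sign. This is the homotopy identity.\<close>

lemma degen_cobar:
  assumes x: "x \<in> carrier (tensor k M A (Suc n))"
  shows "degen (Suc n) (cobar (Suc n) x) = x \<ominus>\<^bsub>tensor k M A (Suc n)\<^esub> cobar n (degen n x)"
proof -
  let ?T = "tensor k M A (Suc n)"
  interpret T: abelian_group ?T by simp
  let ?a = "\<lambda>i. degen (Suc n) (coface M \<mu> (Suc n) i x)"
  have "degen (Suc n) (cobar (Suc n) x) = alternating_sum ?T ?a (Suc (Suc n))"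
    unfolding cobar_def by (rule additive_alternating_sum[OF degen_additive]) (use x in simp_all)
  also have "\<dots> = ?a 0 \<ominus>\<^bsub>?T\<^esub> alternating_sum ?T (\<lambda>i. ?a (Suc i)) (Suc n)"
    by (rule T.alternating_sum_shift) (use x in simp)
  also have "alternating_sum ?T (\<lambda>i. ?a (Suc i)) (Suc n) = cobar n (degen n x)"
    unfolding cobar_def by (rule T.alternating_sum_cong) (use x in \<open>simp_all add: degen_coface_Suc\<close>)
  also have "?a 0 = x" using x by (rule degen_coface_0)
  finally show ?thesis .
qed

lemma cobar_exact:
  assumes x: "x \<in> carrier (tensor k M A (Suc n))" and z: "cobar (Suc n) x = \<zero>\<^bsub>tensor k M A (Suc (Suc n))\<^esub>"
  shows "\<exists>y \<in> carrier (tensor k M A n). x = cobar n y"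
proof
  let ?T = "tensor k M A (Suc n)"
  interpret T: abelian_group ?T by simp
  show dx: "degen n x \<in> carrier (tensor k M A n)" using x by simp
  have "degen (Suc n) (cobar (Suc n) x) = \<zero>\<^bsub>?T\<^esub>"
    unfolding z by (rule additive_zero[OF degen_additive]) simp_all
  then have "x \<ominus>\<^bsub>?T\<^esub> cobar n (degen n x) = \<zero>\<^bsub>?T\<^esub>"
    unfolding degen_cobar[OF x] .
  from T.diff_zero_imp_eq[OF this x cobar_closed[OF dx]] show "x = cobar n (degen n x)" .
qed

end

section \<open>Sets that embed in the test type\<close>

text \<open>Flatness and injectivity are only available for test objects over the test type. They are applied to
  tensor products, which have other element types, after transport along an injection.\<close>

definition embeds :: "'t itself \<Rightarrow> 'x set \<Rightarrow> bool"
  where "embeds TYPE('t) S \<longleftrightarrow> (\<exists>\<phi> :: 'x \<Rightarrow> 't. inj_on \<phi> S)"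

lemma embedsI: "inj_on (\<phi> :: 'x \<Rightarrow> 't) S \<Longrightarrow> embeds TYPE('t) S"
  unfolding embeds_def by (rule exI)

lemma embeds_inj:
  assumes "inj_on f S" "f ` S \<subseteq> S'" "embeds TYPE('t) S'"
  shows "embeds TYPE('t) S"
proof -
  obtain \<phi> :: "_ \<Rightarrow> 't" where "inj_on \<phi> S'" using assms(3) by (auto simp: embeds_def)
  then have "inj_on (\<phi> \<circ> f) S" using assms(1,2) by (meson comp_inj_on inj_on_subset)
  then show ?thesis by (rule embedsI)
qed

lemma embeds_subset: "\<lbrakk>S \<subseteq> S'; embeds TYPE('t) S'\<rbrakk> \<Longrightarrow> embeds TYPE('t) S"
  by (rule embeds_inj[of id]) auto

text \<open>A number becomes the indicator sequence of a singleton, with the two distinct elements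
  of \<open>'b\<close> as truth values.\<close>

lemma embeds_nat:
  assumes "(x :: 'b) \<noteq> y"
  shows "embeds TYPE(nat \<Rightarrow> 'b) (S :: nat set)"
proof -
  have "inj (\<lambda>n i. if i = n then x else y :: 'b)"
  proof (rule injI)
    fix n m assume "(\<lambda>i. if i = n then x else y) = (\<lambda>i. if i = m then x else y)"
    from fun_cong[OF this, of n] show "n = m" using assms by (auto split: if_splits)
  qed
  then show ?thesis by (rule embedsI[OF inj_on_subset[OF _ subset_UNIV]])
qed

lemma embeds_int:
  assumes "(x :: 'b) \<noteq> y"
  shows "embeds TYPE(nat \<Rightarrow> 'b) (S :: int set)"
  by (rule embeds_inj[where f=int_encode and S'=UNIV])
    (auto intro: inj_on_subset[OF inj_int_encode] embeds_nat[OF assms])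

text \<open>Two sequences are interleaved, one on the even and one on the odd positions.\<close>

lemma embeds_Times:
  assumes "embeds TYPE(nat \<Rightarrow> 'b) S" "embeds TYPE(nat \<Rightarrow> 'b) S'"
  shows "embeds TYPE(nat \<Rightarrow> 'b) (S \<times> S')"
proof -
  obtain \<phi> :: "_ \<Rightarrow> nat \<Rightarrow> 'b" and \<psi> :: "_ \<Rightarrow> nat \<Rightarrow> 'b" where *: "inj_on \<phi> S" "inj_on \<psi> S'"
    using assms by (auto simp: embeds_def)
  have "inj_on (\<lambda>(x, y) i. if even i then \<phi> x (i div 2) else \<psi> y (i div 2)) (S \<times> S')"
  proof (rule inj_onI, clarify)
    fix x y x' y'
    assume xy: "x \<in> S" "y \<in> S'" "x' \<in> S" "y' \<in> S'"
      and eq: "(\<lambda>i. if even i then \<phi> x (i div 2) else \<psi> y (i div 2))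
        = (\<lambda>i. if even i then \<phi> x' (i div 2) else \<psi> y' (i div 2))"
    have "\<phi> x = \<phi> x'"
    proof
      fix i show "\<phi> x i = \<phi> x' i" using fun_cong[OF eq, of "2 * i"] by simp
    qed
    moreover have "\<psi> y = \<psi> y'"
    proof
      fix i show "\<psi> y i = \<psi> y' i" using fun_cong[OF eq, of "2 * i + 1"] by simp
    qed
    ultimately show "x = x' \<and> y = y'"
      using inj_onD[OF *(1)] inj_onD[OF *(2)] xy by blast
  qed
  then show ?thesis by (rule embedsI)
qed

text \<open>All entries are stored in one sequence by means of a pairing function on positions. The
  length is recorded separately because \<open>xs ! i\<close> is unspecified beyond it.\<close>

lemma embeds_lists:
  assumes "(x :: 'b) \<noteq> y" "embeds TYPE(nat \<Rightarrow> 'b) S"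
  shows "embeds TYPE(nat \<Rightarrow> 'b) (lists S)"
proof -
  obtain \<phi> :: "_ \<Rightarrow> nat \<Rightarrow> 'b" where \<phi>: "inj_on \<phi> S" using assms(2) by (auto simp: embeds_def)
  let ?f = "\<lambda>xs. (length xs, \<lambda>p. \<phi> (xs ! fst (prod_decode p)) (snd (prod_decode p)))"
  have inj: "inj_on ?f (lists S)"
  proof (rule inj_onI)
    fix xs ys assume xs: "xs \<in> lists S" "ys \<in> lists S" and eq: "?f xs = ?f ys"
    then have len: "length xs = length ys" by simp
    have eq2: "(\<lambda>p. \<phi> (xs ! fst (prod_decode p)) (snd (prod_decode p)))
        = (\<lambda>p. \<phi> (ys ! fst (prod_decode p)) (snd (prod_decode p)))"
      using eq by (rule Pair_inject)
    have "\<phi> (xs ! i) = \<phi> (ys ! i)" for i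
    proof
      fix j show "\<phi> (xs ! i) j = \<phi> (ys ! i) j" using fun_cong[OF eq2, of "prod_encode (i, j)"] by simp
    qed
    then show "xs = ys"
      using len xs by (intro nth_equalityI inj_onD[OF \<phi>]) auto
  qed
  have "embeds TYPE(nat \<Rightarrow> 'b) (UNIV :: (nat \<Rightarrow> 'b) set)"
    by (rule embedsI[of id]) simp
  then have "embeds TYPE(nat \<Rightarrow> 'b) ((UNIV :: nat set) \<times> (UNIV :: (nat \<Rightarrow> 'b) set))"
    by (intro embeds_Times embeds_nat[OF assms(1)])
  then show ?thesis by (rule embeds_inj[OF inj, rotated]) simp
qed

text \<open>A finitely supported function is recovered from its graph, listed along a chosen
  enumeration of its support.\<close>

lemma embeds_poly_mapping:
  assumes "(x :: 'b) \<noteq> y" "embeds TYPE(nat \<Rightarrow> 'b) S"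
  shows "embeds TYPE(nat \<Rightarrow> 'b) {c :: 'p \<Rightarrow>\<^sub>0 int. Poly_Mapping.keys c \<subseteq> S}"
proof -
  define l where "l c = (SOME xs. set xs = Poly_Mapping.keys c)" for c :: "'p \<Rightarrow>\<^sub>0 int"
  have l: "set (l c) = Poly_Mapping.keys c" for c :: "'p \<Rightarrow>\<^sub>0 int"
    unfolding l_def by (rule someI_ex) (simp add: finite_list)
  let ?f = "\<lambda>c. map (\<lambda>p. (p, Poly_Mapping.lookup c p)) (l c)"
  have "inj_on ?f {c. Poly_Mapping.keys c \<subseteq> S}"
  proof (rule inj_onI)
    fix c d :: "'p \<Rightarrow>\<^sub>0 int" assume eq: "?f c = ?f d"
    have "map fst (?f c) = l c" "map fst (?f d) = l d" by (simp_all add: map_idI)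
    with eq have ll: "l c = l d" by metis
    then have k: "Poly_Mapping.keys c = Poly_Mapping.keys d" by (metis l)
    show "c = d"
    proof (rule poly_mapping_eqI)
      fix p
      show "Poly_Mapping.lookup c p = Poly_Mapping.lookup d p"
      proof (cases "p \<in> Poly_Mapping.keys c")
        case True
        then have "(p, Poly_Mapping.lookup c p) \<in> set (?f c)" by (auto simp: l)
        then show ?thesis unfolding eq by auto
      next
        case False
        with k show ?thesis by (metis not_in_keys_iff_lookup_eq_zero)
      qed
    qed
  qed
  then show ?thesis
    by (rule embeds_inj[OF _ _ embeds_lists[OF assms(1) embeds_Times[OF assms(2) embeds_int[OF assms(1)]]]])
      (auto simp: l)
qed

section \<open>Transport of structure\<close>

definition transport_module :: "('m \<Rightarrow> 't) \<Rightarrow> ('k, 'm, 'z) module_scheme \<Rightarrow> ('k, 't) module"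
  where "transport_module \<phi> M = (let \<psi> = inv_into (carrier M) \<phi> in
    \<lparr>carrier = \<phi> ` carrier M, mult = undefined, one = undefined, ring.zero = \<phi> \<zero>\<^bsub>M\<^esub>,
     add = (\<lambda>x y. \<phi> (\<psi> x \<oplus>\<^bsub>M\<^esub> \<psi> y)), smult = (\<lambda>r x. \<phi> (r \<odot>\<^bsub>M\<^esub> \<psi> x))\<rparr>)"

context tensor_factor
begin

lemma
  assumes M: "module k M" and \<phi>: "inj_on \<phi> (carrier M)"
  shows transport_module: "module k (transport_module \<phi> M)"
    and transport_linear: "\<phi> \<in> linear_maps k M (transport_module \<phi> M)"
    and transport_inv_linear: "inv_into (carrier M) \<phi> \<in> linear_maps k (transport_module \<phi> M) M"
proof -
  interpret M: module k M by (fact M)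
  have simps: "carrier (transport_module \<phi> M) = \<phi> ` carrier M" "\<zero>\<^bsub>transport_module \<phi> M\<^esub> = \<phi> \<zero>\<^bsub>M\<^esub>"
    "x \<oplus>\<^bsub>transport_module \<phi> M\<^esub> y = \<phi> (inv_into (carrier M) \<phi> x \<oplus>\<^bsub>M\<^esub> inv_into (carrier M) \<phi> y)"
    "r \<odot>\<^bsub>transport_module \<phi> M\<^esub> x = \<phi> (r \<odot>\<^bsub>M\<^esub> inv_into (carrier M) \<phi> x)" for x y r
    by (simp_all add: transport_module_def Let_def)
  note simps' = simps inv_into_f_f[OF \<phi>]
  show "module k (transport_module \<phi> M)"
  proof (rule moduleI)
    show "abelian_group (transport_module \<phi> M)"
    proof (rule abelian_groupI)
      fix x assume "x \<in> carrier (transport_module \<phi> M)"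
      then obtain m where m: "m \<in> carrier M" "x = \<phi> m" by (auto simp: simps)
      then show "\<exists>y \<in> carrier (transport_module \<phi> M). y \<oplus>\<^bsub>transport_module \<phi> M\<^esub> x = \<zero>\<^bsub>transport_module \<phi> M\<^esub>"
        by (intro bexI[of _ "\<phi> (\<ominus>\<^bsub>M\<^esub> m)"]) (auto simp: simps' M.l_neg)
    qed (auto simp: simps' M.a_ac)
  qed (auto simp: simps' k_cring M.smult_l_distr M.smult_r_distr M.smult_assoc1)
  show "\<phi> \<in> linear_maps k M (transport_module \<phi> M)"
    by (intro linear_mapsI additive_mapsI) (auto simp: simps')
  show "inv_into (carrier M) \<phi> \<in> linear_maps k (transport_module \<phi> M) M"
    by (intro linear_mapsI additive_mapsI) (auto simp: simps')
qed

lemma transport_carrier: "carrier (transport_module \<phi> M) = \<phi> ` carrier M"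
  by (simp add: transport_module_def Let_def)

text \<open>A coset is named by a chosen representative, which is a finitely supported function on
  pairs of an element and a list.\<close>

lemma embeds_tensor:
  assumes "(x :: 'b) \<noteq> y" and M: "embeds TYPE(nat \<Rightarrow> 'b) (carrier M)" and A: "embeds TYPE(nat \<Rightarrow> 'b) (carrier A)"
  shows "embeds TYPE(nat \<Rightarrow> 'b) (carrier (tensor k M A n))"
proof -
  let ?q = "\<lambda>c. tensor_null k M A n #>\<^bsub>tensor_free M A n\<^esub> c"
  define r where "r = inv_into (carrier (tensor_free M A n)) ?q"
  have r: "r X \<in> carrier (tensor_free M A n)" "?q (r X) = X" if "X \<in> carrier (tensor k M A n)" for X
  proof -
    have "X \<in> ?q ` carrier (tensor_free M A n)"
      using carrier_tensor_cases[OF that] by (metis image_eqI)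
    then show "r X \<in> carrier (tensor_free M A n)" "?q (r X) = X"
      unfolding r_def by (rule inv_into_into, rule f_inv_into_f)
  qed
  have inj: "inj_on r (carrier (tensor k M A n))"
    by (rule inj_on_inverseI[where g="?q"]) (rule r(2))
  have sub: "r ` carrier (tensor k M A n) \<subseteq> {c. Poly_Mapping.keys c \<subseteq> carrier M \<times> lists (carrier A)}"
  proof (rule image_subsetI)
    fix X assume "X \<in> carrier (tensor k M A n)"
    then have "Poly_Mapping.keys (r X) \<subseteq> carrier M \<times> {as. length as = n \<and> set as \<subseteq> carrier A}"
      using r(1) unfolding tensor_free_simps by blast
    also have "\<dots> \<subseteq> carrier M \<times> lists (carrier A)" by auto
    finally show "r X \<in> {c. Poly_Mapping.keys c \<subseteq> carrier M \<times> lists (carrier A)}" by simp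
  qed
  show ?thesis
    by (rule embeds_inj[OF inj sub embeds_poly_mapping[OF assms(1) embeds_Times[OF M embeds_lists[OF assms(1) A]]]])
qed

end

section \<open>Flatness\<close>

text \<open>Lifts out of tensor products expect their target as a ring record, so the quotient group
  is wrapped into one whose multiplicative part carries no information.\<close>

lemma comm_group_quotient_ring:
  fixes X :: "('x, 'p) ring_scheme"
  assumes X: "abelian_group X" and H: "subgroup H (add_monoid X)"
  obtains B :: "'x set ring" and q where "abelian_group B" "q \<in> additive_maps X B"
    "\<And>x. x \<in> carrier X \<Longrightarrow> q x = \<zero>\<^bsub>B\<^esub> \<longleftrightarrow> x \<in> H"
proof -
  let ?G = "add_monoid X"
  let ?B = "\<lparr>carrier = carrier (?G Mod H), mult = undefined, one = undefined,
     ring.zero = \<one>\<^bsub>?G Mod H\<^esub>, add = mult (?G Mod H)\<rparr> :: 'x set ring"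
  interpret G: comm_group ?G by (rule abelian_group.a_comm_group[OF X])
  have c: "comm_group (?G Mod H)" by (rule G.abelian_FactGroup[OF H])
  have B: "abelian_group ?B"
    by (rule comm_group_abelian_groupI) (use c in \<open>simp add: FactGroup_def\<close>)
  have n: "H \<lhd> ?G" by (rule G.subgroup_imp_normal[OF H])
  show ?thesis
  proof (rule that[OF B])
    show "(\<lambda>x. H #>\<^bsub>?G\<^esub> x) \<in> additive_maps X ?B"
      using normal.r_coset_hom_Mod[OF n] by (simp add: hom_def)
    fix x assume "x \<in> carrier X"
    then show "H #>\<^bsub>?G\<^esub> x = \<zero>\<^bsub>?B\<^esub> \<longleftrightarrow> x \<in> H"
      using G.coset_join1[OF _ _ H] G.coset_join2[OF _ H] by auto
  qed
qed

context tensor_factor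
begin

text \<open>The isomorphism \<open>M \<otimes> A\<^bsup>\<otimes>(n+1)\<^esup> \<cong> (M \<otimes> A\<^bsup>\<otimes>n\<^esup>) \<otimes> A\<close>, which reduces flatness of \<open>A\<^bsup>\<otimes>n\<^esup>\<close> to that of \<open>A\<close>.\<close>

definition retensor :: "('k, 'm, 'z) module_scheme \<Rightarrow> nat \<Rightarrow> ('m, 'a) tensors \<Rightarrow> (('m, 'a) tensors, 'a) tensors"
  where "retensor M n = snoc_lift M (tensor k (tensor k M A n) A (Suc 0)) (\<lambda>x a. pure_tensor k (tensor k M A n) A x [a])"

lemma
  assumes M: "module k M"
  shows retensor_additive: "retensor M n \<in> additive_maps (tensor k M A (Suc n)) (tensor k (tensor k M A n) A (Suc 0))"
    and retensor_snoc: "\<lbrakk>x \<in> carrier (tensor k M A n); a \<in> carrier A\<rbrakk>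
      \<Longrightarrow> retensor M n (snoc M n x a) = pure_tensor k (tensor k M A n) A x [a]"
    and retensor_inj: "inj_on (retensor M n) (carrier (tensor k M A (Suc n)))"
proof -
  let ?T = "tensor k M A n" and ?S = "tensor k M A (Suc n)"
  have T: "module k ?T" using M by simp
  have bil: "bilinear_map ?T (tensor k ?T A (Suc 0)) (\<lambda>x a. pure_tensor k ?T A x [a])"
  proof (rule bilinear_mapI)
    fix a assume a: "a \<in> carrier A"
    show "(\<lambda>x. pure_tensor k ?T A x [a]) \<in> additive_maps ?T (tensor k ?T A (Suc 0))"
      by (rule additive_mapsI) (use T a in \<open>simp_all add: pure_add_left\<close>)
  next
    fix x a b assume "x \<in> carrier ?T" "a \<in> carrier A" "b \<in> carrier A"
    then show "pure_tensor k ?T A x [a \<oplus>\<^bsub>A\<^esub> b]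
      = pure_tensor k ?T A x [a] \<oplus>\<^bsub>tensor k ?T A (Suc 0)\<^esub> pure_tensor k ?T A x [b]"
      by (rule linear_add[OF pure_linear[OF T]])
  next
    fix r x a assume "r \<in> carrier k" "x \<in> carrier ?T" "a \<in> carrier A"
    then show "pure_tensor k ?T A (r \<odot>\<^bsub>?T\<^esub> x) [a] = pure_tensor k ?T A x [r \<odot>\<^bsub>A\<^esub> a]"
      using pure_smult_slot[OF T, of r x a "[]" "[]"] by simp
  qed
  show add: "retensor M n \<in> additive_maps ?S (tensor k ?T A (Suc 0))"
    unfolding retensor_def by (rule snoc_lift_additive[OF M _ bil]) (simp add: T)
  show sn: "retensor M n (snoc M n x a) = pure_tensor k ?T A x [a]" if "x \<in> carrier ?T" "a \<in> carrier A" for x a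
    unfolding retensor_def using that T by (simp add: snoc_lift_snoc[OF M _ bil])
  have hd: "hd cs \<in> carrier A" if "length cs = Suc 0" "set cs \<subseteq> carrier A" for cs
    using that by (cases cs) auto
  have b: "balanced_map k ?T A (Suc 0) ?S (\<lambda>x cs. snoc M n x (hd cs))"
    by (rule balanced_mapI)
      (simp_all add: M hd snoc_add snoc_smult_right snoc_smult additive_add[OF snoc_additive])
  note lift = tensor_lift_pure_additive[OF T abelian_group_tensor[OF M] b]
  have "tensor_lift ?S (\<lambda>x cs. snoc M n x (hd cs)) (retensor M n X) = X" if X: "X \<in> carrier ?S" for X
    by (rule snoc_eqI[OF M _ additive_compose[OF add lift(1)] additive_id _ X]) (simp_all add: M sn lift(2))
  then show "inj_on (retensor M n) (carrier ?S)"
    by (rule inj_on_inverseI)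
qed

end

context hopf_factor
begin

lemma retensor_linear:
  assumes M: "module k M"
  shows "retensor M n \<in> linear_maps k (tensor k M A (Suc n)) (tensor k (tensor k M A n) A (Suc 0))"
proof (rule linear_mapsI[OF retensor_additive[OF M]])
  let ?T = "tensor k M A n" and ?S = "tensor k M A (Suc n)"
  have T: "module k ?T" using M by simp
  fix r x assume r: "r \<in> carrier k" and x: "x \<in> carrier ?S"
  show "retensor M n (r \<odot>\<^bsub>?S\<^esub> x) = r \<odot>\<^bsub>tensor k ?T A (Suc 0)\<^esub> retensor M n x"
  proof (rule snoc_eqI[OF M _ additive_compose[OF smult_tensor_additive[OF M r] retensor_additive[OF M]]
        additive_compose[OF retensor_additive[OF M] smult_tensor_additive[OF T r]] _ x])
    fix y a assume y: "y \<in> carrier ?T" and a: "a \<in> carrier A"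
    have "r \<odot>\<^bsub>?S\<^esub> snoc M n y a = snoc M n (r \<odot>\<^bsub>?T\<^esub> y) a"
      using M y a r by (simp add: snoc_smult)
    then show "retensor M n (r \<odot>\<^bsub>?S\<^esub> snoc M n y a) = r \<odot>\<^bsub>tensor k ?T A (Suc 0)\<^esub> retensor M n (snoc M n y a)"
      using M y a r T by (simp add: retensor_snoc smult_pure)
  qed (simp add: T)
qed

end

text \<open>The parameter \<open>t\<close> makes the type of the test objects visible to
  instantiations; \<open>b0\<close> and \<open>b1\<close> are the two values from which the
  embeddings into sequences are built.\<close>

locale flat_factor = tensor_factor k A
  for k :: "('k, 'y) ring_scheme" and A :: "('k, 'a, 'w) module_scheme" +
  fixes t :: "(nat \<Rightarrow> 'b) itself" and b0 b1 :: 'b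
  assumes flat: "flat_module TYPE(nat \<Rightarrow> 'b) k A"
    and A_embeds: "embeds TYPE(nat \<Rightarrow> 'b) (carrier A)"
    and b01: "b0 \<noteq> b1"
begin

lemma embeds_tensors: "embeds TYPE(nat \<Rightarrow> 'b) (carrier M) \<Longrightarrow> embeds TYPE(nat \<Rightarrow> 'b) (carrier (tensor k M A n))"
  by (rule embeds_tensor[OF b01 _ A_embeds])

text \<open>Flatness speaks about modules over the test type, so f is conjugated with bijections
  from M and N onto copies there. Tensoring preserves the inverse of the first bijection, and
  injectivity travels back.\<close>

lemma flat_inj_1:
  assumes M: "module k M" "embeds TYPE(nat \<Rightarrow> 'b) (carrier M)"
    and N: "module k N" "embeds TYPE(nat \<Rightarrow> 'b) (carrier N)"
    and f: "f \<in> linear_maps k M N" "inj_on f (carrier M)"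
  shows "inj_on (tensor_map k N A (Suc 0) f) (carrier (tensor k M A (Suc 0)))"
proof (rule inj_onI)
  obtain \<phi> :: "_ \<Rightarrow> nat \<Rightarrow> 'b" and \<psi> :: "_ \<Rightarrow> nat \<Rightarrow> 'b" where \<phi>: "inj_on \<phi> (carrier M)" and \<psi>: "inj_on \<psi> (carrier N)"
    using M(2) N(2) by (auto simp: embeds_def)
  let ?M = "transport_module \<phi> M" and ?N = "transport_module \<psi> N" and ?\<phi>' = "inv_into (carrier M) \<phi>"
  let ?f = "\<lambda>x. \<psi> (f (?\<phi>' x))"
  note m = transport_module[OF M(1) \<phi>] and n = transport_module[OF N(1) \<psi>]
  note \<phi>1 = transport_linear[OF M(1) \<phi>] and \<psi>1 = transport_linear[OF N(1) \<psi>] and \<phi>2 = transport_inv_linear[OF M(1) \<phi>]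
  have f': "?f \<in> linear_maps k ?M ?N"
    by (rule linear_compose[OF linear_compose[OF \<phi>2 f(1)] \<psi>1])
  have "inj_on ?f (carrier ?M)"
  proof (rule inj_onI)
    fix x y assume "x \<in> carrier ?M" "y \<in> carrier ?M" and eq: "?f x = ?f y"
    then obtain m m' where m: "m \<in> carrier M" "x = \<phi> m" "m' \<in> carrier M" "y = \<phi> m'"
      by (auto simp: transport_carrier)
    with eq have "\<psi> (f m) = \<psi> (f m')" by (simp add: inv_into_f_f[OF \<phi>])
    then show "x = y"
      using inj_onD[OF \<psi>] inj_onD[OF f(2)] linear_closed[OF f(1)] m by blast
  qed
  then have inj: "inj_on (tensor_map k ?N A (Suc 0) ?f) (carrier (tensor k ?M A (Suc 0)))"
    using flat f' m n unfolding flat_module_def by simp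
  have fc: "(\<lambda>x. \<psi> (f x)) \<in> linear_maps k M ?N"
    by (rule linear_compose[OF f(1) \<psi>1])
  have 1: "tensor_map k ?N A (Suc 0) ?f (tensor_map k ?M A (Suc 0) \<phi> z)
     = tensor_map k ?N A (Suc 0) \<psi> (tensor_map k N A (Suc 0) f z)" if "z \<in> carrier (tensor k M A (Suc 0))" for z
  proof -
    have "tensor_map k ?N A (Suc 0) ?f (tensor_map k ?M A (Suc 0) \<phi> z) = tensor_map k ?N A (Suc 0) (\<lambda>x. \<psi> (f x)) z"
      by (rule map_compose[OF M(1) m n \<phi>1 f' fc _ that]) (simp add: inv_into_f_f[OF \<phi>])
    also have "\<dots> = tensor_map k ?N A (Suc 0) \<psi> (tensor_map k N A (Suc 0) f z)"
      by (rule map_compose[OF M(1) N(1) n f(1) \<psi>1 fc _ that, symmetric]) simp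
    finally show ?thesis .
  qed
  have 2: "tensor_map k M A (Suc 0) ?\<phi>' (tensor_map k ?M A (Suc 0) \<phi> z) = z"
    if z: "z \<in> carrier (tensor k M A (Suc 0))" for z
  proof -
    have id: "(\<lambda>x. x) \<in> linear_maps k M M" by (simp add: linear_mapsI additive_id)
    have "tensor_map k M A (Suc 0) ?\<phi>' (tensor_map k ?M A (Suc 0) \<phi> z) = tensor_map k M A (Suc 0) (\<lambda>x. x) z"
      by (rule map_compose[OF M(1) m M(1) \<phi>1 \<phi>2 id _ z]) (simp add: inv_into_f_f[OF \<phi>])
    also have "\<dots> = z" by (rule map_id[OF M(1) id _ z]) simp
    finally show ?thesis .
  qed
  fix x y assume x: "x \<in> carrier (tensor k M A (Suc 0))" and y: "y \<in> carrier (tensor k M A (Suc 0))"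
    and eq: "tensor_map k N A (Suc 0) f x = tensor_map k N A (Suc 0) f y"
  have "tensor_map k ?N A (Suc 0) ?f (tensor_map k ?M A (Suc 0) \<phi> x)
      = tensor_map k ?N A (Suc 0) ?f (tensor_map k ?M A (Suc 0) \<phi> y)"
    by (simp only: 1[OF x] 1[OF y] eq)
  then have "tensor_map k ?M A (Suc 0) \<phi> x = tensor_map k ?M A (Suc 0) \<phi> y"
    by (rule inj_onD[OF inj _ additive_closed[OF map_additive[OF M(1) m \<phi>1] x]
          additive_closed[OF map_additive[OF M(1) m \<phi>1] y]])
  then show "x = y" using 2[OF x] 2[OF y] by metis
qed

text \<open>A map tensored with n + 1 factors is the one tensored with n factors, tensored once
  more. Flatness is thus applied to modules that are tensor products themselves, which is why their
  elements must embed in the test type.\<close>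

lemma flat_inj:
  assumes M: "module k M" "embeds TYPE(nat \<Rightarrow> 'b) (carrier M)"
    and N: "module k N" "embeds TYPE(nat \<Rightarrow> 'b) (carrier N)"
    and f: "f \<in> linear_maps k M N" "inj_on f (carrier M)"
  shows "inj_on (tensor_map k N A n f) (carrier (tensor k M A n))"
proof (induction n)
  case 0
  show ?case
  proof (rule inj_onI)
    fix x y assume "x \<in> carrier (tensor k M A 0)" "y \<in> carrier (tensor k M A 0)"
      and eq: "tensor_map k N A 0 f x = tensor_map k N A 0 f y"
    then obtain m m' where m: "m \<in> carrier M" "x = pure_tensor k M A m []" "m' \<in> carrier M" "y = pure_tensor k M A m' []"
      using tensor0_cases[OF M(1)] by metis
    then have "pure_tensor k N A (f m) [] = pure_tensor k N A (f m') []"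
      using eq by (simp add: map_pure[OF M(1) N(1) f(1)])
    then have "f m = f m'"
      using pure0_inject[OF N(1)] m linear_closed[OF f(1)] by blast
    then show "x = y" using m f(2) by (auto simp: inj_on_def)
  qed
next
  case (Suc n)
  let ?M = "tensor k M A n" and ?N = "tensor k N A n" and ?g = "tensor_map k N A n f"
  let ?B = "tensor k ?N A (Suc 0)"
  note mg = map_linear[OF M(1) N(1) f(1), of n]
  have g: "inj_on (tensor_map k ?N A (Suc 0) ?g) (carrier (tensor k ?M A (Suc 0)))"
    by (rule flat_inj_1[OF _ embeds_tensors[OF M(2)] _ embeds_tensors[OF N(2)] mg Suc]) (simp_all add: M N)
  have eq: "tensor_map k ?N A (Suc 0) ?g (retensor M n x) = retensor N n (tensor_map k N A (Suc n) f x)"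
    if x: "x \<in> carrier (tensor k M A (Suc n))" for x
  proof (rule snoc_eqI[OF M(1) _ additive_compose[OF retensor_additive[OF M(1)] map_additive[OF _ _ mg]]
        additive_compose[OF map_additive[OF M(1) N(1) f(1)] retensor_additive[OF N(1)]] _ x])
    fix y a assume "y \<in> carrier ?M" "a \<in> carrier A"
    then show "tensor_map k ?N A (Suc 0) ?g (retensor M n (snoc M n y a))
        = retensor N n (tensor_map k N A (Suc n) f (snoc M n y a))"
      using M N f linear_closed[OF mg] by (simp add: retensor_snoc map_pure[OF _ _ mg] map_snoc)
  qed (simp_all add: M N)
  show ?case
  proof (rule inj_onI)
    fix x y assume x: "x \<in> carrier (tensor k M A (Suc n))" and y: "y \<in> carrier (tensor k M A (Suc n))"
      and "tensor_map k N A (Suc n) f x = tensor_map k N A (Suc n) f y"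
    then have "tensor_map k ?N A (Suc 0) ?g (retensor M n x) = tensor_map k ?N A (Suc 0) ?g (retensor M n y)"
      by (simp add: eq)
    then have "retensor M n x = retensor M n y"
      by (rule inj_onD[OF g]) (use x y additive_closed[OF retensor_additive[OF M(1)]] in auto)
    then show "x = y" using x y by (rule inj_onD[OF retensor_inj[OF M(1)]])
  qed
qed

text \<open>Exactness in the middle is split at the image \<open>?I\<close> of g. Flatness makes the
  tensored inclusion of \<open>?I\<close> into P injective. Right exactness handles the surjection
  onto \<open>?I\<close>: a lift from the tensors over \<open>?I\<close> to the cokernel B of the
  tensored f shows that the projection q factors through the tensored g.\<close>

lemma tensor_map_exact:
  fixes N :: "('k, 'n, 'v) module_scheme"
  assumes M: "module k M" "embeds TYPE(nat \<Rightarrow> 'b) (carrier M)"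
    and N: "module k N" "embeds TYPE(nat \<Rightarrow> 'b) (carrier N)"
    and P: "module k P" "embeds TYPE(nat \<Rightarrow> 'b) (carrier P)"
    and f: "f \<in> linear_maps k M N" and g: "g \<in> linear_maps k N P"
    and ex: "f ` carrier M = {x \<in> carrier N. g x = \<zero>\<^bsub>P\<^esub>}"
  shows "tensor_map k N A n f ` carrier (tensor k M A n)
    = {x \<in> carrier (tensor k N A n). tensor_map k P A n g x = \<zero>\<^bsub>tensor k P A n\<^esub>}"
proof (intro subset_antisym subsetI)
  note mf = map_additive[OF M(1) N(1) f, of n] and mg = map_additive[OF N(1) P(1) g, of n]
  let ?N = "tensor k N A n" and ?P = "tensor k P A n"
  interpret N: abelian_group ?N using N by simp
  interpret P: abelian_group ?P using P by simp
  interpret Pm: module k P by (rule P(1))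
  {
    fix y assume "y \<in> tensor_map k N A n f ` carrier (tensor k M A n)"
    then obtain x where x: "x \<in> carrier (tensor k M A n)" "y = tensor_map k N A n f x" by blast
    have z: "(\<lambda>x. \<zero>\<^bsub>?P\<^esub>) \<in> additive_maps (tensor k M A n) ?P"
      by (rule additive_mapsI) simp_all
    have "tensor_map k P A n g (tensor_map k N A n f x) = \<zero>\<^bsub>?P\<^esub>"
    proof (rule additive_eqI[OF M(1) _ additive_compose[OF mf mg] z _ x(1)])
      fix m as assume m: "m \<in> carrier M" "length as = n" "set as \<subseteq> carrier A"
      then have "g (f m) = \<zero>\<^bsub>P\<^esub>" using ex by blast
      moreover have "pure_tensor k P A \<zero>\<^bsub>P\<^esub> as = \<zero>\<^bsub>?P\<^esub>"
        by (rule pure_zero[OF P(1) m(2,3)])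
      ultimately show "tensor_map k P A n g (tensor_map k N A n f (pure_tensor k M A m as)) = \<zero>\<^bsub>?P\<^esub>"
        using m by (simp add: map_pure[OF M(1) N(1) f] map_pure[OF N(1) P(1) g] linear_closed[OF f])
    qed (simp add: P)
    then show "y \<in> {x \<in> carrier ?N. tensor_map k P A n g x = \<zero>\<^bsub>?P\<^esub>}"
      using x additive_closed[OF mf] by simp
  }
  fix x assume "x \<in> {x \<in> carrier ?N. tensor_map k P A n g x = \<zero>\<^bsub>?P\<^esub>}"
  then have x: "x \<in> carrier ?N" "tensor_map k P A n g x = \<zero>\<^bsub>?P\<^esub>" by auto
  let ?H = "tensor_map k N A n f ` carrier (tensor k M A n)"
  have H: "subgroup ?H (add_monoid ?N)"
  proof -
    interpret h: group_hom "add_monoid (tensor k M A n)" "add_monoid ?N" "tensor_map k N A n f"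
      by (intro group_hom.intro group_hom_axioms.intro mf N.a_group
          abelian_group.a_group[OF abelian_group_tensor[OF M(1)]])
    show ?thesis using h.img_is_subgroup by simp
  qed
  obtain B :: "('n, 'a) tensors set ring" and q where B: "abelian_group B" and q: "q \<in> additive_maps ?N B"
    and q0: "\<And>x. x \<in> carrier ?N \<Longrightarrow> q x = \<zero>\<^bsub>B\<^esub> \<longleftrightarrow> x \<in> ?H"
    by (rule comm_group_quotient_ring[OF N.abelian_group_axioms H], rule that, assumption+)
  interpret B: abelian_group B by (fact B)
  let ?I = "P\<lparr>carrier := g ` carrier N\<rparr>"
  interpret Nm: module k N by (rule N(1))
  have I: "module k ?I"
  proof (rule moduleI)
    show "abelian_group ?I"
    proof (rule abelian_groupI; clarsimp)
      fix y y' assume y: "y \<in> carrier N" "y' \<in> carrier N"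
      show "g y \<oplus>\<^bsub>P\<^esub> g y' \<in> g ` carrier N"
        using y by (auto simp: linear_add[OF g, symmetric])
      show "g y \<oplus>\<^bsub>P\<^esub> g y' = g y' \<oplus>\<^bsub>P\<^esub> g y"
        using y by (simp add: Pm.a_comm linear_closed[OF g])
      fix y'' assume "y'' \<in> carrier N"
      then show "g y \<oplus>\<^bsub>P\<^esub> g y' \<oplus>\<^bsub>P\<^esub> g y'' = g y \<oplus>\<^bsub>P\<^esub> (g y' \<oplus>\<^bsub>P\<^esub> g y'')"
        using y by (simp add: Pm.a_assoc linear_closed[OF g])
    next
      show "\<zero>\<^bsub>P\<^esub> \<in> g ` carrier N"
        using additive_zero[OF linear_additive[OF g]] N P by (metis Nm.zero_closed image_eqI module_abelian_group)
    next
      fix y assume y: "y \<in> carrier N"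
      then show "\<zero>\<^bsub>P\<^esub> \<oplus>\<^bsub>P\<^esub> g y = g y" by (simp add: linear_closed[OF g])
      have "g (\<ominus>\<^bsub>N\<^esub> y) \<oplus>\<^bsub>P\<^esub> g y = \<zero>\<^bsub>P\<^esub>"
        using y N P by (simp add: linear_closed[OF g] additive_minus[OF linear_additive[OF g]] Pm.l_neg)
      then show "\<exists>z \<in> carrier N. g z \<oplus>\<^bsub>P\<^esub> g y = \<zero>\<^bsub>P\<^esub>"
        using y by blast
    qed
    show "r \<odot>\<^bsub>?I\<^esub> y \<in> carrier ?I" if "r \<in> carrier k" "y \<in> carrier ?I" for r y
      using that by (auto simp: linear_smult[OF g, symmetric])
  qed (use k_cring linear_closed[OF g] in \<open>auto simp: Pm.smult_l_distr Pm.smult_r_distr Pm.smult_assoc1\<close>)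
  have gI: "g \<in> linear_maps k N ?I"
    using g by (auto simp: linear_maps_def hom_def)
  have iI: "(\<lambda>x. x) \<in> linear_maps k ?I P"
    using linear_closed[OF g] by (auto simp: linear_maps_def hom_def)
  have eI: "embeds TYPE(nat \<Rightarrow> 'b) (carrier ?I)"
    by (rule embeds_subset[OF _ P(2)]) (use linear_closed[OF g] in auto)
  have inj: "inj_on (tensor_map k P A n (\<lambda>x. x)) (carrier (tensor k ?I A n))"
    by (rule flat_inj[OF I eI P iI]) simp
  \<comment> \<open>A set-theoretic section of g. It need not be linear, but by \<open>wd\<close>
    its choice is invisible after q, and this makes the lift below balanced.\<close>
  define s where "s = inv_into (carrier N) g"
  have s: "s i \<in> carrier N \<and> g (s i) = i" if "i \<in> g ` carrier N" for i
    using inv_into_into[OF that] f_inv_into_f[OF that] by (simp add: s_def)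
  have wd: "q (pure_tensor k N A y as) = q (pure_tensor k N A y' as)"
    if y: "y \<in> carrier N" "y' \<in> carrier N" "g y = g y'" and as: "length as = n" "set as \<subseteq> carrier A" for y y' as
  proof -
    have "g (y \<ominus>\<^bsub>N\<^esub> y') = g y \<ominus>\<^bsub>P\<^esub> g y'"
      by (rule additive_diff[OF linear_additive[OF g] module_abelian_group[OF N(1)] module_abelian_group[OF P(1)] y(1,2)])
    then have "y \<ominus>\<^bsub>N\<^esub> y' \<in> f ` carrier M"
      unfolding ex using y linear_closed[OF g y(2)] by (simp add: a_minus_def[of P] Pm.r_neg)
    then obtain m where m: "m \<in> carrier M" "f m = y \<ominus>\<^bsub>N\<^esub> y'"
      by force
    have "y = f m \<oplus>\<^bsub>N\<^esub> y'"
      using y by (simp add: m a_minus_def Nm.a_assoc Nm.l_neg)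
    then have "pure_tensor k N A y as = tensor_map k N A n f (pure_tensor k M A m as) \<oplus>\<^bsub>?N\<^esub> pure_tensor k N A y' as"
      using pure_add_left[OF N(1) linear_closed[OF f m(1)] y(2) as] m(1) as by (simp add: map_pure[OF M(1) N(1) f])
    moreover have t: "tensor_map k N A n f (pure_tensor k M A m as) \<in> ?H"
      using m as M by simp
    then have t': "tensor_map k N A n f (pure_tensor k M A m as) \<in> carrier ?N"
      using subgroup.mem_carrier[OF H t] by simp
    with t have "q (tensor_map k N A n f (pure_tensor k M A m as)) = \<zero>\<^bsub>B\<^esub>"
      using q0 by blast
    ultimately show ?thesis
      using y as N t' additive_closed[OF q, of "pure_tensor k N A y' as"] by (simp add: additive_add[OF q])
  qed
  have bq: "balanced_map k N A n B (\<lambda>y as. q (pure_tensor k N A y as))"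
    by (rule balanced_compose[OF pure_balanced[OF N(1)] q])
  have sI: "s i \<in> carrier N" "g (s i) = i" if "i \<in> carrier ?I" for i
    using s that by simp_all
  have b: "balanced_map k ?I A n B (\<lambda>i as. q (pure_tensor k N A (s i) as))"
  proof (rule balanced_mapI)
    fix i as assume i: "i \<in> carrier ?I" and as: "length as = n" "set as \<subseteq> carrier A"
    show "q (pure_tensor k N A (s i) as) \<in> carrier B"
      by (rule balanced_mapD(1)[OF bq sI(1)[OF i] as])
    fix i' assume i': "i' \<in> carrier ?I"
    then have ii: "i \<oplus>\<^bsub>?I\<^esub> i' \<in> carrier ?I" by (rule module_closed(1)[OF I i])
    have "q (pure_tensor k N A (s (i \<oplus>\<^bsub>?I\<^esub> i')) as) = q (pure_tensor k N A (s i \<oplus>\<^bsub>N\<^esub> s i') as)"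
      by (rule wd[OF sI(1)[OF ii] _ _ as])
        (use sI[OF i] sI[OF i'] sI[OF ii] in \<open>simp_all add: N linear_add[OF g]\<close>)
    also have "\<dots> = q (pure_tensor k N A (s i) as) \<oplus>\<^bsub>B\<^esub> q (pure_tensor k N A (s i') as)"
      by (rule balanced_mapD(2)[OF bq sI(1)[OF i] sI(1)[OF i'] as])
    finally show "q (pure_tensor k N A (s (i \<oplus>\<^bsub>?I\<^esub> i')) as)
      = q (pure_tensor k N A (s i) as) \<oplus>\<^bsub>B\<^esub> q (pure_tensor k N A (s i') as)" .
  next
    fix i us a a' vs
    assume i: "i \<in> carrier ?I" and h: "a \<in> carrier A" "a' \<in> carrier A" "set us \<subseteq> carrier A" "set vs \<subseteq> carrier A"
      "n = length us + 1 + length vs"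
    show "q (pure_tensor k N A (s i) (us @ (a \<oplus>\<^bsub>A\<^esub> a') # vs))
       = q (pure_tensor k N A (s i) (us @ a # vs)) \<oplus>\<^bsub>B\<^esub> q (pure_tensor k N A (s i) (us @ a' # vs))"
      by (rule balanced_mapD(3)[OF bq sI(1)[OF i] h])
  next
    fix r i us a vs
    assume r: "r \<in> carrier k" and i: "i \<in> carrier ?I"
      and h: "a \<in> carrier A" "set us \<subseteq> carrier A" "set vs \<subseteq> carrier A" "n = length us + 1 + length vs"
    have ri: "r \<odot>\<^bsub>?I\<^esub> i \<in> carrier ?I" by (rule module_closed(2)[OF I r i])
    have "q (pure_tensor k N A (s (r \<odot>\<^bsub>?I\<^esub> i)) (us @ a # vs)) = q (pure_tensor k N A (r \<odot>\<^bsub>N\<^esub> s i) (us @ a # vs))"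
      by (rule wd[OF sI(1)[OF ri]])
        (use sI[OF i] sI[OF ri] r h in \<open>simp_all add: N linear_smult[OF g]\<close>)
    also have "\<dots> = q (pure_tensor k N A (s i) (us @ (r \<odot>\<^bsub>A\<^esub> a) # vs))"
      using pure_smult_slot[OF N(1) r sI(1)[OF i] h(1-3)] by simp
    finally show "q (pure_tensor k N A (s (r \<odot>\<^bsub>?I\<^esub> i)) (us @ a # vs))
       = q (pure_tensor k N A (s i) (us @ (r \<odot>\<^bsub>A\<^esub> a) # vs))" .
  qed
  note lift = tensor_lift_pure_additive[OF I B b]
  have "tensor_lift B (\<lambda>i as. q (pure_tensor k N A (s i) as)) (tensor_map k ?I A n g x) = q x"
  proof (rule additive_eqI[OF N(1) B additive_compose[OF map_additive[OF N(1) I gI] lift(1)] q _ x(1)])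
    fix y as assume y: "y \<in> carrier N" "length as = n" "set as \<subseteq> carrier A"
    then have "q (pure_tensor k N A (s (g y)) as) = q (pure_tensor k N A y as)"
      using s by (intro wd) auto
    then show "tensor_lift B (\<lambda>i as. q (pure_tensor k N A (s i) as)) (tensor_map k ?I A n g (pure_tensor k N A y as))
        = q (pure_tensor k N A y as)"
      using y lift(2)[of "g y" as] by (simp add: map_pure[OF N(1) I gI])
  qed
  moreover have "tensor_map k ?I A n g x = \<zero>\<^bsub>tensor k ?I A n\<^esub>"
  proof (rule inj_onD[OF inj])
    have "tensor_map k P A n (\<lambda>x. x) (tensor_map k ?I A n g x) = tensor_map k P A n g x"
      by (rule map_compose[OF N(1) I P(1) gI iI g _ x(1)]) simp
    also have "\<dots> = tensor_map k P A n (\<lambda>x. x) \<zero>\<^bsub>tensor k ?I A n\<^esub>"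
      using additive_zero[OF map_additive[OF I P(1) iI]] I P x(2) by simp
    finally show "tensor_map k P A n (\<lambda>x. x) (tensor_map k ?I A n g x)
      = tensor_map k P A n (\<lambda>x. x) \<zero>\<^bsub>tensor k ?I A n\<^esub>" .
    show "tensor_map k ?I A n g x \<in> carrier (tensor k ?I A n)"
      by (rule additive_closed[OF map_additive[OF N(1) I gI] x(1)])
    show "\<zero>\<^bsub>tensor k ?I A n\<^esub> \<in> carrier (tensor k ?I A n)"
      by (rule module_closed(5)[OF module_tensor[OF I]])
  qed
  ultimately have "q x = \<zero>\<^bsub>B\<^esub>"
    using additive_zero[OF lift(1)] I B by simp
  then show "x \<in> ?H" using q0 x(1) by blast
qed

end

section \<open>Constructing difference comodules\<close>

definition make_comodule ::
  "('k, 'x) module \<Rightarrow> ('x \<Rightarrow> 'x) \<Rightarrow> ('x \<Rightarrow> ('x, 'a) tensors) \<Rightarrow> ('k, 'a, 'x) difference_comodule"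
  where "make_comodule N \<sigma> \<nu> = \<lparr>carrier = carrier N, mult = undefined, one = undefined, ring.zero = \<zero>\<^bsub>N\<^esub>,
    add = add N, smult = smult N, mendo = \<sigma>, coaction = \<nu>\<rparr>"

lemma make_comodule_simps [simp]:
  "carrier (make_comodule N \<sigma> \<nu>) = carrier N" "add (make_comodule N \<sigma> \<nu>) = add N"
  "ring.zero (make_comodule N \<sigma> \<nu>) = ring.zero N" "smult (make_comodule N \<sigma> \<nu>) = smult N"
  "mendo (make_comodule N \<sigma> \<nu>) = \<sigma>" "coaction (make_comodule N \<sigma> \<nu>) = \<nu>"
  by (simp_all add: make_comodule_def)

text \<open>The tensor constructions read only the carrier, the addition and the scalar
  multiplication of the coefficients. Since the whole record occurs in the terms, tensors over a
  comodule and over its module still have to be identified by equations.\<close>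

lemma make_comodule_tensor [simp]:
  "tensor k (make_comodule N \<sigma> \<nu>) A n = tensor k N A n"
  "pure_tensor k (make_comodule N \<sigma> \<nu>) A = pure_tensor k N A"
  "tensor_map k (make_comodule N \<sigma> \<nu>) A n = tensor_map k N A n"
proof -
  have f: "tensor_free (make_comodule N \<sigma> \<nu>) A = tensor_free N A" by (simp add: fun_eq_iff tensor_free_def)
  have n: "tensor_null k (make_comodule N \<sigma> \<nu>) A = tensor_null k N A"
    by (simp add: fun_eq_iff tensor_null_def f tensor_relators_def)
  show p: "pure_tensor k (make_comodule N \<sigma> \<nu>) A = pure_tensor k N A"
    by (simp add: fun_eq_iff pure_tensor_def f n)
  show t: "tensor k (make_comodule N \<sigma> \<nu>) A n = tensor k N A n" for n
    by (simp add: tensor_def tensor_additive_def f n p)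
  show "tensor_map k (make_comodule N \<sigma> \<nu>) A n = tensor_map k N A n"
    by (simp add: fun_eq_iff tensor_map_def t p)
qed

lemma make_comodule_hom [simp]:
  "linear_maps k (make_comodule N \<sigma> \<nu>) P = linear_maps k N P"
  "linear_maps k P (make_comodule N \<sigma> \<nu>) = linear_maps k P N"
  by (simp_all add: linear_maps_def hom_def)

lemma make_comodule_additive [simp]:
  "additive_maps (make_comodule N \<sigma> \<nu>) P = additive_maps N P"
  "additive_maps P (make_comodule N \<sigma> \<nu>) = additive_maps P N"
  by (simp_all add: hom_def)

lemma make_comodule_module [simp]:
  assumes "module k N"
  shows "module k (make_comodule N \<sigma> \<nu>)"
proof -
  interpret module k N by fact
  show ?thesis
  proof (rule moduleI)
    show "cring k" by (rule module.axioms(1)[OF assms])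
    show "abelian_group (make_comodule N \<sigma> \<nu>)"
      by (rule abelian_groupI) (auto simp: M.a_ac intro: bexI[of _ "\<ominus>\<^bsub>N\<^esub> _"] M.l_neg)
  qed (simp_all add: smult_l_distr smult_r_distr smult_assoc1)
qed

context hopf_factor
begin

lemma make_difference_module:
  assumes "module k N" "\<sigma> \<in> additive_maps N N"
    and "\<And>r x. \<lbrakk>r \<in> carrier k; x \<in> carrier N\<rbrakk> \<Longrightarrow> \<sigma> (r \<odot>\<^bsub>N\<^esub> x) = rendo k r \<odot>\<^bsub>N\<^esub> \<sigma> x"
  shows "difference_module k (make_comodule N \<sigma> \<nu>)"
  by (intro difference_module.intro difference_module_axioms.intro difference_ring make_comodule_module)
    (use assms in \<open>simp_all add: hom_def\<close>)

text \<open>Cofaces and counit are natural, so the comodule laws hold on the image of any linear map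
  from a comodule that respects the coactions. Covering N by such images proves the laws for N
  without computing in its triple tensors.\<close>

lemma coassociative_image:
  assumes "coassociative_factor k A M \<mu>" "coaction_factor k A N \<nu>" and f: "f \<in> linear_maps k M N"
    and eq: "\<And>m. m \<in> carrier M \<Longrightarrow> \<nu> (f m) = tensor_map k N A (Suc 0) f (\<mu> m)" and m: "m \<in> carrier M"
  shows "coface N \<nu> (Suc 0) 0 (\<nu> (f m)) = coface N \<nu> (Suc 0) (Suc 0) (\<nu> (f m)) \<and>
    coaction_factor.counit_map A N (\<nu> (f m)) = f m"
proof -
  interpret M: coassociative_factor k A M \<mu> by fact
  interpret N: coaction_factor k A N \<nu> by fact
  have c: "coface N \<nu> (Suc 0) i (\<nu> (f m)) = tensor_map k N A (Suc (Suc 0)) f (coface M \<mu> (Suc 0) i (\<mu> m))"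
    if "i \<le> Suc 0" for i
    unfolding eq[OF m]
    by (rule coface_map[OF M.coaction_factor_axioms N.coaction_factor_axioms f eq, symmetric]) (use that m in simp_all)
  have u: "N.counit_map (tensor_map k N A (Suc 0) f x) = f (M.counit_map x)"
    if x: "x \<in> carrier (tensor k M A (Suc 0))" for x
  proof (rule tensor1_eqI[OF M.M_module _ additive_compose[OF map_additive[OF M.M_module N.M_module f] N.counit_map_additive]
        additive_compose[OF M.counit_map_additive linear_additive[OF f]] _ x])
    fix m a assume ma: "m \<in> carrier M" "a \<in> carrier A"
    have "counit A a \<in> carrier k"
      using linear_closed[OF difference_hopf_algebra.counit_linear[OF hopf] ma(2)] by (simp add: regular_module_def)
    then show "N.counit_map (tensor_map k N A (Suc 0) f (pure_tensor k M A m [a]))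
        = f (M.counit_map (pure_tensor k M A m [a]))"
      using ma by (simp add: map_pure[OF M.M_module N.M_module f] N.counit_map_pure M.counit_map_pure
          linear_closed[OF f] linear_smult[OF f])
  qed simp
  show ?thesis
    using c[of 0] c[of "Suc 0"] M.coface_coassociative[OF m] u[OF M.\<mu>_closed[OF m]] M.counital[OF m]
    by (simp add: eq[OF m])
qed

text \<open>The first premise of \<open>co\<close> gives its prover the locale in which cofaces and
  counit of the candidate can be computed; it is discharged here from linearity of \<nu>.\<close>

lemma make_difference_comodule:
  assumes N: "module k N" and \<sigma>: "\<sigma> \<in> additive_maps N N"
    and s: "\<And>r x. \<lbrakk>r \<in> carrier k; x \<in> carrier N\<rbrakk> \<Longrightarrow> \<sigma> (r \<odot>\<^bsub>N\<^esub> x) = rendo k r \<odot>\<^bsub>N\<^esub> \<sigma> x"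
    and \<nu>: "\<nu> \<in> linear_maps k N (tensor k N A (Suc 0))"
    and \<nu>\<sigma>: "\<And>x. x \<in> carrier N \<Longrightarrow> \<nu> (\<sigma> x) = tensor_endo k (make_comodule N \<sigma> \<nu>) A (Suc 0) (\<nu> x)"
    and co: "\<And>x. \<lbrakk>coaction_factor k A (make_comodule N \<sigma> \<nu>) \<nu>; x \<in> carrier N\<rbrakk> \<Longrightarrow>
      coface (make_comodule N \<sigma> \<nu>) \<nu> (Suc 0) 0 (\<nu> x) = coface (make_comodule N \<sigma> \<nu>) \<nu> (Suc 0) (Suc 0) (\<nu> x) \<and>
      coaction_factor.counit_map A (make_comodule N \<sigma> \<nu>) (\<nu> x) = x"
  shows "difference_comodule k A (make_comodule N \<sigma> \<nu>)"
proof -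
  interpret F: coaction_factor k A "make_comodule N \<sigma> \<nu>" \<nu>
    by (intro coaction_factor.intro coaction_factor_axioms.intro hopf_factor_axioms)
      (simp_all add: N \<nu>)
  have "coassociative_counital k A (make_comodule N \<sigma> \<nu>) \<nu>"
    unfolding F.coassociative_iff using co[OF F.coaction_factor_axioms] by simp
  then show ?thesis
    by (intro difference_comodule.intro difference_comodule_axioms.intro make_difference_module N \<sigma> s)
      (simp_all add: \<nu> \<nu>\<sigma>)
qed

section \<open>Comodule maps and transport of comodules\<close>

lemma comodule_maps_compose:
  assumes L: "difference_comodule k A L" and M: "difference_comodule k A M" and N: "difference_comodule k A N"
    and f: "f \<in> comodule_maps k A L M" and g: "g \<in> comodule_maps k A M N"
  shows "(\<lambda>x. g (f x)) \<in> comodule_maps k A L N"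
proof (rule comodule_mapsI)
  note fl = comodule_map_linear[OF f] and gl = comodule_map_linear[OF g]
  show gf: "(\<lambda>x. g (f x)) \<in> linear_maps k L N" by (rule linear_compose[OF fl gl])
  fix m assume m: "m \<in> carrier L"
  show "g (f (mendo L m)) = mendo N (g (f m))"
    using m by (simp add: comodule_map_mendo[OF f] comodule_map_mendo[OF g] linear_closed[OF fl])
  have c: "coaction L m \<in> carrier (tensor k L A (Suc 0))"
    by (rule linear_closed[OF comodule_coaction_linear[OF L] m])
  have "coaction N (g (f m)) = tensor_map k N A (Suc 0) g (tensor_map k M A (Suc 0) f (coaction L m))"
    using m by (simp add: comodule_map_coaction[OF f] comodule_map_coaction[OF g] linear_closed[OF fl])
  also have "\<dots> = tensor_map k N A (Suc 0) (\<lambda>x. g (f x)) (coaction L m)"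
    by (rule map_compose[OF _ _ _ fl gl gf _ c]) (simp_all add: L M N)
  finally show "coaction N (g (f m)) = tensor_map k N A (Suc 0) (\<lambda>x. g (f x)) (coaction L m)" .
qed

lemma comodule_maps_id:
  assumes "difference_comodule k A L"
  shows "(\<lambda>x. x) \<in> comodule_maps k A L L"
proof (rule comodule_mapsI)
  show l: "(\<lambda>x. x) \<in> linear_maps k L L" by (simp add: linear_mapsI additive_id)
  fix m assume "m \<in> carrier L"
  then have c: "coaction L m \<in> carrier (tensor k L A (Suc 0))"
    by (rule linear_closed[OF comodule_coaction_linear[OF assms]])
  show "coaction L m = tensor_map k L A (Suc 0) (\<lambda>x. x) (coaction L m)"
    by (rule map_id[OF _ l _ c, symmetric]) (simp_all add: assms)
qed simp

definition transport_comodule :: "('m \<Rightarrow> 't) \<Rightarrow> ('k, 'a, 'm) difference_comodule \<Rightarrow> ('k, 'a, 't) difference_comodule"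
  where "transport_comodule \<phi> X = make_comodule (transport_module \<phi> X)
    (\<lambda>x. \<phi> (mendo X (inv_into (carrier X) \<phi> x)))
    (\<lambda>x. tensor_map k (transport_module \<phi> X) A (Suc 0) \<phi> (coaction X (inv_into (carrier X) \<phi> x)))"

lemma
  assumes X: "difference_comodule k A X" and \<phi>: "inj_on \<phi> (carrier X)"
  shows transport_comodule: "difference_comodule k A (transport_comodule \<phi> X)"
    and transport_comodule_map: "\<phi> \<in> comodule_maps k A X (transport_comodule \<phi> X)"
    and transport_comodule_inv: "inv_into (carrier X) \<phi> \<in> comodule_maps k A (transport_comodule \<phi> X) X"
proof -
  let ?N = "transport_module \<phi> X" and ?\<psi> = "inv_into (carrier X) \<phi>"
  let ?\<sigma> = "\<lambda>x. \<phi> (mendo X (?\<psi> x))" and ?\<nu> = "\<lambda>x. tensor_map k ?N A (Suc 0) \<phi> (coaction X (?\<psi> x))"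
  let ?C = "make_comodule ?N ?\<sigma> ?\<nu>"
  have C: "transport_comodule \<phi> X = ?C" by (simp add: transport_comodule_def)
  have dX: "difference_module k X" and mX: "module k X" using X by simp_all
  note N = transport_module[OF mX \<phi>] and \<phi>1 = transport_linear[OF mX \<phi>] and \<psi>1 = transport_inv_linear[OF mX \<phi>]
  note \<phi>m = map_linear[OF mX N \<phi>1] and \<psi>m = map_linear[OF N mX \<psi>1]
  note inv = inv_into_f_f[OF \<phi>]
  have c: "coaction X m \<in> carrier (tensor k X A (Suc 0))" if "m \<in> carrier X" for m
    by (rule linear_closed[OF comodule_coaction_linear[OF X] that])
  have \<sigma>: "?\<sigma> \<in> additive_maps ?N ?N"
    by (rule additive_compose[OF additive_compose[OF linear_additive[OF \<psi>1] mendo_additive[OF dX]] linear_additive[OF \<phi>1]])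
  have s: "?\<sigma> (r \<odot>\<^bsub>?N\<^esub> x) = rendo k r \<odot>\<^bsub>?N\<^esub> ?\<sigma> x" if "r \<in> carrier k" "x \<in> carrier ?N" for r x
    using that by (simp add: linear_smult[OF \<psi>1] linear_closed[OF \<psi>1] linear_smult[OF \<phi>1] dX)
  have \<nu>: "?\<nu> \<in> linear_maps k ?N (tensor k ?N A (Suc 0))"
    by (rule linear_compose[OF linear_compose[OF \<psi>1 comodule_coaction_linear[OF X]] \<phi>m])
  have dC: "difference_module k ?C"
    by (rule make_difference_module[OF N \<sigma> s])
  have \<phi>C: "\<phi> \<in> linear_maps k X ?C" using \<phi>1 by simp
  have e: "tensor_map k ?N A (Suc 0) \<phi> (tensor_endo k X A (Suc 0) x)
      = tensor_endo k ?C A (Suc 0) (tensor_map k ?N A (Suc 0) \<phi> x)" if "x \<in> carrier (tensor k X A (Suc 0))" for x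
    using map_endo[OF dX dC \<phi>C _ that] by (simp add: inv)
  show XC: "difference_comodule k A (transport_comodule \<phi> X)"
    unfolding C
  proof (rule make_difference_comodule[OF N \<sigma> s \<nu>])
    fix x assume "x \<in> carrier ?N"
    then obtain m where m: "m \<in> carrier X" "x = \<phi> m" by (auto simp: transport_carrier)
    show "?\<nu> (?\<sigma> x) = tensor_endo k ?C A (Suc 0) (?\<nu> x)"
      using m dX by (simp add: inv comodule_coaction_mendo[OF X] e c)
    assume F: "coaction_factor k A ?C ?\<nu>"
    show "coface ?C ?\<nu> (Suc 0) 0 (?\<nu> x) = coface ?C ?\<nu> (Suc 0) (Suc 0) (?\<nu> x) \<and>
      coaction_factor.counit_map A ?C (?\<nu> x) = x"
      using coassociative_image[OF comodule_factor[OF X] F \<phi>C _ m(1)] m by (simp add: inv)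
  qed
  show "\<phi> \<in> comodule_maps k A X (transport_comodule \<phi> X)"
    unfolding C by (rule comodule_mapsI[OF \<phi>C]) (simp_all add: inv)
  show "?\<psi> \<in> comodule_maps k A (transport_comodule \<phi> X) X"
    unfolding C
  proof (rule comodule_mapsI)
    show "?\<psi> \<in> linear_maps k ?C X" using \<psi>1 by simp
    fix x assume "x \<in> carrier ?C"
    then obtain m where m: "m \<in> carrier X" "x = \<phi> m" by (auto simp: transport_carrier)
    show "?\<psi> (mendo ?C x) = mendo X (?\<psi> x)" using m dX by (simp add: inv)
    have i: "(\<lambda>x. x) \<in> linear_maps k X X" by (simp add: linear_mapsI additive_id)
    have "tensor_map k X A (Suc 0) ?\<psi> (tensor_map k ?N A (Suc 0) \<phi> (coaction X m))
      = tensor_map k X A (Suc 0) (\<lambda>x. x) (coaction X m)"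
      by (rule map_compose[OF mX N mX \<phi>1 \<psi>1 i _ c[OF m(1)]]) (simp add: inv)
    also have "\<dots> = coaction X m" by (rule map_id[OF mX i _ c[OF m(1)]]) simp
    finally show "coaction X (?\<psi> x) = tensor_map k X A (Suc 0) ?\<psi> (coaction ?C x)"
      using m by (simp add: inv)
  qed
qed

end

section \<open>Injective comodules\<close>

text \<open>The base ring has to embed as well, because an extension of the unit comodule by J has
  the elements of J \<times> k.\<close>

locale comodule_test = hopf_factor k A + flat_factor k A t b0 b1
  for k :: "'k difference_ring" and A :: "('k, 'a) difference_hopf_algebra"
    and t :: "(nat \<Rightarrow> 'b) itself" and b0 b1 :: 'b +
  assumes k_embeds: "embeds TYPE(nat \<Rightarrow> 'b) (carrier k)"
begin

text \<open>The extension problem is moved to copies of X and Y over the test type, and its solution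
  is restricted along the embedding of Y. The injective object J stays in its own type, since only
  test objects are confined to the test type.\<close>

lemma injective_extension:
  assumes J: "injective_comodule TYPE(nat \<Rightarrow> 'b) k A J"
    and X: "difference_comodule k A X" "embeds TYPE(nat \<Rightarrow> 'b) (carrier X)"
    and Y: "difference_comodule k A Y" "embeds TYPE(nat \<Rightarrow> 'b) (carrier Y)"
    and i: "i \<in> comodule_maps k A X Y" "inj_on i (carrier X)" and f: "f \<in> comodule_maps k A X J"
  obtains g where "g \<in> comodule_maps k A Y J" "\<And>x. x \<in> carrier X \<Longrightarrow> g (i x) = f x"
proof -
  obtain \<phi> :: "_ \<Rightarrow> nat \<Rightarrow> 'b" and \<psi> :: "_ \<Rightarrow> nat \<Rightarrow> 'b" where \<phi>: "inj_on \<phi> (carrier X)" and \<psi>: "inj_on \<psi> (carrier Y)"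
    using X(2) Y(2) by (auto simp: embeds_def)
  let ?X = "transport_comodule \<phi> X" and ?Y = "transport_comodule \<psi> Y" and ?\<phi>' = "inv_into (carrier X) \<phi>"
  have dJ: "difference_comodule k A J" using J by (simp add: injective_comodule_def)
  note cX = transport_comodule[OF X(1) \<phi>] and cY = transport_comodule[OF Y(1) \<psi>]
  note mX = transport_comodule_inv[OF X(1) \<phi>] and mY = transport_comodule_map[OF Y(1) \<psi>]
  have carX: "carrier ?X = \<phi> ` carrier X" by (simp add: transport_comodule_def transport_carrier)
  have i': "(\<lambda>x. \<psi> (i (?\<phi>' x))) \<in> comodule_maps k A ?X ?Y"
    by (rule comodule_maps_compose[OF cX Y(1) cY comodule_maps_compose[OF cX X(1) Y(1) mX i(1)] mY])
  have f': "(\<lambda>x. f (?\<phi>' x)) \<in> comodule_maps k A ?X J"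
    by (rule comodule_maps_compose[OF cX X(1) dJ mX f])
  have ic: "i x \<in> carrier Y" if "x \<in> carrier X" for x
    by (rule linear_closed[OF comodule_map_linear[OF i(1)] that])
  have inj: "inj_on (\<lambda>x. \<psi> (i (?\<phi>' x))) (carrier ?X)"
  proof (rule inj_onI)
    fix x y assume "x \<in> carrier ?X" "y \<in> carrier ?X" and eq: "\<psi> (i (?\<phi>' x)) = \<psi> (i (?\<phi>' y))"
    then obtain m m' where m: "m \<in> carrier X" "x = \<phi> m" "m' \<in> carrier X" "y = \<phi> m'"
      by (auto simp: carX)
    with eq have "\<psi> (i m) = \<psi> (i m')" by (simp add: inv_into_f_f[OF \<phi>])
    then show "x = y"
      using inj_onD[OF \<psi>] inj_onD[OF i(2)] ic m by blast
  qed
  have "\<exists>g \<in> comodule_maps k A ?Y J. \<forall>x \<in> carrier ?X. g (\<psi> (i (?\<phi>' x))) = f (?\<phi>' x)"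
    using J i' f' cX cY inj unfolding injective_comodule_def by (elim conjE allE ballE impE) auto
  then obtain g where g: "g \<in> comodule_maps k A ?Y J" "\<And>x. x \<in> carrier ?X \<Longrightarrow> g (\<psi> (i (?\<phi>' x))) = f (?\<phi>' x)"
    by blast
  show ?thesis
  proof (rule that)
    show "(\<lambda>y. g (\<psi> y)) \<in> comodule_maps k A Y J"
      by (rule comodule_maps_compose[OF Y(1) cY dJ mY g(1)])
    fix x assume x: "x \<in> carrier X"
    then show "g (\<psi> (i x)) = f x"
      using g(2)[of "\<phi> x"] by (simp add: carX inv_into_f_f[OF \<phi>])
  qed
qed


text \<open>The cofree comodule \<open>J \<otimes> A\<close>, into which \<open>J\<close> embeds by its coaction.\<close>

definition cofree :: "('k, 'a, 'm) difference_comodule \<Rightarrow> ('k, 'a, ('m, 'a) tensors) difference_comodule"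
  where "cofree J = make_comodule (tensor k J A (Suc 0)) (tensor_endo k J A (Suc 0))
    (\<lambda>x. retensor J (Suc 0) (coface J (coaction J) (Suc 0) (Suc 0) x))"

context
  fixes J :: "('k, 'a, 'm) difference_comodule"
  assumes J: "difference_comodule k A J"
begin

interpretation J: coassociative_factor k A J "coaction J"
  using J by (rule comodule_factor)

abbreviation (input) "JA \<equiv> tensor k J A (Suc 0)"
abbreviation (input) "\<nu> \<equiv> (\<lambda>x. retensor J (Suc 0) (coface J (coaction J) (Suc 0) (Suc 0) x))"

lemma J_difference_module: "difference_module k J" and J_module: "module k J"
  using J by simp_all

lemma cofree_coaction_linear: "\<nu> \<in> linear_maps k JA (tensor k JA A (Suc 0))"
  by (rule linear_compose[OF J.coface_linear retensor_linear[OF J_module]])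

text \<open>For fixed m, sending a to m \<otimes> a respects the coactions of A and of J \<otimes>
  A. The laws of the cofree comodule are deduced from those of the Hopf algebra along these
  maps.\<close>

lemma cofree_coaction_pure:
  assumes m: "m \<in> carrier J" and a: "a \<in> carrier A"
  shows "\<nu> (pure_tensor k J A m [a]) = tensor_map k JA A (Suc 0) (\<lambda>b. pure_tensor k J A m [b]) (comult A a)"
proof -
  have p: "pure_tensor k J A m [] \<in> carrier (tensor k J A 0)" using m by simp
  have s: "pure_tensor k J A m [b] = snoc J 0 (pure_tensor k J A m []) b" if "b \<in> carrier A" for b
    using snoc_pure[OF J_module that m, of "[]" 0] by simp
  have T: "module k JA" by simp
  have "retensor J (Suc 0) (double J 0 (pure_tensor k J A m []) D)
     = tensor_map k JA A (Suc 0) (\<lambda>b. pure_tensor k J A m [b]) D" if D: "D \<in> carrier (tensor k A A (Suc 0))" for D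
  proof (rule tensor1_eqI[OF A_module _ additive_compose[OF double_additive[OF J_module p] retensor_additive[OF J_module]]
        map_additive[OF A_module T pure_linear[OF J_module m]] _ D])
    fix b c assume bc: "b \<in> carrier A" "c \<in> carrier A"
    then show "retensor J (Suc 0) (double J 0 (pure_tensor k J A m []) (pure_tensor k A A b [c]))
        = tensor_map k JA A (Suc 0) (\<lambda>b. pure_tensor k J A m [b]) (pure_tensor k A A b [c])"
      using m p by (simp add: double_pure retensor_snoc map_pure[OF A_module T pure_linear[OF J_module m]] s[symmetric])
  qed simp
  then show ?thesis
    using a p by (simp add: s[OF a] J.coface_comult)
qed

lemma cofree_comodule: "difference_comodule k A (cofree J)"
  unfolding cofree_def
proof (rule make_difference_comodule[OF module_tensor[OF J_module] endo_additive[OF J_difference_module]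
      endo_smult[OF J_difference_module] cofree_coaction_linear])
  let ?C = "make_comodule JA (tensor_endo k J A (Suc 0)) \<nu>"
  have dC: "difference_module k ?C"
    by (rule make_difference_module[OF module_tensor[OF J_module] endo_additive[OF J_difference_module]
        endo_smult[OF J_difference_module]])
  have e: "retensor J (Suc 0) (tensor_endo k J A (Suc (Suc 0)) x) = tensor_endo k ?C A (Suc 0) (retensor J (Suc 0) x)"
    if x: "x \<in> carrier (tensor k J A (Suc (Suc 0)))" for x
  proof (rule snoc_eqI[OF J_module _ additive_compose[OF endo_additive[OF J_difference_module] retensor_additive[OF J_module]]
        additive_compose[OF retensor_additive[OF J_module] endo_additive[OF dC, unfolded make_comodule_tensor]] _ x])
    fix y a assume "y \<in> carrier JA" "a \<in> carrier A"
    then show "retensor J (Suc 0) (tensor_endo k J A (Suc (Suc 0)) (snoc J (Suc 0) y a))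
        = tensor_endo k ?C A (Suc 0) (retensor J (Suc 0) (snoc J (Suc 0) y a))"
      using endo_pure[OF dC, of y "[a]" "Suc 0"]
      by (simp add: endo_snoc J_difference_module retensor_snoc)
  qed simp
  show "\<nu> (tensor_endo k J A (Suc 0) x) = tensor_endo k ?C A (Suc 0) (\<nu> x)" if x: "x \<in> carrier JA" for x
    using coface_endo[OF J.coaction_factor_axioms J_difference_module comodule_coaction_mendo[OF J] _ x, of "Suc 0"]
      e[OF J.coface_closed[OF x, of "Suc 0"]] by simp
  assume F: "coaction_factor k A ?C \<nu>"
  interpret F: coaction_factor k A ?C \<nu> by (rule F)
  have c: "(\<lambda>x. coface ?C \<nu> (Suc 0) i (\<nu> x)) \<in> additive_maps JA (tensor k JA A (Suc (Suc 0)))" for i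
    using additive_compose[OF linear_additive[OF cofree_coaction_linear], of "coface ?C \<nu> (Suc 0) i"]
      F.coface_additive[of "Suc 0" i] by simp
  have u: "(\<lambda>x. F.counit_map (\<nu> x)) \<in> additive_maps JA JA"
    using F.counit_map_additive unfolding make_comodule_additive make_comodule_tensor
    by (rule additive_compose[OF linear_additive[OF cofree_coaction_linear]])
  \<comment> \<open>The elements m \<otimes> a for varying m are the images of the maps from
    \<open>A\<close> just described, and they generate J \<otimes> A; both laws are inherited from
    \<open>comult\<close>.\<close>
  have at: "coface ?C \<nu> (Suc 0) 0 (\<nu> (pure_tensor k J A m [a])) = coface ?C \<nu> (Suc 0) (Suc 0) (\<nu> (pure_tensor k J A m [a]))
      \<and> F.counit_map (\<nu> (pure_tensor k J A m [a])) = pure_tensor k J A m [a]"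
    if m: "m \<in> carrier J" and a: "a \<in> carrier A" for m a
    using coassociative_image[OF A_coassociative_factor F, of "\<lambda>b. pure_tensor k J A m [b]" a]
      pure_linear[OF J_module m] cofree_coaction_pure[OF m] a by simp
  show "coface ?C \<nu> (Suc 0) 0 (\<nu> x) = coface ?C \<nu> (Suc 0) (Suc 0) (\<nu> x) \<and> F.counit_map (\<nu> x) = x"
    if x: "x \<in> carrier JA" for x
  proof
    show "coface ?C \<nu> (Suc 0) 0 (\<nu> x) = coface ?C \<nu> (Suc 0) (Suc 0) (\<nu> x)"
      by (rule tensor1_eqI[OF J_module _ c c _ x]) (simp_all add: at)
    show "F.counit_map (\<nu> x) = x"
      by (rule tensor1_eqI[OF J_module _ u additive_id _ x]) (simp_all add: at)
  qed
qed

text \<open>Once the coface of index 0 is recognized as \<mu> \<otimes> id, respecting the coactions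
  is the coassociativity of J.\<close>

lemma coaction_cofree_map: "coaction J \<in> comodule_maps k A J (cofree J)"
proof (rule comodule_mapsI)
  show "coaction J \<in> linear_maps k J (cofree J)"
    using comodule_coaction_linear[OF J] by (simp add: cofree_def)
  fix m assume m: "m \<in> carrier J"
  show "coaction J (mendo J m) = mendo (cofree J) (coaction J m)"
    by (simp add: cofree_def comodule_coaction_mendo[OF J m])
  have x: "coaction J m \<in> carrier JA" using m by simp
  have "retensor J (Suc 0) (coface J (coaction J) (Suc 0) 0 x) = tensor_map k JA A (Suc 0) (coaction J) x"
    if x: "x \<in> carrier JA" for x
  proof (rule tensor1_eqI[OF J_module _ additive_compose[OF J.coface_additive retensor_additive[OF J_module]]
        map_additive[OF J_module module_tensor[OF J_module] J.\<mu>_linear] _ x])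
    fix n a assume n: "n \<in> carrier J" and a: "a \<in> carrier A"
    have "coface J (coaction J) (Suc 0) 0 (pure_tensor k J A n [a]) = snoc J (Suc 0) (coaction J n) a"
      using J.coface_pure_first[OF n, of "[a]" "Suc 0"] a by (simp add: snoc_def)
    then show "retensor J (Suc 0) (coface J (coaction J) (Suc 0) 0 (pure_tensor k J A n [a]))
        = tensor_map k JA A (Suc 0) (coaction J) (pure_tensor k J A n [a])"
      using n a by (simp add: retensor_snoc map_pure[OF J_module module_tensor[OF J_module] J.\<mu>_linear])
  qed simp
  from this[OF x] show "coaction (cofree J) (coaction J m) = tensor_map k (cofree J) A (Suc 0) (coaction J) (coaction J m)"
    using J.coface_coassociative[OF m] by (simp add: cofree_def)
qed

lemma coaction_inj: "inj_on (coaction J) (carrier J)"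
  by (rule inj_on_inverseI[of _ J.counit_map]) (rule J.counital)

text \<open>The identity of J is extended along its coaction, a monomorphism by the counit law. The
  cofree comodule and this monomorphism carry \<sigma>, so injectivity among difference comodules
  applies.\<close>

lemma injective_contraction:
  assumes inj: "injective_comodule TYPE(nat \<Rightarrow> 'b) k A J" and emb: "embeds TYPE(nat \<Rightarrow> 'b) (carrier J)"
  obtains \<rho> where "contraction k A J (coaction J) \<rho>"
proof -
  have emb': "embeds TYPE(nat \<Rightarrow> 'b) (carrier (cofree J))"
    using embeds_tensors[OF emb, of "Suc 0"] by (simp add: cofree_def)
  obtain \<rho> where \<rho>: "\<rho> \<in> comodule_maps k A (cofree J) J" "\<And>m. m \<in> carrier J \<Longrightarrow> \<rho> (coaction J m) = m"
    by (rule injective_extension[OF inj J emb cofree_comodule emb' coaction_cofree_map coaction_inj comodule_maps_id[OF J]])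
      (rule that, assumption+)
  have \<rho>l: "\<rho> \<in> linear_maps k JA J"
    using comodule_map_linear[OF \<rho>(1)] by (simp add: cofree_def)
  have "contraction k A J (coaction J) \<rho>"
  proof (intro contraction.intro contraction_axioms.intro J.coassociative_factor_axioms)
    show "\<rho> \<in> linear_maps k JA J" by (rule \<rho>l)
    show "\<rho> (coaction J m) = m" if "m \<in> carrier J" for m using \<rho>(2) that .
    fix m a assume m: "m \<in> carrier J" and a: "a \<in> carrier A"
    note p = pure_linear[OF J_module m]
    have "coaction J (\<rho> (pure_tensor k J A m [a])) = tensor_map k J A (Suc 0) \<rho> (\<nu> (pure_tensor k J A m [a]))"
      using comodule_map_coaction[OF \<rho>(1), of "pure_tensor k J A m [a]"] m a by (simp add: cofree_def)
    also have "\<dots> = tensor_map k J A (Suc 0) (\<lambda>b. \<rho> (pure_tensor k J A m [b])) (comult A a)"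
      unfolding cofree_coaction_pure[OF m a]
      by (rule map_compose[OF A_module module_tensor[OF J_module] J_module p \<rho>l linear_compose[OF p \<rho>l] _ comult_closed[OF a]]) simp
    finally show "coaction J (\<rho> (pure_tensor k J A m [a]))
      = tensor_map k J A (Suc 0) (\<lambda>b. \<rho> (pure_tensor k J A m [b])) (comult A a)" .
  qed
  then show ?thesis by (rule that)
qed

lemma injective_hochschild_exact:
  assumes inj: "injective_comodule TYPE(nat \<Rightarrow> 'b) k A J" and emb: "embeds TYPE(nat \<Rightarrow> 'b) (carrier J)"
    and x: "x \<in> carrier (tensor k J A (Suc n))"
    and z: "hochschild_diff k A J (Suc n) x = \<zero>\<^bsub>tensor k J A (Suc (Suc n))\<^esub>"
  shows "\<exists>y \<in> carrier (tensor k J A n). x = hochschild_diff k A J n y"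
proof -
  obtain \<rho> where "contraction k A J (coaction J) \<rho>"
    by (rule injective_contraction[OF inj emb])
  then interpret contraction k A J "coaction J" \<rho> .
  have "J.cobar (Suc n) x = \<zero>\<^bsub>tensor k J A (Suc (Suc n))\<^esub>"
    using z x by (simp add: hochschild_diff_eq[OF J])
  from cobar_exact[OF x this] show ?thesis
    by (auto simp: hochschild_diff_eq[OF J])
qed

end


section \<open>Surjectivity of \<open>\<sigma> - 1\<close> on the invariants of an injective comodule\<close>

text \<open>An invariant \<open>x\<close> of \<open>J\<close> defines the extension of the trivial comodule by \<open>J\<close> in which
  \<open>\<sigma> (0, 1) = (x, 1)\<close>; a retraction of it onto \<open>J\<close> maps \<open>(0, 1)\<close> to an invariant \<open>y\<close>
  with \<open>\<sigma> y = x + y\<close>.\<close>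

definition extension_module :: "('k, 'a, 'm) difference_comodule \<Rightarrow> ('k, 'm \<times> 'k) module"
  where "extension_module J = \<lparr>carrier = carrier J \<times> carrier k, mult = undefined, one = undefined,
    ring.zero = (\<zero>\<^bsub>J\<^esub>, \<zero>\<^bsub>k\<^esub>), add = (\<lambda>(j, r) (j', r'). (j \<oplus>\<^bsub>J\<^esub> j', r \<oplus>\<^bsub>k\<^esub> r')),
    smult = (\<lambda>s (j, r). (s \<odot>\<^bsub>J\<^esub> j, s \<otimes>\<^bsub>k\<^esub> r))\<rparr>"

definition extension_comodule :: "('k, 'a, 'm) difference_comodule \<Rightarrow> 'm \<Rightarrow> ('k, 'a, 'm \<times> 'k) difference_comodule"
  where "extension_comodule J x = (let E = extension_module J in make_comodule E
    (\<lambda>(j, r). (mendo J j \<oplus>\<^bsub>J\<^esub> rendo k r \<odot>\<^bsub>J\<^esub> x, rendo k r))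
    (\<lambda>(j, r). tensor_map k E A (Suc 0) (\<lambda>j. (j, \<zero>\<^bsub>k\<^esub>)) (coaction J j)
      \<oplus>\<^bsub>tensor k E A (Suc 0)\<^esub> pure_tensor k E A (\<zero>\<^bsub>J\<^esub>, r) [\<one>\<^bsub>A\<^esub>]))"

context
  fixes J :: "('k, 'a, 'm) difference_comodule" and x
  assumes J: "difference_comodule k A J"
    and x: "x \<in> carrier J" "coaction J x = pure_tensor k J A x [\<one>\<^bsub>A\<^esub>]"
begin

interpretation J: coassociative_factor k A J "coaction J"
  using J by (rule comodule_factor)

interpretation Jm: module k J using J by simp

abbreviation (input) "E \<equiv> extension_module J"
abbreviation (input) "i1 \<equiv> (\<lambda>j. (j, \<zero>\<^bsub>k\<^esub>))"
abbreviation (input) "\<sigma>E \<equiv> (\<lambda>(j, r). (mendo J j \<oplus>\<^bsub>J\<^esub> rendo k r \<odot>\<^bsub>J\<^esub> x, rendo k r))"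
abbreviation (input) "\<nu>E \<equiv> (\<lambda>(j, r). tensor_map k E A (Suc 0) i1 (coaction J j)
      \<oplus>\<^bsub>tensor k E A (Suc 0)\<^esub> pure_tensor k E A (\<zero>\<^bsub>J\<^esub>, r) [\<one>\<^bsub>A\<^esub>])"

lemma extension_simps:
  "carrier E = carrier J \<times> carrier k" "\<zero>\<^bsub>E\<^esub> = (\<zero>\<^bsub>J\<^esub>, \<zero>\<^bsub>k\<^esub>)"
  "(j, r) \<oplus>\<^bsub>E\<^esub> (j', r') = (j \<oplus>\<^bsub>J\<^esub> j', r \<oplus>\<^bsub>k\<^esub> r')" "s \<odot>\<^bsub>E\<^esub> (j, r) = (s \<odot>\<^bsub>J\<^esub> j, s \<otimes>\<^bsub>k\<^esub> r)"
  by (simp_all add: extension_module_def)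

lemma extension_module_module: "module k E"
proof (rule moduleI)
  show "abelian_group E"
  proof (rule abelian_groupI)
    fix y assume "y \<in> carrier E"
    then obtain j r where y: "y = (j, r)" "j \<in> carrier J" "r \<in> carrier k" by (auto simp: extension_simps)
    show "\<exists>z \<in> carrier E. z \<oplus>\<^bsub>E\<^esub> y = \<zero>\<^bsub>E\<^esub>"
      by (rule bexI[of _ "(\<ominus>\<^bsub>J\<^esub> j, \<ominus>\<^bsub>k\<^esub> r)"]) (use y in \<open>simp_all add: extension_simps Jm.M.l_neg Jm.R.l_neg\<close>)
  qed (auto simp: extension_simps Jm.M.a_ac Jm.R.a_ac)
qed (auto simp: extension_simps k_cring Jm.smult_l_distr Jm.smult_r_distr Jm.smult_assoc1 Jm.R.l_distr Jm.R.r_distr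
    Jm.R.m_assoc)

lemma i1_linear: "i1 \<in> linear_maps k J E"
  by (intro linear_mapsI additive_mapsI) (simp_all add: extension_simps)

lemma rendo_simps:
  "\<lbrakk>r \<in> carrier k; s \<in> carrier k\<rbrakk> \<Longrightarrow> rendo k (r \<oplus>\<^bsub>k\<^esub> s) = rendo k r \<oplus>\<^bsub>k\<^esub> rendo k s"
  "\<lbrakk>r \<in> carrier k; s \<in> carrier k\<rbrakk> \<Longrightarrow> rendo k (r \<otimes>\<^bsub>k\<^esub> s) = rendo k r \<otimes>\<^bsub>k\<^esub> rendo k s"
  "rendo k \<one>\<^bsub>k\<^esub> = \<one>\<^bsub>k\<^esub>" "rendo k \<zero>\<^bsub>k\<^esub> = \<zero>\<^bsub>k\<^esub>"
proof -
  note h = difference_ring.rendo_hom[OF difference_ring]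
  show a: "\<lbrakk>r \<in> carrier k; s \<in> carrier k\<rbrakk> \<Longrightarrow> rendo k (r \<oplus>\<^bsub>k\<^esub> s) = rendo k r \<oplus>\<^bsub>k\<^esub> rendo k s" for r s
    by (rule ring_hom_add[OF h])
  show "\<lbrakk>r \<in> carrier k; s \<in> carrier k\<rbrakk> \<Longrightarrow> rendo k (r \<otimes>\<^bsub>k\<^esub> s) = rendo k r \<otimes>\<^bsub>k\<^esub> rendo k s"
    by (rule ring_hom_mult[OF h])
  show "rendo k \<one>\<^bsub>k\<^esub> = \<one>\<^bsub>k\<^esub>" by (rule ring_hom_one[OF h])
  have "rendo k \<in> additive_maps k k" by (rule additive_mapsI) (simp_all add: a)
  then show "rendo k \<zero>\<^bsub>k\<^esub> = \<zero>\<^bsub>k\<^esub>"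
    by (rule additive_zero) (rule Jm.R.abelian_group_axioms)+
qed

lemma \<sigma>E_additive: "\<sigma>E \<in> additive_maps E E"
  using x J by (intro additive_mapsI) (auto simp: extension_simps rendo_simps Jm.smult_l_distr Jm.M.a_ac)

lemma \<sigma>E_smult: "\<lbrakk>s \<in> carrier k; y \<in> carrier E\<rbrakk> \<Longrightarrow> \<sigma>E (s \<odot>\<^bsub>E\<^esub> y) = rendo k s \<odot>\<^bsub>E\<^esub> \<sigma>E y"
  using x J by (auto simp: extension_simps rendo_simps Jm.smult_r_distr Jm.smult_assoc1)

lemma \<nu>E_linear: "\<nu>E \<in> linear_maps k E (tensor k E A (Suc 0))"
proof -
  let ?T = "tensor k E A (Suc 0)"
  have T: "module k ?T" by (simp add: extension_module_module)
  interpret T: module k ?T by (rule T)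
  have f: "fst \<in> linear_maps k E J"
    by (intro linear_mapsI additive_mapsI) (auto simp: extension_simps)
  have s: "(\<lambda>y. (\<zero>\<^bsub>J\<^esub>, snd y)) \<in> linear_maps k E E"
    by (intro linear_mapsI additive_mapsI) (auto simp: extension_simps)
  have 1: "(\<lambda>y. tensor_map k E A (Suc 0) i1 (coaction J (fst y))) \<in> linear_maps k E ?T"
    by (rule linear_compose[OF linear_compose[OF f J.\<mu>_linear] map_linear[OF J.M_module extension_module_module i1_linear]])
  have 2: "(\<lambda>y. pure_tensor k E A (\<zero>\<^bsub>J\<^esub>, snd y) [\<one>\<^bsub>A\<^esub>]) \<in> linear_maps k E ?T"
    by (rule linear_compose[OF s pure_linear_left[OF extension_module_module one_closed]])
  have "(\<lambda>y. tensor_map k E A (Suc 0) i1 (coaction J (fst y)) \<oplus>\<^bsub>?T\<^esub> pure_tensor k E A (\<zero>\<^bsub>J\<^esub>, snd y) [\<one>\<^bsub>A\<^esub>])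
      \<in> linear_maps k E ?T"
  proof (rule linear_mapsI)
    show "(\<lambda>y. tensor_map k E A (Suc 0) i1 (coaction J (fst y)) \<oplus>\<^bsub>?T\<^esub> pure_tensor k E A (\<zero>\<^bsub>J\<^esub>, snd y) [\<one>\<^bsub>A\<^esub>])
      \<in> additive_maps E ?T"
      by (rule additive_add_map[OF T.M.abelian_group_axioms linear_additive[OF 1] linear_additive[OF 2]])
    fix r y assume r: "r \<in> carrier k" and y: "y \<in> carrier E"
    show "tensor_map k E A (Suc 0) i1 (coaction J (fst (r \<odot>\<^bsub>E\<^esub> y))) \<oplus>\<^bsub>?T\<^esub> pure_tensor k E A (\<zero>\<^bsub>J\<^esub>, snd (r \<odot>\<^bsub>E\<^esub> y)) [\<one>\<^bsub>A\<^esub>]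
      = r \<odot>\<^bsub>?T\<^esub> (tensor_map k E A (Suc 0) i1 (coaction J (fst y)) \<oplus>\<^bsub>?T\<^esub> pure_tensor k E A (\<zero>\<^bsub>J\<^esub>, snd y) [\<one>\<^bsub>A\<^esub>])"
      using linear_smult[OF 1 r y] linear_smult[OF 2 r y] T.smult_r_distr[OF r linear_closed[OF 1 y] linear_closed[OF 2 y]]
      by simp
  qed
  then show ?thesis by (simp add: case_prod_unfold)
qed

lemma \<nu>E_i1: "j \<in> carrier J \<Longrightarrow> \<nu>E (j, \<zero>\<^bsub>k\<^esub>) = tensor_map k E A (Suc 0) i1 (coaction J j)"
proof -
  assume j: "j \<in> carrier J"
  let ?T = "tensor k E A (Suc 0)"
  interpret T: abelian_group ?T by (simp add: extension_module_module)
  have "pure_tensor k E A (\<zero>\<^bsub>J\<^esub>, \<zero>\<^bsub>k\<^esub>) [\<one>\<^bsub>A\<^esub>] = \<zero>\<^bsub>?T\<^esub>"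
    using pure_zero[OF extension_module_module, of "[\<one>\<^bsub>A\<^esub>]" "Suc 0"] by (simp add: extension_simps)
  then show ?thesis
    using j additive_closed[OF map_additive[OF J.M_module extension_module_module i1_linear], of "coaction J j" "Suc 0"]
    by simp
qed

lemma \<nu>E_i2:
  assumes r: "r \<in> carrier k"
  shows "\<nu>E (\<zero>\<^bsub>J\<^esub>, r) = pure_tensor k E A (\<zero>\<^bsub>J\<^esub>, r) [\<one>\<^bsub>A\<^esub>]"
proof -
  let ?T = "tensor k E A (Suc 0)"
  interpret T: abelian_group ?T by (simp add: extension_module_module)
  have "coaction J \<zero>\<^bsub>J\<^esub> = \<zero>\<^bsub>tensor k J A (Suc 0)\<^esub>"
    by (rule additive_zero[OF linear_additive[OF J.\<mu>_linear]]) simp_all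
  moreover have "tensor_map k E A (Suc 0) i1 \<zero>\<^bsub>tensor k J A (Suc 0)\<^esub> = \<zero>\<^bsub>?T\<^esub>"
    by (rule additive_zero[OF map_additive[OF J.M_module extension_module_module i1_linear]])
      (simp_all add: extension_module_module)
  moreover have "pure_tensor k E A (\<zero>\<^bsub>J\<^esub>, r) [\<one>\<^bsub>A\<^esub>] \<in> carrier ?T"
    using r by (simp add: extension_module_module extension_simps)
  ultimately show ?thesis by simp
qed

lemma extension_split:
  "\<lbrakk>j \<in> carrier J; r \<in> carrier k\<rbrakk> \<Longrightarrow> (j, r) = (j, \<zero>\<^bsub>k\<^esub>) \<oplus>\<^bsub>E\<^esub> (\<zero>\<^bsub>J\<^esub>, r)"
  by (simp add: extension_simps)

lemma extension_comodule_eq: "extension_comodule J x = make_comodule E \<sigma>E \<nu>E"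
  by (simp add: extension_comodule_def Let_def)

text \<open>Each law is checked on the two summands, which generate: on (j, 0) it is inherited from
  J along the inclusion, and on (0, r) the coaction appends a unit. The summands interact only
  through \<sigma>.\<close>

lemma extension_comodule: "difference_comodule k A (extension_comodule J x)"
  unfolding extension_comodule_eq
proof (rule make_difference_comodule[OF extension_module_module \<sigma>E_additive \<sigma>E_smult \<nu>E_linear])
  let ?C = "make_comodule E \<sigma>E \<nu>E" and ?T = "tensor k E A (Suc 0)"
  note mE = extension_module_module
  interpret T: abelian_group ?T by (simp add: mE)
  have dC: "difference_module k ?C"
    by (rule make_difference_module[OF mE \<sigma>E_additive \<sigma>E_smult])
  have i1C: "i1 \<in> linear_maps k J ?C" using i1_linear by simp
  have eadd: "tensor_endo k ?C A (Suc 0) \<in> additive_maps ?T ?T"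
    using endo_additive[OF dC] unfolding make_comodule_tensor .
  have i1s: "i1 (mendo J j) = mendo ?C (i1 j)" if "j \<in> carrier J" for j
    using that x J by (simp add: rendo_simps)
  have i1E: "i1 j \<in> carrier E" if "j \<in> carrier J" for j
    using that by (simp add: extension_simps)
  have i2E: "(\<zero>\<^bsub>J\<^esub>, r) \<in> carrier E" if "r \<in> carrier k" for r
    using that by (simp add: extension_simps)
  note \<sigma>c = additive_closed[OF \<sigma>E_additive]
  have 1: "\<nu>E (\<sigma>E (i1 j)) = tensor_endo k ?C A (Suc 0) (\<nu>E (i1 j))" if j: "j \<in> carrier J" for j
  proof -
    have "\<sigma>E (i1 j) = i1 (mendo J j)"
      using j x J by (simp add: rendo_simps)
    then have "\<nu>E (\<sigma>E (i1 j)) = \<nu>E (i1 (mendo J j))"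
      by (rule arg_cong)
    also have "\<dots> = tensor_map k E A (Suc 0) i1 (coaction J (mendo J j))"
      by (rule \<nu>E_i1) (use j J in simp)
    also have "\<dots> = tensor_map k E A (Suc 0) i1 (tensor_endo k J A (Suc 0) (coaction J j))"
      using comodule_coaction_mendo[OF J j] by simp
    also have "\<dots> = tensor_endo k ?C A (Suc 0) (tensor_map k E A (Suc 0) i1 (coaction J j))"
      using map_endo[OF comodule_difference_module[OF J] dC i1C i1s J.\<mu>_closed[OF j]] unfolding make_comodule_tensor .
    also have "tensor_map k E A (Suc 0) i1 (coaction J j) = \<nu>E (i1 j)"
      by (rule \<nu>E_i1[OF j, symmetric])
    finally show ?thesis .
  qed
  have 2: "\<nu>E (\<sigma>E (\<zero>\<^bsub>J\<^esub>, r)) = tensor_endo k ?C A (Suc 0) (\<nu>E (\<zero>\<^bsub>J\<^esub>, r))" if r: "r \<in> carrier k" for r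
  proof -
    let ?r = "rendo k r"
    have z: "mendo J \<zero>\<^bsub>J\<^esub> = \<zero>\<^bsub>J\<^esub>"
      by (rule additive_zero[OF mendo_additive[OF comodule_difference_module[OF J]]]) simp_all
    have "\<sigma>E (\<zero>\<^bsub>J\<^esub>, r) = (?r \<odot>\<^bsub>J\<^esub> x, ?r)"
      using r x z by simp
    also have "\<dots> = i1 (?r \<odot>\<^bsub>J\<^esub> x) \<oplus>\<^bsub>E\<^esub> (\<zero>\<^bsub>J\<^esub>, ?r)"
      by (rule extension_split) (use r x in simp_all)
    finally have s: "\<sigma>E (\<zero>\<^bsub>J\<^esub>, r) = i1 (?r \<odot>\<^bsub>J\<^esub> x) \<oplus>\<^bsub>E\<^esub> (\<zero>\<^bsub>J\<^esub>, ?r)" .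
    have rx: "?r \<odot>\<^bsub>J\<^esub> x \<in> carrier J" using r x by simp
    \<comment> \<open>The endomorphism moves (0, r) by a multiple of x into J. Invariance of x keeps
      the coaction trivial there, which is why x must be invariant for the twisted endomorphism to
      respect the coaction.\<close>
    have "coaction J (?r \<odot>\<^bsub>J\<^esub> x) = pure_tensor k J A (?r \<odot>\<^bsub>J\<^esub> x) [\<one>\<^bsub>A\<^esub>]"
      using r x by (simp add: linear_smult[OF J.\<mu>_linear] smult_pure)
    then have c: "\<nu>E (i1 (?r \<odot>\<^bsub>J\<^esub> x)) = pure_tensor k E A (i1 (?r \<odot>\<^bsub>J\<^esub> x)) [\<one>\<^bsub>A\<^esub>]"
      unfolding \<nu>E_i1[OF rx] using rx by (simp add: map_pure[OF J.M_module mE i1_linear])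
    have "\<nu>E (\<sigma>E (\<zero>\<^bsub>J\<^esub>, r)) = \<nu>E (i1 (?r \<odot>\<^bsub>J\<^esub> x)) \<oplus>\<^bsub>?T\<^esub> \<nu>E (\<zero>\<^bsub>J\<^esub>, ?r)"
      unfolding s by (rule linear_add[OF \<nu>E_linear i1E[OF rx] i2E]) (use r in simp)
    also have "\<dots> = pure_tensor k E A (i1 (?r \<odot>\<^bsub>J\<^esub> x)) [\<one>\<^bsub>A\<^esub>] \<oplus>\<^bsub>?T\<^esub> pure_tensor k E A (\<zero>\<^bsub>J\<^esub>, ?r) [\<one>\<^bsub>A\<^esub>]"
      unfolding c using \<nu>E_i2[of ?r] r by simp
    also have "\<dots> = pure_tensor k E A (\<sigma>E (\<zero>\<^bsub>J\<^esub>, r)) [\<one>\<^bsub>A\<^esub>]"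
      unfolding s by (rule pure_add_left[symmetric, OF mE i1E[OF rx] i2E]) (use r in simp_all)
    also have "\<dots> = tensor_endo k ?C A (Suc 0) (pure_tensor k E A (\<zero>\<^bsub>J\<^esub>, r) [\<one>\<^bsub>A\<^esub>])"
      using endo_pure[OF dC, of "(\<zero>\<^bsub>J\<^esub>, r)" "[\<one>\<^bsub>A\<^esub>]" "Suc 0"] i2E[OF r] by simp
    also have "pure_tensor k E A (\<zero>\<^bsub>J\<^esub>, r) [\<one>\<^bsub>A\<^esub>] = \<nu>E (\<zero>\<^bsub>J\<^esub>, r)"
      by (rule \<nu>E_i2[OF r, symmetric])
    finally show ?thesis .
  qed
  {
    fix y assume "y \<in> carrier E"
    then obtain j r where jr: "y = (j, r)" and j: "j \<in> carrier J" and r: "r \<in> carrier k"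
      unfolding extension_simps(1) by (rule SigmaE)
    have y: "y = i1 j \<oplus>\<^bsub>E\<^esub> (\<zero>\<^bsub>J\<^esub>, r)"
      unfolding jr by (rule extension_split[OF j r])
    note \<nu>c = linear_closed[OF \<nu>E_linear]
    have "\<nu>E (\<sigma>E y) = \<nu>E (\<sigma>E (i1 j)) \<oplus>\<^bsub>?T\<^esub> \<nu>E (\<sigma>E (\<zero>\<^bsub>J\<^esub>, r))"
      unfolding y additive_add[OF \<sigma>E_additive i1E[OF j] i2E[OF r]]
      by (rule linear_add[OF \<nu>E_linear \<sigma>c[OF i1E[OF j]] \<sigma>c[OF i2E[OF r]]])
    also have "\<dots> = tensor_endo k ?C A (Suc 0) (\<nu>E (i1 j)) \<oplus>\<^bsub>?T\<^esub> tensor_endo k ?C A (Suc 0) (\<nu>E (\<zero>\<^bsub>J\<^esub>, r))"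
      unfolding 1[OF j] 2[OF r] ..
    also have "\<dots> = tensor_endo k ?C A (Suc 0) (\<nu>E (i1 j) \<oplus>\<^bsub>?T\<^esub> \<nu>E (\<zero>\<^bsub>J\<^esub>, r))"
      by (rule additive_add[OF eadd \<nu>c[OF i1E[OF j]] \<nu>c[OF i2E[OF r]], symmetric])
    also have "\<nu>E (i1 j) \<oplus>\<^bsub>?T\<^esub> \<nu>E (\<zero>\<^bsub>J\<^esub>, r) = \<nu>E y"
      unfolding y by (rule linear_add[OF \<nu>E_linear i1E[OF j] i2E[OF r], symmetric])
    finally show "\<nu>E (\<sigma>E y) = tensor_endo k ?C A (Suc 0) (\<nu>E y)" .
    assume F: "coaction_factor k A ?C \<nu>E"
    interpret F: coaction_factor k A ?C \<nu>E by (rule F)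
    have cf: "coface ?C \<nu>E (Suc 0) i \<in> additive_maps ?T (tensor k E A (Suc (Suc 0)))" for i
      using F.coface_additive[of "Suc 0" i] unfolding make_comodule_tensor .
    have cu: "F.counit_map \<in> additive_maps ?T E"
      using F.counit_map_additive unfolding make_comodule_additive make_comodule_tensor .
    have c1: "coface ?C \<nu>E (Suc 0) 0 (\<nu>E (i1 j)) = coface ?C \<nu>E (Suc 0) (Suc 0) (\<nu>E (i1 j)) \<and> F.counit_map (\<nu>E (i1 j)) = i1 j"
      by (rule coassociative_image[OF J.coassociative_factor_axioms F i1C _ j])
        (use \<nu>E_i1 in simp)
    have C2: "(\<zero>\<^bsub>J\<^esub>, r) \<in> carrier ?C" using i2E[OF r] by simp
    \<comment> \<open>With y = (0, r), both cofaces of y \<otimes> 1 are y \<otimes> 1 \<otimes> 1,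
      the second one because \<open>comult\<close> preserves the unit.\<close>
    have c2: "coface ?C \<nu>E (Suc 0) 0 (\<nu>E (\<zero>\<^bsub>J\<^esub>, r)) = coface ?C \<nu>E (Suc 0) (Suc 0) (\<nu>E (\<zero>\<^bsub>J\<^esub>, r))"
    proof -
      have p: "pure_tensor k ?C A (\<zero>\<^bsub>J\<^esub>, r) [] \<in> carrier (tensor k ?C A 0)" using C2 by (simp add: mE)
      have s: "pure_tensor k ?C A (\<zero>\<^bsub>J\<^esub>, r) [\<one>\<^bsub>A\<^esub>] = snoc ?C 0 (pure_tensor k ?C A (\<zero>\<^bsub>J\<^esub>, r) []) \<one>\<^bsub>A\<^esub>"
        using snoc_pure[OF F.M_module one_closed C2, of "[]" 0] by simp
      have n: "\<nu>E (\<zero>\<^bsub>J\<^esub>, r) = pure_tensor k ?C A (\<zero>\<^bsub>J\<^esub>, r) [\<one>\<^bsub>A\<^esub>]"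
        unfolding \<nu>E_i2[OF r] make_comodule_tensor ..
      have "coface ?C \<nu>E (Suc 0) 0 (\<nu>E (\<zero>\<^bsub>J\<^esub>, r)) = snoc ?C (Suc 0) (\<nu>E (\<zero>\<^bsub>J\<^esub>, r)) \<one>\<^bsub>A\<^esub>"
        unfolding n s using F.coface_snoc[of 0 0 "pure_tensor k ?C A (\<zero>\<^bsub>J\<^esub>, r) []" "\<one>\<^bsub>A\<^esub>"] F.coface_0[OF C2] p n s
        by (simp only: le_refl one_closed)
      also have "\<dots> = double ?C 0 (pure_tensor k ?C A (\<zero>\<^bsub>J\<^esub>, r) []) (comult A \<one>\<^bsub>A\<^esub>)"
        unfolding n s comult_one by (rule double_pure[OF F.M_module p one_closed one_closed, symmetric])
      also have "\<dots> = coface ?C \<nu>E (Suc 0) (Suc 0) (\<nu>E (\<zero>\<^bsub>J\<^esub>, r))"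
        unfolding n s by (rule F.coface_comult[OF p one_closed, symmetric])
      finally show ?thesis .
    qed
    have c3: "F.counit_map (\<nu>E (\<zero>\<^bsub>J\<^esub>, r)) = (\<zero>\<^bsub>J\<^esub>, r)"
    proof -
      have "counit A \<one>\<^bsub>A\<^esub> = \<one>\<^bsub>k\<^esub>"
        by (rule ring_hom_one[OF difference_hopf_algebra.counit_ring_hom[OF hopf]])
      then show ?thesis
        unfolding \<nu>E_i2[OF r] using F.counit_map_pure[OF C2 one_closed] r by (simp add: extension_simps)
    qed
    show "coface ?C \<nu>E (Suc 0) 0 (\<nu>E y) = coface ?C \<nu>E (Suc 0) (Suc 0) (\<nu>E y) \<and> F.counit_map (\<nu>E y) = y"
      unfolding y linear_add[OF \<nu>E_linear i1E[OF j] i2E[OF r]]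
        additive_add[OF cf \<nu>c[OF i1E[OF j]] \<nu>c[OF i2E[OF r]]] additive_add[OF cu \<nu>c[OF i1E[OF j]] \<nu>c[OF i2E[OF r]]]
        c2 c3 conjunct1[OF c1] conjunct2[OF c1] by simp
  }
qed

lemma injective_sigma_surjective:
  assumes inj: "injective_comodule TYPE(nat \<Rightarrow> 'b) k A J" and emb: "embeds TYPE(nat \<Rightarrow> 'b) (carrier J)"
  shows "\<exists>y \<in> carrier J. coaction J y = pure_tensor k J A y [\<one>\<^bsub>A\<^esub>] \<and> mendo J y = x \<oplus>\<^bsub>J\<^esub> y"
proof -
  let ?C = "extension_comodule J x"
  have C: "carrier ?C = carrier J \<times> carrier k"
    by (simp add: extension_comodule_eq extension_simps)
  have embC: "embeds TYPE(nat \<Rightarrow> 'b) (carrier ?C)"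
    unfolding C by (rule embeds_Times[OF emb k_embeds])
  have i: "i1 \<in> comodule_maps k A J ?C"
    unfolding extension_comodule_eq
  proof (rule comodule_mapsI)
    show "i1 \<in> linear_maps k J (make_comodule E \<sigma>E \<nu>E)" using i1_linear by simp
    fix m assume m: "m \<in> carrier J"
    show "i1 (mendo J m) = mendo (make_comodule E \<sigma>E \<nu>E) (i1 m)"
      using m x J by (simp add: rendo_simps)
    show "coaction (make_comodule E \<sigma>E \<nu>E) (i1 m) = tensor_map k (make_comodule E \<sigma>E \<nu>E) A (Suc 0) i1 (coaction J m)"
      using \<nu>E_i1[OF m] by simp
  qed
  have ii: "inj_on i1 (carrier J)" by (rule inj_onI) simp
  obtain \<rho> where \<rho>: "\<rho> \<in> comodule_maps k A ?C J" "\<And>m. m \<in> carrier J \<Longrightarrow> \<rho> (i1 m) = m"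
    by (rule injective_extension[OF inj J emb extension_comodule embC i ii comodule_maps_id[OF J]])
      (rule that, assumption+)
  have \<rho>l: "\<rho> \<in> linear_maps k E J"
    using comodule_map_linear[OF \<rho>(1)] by (simp add: extension_comodule_eq)
  let ?u = "(\<zero>\<^bsub>J\<^esub>, \<one>\<^bsub>k\<^esub>)"
  have u: "?u \<in> carrier E" "?u \<in> carrier ?C" by (simp_all add: C extension_simps)
  show ?thesis
  proof (intro bexI conjI)
    show \<rho>u: "\<rho> ?u \<in> carrier J" by (rule linear_closed[OF \<rho>l u(1)])
    have "coaction J (\<rho> ?u) = tensor_map k J A (Suc 0) \<rho> (\<nu>E ?u)"
      using comodule_map_coaction[OF \<rho>(1) u(2)] by (simp add: extension_comodule_eq)
    also have "\<nu>E ?u = pure_tensor k E A ?u [\<one>\<^bsub>A\<^esub>]"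
      by (rule \<nu>E_i2) simp
    also have "tensor_map k J A (Suc 0) \<rho> (pure_tensor k E A ?u [\<one>\<^bsub>A\<^esub>]) = pure_tensor k J A (\<rho> ?u) [\<one>\<^bsub>A\<^esub>]"
      by (rule map_pure[OF extension_module_module J.M_module \<rho>l u(1)]) simp_all
    finally show "coaction J (\<rho> ?u) = pure_tensor k J A (\<rho> ?u) [\<one>\<^bsub>A\<^esub>]" .
    have z: "mendo J \<zero>\<^bsub>J\<^esub> = \<zero>\<^bsub>J\<^esub>"
      by (rule additive_zero[OF mendo_additive[OF comodule_difference_module[OF J]]]) simp_all
    have "mendo J (\<rho> ?u) = \<rho> (\<sigma>E ?u)"
      using comodule_map_mendo[OF \<rho>(1) u(2)] by (simp add: extension_comodule_eq)
    also have "\<sigma>E ?u = (x, \<one>\<^bsub>k\<^esub>)"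
      using x z by (simp add: rendo_simps)
    also have "(x, \<one>\<^bsub>k\<^esub>) = i1 x \<oplus>\<^bsub>E\<^esub> ?u"
      by (rule extension_split) (use x in simp_all)
    also have "\<rho> (i1 x \<oplus>\<^bsub>E\<^esub> ?u) = \<rho> (i1 x) \<oplus>\<^bsub>J\<^esub> \<rho> ?u"
      by (rule linear_add[OF \<rho>l _ u(1)]) (use x in \<open>simp add: extension_simps\<close>)
    finally show "mendo J (\<rho> ?u) = x \<oplus>\<^bsub>J\<^esub> \<rho> ?u"
      using \<rho>(2)[OF x(1)] by simp
  qed
qed

end

end

section \<open>Short exact sequences from additive relations\<close>

text \<open>Homomorphisms between quotients are given by additive relations between groups mapping onto them.\<close>

definition relation_between ::
  "('x, 'p) monoid_scheme \<Rightarrow> ('y, 'q) monoid_scheme \<Rightarrow> ('x \<Rightarrow> 'y \<Rightarrow> bool) \<Rightarrow> bool"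
  where "relation_between Z Z' R \<longleftrightarrow>
    (\<forall>x y. R x y \<longrightarrow> x \<in> carrier Z \<and> y \<in> carrier Z') \<and> (\<forall>x \<in> carrier Z. \<exists>y. R x y) \<and>
    (\<forall>x y x' y'. R x y \<longrightarrow> R x' y' \<longrightarrow> R (x \<otimes>\<^bsub>Z\<^esub> inv\<^bsub>Z\<^esub> x') (y \<otimes>\<^bsub>Z'\<^esub> inv\<^bsub>Z'\<^esub> y'))"

text \<open>If two elements with the same image under \<pi> are related to y and y', closure under
  quotients relates an element of the kernel of \<pi> to the quotient of y and y', which \<pi>' then
  kills. So the choice of a related element does not matter after \<pi>'.\<close>

lemma relation_hom:
  assumes Z: "group Z" "group Z'" and Q: "group Q" "group Q'"
    and \<pi>: "\<pi> \<in> epi Z Q" and \<pi>': "\<pi>' \<in> hom Z' Q'"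
    and R: "relation_between Z Z' R" and wd: "\<And>x y. \<lbrakk>R x y; \<pi> x = \<one>\<^bsub>Q\<^esub>\<rbrakk> \<Longrightarrow> \<pi>' y = \<one>\<^bsub>Q'\<^esub>"
  obtains h where "h \<in> hom Q Q'" "\<And>x y. R x y \<Longrightarrow> h (\<pi> x) = \<pi>' y"
proof -
  interpret Z: group Z by (fact Z)
  interpret Z': group Z' by (fact Z)
  interpret Q: group Q by (fact Q)
  interpret Q': group Q' by (fact Q)
  have \<pi>1: "\<pi> \<in> hom Z Q" and sur: "\<pi> ` carrier Z = carrier Q" using \<pi> by (auto simp: epi_def)
  interpret p: group_hom Z Q \<pi> by (intro group_hom.intro group_hom_axioms.intro Z Q \<pi>1)
  interpret p': group_hom Z' Q' \<pi>' by (intro group_hom.intro group_hom_axioms.intro Z Q \<pi>')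
  have car: "x \<in> carrier Z" "y \<in> carrier Z'" if "R x y" for x y
    using R that by (auto simp: relation_between_def)
  have tot: "\<exists>y. R x y" if "x \<in> carrier Z" for x
    using R that by (auto simp: relation_between_def)
  have dif: "R (x \<otimes>\<^bsub>Z\<^esub> inv\<^bsub>Z\<^esub> x') (y \<otimes>\<^bsub>Z'\<^esub> inv\<^bsub>Z'\<^esub> y')" if "R x y" "R x' y'" for x y x' y'
    using R that unfolding relation_between_def by metis
  have uniq: "\<pi>' y = \<pi>' y'" if xy: "R x y" "R x' y'" and eq: "\<pi> x = \<pi> x'" for x y x' y'
  proof -
    have "\<pi> (x \<otimes>\<^bsub>Z\<^esub> inv\<^bsub>Z\<^esub> x') = \<one>\<^bsub>Q\<^esub>"
      using car[OF xy(1)] car[OF xy(2)] eq by simp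
    then have "\<pi>' (y \<otimes>\<^bsub>Z'\<^esub> inv\<^bsub>Z'\<^esub> y') = \<one>\<^bsub>Q'\<^esub>"
      by (rule wd[OF dif[OF xy]])
    then have "\<pi>' y \<otimes>\<^bsub>Q'\<^esub> inv\<^bsub>Q'\<^esub> \<pi>' y' = \<one>\<^bsub>Q'\<^esub>"
      using car[OF xy(1)] car[OF xy(2)] by simp
    then show ?thesis
      using car[OF xy(1)] car[OF xy(2)] by (metis Q'.inv_equality Q'.inv_inv p'.hom_closed Q'.inv_closed)
  qed
  define h where "h q = \<pi>' (SOME y. \<exists>x. R x y \<and> \<pi> x = q)" for q
  have h: "h (\<pi> x) = \<pi>' y" if xy: "R x y" for x y
  proof -
    have "\<exists>x'. R x' (SOME y. \<exists>x'. R x' y \<and> \<pi> x' = \<pi> x) \<and> \<pi> x' = \<pi> x"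
      by (rule someI_ex) (use xy in blast)
    then show ?thesis
      unfolding h_def using uniq[OF _ xy] by blast
  qed
  have add: "R (x \<otimes>\<^bsub>Z\<^esub> x') (y \<otimes>\<^bsub>Z'\<^esub> y')" if xy: "R x y" "R x' y'" for x y x' y'
  proof -
    note c = car[OF xy(1)] car[OF xy(2)]
    \<comment> \<open>Products are recovered from quotients: the inverse of x' is (x' / x') / x',
      and dividing x by it multiplies by x'.\<close>
    have "R (\<one>\<^bsub>Z\<^esub> \<otimes>\<^bsub>Z\<^esub> inv\<^bsub>Z\<^esub> x') (\<one>\<^bsub>Z'\<^esub> \<otimes>\<^bsub>Z'\<^esub> inv\<^bsub>Z'\<^esub> y')"
      using dif[OF dif[OF xy(2) xy(2)] xy(2)] c by simp
    from dif[OF xy(1) this] show ?thesis using c by simp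
  qed
  show ?thesis
  proof (rule that[of h])
    show "h (\<pi> x) = \<pi>' y" if "R x y" for x y using that by (rule h)
    show "h \<in> hom Q Q'"
    proof (rule homI)
      fix q assume "q \<in> carrier Q"
      then obtain x where x: "x \<in> carrier Z" "q = \<pi> x" using sur by blast
      obtain y where y: "R x y" using tot[OF x(1)] by blast
      then show "h q \<in> carrier Q'" using h[OF y] car[OF y] x by simp
      fix q' assume "q' \<in> carrier Q"
      then obtain x' where x': "x' \<in> carrier Z" "q' = \<pi> x'" using sur by blast
      obtain y' where y': "R x' y'" using tot[OF x'(1)] by blast
      show "h (q \<otimes>\<^bsub>Q\<^esub> q') = h q \<otimes>\<^bsub>Q'\<^esub> h q'"
        using h[OF add[OF y y']] h[OF y] h[OF y'] car[OF y] car[OF y'] x x' by simp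
    qed
  qed
qed

text \<open>The hypotheses are statements about representatives: \<open>R0\<close> gives
  well-definedness and injectivity of the first map, \<open>S0\<close> well-definedness of the
  second, \<open>onto\<close> its surjectivity, \<open>RS\<close> and \<open>ex\<close> the two
  inclusions in the middle. Witnesses are compared after projection only, which leaves room to
  change a cocycle by a coboundary.\<close>

lemma short_exact_relations:
  assumes Z: "group Z1" "group Z2" "group Z3" and Q: "group Q1" "group Q2" "group Q3"
    and \<pi>: "\<pi>1 \<in> epi Z1 Q1" "\<pi>2 \<in> epi Z2 Q2" "\<pi>3 \<in> epi Z3 Q3"
    and R: "relation_between Z1 Z2 R" and S: "relation_between Z2 Z3 S"
    and R0: "\<And>x y. R x y \<Longrightarrow> \<pi>1 x = \<one>\<^bsub>Q1\<^esub> \<longleftrightarrow> \<pi>2 y = \<one>\<^bsub>Q2\<^esub>"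
    and S0: "\<And>y z. \<lbrakk>S y z; \<pi>2 y = \<one>\<^bsub>Q2\<^esub>\<rbrakk> \<Longrightarrow> \<pi>3 z = \<one>\<^bsub>Q3\<^esub>"
    and onto: "\<And>z. z \<in> carrier Z3 \<Longrightarrow> \<exists>y z'. S y z' \<and> \<pi>3 z' = \<pi>3 z"
    and RS: "\<And>x y. R x y \<Longrightarrow> \<exists>z. S y z \<and> \<pi>3 z = \<one>\<^bsub>Q3\<^esub>"
    and ex: "\<And>y z. \<lbrakk>S y z; \<pi>3 z = \<one>\<^bsub>Q3\<^esub>\<rbrakk> \<Longrightarrow> \<exists>x y'. R x y' \<and> \<pi>2 y' = \<pi>2 y"
  shows "\<exists>\<alpha> \<beta>. short_exact Q1 \<alpha> Q2 \<beta> Q3"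
proof -
  interpret Q1: group Q1 by (fact Q)
  interpret Q2: group Q2 by (fact Q)
  have h2: "\<pi>2 \<in> hom Z2 Q2" and h3: "\<pi>3 \<in> hom Z3 Q3"
    and sur1: "\<pi>1 ` carrier Z1 = carrier Q1" and sur2: "\<pi>2 ` carrier Z2 = carrier Q2"
    and sur3: "\<pi>3 ` carrier Z3 = carrier Q3"
    using \<pi> by (auto simp: epi_def)
  have Rc: "x \<in> carrier Z1" "y \<in> carrier Z2" if "R x y" for x y
    using R that by (auto simp: relation_between_def)
  have Sc: "y \<in> carrier Z2" "z \<in> carrier Z3" if "S y z" for y z
    using S that by (auto simp: relation_between_def)
  have Rt: "\<exists>y. R x y" if "x \<in> carrier Z1" for x
    using R that by (auto simp: relation_between_def)
  have St: "\<exists>z. S y z" if "y \<in> carrier Z2" for y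
    using S that by (auto simp: relation_between_def)
  obtain \<alpha> where \<alpha>: "\<alpha> \<in> hom Q1 Q2" "\<And>x y. R x y \<Longrightarrow> \<alpha> (\<pi>1 x) = \<pi>2 y"
    by (rule relation_hom[OF Z(1,2) Q(1,2) \<pi>(1) h2 R]) (use R0 in blast)+
  obtain \<beta> where \<beta>: "\<beta> \<in> hom Q2 Q3" "\<And>y z. S y z \<Longrightarrow> \<beta> (\<pi>2 y) = \<pi>3 z"
    by (rule relation_hom[OF Z(2,3) Q(2,3) \<pi>(2) h3 S]) (use S0 in blast)+
  interpret a: group_hom Q1 Q2 \<alpha> by (intro group_hom.intro group_hom_axioms.intro Q \<alpha>)
  have "inj_on \<alpha> (carrier Q1)"
  proof (rule a.inj_on_one_iff[THEN iffD2], intro allI impI)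
    fix q assume q: "q \<in> carrier Q1" "\<alpha> q = \<one>\<^bsub>Q2\<^esub>"
    then obtain x where x: "x \<in> carrier Z1" "q = \<pi>1 x" using sur1 by blast
    obtain y where "R x y" using Rt[OF x(1)] by blast
    then show "q = \<one>\<^bsub>Q1\<^esub>" using R0 \<alpha>(2) q(2) x(2) by metis
  qed
  moreover have "\<beta> ` carrier Q2 = carrier Q3"
  proof (intro subset_antisym subsetI)
    fix q assume "q \<in> carrier Q3"
    then obtain z where z: "z \<in> carrier Z3" "q = \<pi>3 z" using sur3 by blast
    obtain y z' where yz: "S y z'" "\<pi>3 z' = \<pi>3 z" using onto[OF z(1)] by blast
    have "\<pi>2 y \<in> carrier Q2" by (rule hom_in_carrier[OF h2 Sc(1)[OF yz(1)]])
    moreover have "q = \<beta> (\<pi>2 y)" using \<beta>(2)[OF yz(1)] yz z by simp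
    ultimately show "q \<in> \<beta> ` carrier Q2" by blast
  next
    fix q assume "q \<in> \<beta> ` carrier Q2"
    then show "q \<in> carrier Q3" using \<beta>(1) by (auto simp: hom_def)
  qed
  moreover have "\<alpha> ` carrier Q1 = kernel Q2 Q3 \<beta>"
  proof (intro subset_antisym subsetI)
    fix q assume "q \<in> \<alpha> ` carrier Q1"
    then obtain q1 where q1: "q1 \<in> \<pi>1 ` carrier Z1" "q = \<alpha> q1" unfolding sur1 by (rule imageE)
    then obtain x where x: "x \<in> carrier Z1" "q = \<alpha> (\<pi>1 x)" by blast
    obtain y where y: "R x y" using Rt[OF x(1)] by blast
    obtain z where z: "S y z" "\<pi>3 z = \<one>\<^bsub>Q3\<^esub>" using RS[OF y] by blast
    have "q = \<pi>2 y" using \<alpha>(2)[OF y] x by simp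
    moreover have "\<pi>2 y \<in> carrier Q2" by (rule hom_in_carrier[OF h2 Rc(2)[OF y]])
    moreover have "\<beta> (\<pi>2 y) = \<one>\<^bsub>Q3\<^esub>" using \<beta>(2)[OF z(1)] z(2) by simp
    ultimately show "q \<in> kernel Q2 Q3 \<beta>" by (simp add: kernel_def)
  next
    fix q assume "q \<in> kernel Q2 Q3 \<beta>"
    then have q: "q \<in> carrier Q2" "\<beta> q = \<one>\<^bsub>Q3\<^esub>" by (auto simp: kernel_def)
    then obtain y where y: "y \<in> carrier Z2" "q = \<pi>2 y" using sur2 by blast
    obtain z where z: "S y z" using St[OF y(1)] by blast
    have "\<pi>3 z = \<one>\<^bsub>Q3\<^esub>" using \<beta>(2)[OF z] q(2) y(2) by simp
    from ex[OF z this] obtain x y' where x: "R x y'" "\<pi>2 y' = \<pi>2 y" by blast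
    have "\<pi>1 x \<in> carrier Q1" using imageI[OF Rc(1)[OF x(1)], of \<pi>1] unfolding sur1 .
    moreover have "q = \<alpha> (\<pi>1 x)" using \<alpha>(2)[OF x(1)] x(2) y(2) by simp
    ultimately show "q \<in> \<alpha> ` carrier Q1" by blast
  qed
  ultimately have "short_exact Q1 \<alpha> Q2 \<beta> Q3"
    using Q \<alpha>(1) \<beta>(1) by (simp add: short_exact_def mon_def epi_def)
  then show ?thesis by blast
qed

lemma quotient_epi:
  assumes Z: "comm_group Z" and B: "subgroup B Z"
  shows "comm_group (Z Mod B)" and "(\<lambda>z. B #>\<^bsub>Z\<^esub> z) \<in> epi Z (Z Mod B)"
    and "z \<in> carrier Z \<Longrightarrow> B #>\<^bsub>Z\<^esub> z = \<one>\<^bsub>Z Mod B\<^esub> \<longleftrightarrow> z \<in> B"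
proof -
  interpret comm_group Z by fact
  show "comm_group (Z Mod B)" by (rule abelian_FactGroup[OF B])
  have "B \<lhd> Z" by (rule subgroup_imp_normal[OF B])
  then show "(\<lambda>z. B #>\<^bsub>Z\<^esub> z) \<in> epi Z (Z Mod B)"
    using normal.r_coset_hom_Mod[of B Z] by (simp add: epi_def carrier_FactGroup)
  show "B #>\<^bsub>Z\<^esub> z = \<one>\<^bsub>Z Mod B\<^esub> \<longleftrightarrow> z \<in> B" if "z \<in> carrier Z"
    using coset_join1[OF _ that B] coset_join2[OF that B] by auto
qed

section \<open>The zigzag in a double complex\<close>

text \<open>Exactness is assumed away from the edges p = 0 and q = 0; the kernels at the edges carry
  the two complexes to be compared. The differentials commute without signs, as no total complex is
  formed.\<close>

locale double_complex =
  fixes X :: "nat \<Rightarrow> nat \<Rightarrow> ('x, 'p) ring_scheme" and d \<delta> s :: "nat \<Rightarrow> nat \<Rightarrow> 'x \<Rightarrow> 'x"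
  assumes X [simp]: "\<And>p q. abelian_group (X p q)"
    and d: "\<And>p q. d p q \<in> additive_maps (X p q) (X (Suc p) q)"
    and \<delta>: "\<And>p q. \<delta> p q \<in> additive_maps (X p q) (X p (Suc q))"
    and s: "\<And>p q. s p q \<in> additive_maps (X p q) (X p q)"
    and \<delta>d: "\<And>p q x. x \<in> carrier (X p q) \<Longrightarrow> \<delta> (Suc p) q (d p q x) = d p (Suc q) (\<delta> p q x)"
    and sd: "\<And>p q x. x \<in> carrier (X p q) \<Longrightarrow> s (Suc p) q (d p q x) = d p q (s p q x)"
    and s\<delta>: "\<And>p q x. x \<in> carrier (X p q) \<Longrightarrow> s p (Suc q) (\<delta> p q x) = \<delta> p q (s p q x)"
    and d_exact: "\<And>p q. d p q ` carrier (X p q) = {x \<in> carrier (X (Suc p) q). d (Suc p) q x = \<zero>\<^bsub>X (Suc (Suc p)) q\<^esub>}"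
    and \<delta>_exact: "\<And>p q. \<delta> p q ` carrier (X p q) = {x \<in> carrier (X p (Suc q)). \<delta> p (Suc q) x = \<zero>\<^bsub>X p (Suc (Suc q))\<^esub>}"
begin

lemma X_closed [simp]:
  "\<lbrakk>x \<in> carrier (X p q); y \<in> carrier (X p q)\<rbrakk> \<Longrightarrow> x \<ominus>\<^bsub>X p q\<^esub> y \<in> carrier (X p q)"
  "\<lbrakk>x \<in> carrier (X p q); y \<in> carrier (X p q)\<rbrakk> \<Longrightarrow> x \<oplus>\<^bsub>X p q\<^esub> y \<in> carrier (X p q)"
  "\<zero>\<^bsub>X p q\<^esub> \<in> carrier (X p q)"
  "x \<in> carrier (X p q) \<Longrightarrow> d p q x \<in> carrier (X (Suc p) q)"
  "x \<in> carrier (X p q) \<Longrightarrow> \<delta> p q x \<in> carrier (X p (Suc q))"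
  "x \<in> carrier (X p q) \<Longrightarrow> s p q x \<in> carrier (X p q)"
  by (simp_all add: additive_closed[OF d] additive_closed[OF \<delta>] additive_closed[OF s]
      abelian_group.minus_closed[OF X] abelian_groupE(1,2)[OF X])

lemma X_diff [simp]:
  "\<lbrakk>x \<in> carrier (X p q); y \<in> carrier (X p q)\<rbrakk> \<Longrightarrow> d p q (x \<ominus>\<^bsub>X p q\<^esub> y) = d p q x \<ominus>\<^bsub>X (Suc p) q\<^esub> d p q y"
  "\<lbrakk>x \<in> carrier (X p q); y \<in> carrier (X p q)\<rbrakk> \<Longrightarrow> \<delta> p q (x \<ominus>\<^bsub>X p q\<^esub> y) = \<delta> p q x \<ominus>\<^bsub>X p (Suc q)\<^esub> \<delta> p q y"
  "\<lbrakk>x \<in> carrier (X p q); y \<in> carrier (X p q)\<rbrakk> \<Longrightarrow> s p q (x \<ominus>\<^bsub>X p q\<^esub> y) = s p q x \<ominus>\<^bsub>X p q\<^esub> s p q y"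
  by (simp_all add: additive_diff[OF d X X] additive_diff[OF \<delta> X X] additive_diff[OF s X X])

lemma X_zero [simp]: "d p q \<zero>\<^bsub>X p q\<^esub> = \<zero>\<^bsub>X (Suc p) q\<^esub>" "\<delta> p q \<zero>\<^bsub>X p q\<^esub> = \<zero>\<^bsub>X p (Suc q)\<^esub>" "s p q \<zero>\<^bsub>X p q\<^esub> = \<zero>\<^bsub>X p q\<^esub>"
  by (simp_all add: additive_zero[OF d X X] additive_zero[OF \<delta> X X] additive_zero[OF s X X])

lemma X_minus_zero [simp]: "x \<in> carrier (X p q) \<Longrightarrow> x \<ominus>\<^bsub>X p q\<^esub> \<zero>\<^bsub>X p q\<^esub> = x"
  "x \<in> carrier (X p q) \<Longrightarrow> x \<ominus>\<^bsub>X p q\<^esub> x = \<zero>\<^bsub>X p q\<^esub>"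
proof -
  interpret abelian_group "X p q" by simp
  show "x \<in> carrier (X p q) \<Longrightarrow> x \<ominus>\<^bsub>X p q\<^esub> \<zero>\<^bsub>X p q\<^esub> = x"
    "x \<in> carrier (X p q) \<Longrightarrow> x \<ominus>\<^bsub>X p q\<^esub> x = \<zero>\<^bsub>X p q\<^esub>"
    using add.inv_one by (simp_all add: a_minus_def r_neg)
qed

lemma dd [simp]: "x \<in> carrier (X p q) \<Longrightarrow> d (Suc p) q (d p q x) = \<zero>\<^bsub>X (Suc (Suc p)) q\<^esub>"
  using d_exact[of p q] by blast

lemma \<delta>\<delta> [simp]: "x \<in> carrier (X p q) \<Longrightarrow> \<delta> p (Suc q) (\<delta> p q x) = \<zero>\<^bsub>X p (Suc (Suc q))\<^esub>"
  using \<delta>_exact[of p q] by blast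

lemma d_exactD:
  assumes "x \<in> carrier (X (Suc p) q)" "d (Suc p) q x = \<zero>\<^bsub>X (Suc (Suc p)) q\<^esub>"
  obtains w where "w \<in> carrier (X p q)" "x = d p q w"
  using assms d_exact[of p q] by blast

lemma \<delta>_exactD:
  assumes "x \<in> carrier (X p (Suc q))" "\<delta> p (Suc q) x = \<zero>\<^bsub>X p (Suc (Suc q))\<^esub>"
  obtains w where "w \<in> carrier (X p q)" "x = \<delta> p q w"
  using assms \<delta>_exact[of p q] by blast

definition cyc :: "nat \<Rightarrow> nat \<Rightarrow> 'x set"
  where "cyc p q = {x \<in> carrier (X p q). d p q x = \<zero>\<^bsub>X (Suc p) q\<^esub> \<and> \<delta> p q x = \<zero>\<^bsub>X p (Suc q)\<^esub>}"

text \<open>For \<open>p, q > 0\<close> the two groups of boundaries below agree, both being the image of \<open>d \<circ> \<delta>\<close>.\<close>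

definition vbd :: "nat \<Rightarrow> nat \<Rightarrow> 'x set"
  where "vbd p q = (case q of 0 \<Rightarrow> {\<zero>\<^bsub>X p 0\<^esub>} | Suc q \<Rightarrow> \<delta> p q ` {x \<in> carrier (X p q). d p q x = \<zero>\<^bsub>X (Suc p) q\<^esub>})"

text \<open>No horizontal differential arrives in column 0. The convention made there lets the
  staircase of length 0, which is equality, respect boundaries.\<close>

definition hbd :: "nat \<Rightarrow> nat \<Rightarrow> 'x set"
  where "hbd p q = (case p of 0 \<Rightarrow> vbd 0 q | Suc p \<Rightarrow> d p q ` {x \<in> carrier (X p q). \<delta> p q x = \<zero>\<^bsub>X p (Suc q)\<^esub>})"

lemma hbd_vbd: "hbd p (Suc q) = vbd p (Suc q)"
proof (cases p)
  case (Suc p')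
  have "d p' (Suc q) ` {x \<in> carrier (X p' (Suc q)). \<delta> p' (Suc q) x = \<zero>\<^bsub>X p' (Suc (Suc q))\<^esub>}
      = d p' (Suc q) ` \<delta> p' q ` carrier (X p' q)"
    unfolding \<delta>_exact ..
  also have "\<dots> = \<delta> (Suc p') q ` d p' q ` carrier (X p' q)"
    unfolding image_image by (rule image_cong) (simp_all add: \<delta>d)
  also have "\<dots> = vbd p (Suc q)"
    unfolding d_exact by (simp add: vbd_def Suc)
  finally show ?thesis by (simp add: hbd_def Suc)
qed (simp add: hbd_def)

text \<open>The staircase relation between the cocycles of the first column and those of the first row.\<close>

primrec zigzag :: "nat \<Rightarrow> nat \<Rightarrow> 'x \<Rightarrow> 'x \<Rightarrow> bool"
  where
    "zigzag 0 q x y \<longleftrightarrow> x \<in> cyc 0 q \<and> y = x"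
  | "zigzag (Suc p) q x y \<longleftrightarrow> (\<exists>w \<in> carrier (X p q). zigzag p (Suc q) x (\<delta> p q w) \<and> y = d p q w)"

text \<open>Both memberships reduce to the vanishing of the composite of d and \<delta> at
  w.\<close>

lemma cyc_step: "w \<in> carrier (X p q) \<Longrightarrow> \<delta> p q w \<in> cyc p (Suc q) \<longleftrightarrow> d p q w \<in> cyc (Suc p) q"
  by (simp add: cyc_def \<delta>d)

lemma zigzag_cyc: "zigzag p q x y \<Longrightarrow> x \<in> cyc 0 (p + q) \<and> y \<in> cyc p q"
proof (induction p arbitrary: q y)
  case (Suc p)
  then obtain w where "w \<in> carrier (X p q)" "zigzag p (Suc q) x (\<delta> p q w)" "y = d p q w" by auto
  with Suc.IH[of "Suc q" "\<delta> p q w"] show ?case by (simp add: cyc_step)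
qed simp

text \<open>Exactness of the columns supplies the element w of each step; exactness of the rows does
  the same in \<open>zigzag_onto\<close>, where the staircase is traversed in the other
  direction.\<close>

lemma zigzag_total: "x \<in> cyc 0 (p + q) \<Longrightarrow> \<exists>y. zigzag p q x y"
proof (induction p arbitrary: q)
  case (Suc p)
  then obtain z where z: "zigzag p (Suc q) x z" by force
  then have "z \<in> cyc p (Suc q)" using zigzag_cyc by blast
  then obtain w where "w \<in> carrier (X p q)" "z = \<delta> p q w"
    unfolding cyc_def by (blast elim: \<delta>_exactD)
  then show ?case using z by auto
qed auto

lemma zigzag_onto: "y \<in> cyc p q \<Longrightarrow> \<exists>x. zigzag p q x y"
proof (induction p arbitrary: q y)
  case (Suc p)
  then obtain w where w: "w \<in> carrier (X p q)" "y = d p q w"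
    unfolding cyc_def by (blast elim: d_exactD)
  then have "\<delta> p q w \<in> cyc p (Suc q)" using Suc.prems by (simp add: cyc_step)
  from Suc.IH[OF this] show ?case using w by auto
qed auto

lemma zigzag_diff:
  "\<lbrakk>zigzag p q x y; zigzag p q x' y'\<rbrakk> \<Longrightarrow> zigzag p q (x \<ominus>\<^bsub>X 0 (p + q)\<^esub> x') (y \<ominus>\<^bsub>X p q\<^esub> y')"
proof (induction p arbitrary: q y y')
  case 0
  then show ?case by (simp add: cyc_def)
next
  case (Suc p)
  from Suc.prems obtain w w' where w: "w \<in> carrier (X p q)" "zigzag p (Suc q) x (\<delta> p q w)" "y = d p q w"
    and w': "w' \<in> carrier (X p q)" "zigzag p (Suc q) x' (\<delta> p q w')" "y' = d p q w'" by auto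
  have "zigzag p (Suc q) (x \<ominus>\<^bsub>X 0 (p + Suc q)\<^esub> x') (\<delta> p q (w \<ominus>\<^bsub>X p q\<^esub> w'))"
    using Suc.IH[OF w(2) w'(2)] w(1) w'(1) by simp
  then show ?case
    using w w' by (auto intro!: bexI[of _ "w \<ominus>\<^bsub>X p q\<^esub> w'"])
qed

lemma zigzag_s: "zigzag p q x y \<Longrightarrow> zigzag p q (s 0 (p + q) x) (s p q y)"
proof (induction p arbitrary: q y)
  case 0
  then show ?case by (simp add: cyc_def sd[symmetric] s\<delta>[symmetric])
next
  case (Suc p)
  then obtain w where w: "w \<in> carrier (X p q)" "zigzag p (Suc q) x (\<delta> p q w)" "y = d p q w" by auto
  have "zigzag p (Suc q) (s 0 (p + Suc q) x) (\<delta> p q (s p q w))"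
    using Suc.IH[OF w(2)] w(1) by (simp add: s\<delta>)
  then show ?case
    using w by (auto simp: sd intro!: bexI[of _ "s p q w"])
qed

text \<open>If w and u have the same image under \<delta> and d kills u, then w - u is killed by
  \<delta> and has the same image under d as w. The converse exchanges d and \<delta>.\<close>

lemma step_boundary:
  assumes w: "w \<in> carrier (X p q)"
  shows "\<delta> p q w \<in> vbd p (Suc q) \<longleftrightarrow> d p q w \<in> hbd (Suc p) q"
proof
  assume "\<delta> p q w \<in> vbd p (Suc q)"
  then obtain u where u: "u \<in> carrier (X p q)" "d p q u = \<zero>\<^bsub>X (Suc p) q\<^esub>" "\<delta> p q w = \<delta> p q u"
    by (auto simp: vbd_def)
  have "d p q w = d p q (w \<ominus>\<^bsub>X p q\<^esub> u)" "\<delta> p q (w \<ominus>\<^bsub>X p q\<^esub> u) = \<zero>\<^bsub>X p (Suc q)\<^esub>"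
    using w u by simp_all
  then show "d p q w \<in> hbd (Suc p) q"
    using w u(1) by (auto simp: hbd_def simp del: X_diff)
next
  assume "d p q w \<in> hbd (Suc p) q"
  then obtain u where u: "u \<in> carrier (X p q)" "\<delta> p q u = \<zero>\<^bsub>X p (Suc q)\<^esub>" "d p q w = d p q u"
    by (auto simp: hbd_def)
  have "\<delta> p q w = \<delta> p q (w \<ominus>\<^bsub>X p q\<^esub> u)" "d p q (w \<ominus>\<^bsub>X p q\<^esub> u) = \<zero>\<^bsub>X (Suc p) q\<^esub>"
    using w u by simp_all
  then show "\<delta> p q w \<in> vbd p (Suc q)"
    using w u(1) by (auto simp: vbd_def simp del: X_diff)
qed

text \<open>One step turns vertical boundaries into horizontal ones, and \<open>hbd_vbd\<close>
  turns them back for the next step. Read in both directions, this makes the staircase well defined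
  and injective on classes.\<close>

lemma zigzag_boundary: "zigzag p q x y \<Longrightarrow> x \<in> vbd 0 (p + q) \<longleftrightarrow> y \<in> hbd p q"
proof (induction p arbitrary: q y)
  case 0
  then show ?case by (simp add: hbd_def)
next
  case (Suc p)
  then obtain w where w: "w \<in> carrier (X p q)" "zigzag p (Suc q) x (\<delta> p q w)" "y = d p q w" by auto
  then show ?case
    using Suc.IH[OF w(2)] step_boundary[OF w(1)] by (simp add: hbd_vbd)
qed

end

section \<open>Cohomology with an endomorphism\<close>

lemma subgroup_comm_group:
  assumes "comm_group G" "subgroup H G"
  shows "comm_group (G\<lparr>carrier := H\<rparr>)"
proof -
  interpret comm_group G by fact
  interpret H: group "G\<lparr>carrier := H\<rparr>" by (rule subgroup_imp_group[OF assms(2)])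
  show ?thesis
    by (rule H.group_comm_groupI) (use subgroup.mem_carrier[OF assms(2)] in \<open>simp add: m_comm\<close>)
qed

lemma hom_deviation:
  assumes "comm_group H" and E: "E \<in> hom H H"
  shows "(\<lambda>x. E x \<otimes>\<^bsub>H\<^esub> inv\<^bsub>H\<^esub> x) \<in> hom H H"
proof (rule homI)
  interpret comm_group H by fact
  note c = hom_in_carrier[OF E]
  fix x assume x: "x \<in> carrier H"
  then show "E x \<otimes>\<^bsub>H\<^esub> inv\<^bsub>H\<^esub> x \<in> carrier H" using c by simp
  fix y assume y: "y \<in> carrier H"
  show "E (x \<otimes>\<^bsub>H\<^esub> y) \<otimes>\<^bsub>H\<^esub> inv\<^bsub>H\<^esub> (x \<otimes>\<^bsub>H\<^esub> y) = E x \<otimes>\<^bsub>H\<^esub> inv\<^bsub>H\<^esub> x \<otimes>\<^bsub>H\<^esub> (E y \<otimes>\<^bsub>H\<^esub> inv\<^bsub>H\<^esub> y)"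
    using x y c by (simp add: hom_mult[OF E] inv_mult m_ac)
qed

locale cochain_endo =
  fixes C :: "nat \<Rightarrow> ('x, 'p) monoid_scheme" and d s :: "nat \<Rightarrow> 'x \<Rightarrow> 'x"
  assumes C: "\<And>n. comm_group (C n)"
    and d: "\<And>n. d n \<in> hom (C n) (C (Suc n))"
    and s: "\<And>n. s n \<in> hom (C n) (C n)"
    and dd: "\<And>n x. x \<in> carrier (C n) \<Longrightarrow> d (Suc n) (d n x) = \<one>\<^bsub>C (Suc (Suc n))\<^esub>"
    and sd: "\<And>n x. x \<in> carrier (C n) \<Longrightarrow> s (Suc n) (d n x) = d n (s n x)"
begin

definition Z :: "nat \<Rightarrow> ('x, 'p) monoid_scheme"
  where "Z n = (C n)\<lparr>carrier := kernel (C n) (C (Suc n)) (d n)\<rparr>"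

definition B :: "nat \<Rightarrow> 'x set"
  where "B n = coboundaries C d n"

definition pr :: "nat \<Rightarrow> 'x \<Rightarrow> 'x set"
  where "pr n z = B n #>\<^bsub>Z n\<^esub> z"

text \<open>The formula of \<open>group_cohomology_endo\<close> for an arbitrary complex.\<close>

definition E :: "nat \<Rightarrow> 'x set \<Rightarrow> 'x set"
  where "E n X = B n <#>\<^bsub>C n\<^esub> (s n ` X)"

lemma C_group: "group (C n)"
  using C by (rule comm_group.axioms(2))

lemma d_group_hom: "group_hom (C n) (C (Suc n)) (d n)"
  by (intro group_hom.intro group_hom_axioms.intro C_group d)

lemma Z_subgroup: "subgroup (kernel (C n) (C (Suc n)) (d n)) (C n)"
  by (rule group_hom.subgroup_kernel[OF d_group_hom])

lemma carrier_Z: "carrier (Z n) = {x \<in> carrier (C n). d n x = \<one>\<^bsub>C (Suc n)\<^esub>}"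
  by (simp add: Z_def kernel_def)

lemma Z_comm_group: "comm_group (Z n)"
  unfolding Z_def by (rule subgroup_comm_group[OF C Z_subgroup])

lemma Z_mult: "x \<otimes>\<^bsub>Z n\<^esub> y = x \<otimes>\<^bsub>C n\<^esub> y"
  by (simp add: Z_def)

lemma Z_inv: "x \<in> carrier (Z n) \<Longrightarrow> inv\<^bsub>Z n\<^esub> x = inv\<^bsub>C n\<^esub> x"
  using group.m_inv_consistent[OF C_group Z_subgroup] by (simp add: Z_def)

lemma B_subgroup_C: "subgroup (B n) (C n)"
proof (cases n)
  case 0
  then show ?thesis using group.triv_subgroup[OF C_group] by (simp add: B_def coboundaries_def)
next
  case (Suc m)
  then show ?thesis using group_hom.img_is_subgroup[OF d_group_hom] by (simp add: B_def coboundaries_def)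
qed

lemma B_subset: "B n \<subseteq> carrier (Z n)"
proof (cases n)
  case 0
  then show ?thesis
    using group_hom.hom_one[OF d_group_hom, of 0] monoid.one_closed[OF group.is_monoid[OF C_group]]
    by (simp add: B_def coboundaries_def carrier_Z)
next
  case (Suc m)
  then show ?thesis
    using hom_in_carrier[OF d] by (auto simp: B_def coboundaries_def carrier_Z dd)
qed

lemma B_subgroup: "subgroup (B n) (Z n)"
  using group.subgroup_incl[OF C_group B_subgroup_C Z_subgroup] B_subset by (simp add: Z_def)

lemma s_Z: "z \<in> carrier (Z n) \<Longrightarrow> s n z \<in> carrier (Z n)"
  using group_hom.hom_one[OF group_hom.intro[OF C_group C_group group_hom_axioms.intro[OF s]]]
  by (simp add: carrier_Z hom_in_carrier[OF s] sd[symmetric])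

lemma s_B: "z \<in> B n \<Longrightarrow> s n z \<in> B n"
  using group_hom.hom_one[OF group_hom.intro[OF C_group C_group group_hom_axioms.intro[OF s]]]
  by (auto simp: B_def coboundaries_def sd hom_in_carrier[OF s] split: nat.splits)

lemma cohomology_eq: "cohomology C d n = Z n Mod B n"
  by (simp add: cohomology_def Z_def B_def)

lemma cohomology_comm_group: "comm_group (cohomology C d n)"
  unfolding cohomology_eq by (rule quotient_epi(1)[OF Z_comm_group B_subgroup])

lemma pr_epi: "pr n \<in> epi (Z n) (cohomology C d n)"
  unfolding cohomology_eq pr_def[abs_def] by (rule quotient_epi(2)[OF Z_comm_group B_subgroup])

lemma pr_one: "z \<in> carrier (Z n) \<Longrightarrow> pr n z = \<one>\<^bsub>cohomology C d n\<^esub> \<longleftrightarrow> z \<in> B n"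
  unfolding cohomology_eq pr_def by (rule quotient_epi(3)[OF Z_comm_group B_subgroup])

lemma pr_hom: "pr n \<in> hom (Z n) (cohomology C d n)" and pr_onto: "pr n ` carrier (Z n) = carrier (cohomology C d n)"
  using pr_epi by (auto simp: epi_def)

lemma pr_closed: "z \<in> carrier (Z n) \<Longrightarrow> pr n z \<in> carrier (cohomology C d n)"
  by (rule hom_in_carrier[OF pr_hom])

lemma pr_group_hom: "group_hom (Z n) (cohomology C d n) (pr n)"
  by (intro group_hom.intro group_hom_axioms.intro pr_hom comm_group.axioms(2) Z_comm_group cohomology_comm_group)

text \<open>The image of the coset of z under s lies in the coset of \<open>s n z\<close> but need
  not fill it, since s need not map the coboundaries onto themselves. Multiplying by
  \<open>B n\<close> in the definition of \<open>E\<close> completes it.\<close>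

lemma E_pr:
  assumes z: "z \<in> carrier (Z n)"
  shows "E n (pr n z) = pr n (s n z)"
proof -
  interpret C: comm_group "C n" by (rule C)
  note B = B_subgroup_C[of n]
  have zc: "z \<in> carrier (C n)" using z by (simp add: carrier_Z)
  have "E n (pr n z) = {b \<otimes>\<^bsub>C n\<^esub> s n (b' \<otimes>\<^bsub>C n\<^esub> z) | b b'. b \<in> B n \<and> b' \<in> B n}"
    by (auto simp: E_def pr_def set_mult_def r_coset_def Z_mult)
  also have "\<dots> = {b \<otimes>\<^bsub>C n\<^esub> s n z | b. b \<in> B n}"
  proof (intro subset_antisym subsetI)
    fix x assume "x \<in> {b \<otimes>\<^bsub>C n\<^esub> s n (b' \<otimes>\<^bsub>C n\<^esub> z) | b b'. b \<in> B n \<and> b' \<in> B n}"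
    then obtain b b' where b: "b \<in> B n" "b' \<in> B n" "x = b \<otimes>\<^bsub>C n\<^esub> s n (b' \<otimes>\<^bsub>C n\<^esub> z)" by blast
    have "x = (b \<otimes>\<^bsub>C n\<^esub> s n b') \<otimes>\<^bsub>C n\<^esub> s n z"
      using b zc subgroup.mem_carrier[OF B] hom_in_carrier[OF s] by (simp add: hom_mult[OF s] C.m_assoc)
    moreover have "b \<otimes>\<^bsub>C n\<^esub> s n b' \<in> B n"
      by (rule subgroup.m_closed[OF B b(1) s_B[OF b(2)]])
    ultimately show "x \<in> {b \<otimes>\<^bsub>C n\<^esub> s n z | b. b \<in> B n}" by blast
  next
    fix x assume "x \<in> {b \<otimes>\<^bsub>C n\<^esub> s n z | b. b \<in> B n}"
    then obtain b where b: "b \<in> B n" "x = b \<otimes>\<^bsub>C n\<^esub> s n z" by blast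
    moreover have "\<one>\<^bsub>C n\<^esub> \<in> B n" by (rule subgroup.one_closed[OF B])
    moreover have "s n (\<one>\<^bsub>C n\<^esub> \<otimes>\<^bsub>C n\<^esub> z) = s n z" using zc by simp
    ultimately show "x \<in> {b \<otimes>\<^bsub>C n\<^esub> s n (b' \<otimes>\<^bsub>C n\<^esub> z) | b b'. b \<in> B n \<and> b' \<in> B n}" by force
  qed
  also have "\<dots> = pr n (s n z)"
    by (auto simp: pr_def r_coset_def Z_mult)
  finally show ?thesis .
qed

lemma E_hom: "E n \<in> hom (cohomology C d n) (cohomology C d n)"
proof (rule homI)
  fix q assume "q \<in> carrier (cohomology C d n)"
  then obtain z where z: "z \<in> carrier (Z n)" "q = pr n z" unfolding pr_onto[symmetric] by (rule imageE)
  then show "E n q \<in> carrier (cohomology C d n)" by (simp add: E_pr pr_closed s_Z)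
  fix q' assume "q' \<in> carrier (cohomology C d n)"
  then obtain z' where z': "z' \<in> carrier (Z n)" "q' = pr n z'" unfolding pr_onto[symmetric] by (rule imageE)
  interpret Z: comm_group "Z n" by (rule Z_comm_group)
  have "s n (z \<otimes>\<^bsub>Z n\<^esub> z') = s n z \<otimes>\<^bsub>Z n\<^esub> s n z'"
    using z z' by (simp add: Z_mult carrier_Z hom_mult[OF s])
  then show "E n (q \<otimes>\<^bsub>cohomology C d n\<^esub> q') = E n q \<otimes>\<^bsub>cohomology C d n\<^esub> E n q'"
    using z z' hom_mult[OF pr_hom] by (simp add: E_pr s_Z hom_mult[OF pr_hom, symmetric])
qed

text \<open>This is \<sigma> - 1 in multiplicative notation.\<close>

definition dev :: "nat \<Rightarrow> 'x \<Rightarrow> 'x"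
  where "dev n z = s n z \<otimes>\<^bsub>C n\<^esub> inv\<^bsub>C n\<^esub> z"

lemma dev_Z: "z \<in> carrier (Z n) \<Longrightarrow> dev n z \<in> carrier (Z n)"
proof -
  assume z: "z \<in> carrier (Z n)"
  interpret Z: comm_group "Z n" by (rule Z_comm_group)
  have "dev n z = s n z \<otimes>\<^bsub>Z n\<^esub> inv\<^bsub>Z n\<^esub> z" using z by (simp add: dev_def Z_mult Z_inv)
  then show ?thesis using s_Z[OF z] z by simp
qed

lemma E_deviation:
  assumes z: "z \<in> carrier (Z n)"
  shows "E n (pr n z) \<otimes>\<^bsub>cohomology C d n\<^esub> inv\<^bsub>cohomology C d n\<^esub> pr n z = pr n (dev n z)"
proof -
  interpret p: group_hom "Z n" "cohomology C d n" "pr n" by (rule pr_group_hom)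
  show ?thesis
    using z p.hom_mult[OF s_Z[OF z] p.G.inv_closed[OF z]] by (simp add: E_pr dev_def Z_mult Z_inv[symmetric])
qed

text \<open>The two successive quotients are presented as one quotient of the group of cocycles. Its
  kernel is described by cocycles and coboundaries, so that the diagram chase below never touches a
  class.\<close>

lemma coinvariants_presentation:
  obtains \<pi> where "group (coinvariants (cohomology C d n) (E n))"
    "\<pi> \<in> epi (Z n) (coinvariants (cohomology C d n) (E n))"
    "\<And>z. z \<in> carrier (Z n) \<Longrightarrow> \<pi> z = \<one>\<^bsub>coinvariants (cohomology C d n) (E n)\<^esub> \<longleftrightarrow>
      (\<exists>z' \<in> carrier (Z n). z \<otimes>\<^bsub>C n\<^esub> inv\<^bsub>C n\<^esub> dev n z' \<in> B n)"
proof -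
  let ?H = "cohomology C d n" and ?D = "\<lambda>x. E n x \<otimes>\<^bsub>cohomology C d n\<^esub> inv\<^bsub>cohomology C d n\<^esub> x"
  interpret H: comm_group ?H by (rule cohomology_comm_group)
  interpret p: group_hom "Z n" ?H "pr n" by (rule pr_group_hom)
  have D: "?D \<in> hom ?H ?H" by (rule hom_deviation[OF cohomology_comm_group E_hom])
  have I: "subgroup (?D ` carrier ?H) ?H"
    by (rule group_hom.img_is_subgroup) (intro group_hom.intro group_hom_axioms.intro H.is_group D)
  note q = quotient_epi[OF cohomology_comm_group I]
  have eq: "coinvariants ?H (E n) = ?H Mod (?D ` carrier ?H)" by (simp add: coinvariants_def)
  let ?\<pi> = "\<lambda>z. (?D ` carrier ?H) #>\<^bsub>?H\<^esub> pr n z"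
  show ?thesis
  proof (rule that[of ?\<pi>])
    show "group (coinvariants ?H (E n))"
      unfolding eq by (rule comm_group.axioms(2)[OF q(1)])
    have h: "(\<lambda>x. (?D ` carrier ?H) #>\<^bsub>?H\<^esub> x) \<in> hom ?H (?H Mod (?D ` carrier ?H))"
      and o: "(\<lambda>x. (?D ` carrier ?H) #>\<^bsub>?H\<^esub> x) ` carrier ?H = carrier (?H Mod (?D ` carrier ?H))"
      using q(2) by (auto simp: epi_def)
    have "?\<pi> \<in> hom (Z n) (?H Mod (?D ` carrier ?H))"
      using hom_compose[OF pr_hom h] by (simp add: comp_def)
    moreover have "?\<pi> ` carrier (Z n) = carrier (?H Mod (?D ` carrier ?H))"
      using o pr_onto[of n] image_image[of "\<lambda>x. (?D ` carrier ?H) #>\<^bsub>?H\<^esub> x" "pr n" "carrier (Z n)"] by simp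
    ultimately show "?\<pi> \<in> epi (Z n) (coinvariants ?H (E n))"
      unfolding eq by (simp add: epi_def)
    fix z assume z: "z \<in> carrier (Z n)"
    have "?D ` carrier ?H = (\<lambda>z'. pr n (dev n z')) ` carrier (Z n)"
      unfolding pr_onto[symmetric] image_image by (rule image_cong) (simp_all add: E_deviation)
    then have "?\<pi> z = \<one>\<^bsub>coinvariants ?H (E n)\<^esub> \<longleftrightarrow> (\<exists>z' \<in> carrier (Z n). pr n z = pr n (dev n z'))"
      unfolding eq q(3)[OF pr_closed[OF z]] by auto
    also have "\<dots> \<longleftrightarrow> (\<exists>z' \<in> carrier (Z n). z \<otimes>\<^bsub>C n\<^esub> inv\<^bsub>C n\<^esub> dev n z' \<in> B n)"
    proof (rule bex_cong[OF refl])
      fix z' assume z': "z' \<in> carrier (Z n)"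
      note dz = dev_Z[OF z']
      have "pr n z = pr n (dev n z') \<longleftrightarrow> pr n (z \<otimes>\<^bsub>Z n\<^esub> inv\<^bsub>Z n\<^esub> dev n z') = \<one>\<^bsub>?H\<^esub>"
      proof -
        have "pr n (z \<otimes>\<^bsub>Z n\<^esub> inv\<^bsub>Z n\<^esub> dev n z') = pr n z \<otimes>\<^bsub>?H\<^esub> inv\<^bsub>?H\<^esub> pr n (dev n z')"
          using z dz by simp
        then show ?thesis
          using H.inv_solve_right'[OF pr_closed[OF z] H.one_closed pr_closed[OF dz]] pr_closed[OF dz]
          by (metis H.l_one H.inv_solve_right pr_closed[OF z] H.one_closed)
      qed
      also have "\<dots> \<longleftrightarrow> z \<otimes>\<^bsub>C n\<^esub> inv\<^bsub>C n\<^esub> dev n z' \<in> B n"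
        using pr_one[OF p.G.m_closed[OF z p.G.inv_closed[OF dz]]] by (simp only: Z_mult Z_inv[OF dz])
      finally show "pr n z = pr n (dev n z') \<longleftrightarrow> z \<otimes>\<^bsub>C n\<^esub> inv\<^bsub>C n\<^esub> dev n z' \<in> B n" .
    qed
    finally show "?\<pi> z = \<one>\<^bsub>coinvariants ?H (E n)\<^esub> \<longleftrightarrow>
      (\<exists>z' \<in> carrier (Z n). z \<otimes>\<^bsub>C n\<^esub> inv\<^bsub>C n\<^esub> dev n z' \<in> B n)" .
  qed
qed

text \<open>These cocycles are fixed by s up to a coboundary only; finding a representative that is
  fixed exactly is the content of \<open>edge_onto\<close>.\<close>

definition ZI :: "nat \<Rightarrow> ('x, 'p) monoid_scheme"
  where "ZI n = (C n)\<lparr>carrier := {z \<in> carrier (Z n). dev n z \<in> B n}\<rparr>"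

lemma invariants_presentation:
  shows "comm_group (ZI n)" and "group (invariants (cohomology C d n) (E n))"
    and "pr n \<in> epi (ZI n) (invariants (cohomology C d n) (E n))"
    and "\<one>\<^bsub>invariants (cohomology C d n) (E n)\<^esub> = \<one>\<^bsub>cohomology C d n\<^esub>"
    and "subgroup (carrier (ZI n)) (C n)"
proof -
  let ?H = "cohomology C d n" and ?D = "\<lambda>x. E n x \<otimes>\<^bsub>cohomology C d n\<^esub> inv\<^bsub>cohomology C d n\<^esub> x"
  interpret H: comm_group ?H by (rule cohomology_comm_group)
  interpret p: group_hom "Z n" ?H "pr n" by (rule pr_group_hom)
  have D: "?D \<in> hom ?H ?H" by (rule hom_deviation[OF cohomology_comm_group E_hom])
  have "{x \<in> carrier ?H. E n x = x} = kernel ?H ?H ?D"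
  proof -
    have "E n x = x \<longleftrightarrow> ?D x = \<one>\<^bsub>?H\<^esub>" if "x \<in> carrier ?H" for x
      using that hom_in_carrier[OF E_hom that] by (metis H.inv_solve_right' H.l_one H.one_closed H.r_inv)
    then show ?thesis by (auto simp: kernel_def)
  qed
  then have inv: "invariants ?H (E n) = ?H\<lparr>carrier := kernel ?H ?H ?D\<rparr>" by (simp add: invariants_def)
  have "subgroup (kernel ?H ?H ?D) ?H"
    by (rule group_hom.subgroup_kernel) (intro group_hom.intro group_hom_axioms.intro H.is_group D)
  then show "group (invariants ?H (E n))"
    unfolding inv by (rule H.subgroup_imp_group)
  show "\<one>\<^bsub>invariants ?H (E n)\<^esub> = \<one>\<^bsub>?H\<^esub>" by (simp add: invariants_def)
  define K where "K = kernel (Z n) ?H (\<lambda>z. ?D (pr n z))"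
  have "{z \<in> carrier (Z n). dev n z \<in> B n} = K"
    unfolding kernel_def K_def by (intro Collect_cong conj_cong refl) (simp add: E_deviation pr_one[OF dev_Z])
  then have ZI: "carrier (ZI n) = K" by (simp add: ZI_def)
  have k: "subgroup K (Z n)"
    unfolding K_def by (rule group_hom.subgroup_kernel)
      (use hom_compose[OF pr_hom D] in \<open>simp add: group_hom_def group_hom_axioms_def H.is_group p.G.is_group comp_def\<close>)
  show sub: "subgroup (carrier (ZI n)) (C n)"
    unfolding ZI using group.incl_subgroup[OF C_group Z_subgroup] k unfolding Z_def .
  then show "comm_group (ZI n)"
    using subgroup_comm_group[OF C] by (simp add: ZI_def)
  show "pr n \<in> epi (ZI n) (invariants ?H (E n))"
  proof -
    have fix_iff: "E n (pr n z) = pr n z \<longleftrightarrow> dev n z \<in> B n" if z: "z \<in> carrier (Z n)" for z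
      unfolding pr_one[OF dev_Z[OF z], symmetric] E_deviation[OF z, symmetric]
      using pr_closed[OF z] hom_in_carrier[OF E_hom pr_closed[OF z]]
      by (metis H.inv_solve_right' H.l_one H.one_closed H.r_inv)
    have "pr n \<in> hom (ZI n) (invariants ?H (E n))"
    proof (rule homI)
      fix z assume z: "z \<in> carrier (ZI n)"
      then show "pr n z \<in> carrier (invariants ?H (E n))"
        by (simp add: ZI_def invariants_def pr_closed fix_iff)
      fix z' assume "z' \<in> carrier (ZI n)"
      then show "pr n (z \<otimes>\<^bsub>ZI n\<^esub> z') = pr n z \<otimes>\<^bsub>invariants ?H (E n)\<^esub> pr n z'"
        using z hom_mult[OF pr_hom, of z n z'] by (simp add: ZI_def invariants_def Z_mult)
    qed
    moreover have "carrier (invariants ?H (E n)) \<subseteq> pr n ` carrier (ZI n)"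
    proof
      fix q assume q: "q \<in> carrier (invariants ?H (E n))"
      then have "q \<in> carrier ?H" by (simp add: invariants_def)
      then obtain z where z: "z \<in> carrier (Z n)" "q = pr n z" unfolding pr_onto[symmetric] by (rule imageE)
      then have "z \<in> carrier (ZI n)" using q by (simp add: ZI_def invariants_def fix_iff)
      then show "q \<in> pr n ` carrier (ZI n)" using z(2) by blast
    qed
    ultimately show ?thesis
      by (auto simp: epi_def hom_def)
  qed
qed

end

section \<open>The exact sequence of a resolved complex\<close>

lemma (in abelian_group) minus_swap:
  assumes "a \<in> carrier G" "b \<in> carrier G" "c \<in> carrier G" "e \<in> carrier G"
  shows "(a \<ominus> b) \<ominus> (c \<ominus> e) = (a \<ominus> c) \<ominus> (b \<ominus> e)"
  using assms by (simp add: a_minus_def minus_add a_ac)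

text \<open>The complex \<open>F\<close> is the kernel at the start of the rows. The complex
  \<open>L\<close> consists of the \<sigma>-fixed elements in the kernel I of \<delta> in the row q
  = 0; together with \<open>s_onto\<close> this is the short exact sequence of complexes formed by
  \<open>L\<close>, I and \<sigma> - 1 on I.\<close>

locale resolved_complex = double_complex X d \<delta> s
  for X :: "nat \<Rightarrow> nat \<Rightarrow> ('x, 'p) ring_scheme" and d \<delta> s +
  fixes F :: "nat \<Rightarrow> ('y, 'q) ring_scheme" and dF sF :: "nat \<Rightarrow> 'y \<Rightarrow> 'y" and \<epsilon> :: "nat \<Rightarrow> 'y \<Rightarrow> 'x"
    and L :: "nat \<Rightarrow> ('z, 'r) monoid_scheme" and dL :: "nat \<Rightarrow> 'z \<Rightarrow> 'z" and \<iota> :: "nat \<Rightarrow> 'z \<Rightarrow> 'x"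
  assumes F [simp]: "\<And>n. abelian_group (F n)"
    and dF: "\<And>n. dF n \<in> additive_maps (F n) (F (Suc n))"
    and sF: "\<And>n. sF n \<in> additive_maps (F n) (F n)"
    and \<epsilon>: "\<And>n. \<epsilon> n \<in> additive_maps (F n) (X 0 n)"
    and \<epsilon>_inj: "\<And>n. inj_on (\<epsilon> n) (carrier (F n))"
    and \<epsilon>_image: "\<And>n. \<epsilon> n ` carrier (F n) = {x \<in> carrier (X 0 n). d 0 n x = \<zero>\<^bsub>X 1 n\<^esub>}"
    and \<epsilon>_dF: "\<And>n z. z \<in> carrier (F n) \<Longrightarrow> \<epsilon> (Suc n) (dF n z) = \<delta> 0 n (\<epsilon> n z)"
    and \<epsilon>s: "\<And>n z. z \<in> carrier (F n) \<Longrightarrow> \<epsilon> n (sF n z) = s 0 n (\<epsilon> n z)"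
    and L: "\<And>p. comm_group (L p)"
    and dL: "\<And>p. dL p \<in> hom (L p) (L (Suc p))"
    and \<iota>: "\<And>p. \<iota> p \<in> hom (L p) (add_monoid (X p 0))"
    and \<iota>_inj: "\<And>p. inj_on (\<iota> p) (carrier (L p))"
    and \<iota>_image: "\<And>p. \<iota> p ` carrier (L p) = {x \<in> carrier (X p 0). \<delta> p 0 x = \<zero>\<^bsub>X p 1\<^esub> \<and> s p 0 x = x}"
    and \<iota>d: "\<And>p f. f \<in> carrier (L p) \<Longrightarrow> \<iota> (Suc p) (dL p f) = d p 0 (\<iota> p f)"
    and s_onto: "\<And>p x. \<lbrakk>x \<in> carrier (X p 0); \<delta> p 0 x = \<zero>\<^bsub>X p 1\<^esub>\<rbrakk> \<Longrightarrow>
      \<exists>y \<in> carrier (X p 0). \<delta> p 0 y = \<zero>\<^bsub>X p 1\<^esub> \<and> s p 0 y \<ominus>\<^bsub>X p 0\<^esub> y = x"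
begin

lemma F_closed [simp]:
  "z \<in> carrier (F n) \<Longrightarrow> dF n z \<in> carrier (F (Suc n))" "z \<in> carrier (F n) \<Longrightarrow> sF n z \<in> carrier (F n)"
  "z \<in> carrier (F n) \<Longrightarrow> \<epsilon> n z \<in> carrier (X 0 n)"
  "\<lbrakk>z \<in> carrier (F n); z' \<in> carrier (F n)\<rbrakk> \<Longrightarrow> z \<ominus>\<^bsub>F n\<^esub> z' \<in> carrier (F n)"
  by (simp_all add: additive_closed[OF dF] additive_closed[OF sF] additive_closed[OF \<epsilon>] abelian_group.minus_closed[OF F])

lemma F_zero [simp]: "\<zero>\<^bsub>F n\<^esub> \<in> carrier (F n)" "\<epsilon> n \<zero>\<^bsub>F n\<^esub> = \<zero>\<^bsub>X 0 n\<^esub>"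
  by (simp_all add: abelian_groupE(2)[OF F] additive_zero[OF \<epsilon> F X])

lemma \<epsilon>_diff: "\<lbrakk>z \<in> carrier (F n); z' \<in> carrier (F n)\<rbrakk> \<Longrightarrow> \<epsilon> n (z \<ominus>\<^bsub>F n\<^esub> z') = \<epsilon> n z \<ominus>\<^bsub>X 0 n\<^esub> \<epsilon> n z'"
  by (rule additive_diff[OF \<epsilon> F X])

lemma \<epsilon>_eq_iff: "\<lbrakk>z \<in> carrier (F n); z' \<in> carrier (F n)\<rbrakk> \<Longrightarrow> \<epsilon> n z = \<epsilon> n z' \<longleftrightarrow> z = z'"
  using \<epsilon>_inj by (auto simp: inj_on_def)

lemma \<epsilon>_zero_iff: "z \<in> carrier (F n) \<Longrightarrow> \<epsilon> n z = \<zero>\<^bsub>X 0 n\<^esub> \<longleftrightarrow> z = \<zero>\<^bsub>F n\<^esub>"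
  using \<epsilon>_eq_iff[of z n "\<zero>\<^bsub>F n\<^esub>"] by simp

lemma d_\<epsilon> [simp]: "z \<in> carrier (F n) \<Longrightarrow> d 0 n (\<epsilon> n z) = \<zero>\<^bsub>X 1 n\<^esub>"
  using \<epsilon>_image[of n] by blast

text \<open>The complex \<open>F\<close> inherits the vanishing of its squared differential and the
  commutation with \<sigma> from column 0, through the injective \<epsilon>.\<close>

sublocale FC: cochain_endo "\<lambda>n. add_monoid (F n)" dF sF
proof (rule cochain_endo.intro)
  show "comm_group (add_monoid (F n))" for n by (rule abelian_group.a_comm_group[OF F])
  show "dF n \<in> additive_maps (F n) (F (Suc n))" for n by (rule dF)
  show "sF n \<in> additive_maps (F n) (F n)" for n by (rule sF)
  fix n z assume "z \<in> carrier (add_monoid (F n))"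
  then have z: "z \<in> carrier (F n)" by simp
  have "\<epsilon> (Suc (Suc n)) (dF (Suc n) (dF n z)) = \<zero>\<^bsub>X 0 (Suc (Suc n))\<^esub>"
    using z by (simp add: \<epsilon>_dF)
  then show "dF (Suc n) (dF n z) = \<one>\<^bsub>add_monoid (F (Suc (Suc n)))\<^esub>"
    using z by (simp add: \<epsilon>_zero_iff)
  have "\<epsilon> (Suc n) (sF (Suc n) (dF n z)) = \<epsilon> (Suc n) (dF n (sF n z))"
    using z by (simp add: \<epsilon>_dF \<epsilon>s s\<delta>)
  then show "sF (Suc n) (dF n z) = dF n (sF n z)"
    using z by (simp add: \<epsilon>_eq_iff)
qed

lemma FC_dev: "z \<in> carrier (F n) \<Longrightarrow> FC.dev n z = sF n z \<ominus>\<^bsub>F n\<^esub> z"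
  by (simp add: FC.dev_def a_minus_def a_inv_def)

lemma FC_Z: "carrier (FC.Z n) = {z \<in> carrier (F n). dF n z = \<zero>\<^bsub>F (Suc n)\<^esub>}"
  by (simp add: FC.carrier_Z)

lemma \<epsilon>_cyc: "z \<in> carrier (F n) \<Longrightarrow> \<epsilon> n z \<in> cyc 0 n \<longleftrightarrow> z \<in> carrier (FC.Z n)"
  by (simp add: cyc_def FC_Z \<epsilon>_dF[symmetric] \<epsilon>_zero_iff)

text \<open>In column 0 the vertical boundaries come from elements killed by d, that is, from the
  image of \<epsilon>. This explains the restriction to such elements in \<open>vbd\<close>.\<close>

lemma \<epsilon>_vbd:
  assumes z: "z \<in> carrier (F n)"
  shows "\<epsilon> n z \<in> vbd 0 n \<longleftrightarrow> z \<in> FC.B n"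
proof (cases n)
  case 0
  then show ?thesis using z by (simp add: vbd_def FC.B_def coboundaries_def \<epsilon>_zero_iff)
next
  case (Suc m)
  have "vbd 0 n = \<delta> 0 m ` \<epsilon> m ` carrier (F m)"
    unfolding \<epsilon>_image by (simp add: vbd_def Suc)
  also have "\<dots> = \<epsilon> n ` dF m ` carrier (F m)"
    unfolding image_image Suc by (rule image_cong) (simp_all add: \<epsilon>_dF)
  also have "dF m ` carrier (F m) = FC.B n"
    by (simp add: FC.B_def coboundaries_def Suc)
  finally have "vbd 0 n = \<epsilon> n ` FC.B n" .
  moreover have "FC.B n \<subseteq> carrier (F n)"
    using FC.B_subset[of n] by (auto simp: FC_Z)
  ultimately show ?thesis
    using z \<epsilon>_inj[of n] by (simp add: inj_on_image_mem_iff)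
qed

text \<open>The isomorphism between the cohomology of \<open>F\<close> and that of the complex of
  invariants, as a relation between cocycles: a full staircase from column 0 down to row 0.\<close>

definition corr :: "nat \<Rightarrow> 'y \<Rightarrow> 'x \<Rightarrow> bool"
  where "corr n z y \<longleftrightarrow> z \<in> carrier (F n) \<and> zigzag n 0 (\<epsilon> n z) y"

abbreviation (input) D :: "nat \<Rightarrow> 'x \<Rightarrow> 'x"
  where "D p y \<equiv> s p 0 y \<ominus>\<^bsub>X p 0\<^esub> y"

lemma corr_mem: "corr n z y \<Longrightarrow> z \<in> carrier (FC.Z n)" "corr n z y \<Longrightarrow> y \<in> cyc n 0"
  "corr n z y \<Longrightarrow> z \<in> carrier (F n)" "corr n z y \<Longrightarrow> y \<in> carrier (X n 0)"
  using zigzag_cyc[of n 0 "\<epsilon> n z" y] \<epsilon>_cyc[of z n] by (auto simp: corr_def cyc_def)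

lemma corr_total: "z \<in> carrier (FC.Z n) \<Longrightarrow> \<exists>y. corr n z y"
  using zigzag_total[of "\<epsilon> n z" n 0] \<epsilon>_cyc[of z n] by (simp add: corr_def FC_Z)

lemma corr_onto:
  assumes "y \<in> cyc n 0"
  shows "\<exists>z. corr n z y"
proof -
  obtain x where x: "zigzag n 0 x y" using zigzag_onto[OF assms] by blast
  then have "x \<in> cyc 0 n" using zigzag_cyc by fastforce
  then have "x \<in> \<epsilon> n ` carrier (F n)" unfolding \<epsilon>_image by (simp add: cyc_def)
  then show ?thesis using x by (auto simp: corr_def)
qed

lemma corr_diff: "\<lbrakk>corr n z y; corr n z' y'\<rbrakk> \<Longrightarrow> corr n (z \<ominus>\<^bsub>F n\<^esub> z') (y \<ominus>\<^bsub>X n 0\<^esub> y')"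
  using zigzag_diff[of n 0 "\<epsilon> n z" y "\<epsilon> n z'" y'] by (simp add: corr_def \<epsilon>_diff)

lemma corr_s: "corr n z y \<Longrightarrow> corr n (sF n z) (s n 0 y)"
  using zigzag_s[of n 0 "\<epsilon> n z" y] by (simp add: corr_def \<epsilon>s)

lemma corr_dev: "corr n z y \<Longrightarrow> corr n (FC.dev n z) (D n y)"
  using corr_diff[OF corr_s, of n z y z y] by (simp add: FC_dev corr_mem)

lemma corr_boundary: "corr n z y \<Longrightarrow> z \<in> FC.B n \<longleftrightarrow> y \<in> hbd n 0"
  using zigzag_boundary[of n 0 "\<epsilon> n z" y] \<epsilon>_vbd[of z n] by (simp add: corr_def)

lemma hbd_zero: "\<zero>\<^bsub>X p 0\<^esub> \<in> hbd p 0"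
proof (cases p)
  case 0
  then show ?thesis by (simp add: hbd_def vbd_def)
next
  case (Suc m)
  have "\<zero>\<^bsub>X p 0\<^esub> = d m 0 \<zero>\<^bsub>X m 0\<^esub>" by (simp add: Suc)
  then show ?thesis unfolding Suc hbd_def by (auto intro!: image_eqI[of _ _ "\<zero>\<^bsub>X m 0\<^esub>"])
qed

text \<open>A boundary is d of an invariant v, and v is \<sigma> - 1 of an invariant v' by
  \<open>s_onto\<close>. As d commutes with \<sigma>, the image of v' under d is a lift, and it is a
  boundary itself; corrections by it do not change classes.\<close>

lemma hbd_lift:
  assumes "y \<in> hbd p 0"
  obtains w where "w \<in> cyc p 0" "w \<in> hbd p 0" "D p w = y"
proof (cases p)
  case 0
  then have "y = \<zero>\<^bsub>X p 0\<^esub>" using assms by (simp add: hbd_def vbd_def)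
  then show ?thesis using that[of "\<zero>\<^bsub>X p 0\<^esub>"] hbd_zero by (simp add: cyc_def)
next
  case (Suc m)
  then obtain v where v: "v \<in> carrier (X m 0)" "\<delta> m 0 v = \<zero>\<^bsub>X m 1\<^esub>" "y = d m 0 v"
    using assms by (auto simp: hbd_def)
  obtain v' where v': "v' \<in> carrier (X m 0)" "\<delta> m 0 v' = \<zero>\<^bsub>X m 1\<^esub>" "D m v' = v"
    using s_onto[OF v(1,2)] by blast
  show ?thesis
  proof (rule that[of "d m 0 v'"])
    show "d m 0 v' \<in> cyc p 0" using v' by (simp add: Suc cyc_def \<delta>d)
    show "d m 0 v' \<in> hbd p 0" using v' by (simp add: Suc hbd_def)
    have "D p (d m 0 v') = d m 0 (D m v')" using v'(1) by (simp add: Suc sd)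
    then show "D p (d m 0 v') = y" using v v' by simp
  qed
qed

lemma D_diff:
  assumes "x \<in> carrier (X p 0)" "y \<in> carrier (X p 0)"
  shows "D p (x \<ominus>\<^bsub>X p 0\<^esub> y) = D p x \<ominus>\<^bsub>X p 0\<^esub> D p y"
proof -
  interpret abelian_group "X p 0" by simp
  show ?thesis using assms minus_swap[of "s p 0 x" "s p 0 y" x y] by simp
qed

lemma D_zero_iff:
  assumes "x \<in> carrier (X p 0)"
  shows "D p x = \<zero>\<^bsub>X p 0\<^esub> \<longleftrightarrow> s p 0 x = x"
proof -
  interpret abelian_group "X p 0" by simp
  show ?thesis
  proof
    assume "D p x = \<zero>\<^bsub>X p 0\<^esub>"
    then show "s p 0 x = x" by (rule diff_zero_imp_eq) (use assms in simp_all)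
  qed (use assms in simp)
qed

lemma L_closed: "f \<in> carrier (L p) \<Longrightarrow> dL p f \<in> carrier (L (Suc p))"
  by (rule hom_in_carrier[OF dL])

lemma
  assumes "f \<in> carrier (L p)"
  shows \<iota>_closed [simp]: "\<iota> p f \<in> carrier (X p 0)" and \<iota>_\<delta> [simp]: "\<delta> p 0 (\<iota> p f) = \<zero>\<^bsub>X p 1\<^esub>"
    and \<iota>_s: "s p 0 (\<iota> p f) = \<iota> p f" and \<iota>_D: "D p (\<iota> p f) = \<zero>\<^bsub>X p 0\<^esub>"
proof -
  have "\<iota> p f \<in> {x \<in> carrier (X p 0). \<delta> p 0 x = \<zero>\<^bsub>X p 1\<^esub> \<and> s p 0 x = x}"
    unfolding \<iota>_image[symmetric] using assms by (rule imageI)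
  then show "\<iota> p f \<in> carrier (X p 0)" "\<delta> p 0 (\<iota> p f) = \<zero>\<^bsub>X p 1\<^esub>" "s p 0 (\<iota> p f) = \<iota> p f"
    "D p (\<iota> p f) = \<zero>\<^bsub>X p 0\<^esub>" by auto
qed

lemma \<iota>_lift:
  assumes "x \<in> carrier (X p 0)" "\<delta> p 0 x = \<zero>\<^bsub>X p 1\<^esub>" "D p x = \<zero>\<^bsub>X p 0\<^esub>"
  obtains f where "f \<in> carrier (L p)" "x = \<iota> p f"
proof -
  have "x \<in> \<iota> p ` carrier (L p)"
    unfolding \<iota>_image using assms by (simp add: D_zero_iff)
  then show ?thesis using that by blast
qed

lemma \<iota>_eq_iff: "\<lbrakk>f \<in> carrier (L p); g \<in> carrier (L p)\<rbrakk> \<Longrightarrow> \<iota> p f = \<iota> p g \<longleftrightarrow> f = g"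
  using \<iota>_inj by (auto simp: inj_on_def)

lemma \<iota>_group_hom: "group_hom (L p) (add_monoid (X p 0)) (\<iota> p)"
  by (intro group_hom.intro group_hom_axioms.intro \<iota> comm_group.axioms(2)[OF L] abelian_group.a_group X)

lemma \<iota>_one: "\<iota> p \<one>\<^bsub>L p\<^esub> = \<zero>\<^bsub>X p 0\<^esub>"
  using group_hom.hom_one[OF \<iota>_group_hom] by simp

lemma \<iota>_diff: "\<lbrakk>f \<in> carrier (L p); g \<in> carrier (L p)\<rbrakk> \<Longrightarrow> \<iota> p (f \<otimes>\<^bsub>L p\<^esub> inv\<^bsub>L p\<^esub> g) = \<iota> p f \<ominus>\<^bsub>X p 0\<^esub> \<iota> p g"
  using group_hom.hom_mult[OF \<iota>_group_hom] group_hom.hom_inv[OF \<iota>_group_hom]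
    group.inv_closed[OF comm_group.axioms(2)[OF L]]
  by (simp add: a_minus_def a_inv_def)

text \<open>The complex \<open>L\<close> is given the identity as endomorphism, so that the theory
  of cocycles, coboundaries and classes can be shared.\<close>

sublocale LC: cochain_endo L dL "\<lambda>n f. f"
proof (rule cochain_endo.intro)
  show "comm_group (L n)" for n by (rule L)
  show "dL n \<in> hom (L n) (L (Suc n))" for n by (rule dL)
  show "(\<lambda>f. f) \<in> hom (L n) (L n)" for n by (simp add: hom_def)
  fix n f assume f: "f \<in> carrier (L n)"
  have "\<iota> (Suc (Suc n)) (dL (Suc n) (dL n f)) = \<iota> (Suc (Suc n)) \<one>\<^bsub>L (Suc (Suc n))\<^esub>"
    using f by (simp add: \<iota>d L_closed \<iota>_one)
  then show "dL (Suc n) (dL n f) = \<one>\<^bsub>L (Suc (Suc n))\<^esub>"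
    by (rule inj_onD[OF \<iota>_inj])
      (use f L_closed monoid.one_closed[OF group.is_monoid[OF comm_group.axioms(2)[OF L]]] in simp_all)
qed simp

lemma FC_Z_diff: "\<lbrakk>z \<in> carrier (FC.Z n); z' \<in> carrier (FC.Z n)\<rbrakk> \<Longrightarrow> z \<otimes>\<^bsub>FC.Z n\<^esub> inv\<^bsub>FC.Z n\<^esub> z' = z \<ominus>\<^bsub>F n\<^esub> z'"
  by (simp add: FC.Z_mult FC.Z_inv a_minus_def a_inv_def)

lemma FC_ZI_diff:
  assumes "z \<in> carrier (FC.ZI n)" "z' \<in> carrier (FC.ZI n)"
  shows "z \<otimes>\<^bsub>FC.ZI n\<^esub> inv\<^bsub>FC.ZI n\<^esub> z' = z \<ominus>\<^bsub>F n\<^esub> z'"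
  using group.m_inv_consistent[OF FC.C_group FC.invariants_presentation(5) assms(2)]
  by (simp add: FC.ZI_def a_minus_def a_inv_def)

lemma LC_Z_diff: "\<lbrakk>f \<in> carrier (LC.Z n); g \<in> carrier (LC.Z n)\<rbrakk> \<Longrightarrow> f \<otimes>\<^bsub>LC.Z n\<^esub> inv\<^bsub>LC.Z n\<^esub> g = f \<otimes>\<^bsub>L n\<^esub> inv\<^bsub>L n\<^esub> g"
  by (simp add: LC.Z_mult LC.Z_inv)

lemma LC_Z: "carrier (LC.Z n) = {f \<in> carrier (L n). \<iota> n f \<in> cyc n 0}"
proof -
  have "dL n f = \<one>\<^bsub>L (Suc n)\<^esub> \<longleftrightarrow> \<iota> n f \<in> cyc n 0" if f: "f \<in> carrier (L n)" for f
  proof -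
    have "\<one>\<^bsub>L (Suc n)\<^esub> \<in> carrier (L (Suc n))"
      by (rule monoid.one_closed[OF group.is_monoid[OF comm_group.axioms(2)[OF L]]])
    then have "dL n f = \<one>\<^bsub>L (Suc n)\<^esub> \<longleftrightarrow> d n 0 (\<iota> n f) = \<zero>\<^bsub>X (Suc n) 0\<^esub>"
      using \<iota>_eq_iff[OF L_closed[OF f], of "\<one>\<^bsub>L (Suc n)\<^esub>"] unfolding \<iota>d[OF f] \<iota>_one by simp
    then show ?thesis using f \<iota>_\<delta>[OF f] by (simp add: cyc_def)
  qed
  then show ?thesis by (auto simp: LC.carrier_Z)
qed

lemma LC_B: "f \<in> carrier (L (Suc n)) \<Longrightarrow> f \<in> LC.B (Suc n) \<longleftrightarrow> (\<exists>l \<in> carrier (L n). \<iota> (Suc n) f = d n 0 (\<iota> n l))"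
  using \<iota>_eq_iff[of f "Suc n"] L_closed by (auto simp: LC.B_def coboundaries_def \<iota>d[symmetric])

text \<open>The connecting homomorphism for the sequence of \<open>L\<close>, I and \<sigma> - 1:
  the class of z is represented by a cocycle of invariants, this is written as \<sigma> - 1 of some
  invariant u, and d is applied to u. The result is \<sigma>-fixed because d kills the
  cocycle.\<close>

definition connecting :: "nat \<Rightarrow> 'y \<Rightarrow> 'z \<Rightarrow> bool"
  where "connecting n z f \<longleftrightarrow> f \<in> carrier (L (Suc n)) \<and>
    (\<exists>u \<in> carrier (X n 0). \<delta> n 0 u = \<zero>\<^bsub>X n 1\<^esub> \<and> corr n z (D n u) \<and> \<iota> (Suc n) f = d n 0 u)"

text \<open>The map on classes induced by including the \<sigma>-fixed invariants into all
  invariants, read through the staircase.\<close>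

definition edge :: "nat \<Rightarrow> 'z \<Rightarrow> 'y \<Rightarrow> bool"
  where "edge n f z \<longleftrightarrow> f \<in> carrier (L n) \<and> corr n z (\<iota> n f)"

lemma D_closed: "u \<in> carrier (X n 0) \<Longrightarrow> D n u \<in> carrier (X n 0)"
  by simp

section \<open>Exactness on the level of cocycles\<close>

lemma D_d: "u \<in> carrier (X n 0) \<Longrightarrow> D (Suc n) (d n 0 u) = d n 0 (D n u)"
  by (simp add: sd)

lemma D_\<delta>: "\<lbrakk>u \<in> carrier (X n 0); \<delta> n 0 u = \<zero>\<^bsub>X n 1\<^esub>\<rbrakk> \<Longrightarrow> \<delta> n 0 (D n u) = \<zero>\<^bsub>X n 1\<^esub>"
  by (simp add: s\<delta>[symmetric])

lemma connecting_relation: "relation_between (FC.Z n) (LC.Z (Suc n)) (connecting n)"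
  unfolding relation_between_def
proof (intro conjI allI impI ballI)
  fix z f assume "connecting n z f"
  then obtain u where u: "u \<in> carrier (X n 0)" "\<delta> n 0 u = \<zero>\<^bsub>X n 1\<^esub>" "corr n z (D n u)" "\<iota> (Suc n) f = d n 0 u"
    and f: "f \<in> carrier (L (Suc n))"
    unfolding connecting_def by blast
  show "z \<in> carrier (FC.Z n)" by (rule corr_mem(1)[OF u(3)])
  show "f \<in> carrier (LC.Z (Suc n))"
    using f u by (simp add: LC_Z cyc_def \<delta>d)
next
  fix z assume "z \<in> carrier (FC.Z n)"
  then obtain y where y: "corr n z y" using corr_total by blast
  then have yc: "y \<in> carrier (X n 0)" "\<delta> n 0 y = \<zero>\<^bsub>X n 1\<^esub>" "d n 0 y = \<zero>\<^bsub>X (Suc n) 0\<^esub>"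
    using corr_mem(2)[OF y] by (simp_all add: cyc_def)
  obtain u where u: "u \<in> carrier (X n 0)" "\<delta> n 0 u = \<zero>\<^bsub>X n 1\<^esub>" "D n u = y"
    using s_onto[OF yc(1,2)] by blast
  have "D (Suc n) (d n 0 u) = \<zero>\<^bsub>X (Suc n) 0\<^esub>"
    unfolding D_d[OF u(1)] u(3) by (rule yc(3))
  moreover have "\<delta> (Suc n) 0 (d n 0 u) = \<zero>\<^bsub>X (Suc n) 1\<^esub>"
    using u by (simp add: \<delta>d)
  ultimately obtain f where f: "f \<in> carrier (L (Suc n))" "d n 0 u = \<iota> (Suc n) f"
    using \<iota>_lift[of "d n 0 u" "Suc n"] u(1) by (metis X_closed(4))
  have "connecting n z f"
    unfolding connecting_def using f u y by metis
  then show "\<exists>f. connecting n z f" ..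
next
  fix z f z' f' assume zf: "connecting n z f" and zf': "connecting n z' f'"
  from zf obtain u where u: "u \<in> carrier (X n 0)" "\<delta> n 0 u = \<zero>\<^bsub>X n 1\<^esub>" "corr n z (D n u)" "\<iota> (Suc n) f = d n 0 u"
    and f: "f \<in> carrier (L (Suc n))"
    unfolding connecting_def by blast
  from zf' obtain u' where u': "u' \<in> carrier (X n 0)" "\<delta> n 0 u' = \<zero>\<^bsub>X n 1\<^esub>" "corr n z' (D n u')" "\<iota> (Suc n) f' = d n 0 u'"
    and f': "f' \<in> carrier (L (Suc n))"
    unfolding connecting_def by blast
  have fZ: "f \<in> carrier (LC.Z (Suc n))" "f' \<in> carrier (LC.Z (Suc n))"
    using f f' u u' by (simp_all add: LC_Z cyc_def \<delta>d)
  have "corr n (z \<ominus>\<^bsub>F n\<^esub> z') (D n (u \<ominus>\<^bsub>X n 0\<^esub> u'))"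
    unfolding D_diff[OF u(1) u'(1)] by (rule corr_diff[OF u(3) u'(3)])
  moreover have "f \<otimes>\<^bsub>L (Suc n)\<^esub> inv\<^bsub>L (Suc n)\<^esub> f' \<in> carrier (L (Suc n))"
    using f f' L by (meson comm_group.axioms(2) group.inv_closed group.is_monoid monoid.m_closed)
  moreover have "\<iota> (Suc n) (f \<otimes>\<^bsub>L (Suc n)\<^esub> inv\<^bsub>L (Suc n)\<^esub> f') = d n 0 (u \<ominus>\<^bsub>X n 0\<^esub> u')"
    using u u' by (simp add: \<iota>_diff[OF f f'])
  moreover have "u \<ominus>\<^bsub>X n 0\<^esub> u' \<in> carrier (X n 0)" "\<delta> n 0 (u \<ominus>\<^bsub>X n 0\<^esub> u') = \<zero>\<^bsub>X n 1\<^esub>"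
    using u u' by simp_all
  ultimately have "connecting n (z \<ominus>\<^bsub>F n\<^esub> z') (f \<otimes>\<^bsub>L (Suc n)\<^esub> inv\<^bsub>L (Suc n)\<^esub> f')"
    unfolding connecting_def by blast
  then show "connecting n (z \<otimes>\<^bsub>FC.Z n\<^esub> inv\<^bsub>FC.Z n\<^esub> z') (f \<otimes>\<^bsub>LC.Z (Suc n)\<^esub> inv\<^bsub>LC.Z (Suc n)\<^esub> f')"
    unfolding FC_Z_diff[OF corr_mem(1)[OF u(3)] corr_mem(1)[OF u'(3)]] LC_Z_diff[OF fZ] .
qed

lemma corr_fixed:
  assumes f: "f \<in> carrier (L n)" and c: "corr n z (\<iota> n f)"
  shows "z \<in> carrier (FC.ZI n)"
proof -
  have "corr n (FC.dev n z) \<zero>\<^bsub>X n 0\<^esub>"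
    using corr_dev[OF c] unfolding \<iota>_D[OF f] .
  then have "FC.dev n z \<in> FC.B n"
    using corr_boundary hbd_zero by blast
  then show ?thesis
    using corr_mem(1)[OF c] by (simp add: FC.ZI_def)
qed

lemma edge_relation: "relation_between (LC.Z n) (FC.ZI n) (edge n)"
  unfolding relation_between_def
proof (intro conjI allI impI ballI)
  fix f z assume "edge n f z"
  then have f: "f \<in> carrier (L n)" and c: "corr n z (\<iota> n f)" by (auto simp: edge_def)
  show "f \<in> carrier (LC.Z n)" using f corr_mem(2)[OF c] by (simp add: LC_Z)
  show "z \<in> carrier (FC.ZI n)" by (rule corr_fixed[OF f c])
next
  fix f assume "f \<in> carrier (LC.Z n)"
  then show "\<exists>z. edge n f z" using corr_onto[of "\<iota> n f" n] by (auto simp: LC_Z edge_def)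
next
  fix f z f' z' assume "edge n f z" "edge n f' z'"
  then have f: "f \<in> carrier (L n)" and c: "corr n z (\<iota> n f)" and f': "f' \<in> carrier (L n)" and c': "corr n z' (\<iota> n f')"
    by (auto simp: edge_def)
  have fZ: "f \<in> carrier (LC.Z n)" "f' \<in> carrier (LC.Z n)"
    using f f' corr_mem(2)[OF c] corr_mem(2)[OF c'] by (simp_all add: LC_Z)
  have "f \<otimes>\<^bsub>L n\<^esub> inv\<^bsub>L n\<^esub> f' \<in> carrier (L n)"
    using f f' L by (meson comm_group.axioms(2) group.inv_closed group.is_monoid monoid.m_closed)
  then have "edge n (f \<otimes>\<^bsub>L n\<^esub> inv\<^bsub>L n\<^esub> f') (z \<ominus>\<^bsub>F n\<^esub> z')"
    using corr_diff[OF c c'] by (simp add: edge_def \<iota>_diff[OF f f'])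
  then show "edge n (f \<otimes>\<^bsub>LC.Z n\<^esub> inv\<^bsub>LC.Z n\<^esub> f') (z \<otimes>\<^bsub>FC.ZI n\<^esub> inv\<^bsub>FC.ZI n\<^esub> z')"
    unfolding LC_Z_diff[OF fZ] FC_ZI_diff[OF corr_fixed[OF f c] corr_fixed[OF f' c']] .
qed

text \<open>This is the usual description of the kernel of a connecting map. The differential of u
  comes from a \<sigma>-fixed element exactly when u can be changed by a cocycle so as to become
  \<sigma>-fixed, up to boundaries that \<open>hbd_lift\<close> absorbs.\<close>

lemma connecting_boundary:
  assumes zf: "connecting n z f"
  shows "(\<exists>z' \<in> carrier (FC.Z n). z \<ominus>\<^bsub>F n\<^esub> FC.dev n z' \<in> FC.B n) \<longleftrightarrow> f \<in> LC.B (Suc n)"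
proof -
  from zf obtain u where u: "u \<in> carrier (X n 0)" "\<delta> n 0 u = \<zero>\<^bsub>X n 1\<^esub>" "corr n z (D n u)" "\<iota> (Suc n) f = d n 0 u"
    and f: "f \<in> carrier (L (Suc n))"
    unfolding connecting_def by blast
  show ?thesis
    unfolding LC_B[OF f]
  proof
    assume "\<exists>z' \<in> carrier (FC.Z n). z \<ominus>\<^bsub>F n\<^esub> FC.dev n z' \<in> FC.B n"
    then obtain z' where z': "z' \<in> carrier (FC.Z n)" "z \<ominus>\<^bsub>F n\<^esub> FC.dev n z' \<in> FC.B n" by blast
    obtain y' where y': "corr n z' y'" using corr_total[OF z'(1)] by blast
    have yc: "y' \<in> carrier (X n 0)" "\<delta> n 0 y' = \<zero>\<^bsub>X n 1\<^esub>" "d n 0 y' = \<zero>\<^bsub>X (Suc n) 0\<^esub>"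
      using corr_mem(2)[OF y'] by (simp_all add: cyc_def)
    have "D n u \<ominus>\<^bsub>X n 0\<^esub> D n y' \<in> hbd n 0"
      using corr_boundary[OF corr_diff[OF u(3) corr_dev[OF y']]] z'(2) by simp
    then obtain w where w: "w \<in> cyc n 0" "D n w = D n u \<ominus>\<^bsub>X n 0\<^esub> D n y'"
      by (rule hbd_lift)
    have wc: "w \<in> carrier (X n 0)" "\<delta> n 0 w = \<zero>\<^bsub>X n 1\<^esub>" "d n 0 w = \<zero>\<^bsub>X (Suc n) 0\<^esub>"
      using w(1) by (simp_all add: cyc_def)
    \<comment> \<open>The cocycle y' represents z', and w accounts for the boundary by which z and
      \<sigma> - 1 of z' differ. Subtracting both makes u fixed by \<sigma>, while d of it is
      unchanged.\<close>
    let ?t = "u \<ominus>\<^bsub>X n 0\<^esub> y' \<ominus>\<^bsub>X n 0\<^esub> w"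
    have t: "?t \<in> carrier (X n 0)" "\<delta> n 0 ?t = \<zero>\<^bsub>X n 1\<^esub>" "d n 0 ?t = d n 0 u"
      using u(1,2) yc wc by simp_all
    have uy: "u \<ominus>\<^bsub>X n 0\<^esub> y' \<in> carrier (X n 0)" using u(1) yc(1) by simp
    have "D n ?t = \<zero>\<^bsub>X n 0\<^esub>"
      unfolding D_diff[OF uy wc(1)] D_diff[OF u(1) yc(1)] w(2)
      by (rule X_minus_zero(2)) (use u(1) yc(1) in simp)
    from \<iota>_lift[OF t(1,2) this] obtain l where "l \<in> carrier (L n)" "?t = \<iota> n l" .
    then show "\<exists>l \<in> carrier (L n). \<iota> (Suc n) f = d n 0 (\<iota> n l)"
      using t(3) u(4) by metis
  next
    assume "\<exists>l \<in> carrier (L n). \<iota> (Suc n) f = d n 0 (\<iota> n l)"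
    then obtain l where l: "l \<in> carrier (L n)" "\<iota> (Suc n) f = d n 0 (\<iota> n l)" by blast
    \<comment> \<open>This is a cocycle, and \<sigma> - 1 takes the same value on it as on u because
      the subtracted element is fixed. A cocycle z' of \<open>F\<close> corresponding to it shows
      that z is \<sigma> - 1 of z' up to a boundary.\<close>
    let ?t = "u \<ominus>\<^bsub>X n 0\<^esub> \<iota> n l"
    have "d n 0 ?t = d n 0 u \<ominus>\<^bsub>X (Suc n) 0\<^esub> d n 0 (\<iota> n l)"
      using u(1) l(1) by simp
    also have "\<dots> = \<zero>\<^bsub>X (Suc n) 0\<^esub>"
      unfolding l(2)[symmetric] u(4) by (rule X_minus_zero(2)) (use u(1) in simp)
    finally have "?t \<in> cyc n 0"
      using u(1,2) l(1) \<iota>_\<delta>[OF l(1)] by (simp add: cyc_def)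
    then obtain z' where z': "corr n z' ?t" using corr_onto by blast
    have Dt: "D n ?t = D n u"
      unfolding D_diff[OF u(1) \<iota>_closed[OF l(1)]] \<iota>_D[OF l(1)] by (rule X_minus_zero(1)) (use u(1) in simp)
    have "D n u \<ominus>\<^bsub>X n 0\<^esub> D n ?t \<in> hbd n 0"
      unfolding Dt using hbd_zero u(1) by simp
    then have "z \<ominus>\<^bsub>F n\<^esub> FC.dev n z' \<in> FC.B n"
      using corr_boundary[OF corr_diff[OF u(3) corr_dev[OF z']]] by simp
    then show "\<exists>z' \<in> carrier (FC.Z n). z \<ominus>\<^bsub>F n\<^esub> FC.dev n z' \<in> FC.B n"
      using corr_mem(1)[OF z'] by blast
  qed
qed

lemma edge_boundary: "edge n f z \<Longrightarrow> z \<in> FC.B n \<longleftrightarrow> \<iota> n f \<in> hbd n 0"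
  by (simp add: edge_def corr_boundary)

text \<open>For a fixed class with representative y, \<sigma> - 1 of y is a boundary, hence \<sigma>
  - 1 of some w that is a boundary too. Then y - w represents the same class and is fixed
  itself.\<close>

lemma edge_onto:
  assumes z: "z \<in> carrier (FC.ZI n)"
  shows "\<exists>f z'. edge n f z' \<and> z \<ominus>\<^bsub>F n\<^esub> z' \<in> FC.B n"
proof -
  have zZ: "z \<in> carrier (FC.Z n)" "FC.dev n z \<in> FC.B n" using z by (simp_all add: FC.ZI_def)
  obtain y where y: "corr n z y" using corr_total[OF zZ(1)] by blast
  have yc: "y \<in> carrier (X n 0)" "\<delta> n 0 y = \<zero>\<^bsub>X n 1\<^esub>" "d n 0 y = \<zero>\<^bsub>X (Suc n) 0\<^esub>"
    using corr_mem(2)[OF y] by (simp_all add: cyc_def)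
  have "D n y \<in> hbd n 0" using corr_boundary[OF corr_dev[OF y]] zZ(2) by simp
  then obtain w where w: "w \<in> cyc n 0" "w \<in> hbd n 0" "D n w = D n y" by (rule hbd_lift)
  have wc: "w \<in> carrier (X n 0)" "\<delta> n 0 w = \<zero>\<^bsub>X n 1\<^esub>" "d n 0 w = \<zero>\<^bsub>X (Suc n) 0\<^esub>"
    using w(1) by (simp_all add: cyc_def)
  let ?t = "y \<ominus>\<^bsub>X n 0\<^esub> w"
  have t: "?t \<in> carrier (X n 0)" "\<delta> n 0 ?t = \<zero>\<^bsub>X n 1\<^esub>" "?t \<in> cyc n 0"
    using yc wc by (simp_all add: cyc_def)
  have "D n ?t = \<zero>\<^bsub>X n 0\<^esub>"
    unfolding D_diff[OF yc(1) wc(1)] w(3) by (rule X_minus_zero(2)) (use yc(1) in simp)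
  from \<iota>_lift[OF t(1,2) this] obtain f where f: "f \<in> carrier (L n)" "?t = \<iota> n f" .
  obtain z' where z': "corr n z' ?t" using corr_onto[OF t(3)] by blast
  interpret Xn: abelian_group "X n 0" by simp
  have "y \<ominus>\<^bsub>X n 0\<^esub> ?t = w"
    using yc(1) wc(1) by (simp add: a_minus_def Xn.minus_add Xn.a_assoc[symmetric] Xn.r_neg)
  then have "z \<ominus>\<^bsub>F n\<^esub> z' \<in> FC.B n"
    using corr_boundary[OF corr_diff[OF y z']] w(2) by simp
  moreover have "edge n f z'" using f z' by (simp add: edge_def)
  ultimately show ?thesis by blast
qed

theorem short_exact_resolved:
  "\<exists>\<alpha> \<beta>. short_exact (coinvariants (cohomology (\<lambda>n. add_monoid (F n)) dF n) (FC.E n)) \<alpha>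
     (cohomology L dL (Suc n)) \<beta>
     (invariants (cohomology (\<lambda>n. add_monoid (F n)) dF (Suc n)) (FC.E (Suc n)))"
proof -
  obtain \<pi> where \<pi>: "group (coinvariants (cohomology (\<lambda>n. add_monoid (F n)) dF n) (FC.E n))"
    "\<pi> \<in> epi (FC.Z n) (coinvariants (cohomology (\<lambda>n. add_monoid (F n)) dF n) (FC.E n))"
    "\<And>z. z \<in> carrier (FC.Z n) \<Longrightarrow> \<pi> z = \<one>\<^bsub>coinvariants (cohomology (\<lambda>n. add_monoid (F n)) dF n) (FC.E n)\<^esub> \<longleftrightarrow>
      (\<exists>z' \<in> carrier (FC.Z n). z \<otimes>\<^bsub>add_monoid (F n)\<^esub> inv\<^bsub>add_monoid (F n)\<^esub> FC.dev n z' \<in> FC.B n)"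
    by (rule FC.coinvariants_presentation[of n], rule that, assumption+)
  note inv = FC.invariants_presentation[of "Suc n"]
  have ZI_sub: "z \<in> carrier (FC.Z (Suc n))" if "z \<in> carrier (FC.ZI (Suc n))" for z
    using that by (simp add: FC.ZI_def)
  have conn: "z \<in> carrier (FC.Z n)" "f \<in> carrier (LC.Z (Suc n))" if "connecting n z f" for z f
    using connecting_relation[of n, unfolded relation_between_def, THEN conjunct1, rule_format, OF that] by simp_all
  have edg: "f \<in> carrier (LC.Z (Suc n))" "z \<in> carrier (FC.ZI (Suc n))" if "edge (Suc n) f z" for f z
    using edge_relation[of "Suc n", unfolded relation_between_def, THEN conjunct1, rule_format, OF that] by simp_all
  \<comment> \<open>These are the coboundaries of the complex of all invariants: u need not be fixed
    by \<sigma>, unlike in the coboundaries of \<open>L\<close>. The difference between the two is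
    what the connecting map measures.\<close>
  have hbd: "\<iota> (Suc n) f \<in> hbd (Suc n) 0 \<longleftrightarrow> (\<exists>u \<in> carrier (X n 0). \<delta> n 0 u = \<zero>\<^bsub>X n 1\<^esub> \<and> \<iota> (Suc n) f = d n 0 u)" for f
    by (auto simp: hbd_def)
  have pr1: "FC.pr (Suc n) z = \<one>\<^bsub>invariants (cohomology (\<lambda>n. add_monoid (F n)) dF (Suc n)) (FC.E (Suc n))\<^esub> \<longleftrightarrow> z \<in> FC.B (Suc n)"
    if "z \<in> carrier (FC.ZI (Suc n))" for z
    unfolding inv(4) by (rule FC.pr_one[OF ZI_sub[OF that]])
  show ?thesis
  proof (rule short_exact_relations[OF comm_group.axioms(2)[OF FC.Z_comm_group] comm_group.axioms(2)[OF LC.Z_comm_group]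
        comm_group.axioms(2)[OF inv(1)] \<pi>(1) comm_group.axioms(2)[OF LC.cohomology_comm_group] inv(2)
        \<pi>(2) LC.pr_epi inv(3) connecting_relation edge_relation])
    fix z f assume zf: "connecting n z f"
    show "\<pi> z = \<one>\<^bsub>coinvariants (cohomology (\<lambda>n. add_monoid (F n)) dF n) (FC.E n)\<^esub> \<longleftrightarrow>
        LC.pr (Suc n) f = \<one>\<^bsub>cohomology L dL (Suc n)\<^esub>"
      using connecting_boundary[OF zf] \<pi>(3)[OF conn(1)[OF zf]] LC.pr_one[OF conn(2)[OF zf]]
      by (simp add: a_minus_def a_inv_def)
    from zf obtain u where u: "u \<in> carrier (X n 0)" "\<delta> n 0 u = \<zero>\<^bsub>X n 1\<^esub>" "\<iota> (Suc n) f = d n 0 u"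
      and f: "f \<in> carrier (L (Suc n))"
      unfolding connecting_def by blast
    have "\<iota> (Suc n) f \<in> cyc (Suc n) 0" using conn(2)[OF zf] by (simp add: LC_Z)
    then obtain z' where "corr (Suc n) z' (\<iota> (Suc n) f)" using corr_onto by blast
    then have e: "edge (Suc n) f z'" using f by (simp add: edge_def)
    have "\<iota> (Suc n) f \<in> hbd (Suc n) 0" using hbd u by blast
    then have "z' \<in> FC.B (Suc n)" using edge_boundary[OF e] by simp
    then show "\<exists>z'. edge (Suc n) f z' \<and>
        FC.pr (Suc n) z' = \<one>\<^bsub>invariants (cohomology (\<lambda>n. add_monoid (F n)) dF (Suc n)) (FC.E (Suc n))\<^esub>"
      using e pr1[OF edg(2)[OF e]] by blast
  next
    fix f z assume e: "edge (Suc n) f z" and "LC.pr (Suc n) f = \<one>\<^bsub>cohomology L dL (Suc n)\<^esub>"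
    then have "f \<in> LC.B (Suc n)" using LC.pr_one[OF edg(1)[OF e]] by simp
    moreover have "f \<in> carrier (L (Suc n))" using e by (simp add: edge_def)
    ultimately obtain l where l: "l \<in> carrier (L n)" "\<iota> (Suc n) f = d n 0 (\<iota> n l)"
      using LC_B by blast
    have "\<iota> (Suc n) f \<in> hbd (Suc n) 0"
      unfolding hbd using \<iota>_closed[OF l(1)] \<iota>_\<delta>[OF l(1)] l(2) by blast
    then show "FC.pr (Suc n) z = \<one>\<^bsub>invariants (cohomology (\<lambda>n. add_monoid (F n)) dF (Suc n)) (FC.E (Suc n))\<^esub>"
      unfolding pr1[OF edg(2)[OF e]] edge_boundary[OF e] .
  next
    fix z assume z: "z \<in> carrier (FC.ZI (Suc n))"
    obtain f z' where e: "edge (Suc n) f z'" "z \<ominus>\<^bsub>F (Suc n)\<^esub> z' \<in> FC.B (Suc n)"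
      using edge_onto[OF z] by blast
    interpret p: group_hom "FC.Z (Suc n)" "cohomology (\<lambda>n. add_monoid (F n)) dF (Suc n)" "FC.pr (Suc n)"
      by (rule FC.pr_group_hom)
    have zz: "z \<in> carrier (FC.Z (Suc n))" "z' \<in> carrier (FC.Z (Suc n))"
      using ZI_sub z edg(2)[OF e(1)] by auto
    have "FC.pr (Suc n) (z \<otimes>\<^bsub>FC.Z (Suc n)\<^esub> inv\<^bsub>FC.Z (Suc n)\<^esub> z') = \<one>\<^bsub>cohomology (\<lambda>n. add_monoid (F n)) dF (Suc n)\<^esub>"
      using FC.pr_one[OF p.G.m_closed[OF zz(1) p.G.inv_closed[OF zz(2)]]] e(2) unfolding FC_Z_diff[OF zz] by simp
    then have "FC.pr (Suc n) z \<otimes>\<^bsub>cohomology (\<lambda>n. add_monoid (F n)) dF (Suc n)\<^esub>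
        inv\<^bsub>cohomology (\<lambda>n. add_monoid (F n)) dF (Suc n)\<^esub> FC.pr (Suc n) z' = \<one>\<^bsub>cohomology (\<lambda>n. add_monoid (F n)) dF (Suc n)\<^esub>"
      unfolding p.hom_mult[OF zz(1) p.G.inv_closed[OF zz(2)]] p.hom_inv[OF zz(2)] .
    from p.H.inv_equality[OF this p.H.inv_closed[OF p.hom_closed[OF zz(2)]] p.hom_closed[OF zz(1)]]
    have "FC.pr (Suc n) z' = FC.pr (Suc n) z"
      unfolding p.H.inv_inv[OF p.hom_closed[OF zz(2)]] .
    with e(1) show "\<exists>f z'. edge (Suc n) f z' \<and> FC.pr (Suc n) z' = FC.pr (Suc n) z"
      by (intro exI conjI)
  next
    fix f z assume e: "edge (Suc n) f z"
      and "FC.pr (Suc n) z = \<one>\<^bsub>invariants (cohomology (\<lambda>n. add_monoid (F n)) dF (Suc n)) (FC.E (Suc n))\<^esub>"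
    then have "\<iota> (Suc n) f \<in> hbd (Suc n) 0"
      unfolding pr1[OF edg(2)[OF e]] edge_boundary[OF e] by simp
    then obtain u where u: "u \<in> carrier (X n 0)" "\<delta> n 0 u = \<zero>\<^bsub>X n 1\<^esub>" "\<iota> (Suc n) f = d n 0 u"
      unfolding hbd by blast
    have f: "f \<in> carrier (L (Suc n))" using e by (simp add: edge_def)
    \<comment> \<open>Since d of u is \<sigma>-fixed, \<sigma> - 1 of u is a cocycle. The cocycle of
      \<open>F\<close> corresponding to it is the preimage under the connecting map.\<close>
    have "d n 0 (D n u) = \<zero>\<^bsub>X (Suc n) 0\<^esub>"
      unfolding D_d[OF u(1), symmetric] u(3)[symmetric] by (rule \<iota>_D[OF f])
    then have "D n u \<in> cyc n 0"
      using D_closed[OF u(1)] D_\<delta>[OF u(1,2)] by (simp add: cyc_def del: X_diff)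
    then obtain z' where "corr n z' (D n u)" using corr_onto by blast
    then have "connecting n z' f"
      unfolding connecting_def using f u by blast
    then show "\<exists>z' f'. connecting n z' f' \<and> LC.pr (Suc n) f' = LC.pr (Suc n) f"
      using refl by (intro exI conjI)
  qed
qed

end

section \<open>Homomorphisms from the unit comodule\<close>

context hopf_factor
begin

lemma regular_module_module: "module k (regular_module k)"
proof -
  interpret cring k by (rule k_cring)
  show ?thesis
  proof (rule moduleI)
    show "abelian_group (regular_module k)"
      by (rule abelian_groupI) (auto simp: regular_module_def a_ac intro: bexI[of _ "\<ominus>\<^bsub>k\<^esub> _"] l_neg)
  qed (simp_all add: k_cring regular_module_def l_distr r_distr m_assoc)
qed

lemma unit_comodule_simps:
  "carrier (unit_comodule k A) = carrier k" "mendo (unit_comodule k A) = rendo k"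
  "coaction (unit_comodule k A) = (\<lambda>r. pure_tensor k (regular_module k) A r [\<one>\<^bsub>A\<^esub>])"
  "linear_maps k (unit_comodule k A) N = linear_maps k (regular_module k) N"
  by (simp_all add: unit_comodule_def difference_module.defs difference_comodule.defs regular_module_def
      linear_maps_def hom_def)

definition fixed_points :: "('k, 'a, 'm) difference_comodule \<Rightarrow> 'm set"
  where "fixed_points N = {y \<in> carrier N. coaction N y = pure_tensor k N A y [\<one>\<^bsub>A\<^esub>] \<and> mendo N y = y}"

definition unit_map :: "('k, 'a, 'm) difference_comodule \<Rightarrow> 'm \<Rightarrow> 'k \<Rightarrow> 'm"
  where "unit_map N y = (\<lambda>r\<in>carrier k. r \<odot>\<^bsub>N\<^esub> y)"

context
  fixes N :: "('k, 'a, 'm) difference_comodule"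
  assumes N: "difference_comodule k A N"
begin

lemma unit_map_one: "y \<in> carrier N \<Longrightarrow> unit_map N y \<one>\<^bsub>k\<^esub> = y"
  using module.smult_one[OF comodule_module[OF N]] ring.ring_simprules(6)[OF cring.axioms(1)[OF k_cring]]
  by (simp add: unit_map_def)

lemma unit_map_linear:
  assumes y: "y \<in> carrier N"
  shows "unit_map N y \<in> linear_maps k (regular_module k) N"
proof -
  interpret N: module k N by (rule comodule_module[OF N])
  show ?thesis
    using y by (intro linear_mapsI additive_mapsI)
      (simp_all add: unit_map_def regular_module_def N.smult_l_distr N.smult_assoc1)
qed

lemma fixed_pointsD: "y \<in> fixed_points N \<Longrightarrow> y \<in> carrier N"
  by (simp add: fixed_points_def)

lemma fixed_points_zero: "\<zero>\<^bsub>N\<^esub> \<in> fixed_points N"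
proof -
  note m = comodule_module[OF N]
  have "coaction N \<zero>\<^bsub>N\<^esub> = \<zero>\<^bsub>tensor k N A (Suc 0)\<^esub>"
    by (rule additive_zero[OF linear_additive[OF comodule_coaction_linear[OF N]]]) (use m in simp_all)
  moreover have "mendo N \<zero>\<^bsub>N\<^esub> = \<zero>\<^bsub>N\<^esub>"
    by (rule additive_zero[OF mendo_additive[OF comodule_difference_module[OF N]]]) (use m in simp_all)
  moreover have "pure_tensor k N A \<zero>\<^bsub>N\<^esub> [\<one>\<^bsub>A\<^esub>] = \<zero>\<^bsub>tensor k N A (Suc 0)\<^esub>"
    by (rule pure_zero[OF m]) simp_all
  ultimately show ?thesis
    using m by (simp add: fixed_points_def)
qed

lemma fixed_points_diff:
  assumes y: "y \<in> fixed_points N" "y' \<in> fixed_points N"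
  shows "y \<ominus>\<^bsub>N\<^esub> y' \<in> fixed_points N"
proof -
  note m = comodule_module[OF N]
  have c: "y \<in> carrier N" "y' \<in> carrier N" using y by (simp_all add: fixed_pointsD)
  note p = linear_additive[OF pure_linear_left[OF m one_closed]]
  have "coaction N (y \<ominus>\<^bsub>N\<^esub> y') = coaction N y \<ominus>\<^bsub>tensor k N A (Suc 0)\<^esub> coaction N y'"
    by (rule additive_diff[OF linear_additive[OF comodule_coaction_linear[OF N]]]) (use m c in simp_all)
  moreover have "mendo N (y \<ominus>\<^bsub>N\<^esub> y') = mendo N y \<ominus>\<^bsub>N\<^esub> mendo N y'"
    by (rule additive_diff[OF mendo_additive[OF comodule_difference_module[OF N]]]) (use m c in simp_all)
  moreover have "pure_tensor k N A (y \<ominus>\<^bsub>N\<^esub> y') [\<one>\<^bsub>A\<^esub>]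
      = pure_tensor k N A y [\<one>\<^bsub>A\<^esub>] \<ominus>\<^bsub>tensor k N A (Suc 0)\<^esub> pure_tensor k N A y' [\<one>\<^bsub>A\<^esub>]"
    by (rule additive_diff[OF p]) (use m c in simp_all)
  ultimately show ?thesis
    using m y c by (simp add: fixed_points_def)
qed

lemma fixed_points_add:
  assumes y: "y \<in> fixed_points N" "y' \<in> fixed_points N"
  shows "y \<oplus>\<^bsub>N\<^esub> y' \<in> fixed_points N"
proof -
  interpret N: module k N by (rule comodule_module[OF N])
  have "y \<ominus>\<^bsub>N\<^esub> (\<zero>\<^bsub>N\<^esub> \<ominus>\<^bsub>N\<^esub> y') \<in> fixed_points N"
    by (intro fixed_points_diff y fixed_points_zero)
  then show ?thesis
    using y by (simp add: fixed_pointsD a_minus_def)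
qed

text \<open>Evaluation at one inverts \<open>unit_map\<close>. The unit of k is fixed by \<sigma>
  and its coaction appends a unit, so its image under a comodule map is a fixed invariant.\<close>

lemma carrier_unit_hom_group:
  "carrier (comodule_hom_group k A (unit_comodule k A) N) = unit_map N ` fixed_points N"
proof (intro subset_antisym subsetI)
  interpret N: module k N by (rule comodule_module[OF N])
  interpret k: cring k by (rule k_cring)
  fix f assume "f \<in> carrier (comodule_hom_group k A (unit_comodule k A) N)"
  then have f: "f \<in> comodule_maps k A (unit_comodule k A) N" and ext: "f \<in> extensional (carrier k)"
    by (simp_all add: comodule_hom_group_def unit_comodule_simps)
  note lin = comodule_map_linear[OF f, unfolded unit_comodule_simps]
  have mul: "f r = r \<odot>\<^bsub>N\<^esub> f \<one>\<^bsub>k\<^esub>" if r: "r \<in> carrier k" for r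
    using linear_smult[OF lin r, of "\<one>\<^bsub>k\<^esub>"] r by (simp add: regular_module_def)
  have c: "f \<one>\<^bsub>k\<^esub> \<in> carrier N"
    by (rule linear_closed[OF lin]) (simp add: regular_module_def)
  have "mendo N (f \<one>\<^bsub>k\<^esub>) = f \<one>\<^bsub>k\<^esub>"
    using comodule_map_mendo[OF f, of "\<one>\<^bsub>k\<^esub>"] ring_hom_one[OF difference_ring.rendo_hom[OF difference_ring]]
    by (simp add: unit_comodule_simps)
  moreover have "coaction N (f \<one>\<^bsub>k\<^esub>) = tensor_map k N A (Suc 0) f (pure_tensor k (regular_module k) A \<one>\<^bsub>k\<^esub> [\<one>\<^bsub>A\<^esub>])"
    using comodule_map_coaction[OF f, of "\<one>\<^bsub>k\<^esub>"] by (simp add: unit_comodule_simps)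
  moreover have "\<dots> = pure_tensor k N A (f \<one>\<^bsub>k\<^esub>) [\<one>\<^bsub>A\<^esub>]"
    by (rule map_pure[OF regular_module_module comodule_module[OF N] lin]) (simp_all add: regular_module_def)
  ultimately have y: "f \<one>\<^bsub>k\<^esub> \<in> fixed_points N"
    using c by (simp add: fixed_points_def)
  have "f = unit_map N (f \<one>\<^bsub>k\<^esub>)"
    unfolding unit_map_def by (rule extensionalityI[OF ext restrict_extensional]) (simp only: restrict_apply' mul[symmetric])
  then show "f \<in> unit_map N ` fixed_points N"
    by (rule image_eqI[of f "unit_map N" "f \<one>\<^bsub>k\<^esub>" "fixed_points N"]) (rule y)
next
  interpret N: module k N by (rule comodule_module[OF N])
  fix f assume "f \<in> unit_map N ` fixed_points N"
  then obtain y where f: "f = unit_map N y" and y: "y \<in> fixed_points N" by (rule imageE)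
  from y have yc: "y \<in> carrier N" "coaction N y = pure_tensor k N A y [\<one>\<^bsub>A\<^esub>]" "mendo N y = y"
    by (simp_all add: fixed_points_def)
  note lin = unit_map_linear[OF yc(1)]
  have "f \<in> comodule_maps k A (unit_comodule k A) N"
  proof (rule comodule_mapsI)
    show "f \<in> linear_maps k (unit_comodule k A) N" unfolding unit_comodule_simps f by (rule lin)
    fix r assume "r \<in> carrier (unit_comodule k A)"
    then have r: "r \<in> carrier k" by (simp add: unit_comodule_simps)
    show "f (mendo (unit_comodule k A) r) = mendo N (f r)"
      using r yc mendo_smult[OF comodule_difference_module[OF N] r yc(1)]
      by (simp add: f unit_map_def unit_comodule_simps)
    have "coaction N (r \<odot>\<^bsub>N\<^esub> y) = pure_tensor k N A (r \<odot>\<^bsub>N\<^esub> y) [\<one>\<^bsub>A\<^esub>]"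
      unfolding linear_smult[OF comodule_coaction_linear[OF N] r yc(1)] yc(2)
      by (rule smult_pure[OF comodule_module[OF N] r yc(1)]) simp_all
    moreover have "tensor_map k N A (Suc 0) f (pure_tensor k (regular_module k) A r [\<one>\<^bsub>A\<^esub>]) = pure_tensor k N A (f r) [\<one>\<^bsub>A\<^esub>]"
      unfolding f by (rule map_pure[OF regular_module_module comodule_module[OF N] lin]) (simp_all add: regular_module_def r)
    ultimately show "coaction N (f r) = tensor_map k N A (Suc 0) f (coaction (unit_comodule k A) r)"
      using r by (simp add: f unit_map_def unit_comodule_simps)
  qed
  then show "f \<in> carrier (comodule_hom_group k A (unit_comodule k A) N)"
    by (simp add: comodule_hom_group_def unit_comodule_simps f unit_map_def)
qed

lemma unit_map_mult:
  assumes "y \<in> carrier N" "y' \<in> carrier N"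
  shows "unit_map N y \<otimes>\<^bsub>comodule_hom_group k A (unit_comodule k A) N\<^esub> unit_map N y' = unit_map N (y \<oplus>\<^bsub>N\<^esub> y')"
proof -
  interpret N: module k N by (rule comodule_module[OF N])
  show ?thesis
    using assms by (auto simp: comodule_hom_group_def unit_comodule_simps unit_map_def N.smult_r_distr intro!: restrict_ext)
qed

lemma unit_map_zero: "\<one>\<^bsub>comodule_hom_group k A (unit_comodule k A) N\<^esub> = unit_map N \<zero>\<^bsub>N\<^esub>"
proof -
  interpret N: module k N by (rule comodule_module[OF N])
  show ?thesis
    by (auto simp: comodule_hom_group_def unit_comodule_simps unit_map_def intro!: restrict_ext)
qed

lemma comm_group_unit_hom_group: "comm_group (comodule_hom_group k A (unit_comodule k A) N)"
proof -
  interpret N: module k N by (rule comodule_module[OF N])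
  show ?thesis
  proof (rule comm_groupI; unfold carrier_unit_hom_group; (elim imageE)?; hypsubst?)
    show "\<one>\<^bsub>comodule_hom_group k A (unit_comodule k A) N\<^esub> \<in> unit_map N ` fixed_points N"
      unfolding unit_map_zero by (intro imageI fixed_points_zero)
  next
    fix y y' assume y: "y \<in> fixed_points N" "y' \<in> fixed_points N"
    show "unit_map N y \<otimes>\<^bsub>comodule_hom_group k A (unit_comodule k A) N\<^esub> unit_map N y' \<in> unit_map N ` fixed_points N"
      unfolding unit_map_mult[OF y[THEN fixed_pointsD]] by (intro imageI fixed_points_add y)
    show "unit_map N y \<otimes>\<^bsub>comodule_hom_group k A (unit_comodule k A) N\<^esub> unit_map N y'
        = unit_map N y' \<otimes>\<^bsub>comodule_hom_group k A (unit_comodule k A) N\<^esub> unit_map N y"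
      using y by (simp add: unit_map_mult fixed_pointsD N.a_comm)
  next
    fix y y' y'' assume y: "y \<in> fixed_points N" "y' \<in> fixed_points N" "y'' \<in> fixed_points N"
    then show "unit_map N y \<otimes>\<^bsub>comodule_hom_group k A (unit_comodule k A) N\<^esub> unit_map N y' \<otimes>\<^bsub>comodule_hom_group k A (unit_comodule k A) N\<^esub> unit_map N y''
        = unit_map N y \<otimes>\<^bsub>comodule_hom_group k A (unit_comodule k A) N\<^esub> (unit_map N y' \<otimes>\<^bsub>comodule_hom_group k A (unit_comodule k A) N\<^esub> unit_map N y'')"
      by (simp add: unit_map_mult fixed_pointsD N.a_assoc)
  next
    fix y assume y: "y \<in> fixed_points N"
    then show "\<one>\<^bsub>comodule_hom_group k A (unit_comodule k A) N\<^esub> \<otimes>\<^bsub>comodule_hom_group k A (unit_comodule k A) N\<^esub> unit_map N y = unit_map N y"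
      by (simp add: unit_map_zero unit_map_mult fixed_pointsD)
    have z: "\<zero>\<^bsub>N\<^esub> \<ominus>\<^bsub>N\<^esub> y \<in> fixed_points N"
      by (rule fixed_points_diff[OF fixed_points_zero y])
    have "unit_map N (\<zero>\<^bsub>N\<^esub> \<ominus>\<^bsub>N\<^esub> y) \<otimes>\<^bsub>comodule_hom_group k A (unit_comodule k A) N\<^esub> unit_map N y = \<one>\<^bsub>comodule_hom_group k A (unit_comodule k A) N\<^esub>"
      using y by (simp add: unit_map_zero unit_map_mult fixed_pointsD a_minus_def N.l_neg)
    then show "\<exists>f\<in>unit_map N ` fixed_points N.
        f \<otimes>\<^bsub>comodule_hom_group k A (unit_comodule k A) N\<^esub> unit_map N y = \<one>\<^bsub>comodule_hom_group k A (unit_comodule k A) N\<^esub>"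
      by (rule bexI[of _ "unit_map N (\<zero>\<^bsub>N\<^esub> \<ominus>\<^bsub>N\<^esub> y)"]) (rule imageI[OF z])
  qed
qed

text \<open>In degree 0 the differential sends y to \<mu>(y) - y \<otimes> 1, so its kernel consists
  of the invariants. In this form the homomorphisms from the unit comodule are found inside the
  double complex.\<close>

lemma pure0_fixed_points:
  "(\<lambda>y. pure_tensor k N A y []) ` fixed_points N
    = {x \<in> carrier (tensor k N A 0). hochschild_diff k A N 0 x = \<zero>\<^bsub>tensor k N A (Suc 0)\<^esub> \<and> tensor_endo k N A 0 x = x}"
proof -
  note m = comodule_module[OF N]
  interpret T: abelian_group "tensor k N A (Suc 0)" by (simp add: m)
  have endo: "tensor_endo k N A 0 (pure_tensor k N A y []) = pure_tensor k N A (mendo N y) []" if "y \<in> carrier N" for y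
    using endo_pure[OF comodule_difference_module[OF N] that, of "[]" 0] by simp
  have fixed: "tensor_endo k N A 0 (pure_tensor k N A y []) = pure_tensor k N A y [] \<longleftrightarrow> mendo N y = y"
    if y: "y \<in> carrier N" for y
    unfolding endo[OF y] using pure0_inject[OF m mendo_closed[OF comodule_difference_module[OF N] y] y] by (rule iffI) simp_all
  have inv: "hochschild_diff k A N 0 (pure_tensor k N A y []) = \<zero>\<^bsub>tensor k N A (Suc 0)\<^esub>
      \<longleftrightarrow> coaction N y = pure_tensor k N A y [\<one>\<^bsub>A\<^esub>]" if y: "y \<in> carrier N" for y
    unfolding hochschild_diff_0[OF N y]
  proof
    assume "coaction N y \<ominus>\<^bsub>tensor k N A (Suc 0)\<^esub> pure_tensor k N A y [\<one>\<^bsub>A\<^esub>] = \<zero>\<^bsub>tensor k N A (Suc 0)\<^esub>"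
    then show "coaction N y = pure_tensor k N A y [\<one>\<^bsub>A\<^esub>]"
      by (rule T.diff_zero_imp_eq) (use y m linear_closed[OF comodule_coaction_linear[OF N] y] in simp_all)
  qed (use y m in \<open>simp add: a_minus_def T.r_neg\<close>)
  show ?thesis
  proof (intro subset_antisym subsetI)
    fix x assume "x \<in> (\<lambda>y. pure_tensor k N A y []) ` fixed_points N"
    then obtain y where "x = pure_tensor k N A y []" "y \<in> fixed_points N" by (rule imageE)
    then show "x \<in> {x \<in> carrier (tensor k N A 0). hochschild_diff k A N 0 x = \<zero>\<^bsub>tensor k N A (Suc 0)\<^esub> \<and> tensor_endo k N A 0 x = x}"
      using fixed inv m by (simp add: fixed_points_def)
  next
    fix x assume x: "x \<in> {x \<in> carrier (tensor k N A 0). hochschild_diff k A N 0 x = \<zero>\<^bsub>tensor k N A (Suc 0)\<^esub> \<and> tensor_endo k N A 0 x = x}"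
    then obtain y where y: "y \<in> carrier N" "x = pure_tensor k N A y []"
      using tensor0_cases[OF m] by blast
    then have "y \<in> fixed_points N" using x fixed inv by (simp add: fixed_points_def)
    then show "x \<in> (\<lambda>y. pure_tensor k N A y []) ` fixed_points N" unfolding y(2) by (rule imageI)
  qed
qed

end

text \<open>Under \<open>unit_map\<close>, composition with f becomes application of f; the
  differential of the complex computing Ext therefore acts on fixed invariants as the differential
  of the resolution.\<close>

lemma comodule_map_fixed_points:
  assumes M: "difference_comodule k A M" and N: "difference_comodule k A N"
    and f: "f \<in> comodule_maps k A M N" and y: "y \<in> fixed_points M"
  shows "f y \<in> fixed_points N" and "compose (carrier k) f (unit_map M y) = unit_map N (f y)"
proof -
  note lin = comodule_map_linear[OF f]
  have yc: "y \<in> carrier M" "coaction M y = pure_tensor k M A y [\<one>\<^bsub>A\<^esub>]" "mendo M y = y"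
    using y by (simp_all add: fixed_points_def)
  have "coaction N (f y) = pure_tensor k N A (f y) [\<one>\<^bsub>A\<^esub>]"
    unfolding comodule_map_coaction[OF f yc(1)] yc(2)
    by (rule map_pure[OF comodule_module[OF M] comodule_module[OF N] lin yc(1)]) simp_all
  then show "f y \<in> fixed_points N"
    using comodule_map_mendo[OF f yc(1)] linear_closed[OF lin yc(1)] yc(3) by (simp add: fixed_points_def)
  show "compose (carrier k) f (unit_map M y) = unit_map N (f y)"
    unfolding compose_def unit_map_def
    by (rule restrict_ext) (simp add: linear_smult[OF lin _ yc(1)])
qed

end

section \<open>The double complex of an injective resolution\<close>

lemma (in comodule_test) short_exact_resolution:
  assumes F: "difference_comodule k A F" and res: "injective_resolution TYPE(nat \<Rightarrow> 'b) k A F J d e"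
    and emb: "\<And>p. embeds TYPE(nat \<Rightarrow> 'b) (carrier (J p))"
  shows "\<exists>\<alpha> \<beta>. short_exact
      (coinvariants (group_cohomology k A F n) (group_cohomology_endo k A F n)) \<alpha>
      (ext_from_unit k A J d (Suc n)) \<beta>
      (invariants (group_cohomology k A F (Suc n)) (group_cohomology_endo k A F (Suc n)))"
proof -
  have inj: "injective_comodule TYPE(nat \<Rightarrow> 'b) k A (J p)" for p
    using res by (simp add: injective_resolution_def)
  have J: "difference_comodule k A (J p)" for p
    using inj[of p] by (simp add: injective_comodule_def)
  have d: "d p \<in> comodule_maps k A (J p) (J (Suc p))" for p
    using res by (simp add: injective_resolution_def)
  have e: "e \<in> comodule_maps k A F (J 0)" and e_inj: "inj_on e (carrier F)"
    using res by (simp_all add: injective_resolution_def)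
  have e_ker: "e ` carrier F = {x \<in> carrier (J 0). d 0 x = \<zero>\<^bsub>J (Suc 0)\<^esub>}"
    using res by (simp add: injective_resolution_def kernel_def)
  have d_ker: "d p ` carrier (J p) = {x \<in> carrier (J (Suc p)). d (Suc p) x = \<zero>\<^bsub>J (Suc (Suc p))\<^esub>}" for p
    using res by (simp add: injective_resolution_def kernel_def)
  note lin = comodule_map_linear[OF d] and e_lin = comodule_map_linear[OF e]
  note mJ = comodule_module[OF J] and mF = comodule_module[OF F]
  note dJ = comodule_difference_module[OF J] and dF = comodule_difference_module[OF F]
  \<comment> \<open>The coefficients embed through e into the first term of the resolution, so the
    test type needs no summand for the type \<open>'f\<close>.\<close>
  have F_emb: "embeds TYPE(nat \<Rightarrow> 'b) (carrier F)"
    by (rule embeds_inj[OF e_inj _ emb]) (use linear_closed[OF e_lin] in blast)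
  \<comment> \<open>The augmentation uses \<open>tensor_additive\<close>, on which
    \<open>hochschild_complex\<close> is built, whereas the double complex uses the full
    modules.\<close>
  let ?X = "\<lambda>p q. tensor k (J p) A q" and ?F = "tensor_additive k F A"
  let ?d = "\<lambda>p q. tensor_map k (J (Suc p)) A q (d p)" and ?\<delta> = "\<lambda>p. hochschild_diff k A (J p)"
  let ?s = "\<lambda>p. tensor_endo k (J p) A" and ?\<epsilon> = "\<lambda>q. tensor_map k (J 0) A q e"
  let ?L = "\<lambda>p. comodule_hom_group k A (unit_comodule k A) (J p)" and ?\<iota> = "\<lambda>p f. pure_tensor k (J p) A (f \<one>\<^bsub>k\<^esub>) []"
  have F_carrier: "carrier (?F n) = carrier (tensor k F A n)" for n
    by (simp add: tensor_simps tensor_additive_simps)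
  have F_additive: "additive_maps (?F n) Z = additive_maps (tensor k F A n) Z" for n and Z :: "('z, 'w) ring_scheme"
    by (simp add: hom_def tensor_simps tensor_additive_simps)
  have L_image: "?\<iota> p ` carrier (?L p) = (\<lambda>y. pure_tensor k (J p) A y []) ` fixed_points (J p)" for p
    unfolding carrier_unit_hom_group[OF J] image_image
    by (rule image_cong) (simp_all add: unit_map_one[OF J] fixed_pointsD[OF J])
  have double: "double_complex ?X ?d ?\<delta> ?s"
  proof (rule double_complex.intro)
    show "abelian_group (?X p q)" for p q by (simp add: mJ)
    show "?d p q \<in> additive_maps (?X p q) (?X (Suc p) q)" for p q by (rule map_additive[OF mJ mJ lin])
    show "?\<delta> p q \<in> additive_maps (?X p q) (?X p (Suc q))" for p q by (rule hochschild_diff_additive[OF J])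
    show "?s p q \<in> additive_maps (?X p q) (?X p q)" for p q by (rule endo_additive[OF dJ])
    fix p q
    show "?\<delta> (Suc p) q (?d p q x) = ?d p (Suc q) (?\<delta> p q x)" if "x \<in> carrier (?X p q)" for x
      by (rule hochschild_diff_map[OF J J d that, symmetric])
    show "?s (Suc p) q (?d p q x) = ?d p q (?s p q x)" if "x \<in> carrier (?X p q)" for x
      by (rule map_endo[OF dJ dJ lin comodule_map_mendo[OF d] that, symmetric])
    show "?s p (Suc q) (?\<delta> p q x) = ?\<delta> p q (?s p q x)" if "x \<in> carrier (?X p q)" for x
      by (rule hochschild_diff_endo[OF J that])
    show "?d p q ` carrier (?X p q) = {x \<in> carrier (?X (Suc p) q). ?d (Suc p) q x = \<zero>\<^bsub>?X (Suc (Suc p)) q\<^esub>}"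
      by (rule tensor_map_exact[OF mJ emb mJ emb mJ emb lin lin d_ker])
    show "?\<delta> p q ` carrier (?X p q) = {x \<in> carrier (?X p (Suc q)). ?\<delta> p (Suc q) x = \<zero>\<^bsub>?X p (Suc (Suc q))\<^esub>}"
    proof (intro subset_antisym subsetI)
      fix x assume "x \<in> ?\<delta> p q ` carrier (?X p q)"
      then obtain y where y: "x = ?\<delta> p q y" "y \<in> carrier (?X p q)" by (rule imageE)
      then show "x \<in> {x \<in> carrier (?X p (Suc q)). ?\<delta> p (Suc q) x = \<zero>\<^bsub>?X p (Suc (Suc q))\<^esub>}"
        using hochschild_diff_square[OF J y(2)] additive_closed[OF hochschild_diff_additive[OF J] y(2)] by simp
    next
      fix x assume "x \<in> {x \<in> carrier (?X p (Suc q)). ?\<delta> p (Suc q) x = \<zero>\<^bsub>?X p (Suc (Suc q))\<^esub>}"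
      then have "\<exists>y \<in> carrier (?X p q). x = ?\<delta> p q y"
        by (intro injective_hochschild_exact[OF J inj emb]) simp_all
      then show "x \<in> ?\<delta> p q ` carrier (?X p q)" by (simp add: image_iff)
    qed
  qed
  have \<iota>_unit: "?\<iota> p (unit_map (J p) y) = pure_tensor k (J p) A y []" if "y \<in> fixed_points (J p)" for p y
    using unit_map_one[OF J fixed_pointsD[OF J that]] by simp
  have L_cases: thesis if "f \<in> carrier (?L p)" "\<And>y. \<lbrakk>y \<in> fixed_points (J p); f = unit_map (J p) y\<rbrakk> \<Longrightarrow> thesis" for f p thesis
    using that unfolding carrier_unit_hom_group[OF J] by (elim imageE)
  interpret resolved_complex ?X ?d ?\<delta> ?s ?F "hochschild_diff k A F" "tensor_endo k F A" ?\<epsilon>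
    ?L "\<lambda>p. compose (carrier k) (d p)" ?\<iota>
  proof (rule resolved_complex.intro[OF double resolved_complex_axioms.intro])
    show "abelian_group (?F n)" for n by (rule abelian_group_tensor_additive[OF mF])
    show "hochschild_diff k A F n \<in> additive_maps (?F n) (?F (Suc n))" for n
      unfolding F_additive additive_maps_tensor_additive by (rule hochschild_diff_additive[OF F])
    show "tensor_endo k F A n \<in> additive_maps (?F n) (?F n)" for n
      unfolding F_additive additive_maps_tensor_additive by (rule endo_additive[OF dF])
    show "?\<epsilon> n \<in> additive_maps (?F n) (?X 0 n)" for n
      unfolding F_additive by (rule map_additive[OF mF mJ e_lin])
    show "inj_on (?\<epsilon> n) (carrier (?F n))" for n
      unfolding F_carrier by (rule flat_inj[OF mF F_emb mJ emb e_lin e_inj])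
    show "?\<epsilon> n ` carrier (?F n) = {x \<in> carrier (?X 0 n). ?d 0 n x = \<zero>\<^bsub>?X 1 n\<^esub>}" for n
      unfolding F_carrier One_nat_def by (rule tensor_map_exact[OF mF F_emb mJ emb mJ emb e_lin lin e_ker])
    show "?\<epsilon> (Suc n) (hochschild_diff k A F n z) = ?\<delta> 0 n (?\<epsilon> n z)" if "z \<in> carrier (?F n)" for n z
      by (rule hochschild_diff_map[OF F J e]) (use that in \<open>simp add: F_carrier\<close>)
    show "?\<epsilon> n (tensor_endo k F A n z) = ?s 0 n (?\<epsilon> n z)" if "z \<in> carrier (?F n)" for n z
      by (rule map_endo[OF dF dJ e_lin comodule_map_mendo[OF e]]) (use that in \<open>simp_all add: F_carrier\<close>)
    fix p
    interpret T: abelian_group "?X p 0" by (simp add: mJ)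
    interpret Jp: module k "J p" by (rule mJ)
    note pure0 = pure0_additive[OF mJ, of p]
    show "comm_group (?L p)" by (rule comm_group_unit_hom_group[OF J])
    show "compose (carrier k) (d p) \<in> hom (?L p) (?L (Suc p))"
    proof (rule homI)
      fix f assume "f \<in> carrier (?L p)"
      then obtain y where y: "y \<in> fixed_points (J p)" "f = unit_map (J p) y" by (rule L_cases)
      note dy = comodule_map_fixed_points[OF J J d y(1)]
      show "compose (carrier k) (d p) f \<in> carrier (?L (Suc p))"
        unfolding y(2) dy(2) carrier_unit_hom_group[OF J] by (rule imageI[OF dy(1)])
      fix g assume "g \<in> carrier (?L p)"
      then obtain z where z: "z \<in> fixed_points (J p)" "g = unit_map (J p) z" by (rule L_cases)
      note dz = comodule_map_fixed_points[OF J J d z(1)]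
      note c = fixed_pointsD[OF J y(1)] fixed_pointsD[OF J z(1)]
      show "compose (carrier k) (d p) (f \<otimes>\<^bsub>?L p\<^esub> g) = compose (carrier k) (d p) f \<otimes>\<^bsub>?L (Suc p)\<^esub> compose (carrier k) (d p) g"
        unfolding y(2) z(2) dy(2) dz(2) unit_map_mult[OF J c]
          comodule_map_fixed_points(2)[OF J J d fixed_points_add[OF J y(1) z(1)]]
          unit_map_mult[OF J fixed_pointsD[OF J dy(1)] fixed_pointsD[OF J dz(1)]] linear_add[OF lin c] ..
    qed
    show "?\<iota> p \<in> hom (?L p) (add_monoid (?X p 0))"
    proof (rule homI)
      fix f assume "f \<in> carrier (?L p)"
      then obtain y where y: "y \<in> fixed_points (J p)" "f = unit_map (J p) y" by (rule L_cases)
      note yc = fixed_pointsD[OF J y(1)]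
      show "?\<iota> p f \<in> carrier (add_monoid (?X p 0))"
        unfolding y(2) \<iota>_unit[OF y(1)] using additive_closed[OF pure0 yc] by simp
      fix g assume "g \<in> carrier (?L p)"
      then obtain z where z: "z \<in> fixed_points (J p)" "g = unit_map (J p) z" by (rule L_cases)
      note zc = fixed_pointsD[OF J z(1)]
      show "?\<iota> p (f \<otimes>\<^bsub>?L p\<^esub> g) = ?\<iota> p f \<otimes>\<^bsub>add_monoid (?X p 0)\<^esub> ?\<iota> p g"
        unfolding y(2) z(2) unit_map_mult[OF J yc zc] \<iota>_unit[OF fixed_points_add[OF J y(1) z(1)]]
          \<iota>_unit[OF y(1)] \<iota>_unit[OF z(1)] using additive_add[OF pure0 yc zc] by simp
    qed
    show "inj_on (?\<iota> p) (carrier (?L p))"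
    proof (rule inj_onI)
      fix f g assume "f \<in> carrier (?L p)" "g \<in> carrier (?L p)" and eq: "?\<iota> p f = ?\<iota> p g"
      then obtain y z where y: "y \<in> fixed_points (J p)" "f = unit_map (J p) y"
        and z: "z \<in> fixed_points (J p)" "g = unit_map (J p) z" by (elim L_cases)
      have "y = z"
        by (rule pure0_inject[OF mJ fixed_pointsD[OF J y(1)] fixed_pointsD[OF J z(1)]
              eq[unfolded y(2) z(2) \<iota>_unit[OF y(1)] \<iota>_unit[OF z(1)]]])
      then show "f = g" unfolding y(2) z(2) by (rule arg_cong)
    qed
    show "?\<iota> p ` carrier (?L p) = {x \<in> carrier (?X p 0). ?\<delta> p 0 x = \<zero>\<^bsub>?X p 1\<^esub> \<and> ?s p 0 x = x}"
      unfolding L_image One_nat_def by (rule pure0_fixed_points[OF J])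
    show "?\<iota> (Suc p) (compose (carrier k) (d p) f) = ?d p 0 (?\<iota> p f)" if "f \<in> carrier (?L p)" for f
    proof -
      from that obtain y where y: "y \<in> fixed_points (J p)" "f = unit_map (J p) y" by (rule L_cases)
      note dy = comodule_map_fixed_points[OF J J d y(1)]
      show ?thesis
        unfolding y(2) dy(2) \<iota>_unit[OF y(1)] \<iota>_unit[OF dy(1)]
        by (rule map_pure[OF mJ mJ lin fixed_pointsD[OF J y(1)], symmetric]) simp_all
    qed
    fix x assume x: "x \<in> carrier (?X p 0)" "?\<delta> p 0 x = \<zero>\<^bsub>?X p 1\<^esub>"
    obtain m where m: "m \<in> carrier (J p)" "x = pure_tensor k (J p) A m []"
      by (rule tensor0_cases[OF mJ x(1)])
    interpret T1: abelian_group "?X p (Suc 0)" by (simp add: mJ)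
    have "coaction (J p) m = pure_tensor k (J p) A m [\<one>\<^bsub>A\<^esub>]"
      by (rule T1.diff_zero_imp_eq[OF x(2)[unfolded m(2) hochschild_diff_0[OF J m(1)] One_nat_def]])
        (use m(1) mJ linear_closed[OF comodule_coaction_linear[OF J] m(1)] in simp_all)
    from injective_sigma_surjective[OF J m(1) this inj emb]
    obtain y where y: "y \<in> carrier (J p)" "coaction (J p) y = pure_tensor k (J p) A y [\<one>\<^bsub>A\<^esub>]"
      "mendo (J p) y = m \<oplus>\<^bsub>J p\<^esub> y" by blast
    let ?y = "pure_tensor k (J p) A y []"
    have yX: "?y \<in> carrier (?X p 0)" by (rule additive_closed[OF pure0 y(1)])
    have "?\<delta> p 0 ?y = \<zero>\<^bsub>?X p 1\<^esub>"
      unfolding hochschild_diff_0[OF J y(1)] y(2) One_nat_def by (simp add: a_minus_def T1.r_neg mJ y(1))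
    moreover have "?s p 0 ?y = x \<oplus>\<^bsub>?X p 0\<^esub> ?y"
      using endo_pure[OF dJ y(1), of "[]" 0] additive_add[OF pure0 m(1) y(1)] unfolding m(2) y(3) by simp
    then have "?s p 0 ?y \<ominus>\<^bsub>?X p 0\<^esub> ?y = x"
      using x(1) yX by (simp add: a_minus_def T.a_assoc T.r_neg)
    ultimately show "\<exists>y \<in> carrier (?X p 0). ?\<delta> p 0 y = \<zero>\<^bsub>?X p 1\<^esub> \<and> ?s p 0 y \<ominus>\<^bsub>?X p 0\<^esub> y = x"
      using yX by (intro bexI conjI)
  qed
  have complex: "(\<lambda>n. add_monoid (?F n)) = hochschild_complex k A F"
    by (simp add: fun_eq_iff hochschild_complex_def)
  have E: "FC.E q = group_cohomology_endo k A F q" for q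
    unfolding fun_eq_iff FC.E_def FC.B_def
    unfolding complex group_cohomology_endo_def by (simp add: hochschild_complex_def)
  show ?thesis
    using short_exact_resolved[of n] unfolding E
    unfolding complex group_cohomology_def ext_from_unit_def .
qed

theorem proposition21p30:
  fixes k :: "'k difference_ring"
    and A :: "('k, 'a) difference_hopf_algebra"
    and F :: "('k, 'a, 'f) difference_comodule"
    and J :: "nat \<Rightarrow> ('k, 'a, 'm) difference_comodule"
    and d :: "nat \<Rightarrow> 'm \<Rightarrow> 'm" and e :: "'f \<Rightarrow> 'm"
    and n :: nat
  assumes "difference_ring k"
    and "difference_hopf_algebra k A"
    and "flat_module TYPE(('k, 'a, 'm) test) k A"
    and "difference_comodule k A F"
    and "injective_resolution TYPE(('k, 'a, 'm) test) k A F J d e"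
    and "n > 0"
  shows "\<exists>\<alpha> \<beta>. short_exact
      (coinvariants (group_cohomology k A F (n - 1)) (group_cohomology_endo k A F (n - 1))) \<alpha>
      (ext_from_unit k A J d n) \<beta>
      (invariants (group_cohomology k A F n) (group_cohomology_endo k A F n))"
proof -
  obtain l where n: "n = Suc l" using assms(6) by (cases n) simp_all
  have "module k A"
    by (intro difference_module.axioms(2) difference_hopf_algebra.axioms(1) assms(2))
  then have A: "tensor_factor k A" by (rule tensor_factor.intro)
  \<comment> \<open>The two distinct elements lie in different summands of the sum type; k, A and
    the terms of the resolution embed as constant sequences with values in their own
    summands.\<close>
  interpret comodule_test k A "TYPE(('k, 'a, 'm) test)" "Inl undefined" "Inr undefined"
  proof (intro comodule_test.intro hopf_factor.intro flat_factor.intro hopf_factor_axioms.intro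
      flat_factor_axioms.intro comodule_test_axioms.intro A assms(2,3))
    show "embeds TYPE(('k, 'a, 'm) test) (carrier k)"
      by (rule embedsI[of "\<lambda>x _. Inl x"]) (simp add: inj_on_def fun_eq_iff)
    show "embeds TYPE(('k, 'a, 'm) test) (carrier A)"
      by (rule embedsI[of "\<lambda>x _. Inr (Inl x)"]) (simp add: inj_on_def fun_eq_iff)
  qed simp
  have "embeds TYPE(('k, 'a, 'm) test) (carrier (J p))" for p
    by (rule embedsI[of "\<lambda>x _. Inr (Inr x)"]) (simp add: inj_on_def fun_eq_iff)
  then show ?thesis
    unfolding n by (simp add: short_exact_resolution[OF assms(4,5)])
qed

end
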